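(* For an arbitrary sequence $(\epsilon_1,\ldots,\epsilon_n)\in\{0,1\}^n$ the following commutativity holds, with $z=x/y$: $$(\pi_x\otimes\pi_y)\Delta'(g)\;S^{\mathrm{tr}}(z|\epsilon_1,\ldots,\epsilon_n)=S^{\mathrm{tr}}(z|\epsilon_1,\ldots,\epsilon_n)\;(\pi_x\otimes\pi_y)\Delta(g)\qquad\forall g\in\mathcal U_A(\epsilon_1,\ldots,\epsilon_n),$$ $$(\pi_x\otimes\pi_y)\Delta'(g)\;\tilde S^{1,1}(z|\epsilon_1,\ldots,\epsilon_n)=\tilde S^{1,1}(z|\epsilon_1,\ldots,\epsilon_n)\;(\pi_x\otimes\pi_y)\Delta(g)\qquad\forall g\in\mathcal U_B(\epsilon_1,\ldots,\epsilon_n).$$ The first identity is on every $\mathcal W_l\otimes\mathcal W_m$ and the second on $\mathcal W\otimes\mathcal W$.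
   Context: **Notation.** $q^{1/2},x,y$ are generic (algebraically independent indeterminates over $\mathbb C$); vector spaces are over $\mathbb C(q^{1/2},x,y)$. $(a;q)_m=\prod_{k=1}^m(1-aq^{k-1})$, $(q)_m=(q;q)_m$, $(q^2)_m=(q^2;q^2)_m$, $\binom{m}{k}_{q^2}=\frac{(q^2)_m}{(q^2)_k(q^2)_{m-k}}$ (zero unless $0\le k\le m$), $[m]=\frac{q^m-q^{-m}}{q-q^{-1}}$, $(a)_+=\max(a,0)$, $p=\mathrm i q^{-1/2}$ with $\mathrm i=\sqrt{-1}$. **Spaces.** $F$ has basis $|m\rangle$, $m\in\mathbb Z_{\ge0}$; $V$ has basis $|0\rangle,|1\rangle$. $W^{(0)}=F$, $W^{(1)}=V$. $\mathcal W=W^{(\epsilon_1)}\otimes\cdots\otimes W^{(\epsilon_n)}$ has basis $|\mathbf m\rangle=|m_1,\ldots,m_n\rangle$ ($m_i\in\mathbb Z_{\ge0}$ if $\epsilon_i=0$, $m_i\in\{0,1\}$ if $\epsilon_i=1$). $|\mathbf m|=m_1+\cdots+m_n$; $\mathcal W_l\subset\mathcal W$ is the span of $|\mathbf m\rangle$ with $|\mathbf m|=l$ ($0\le l\le n$ if all $\epsilon_i=1$, $l\in\mathbb Z_{\ge0}$ otherwise). $\mathbf e_i$ is the $i$th standard basis vector of $\mathbb Z^n$. **3D $R$ and 3D $L$.** For nonnegative integer indices $$\mathscr S^{(0)\,a,b,c}_{\ \ \ \,i,j,k}=\delta_{a+b,i+j}\delta_{b+c,j+k}\sum_{\lambda,\mu\ge0,\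 \lambda+\mu=b}(-1)^\lambda q^{i(c-j)+(k+1)\lambda+\mu(\mu-k)}\frac{(q^2)_{c+\mu}}{(q^2)_c}\binom{i}{\mu}_{q^2}\binom{j}{\lambda}_{q^2}.$$ $\mathscr S^{(1)\,a,b,c}_{\ \ \ \,i,j,k}$ ($a,b,i,j\in\{0,1\}$, $c,k\in\mathbb Z_{\ge0}$) is zero except $\mathscr S^{(1)0,0,c}_{\ \ \ 0,0,k}=\mathscr S^{(1)1,1,c}_{\ \ \ 1,1,k}=\delta_{c,k}$, $\mathscr S^{(1)0,1,c}_{\ \ \ 0,1,k}=-\delta_{c,k}q^{k+1}$, $\mathscr S^{(1)1,0,c}_{\ \ \ 1,0,k}=\delta_{c,k}q^k$, $\mathscr S^{(1)0,1,c}_{\ \ \ 1,0,k}=\delta_{c,k-1}(1-q^{2k})$, $\mathscr S^{(1)1,0,c}_{\ \ \ 0,1,k}=\delta_{c,k+1}$. **$S^{\mathrm{tr}}$, $S^{1,1}$, $\tilde S^{1,1}$.** $S(z)(|\mathbf i\rangle\otimes|\mathbf j\rangle)=\sum_{\mathbf a,\mathbf b}S(z)^{\mathbf a,\mathbf b}_{\mathbf i,\mathbf j}|\mathbf a\rangle\otimes|\mathbf b\rangle$ with (sums over nonnegative integers, understood as power series in $z$; after normalization they are rational in $z$) $$S^{\mathrm{tr}}(z)^{\mathbf a,\mathbf b}_{\mathbf i,\mathbf j}=\varrho(z)\sum_{c_0,\ldots,c_{n-1}}z^{c_0}\prod_{k=1}^n\mathscr S^{(\epsilon_k)\,a_k,b_k,c_{k-1}}_{\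 \ \ \ \,i_k,j_k,c_k}\quad(c_n:=c_0),$$ $$S^{1,1}(z)^{\mathbf a,\mathbf b}_{\mathbf i,\mathbf j}=\varrho(z)\sum_{c_0,\ldots,c_n}\frac{z^{c_0}(q^2)_{c_0}}{(q)_{c_0}(q)_{c_n}}\prod_{k=1}^n\mathscr S^{(\epsilon_k)\,a_k,b_k,c_{k-1}}_{\ \ \ \ \,i_k,j_k,c_k}.$$ $S^{\mathrm{tr}}(z)$ preserves each $\mathcal W_l\otimes\mathcal W_m$. Normalization: for $S^{\mathrm{tr}}$ on $\mathcal W_l\otimes\mathcal W_m$, $\varrho(z)=(-q)^{-(m-l)_+}(1-q^{|l-m|}z)$ if all $\epsilon_i=1$, and $\varrho(z)=\frac{z^{-m}(q^{l-m}z;q^2)_{m+1}}{(q^{l-m+2}z^{-1};q^2)_m}$ otherwise; for $S^{1,1}$, $\varrho(z)=\frac{(z;q)_\infty}{(-qz;q)_\infty}$. Finally $\tilde S^{1,1}(z)=(K\otimes1)S^{1,1}(z)(1\otimes K^{-1})$ with $K|\mathbf m\rangle=p^{-|\mathbf m|}|\mathbf m\rangle$. **Algebras.** $q_i=q$ if $\epsilon_i=0$, $q_i=-q^{-1}$ if $\epsilon_i=1$. $\tilde n=n-1$ for $\mathcal U_A(\epsilon_1,\ldots,\epsilon_n)$, $\tilde n=n$ for $\mathcal U_B(\epsilon_1,\ldots,\epsilon_n)$, with $\tilde n\ge1$; for $\mathcal U_A$ all indices are in $\mathbb Z/n\mathbb Z$. $\langle i\rangle=\{i,i+1\}$ for $\mathcal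 U_A$, $\langle i\rangle=\{i,i+1\}\cap[1,n]$ for $\mathcal U_B$; $D_{i,j}=\prod_{k\in\langle i\rangle\cap\langle j\rangle}q_k^{2\delta_{i,j}-1}$; $r_i=q$ for $\mathcal U_A$; for $\mathcal U_B$, $r_0=r_n=p$ and $r_i=q$ for $0<i<n$. $\mathcal U_A,\mathcal U_B$ are generated by $e_i,f_i,k_i^{\pm1}$ ($0\le i\le\tilde n$) with relations $k_ik_i^{-1}=k_i^{-1}k_i=1$, $[k_i,k_j]=0$, $k_ie_j=D_{i,j}e_jk_i$, $k_if_j=D_{i,j}^{-1}f_jk_i$, $[e_i,f_j]=\delta_{i,j}\frac{k_i-k_i^{-1}}{r_i-r_i^{-1}}$, and coproduct $\Delta k_i^{\pm1}=k_i^{\pm1}\otimes k_i^{\pm1}$, $\Delta e_i=1\otimes e_i+e_i\otimes k_i$, $\Delta f_i=f_i\otimes1+k_i^{-1}\otimes f_i$. $\Delta'$ is the opposite coproduct. **Representations $\pi_x$.** (Vectors $|\mathbf m'\rangle$ with indices out of range are zero.) $\mathcal U_A$ on $\mathcal W_l$, $i\in\mathbb Z/n\mathbb Z$: $e_i|\mathbf m\rangle=x^{\delta_{i,0}}[m_i]|\mathbf m-\mathbf e_i+\mathbf e_{i+1}\rangle$, $f_i|\mathbf m\rangle=x^{-\delta_{i,0}}[m_{i+1}]|\mathbf m+\mathbf e_i-\mathbf e_{i+1}\rangle$, $k_i|\mathbf m\rangle=q_i^{-m_i}q_{i+1}^{m_{i+1}}|\mathbf m\rangle$. $\mathcal U_B$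 on $\mathcal W$: for $0<i<n$ the same formulas (no $x$), and $e_0|\mathbf m\rangle=x|\mathbf m+\mathbf e_1\rangle$, $f_0|\mathbf m\rangle=x^{-1}[m_1]|\mathbf m-\mathbf e_1\rangle$, $k_0|\mathbf m\rangle=p^{-1}q_1^{m_1}|\mathbf m\rangle$, $e_n|\mathbf m\rangle=[m_n]|\mathbf m-\mathbf e_n\rangle$, $f_n|\mathbf m\rangle=|\mathbf m+\mathbf e_n\rangle$, $k_n|\mathbf m\rangle=p\,q_n^{-m_n}|\mathbf m\rangle$. *)

theory Defs
  imports
    "HOL-Computational_Algebra.Computational_Algebra"
    "HOL-Algebra.QuotRing"
    "HOL-Library.Poly_Mapping"
    "HOL-Library.Product_Plus"
    "HOL-Library.FuncSet"
begin

section \<open>The ground fields\<close>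

text \<open>
  The matrix elements of the solutions are rational functions of \<open>z\<close> over
  \<open>kq = \<complex>(q\<^sup>1\<^sup>/\<^sup>2)\<close>; all vector spaces and algebras are over
  \<open>kxy = \<complex>(q\<^sup>1\<^sup>/\<^sup>2)(x, y)\<close>.
\<close>

type_synonym kq = "complex poly fract"
type_synonym kxy = "kq poly poly fract"

definition sqrt_q :: kq where "sqrt_q = to_fract [:0, 1:]"
definition q :: kq where "q = sqrt_q ^ 2"

definition emb :: "kq \<Rightarrow> kxy" where "emb a = to_fract [:[:a:]:]"
definition x_gen :: kxy where "x_gen = to_fract [:[:0, 1:]:]"
definition y_gen :: kxy where "y_gen = to_fract [:0, 1:]"

definition qq :: kxy where "qq = emb q"
definition pp :: kxy where "pp = emb (to_fract [:\<i>:] * inverse sqrt_q)"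

definition qpoch :: "'a::comm_ring_1 \<Rightarrow> 'a \<Rightarrow> nat \<Rightarrow> 'a" where
  "qpoch a Q m = (\<Prod>k=1..m. 1 - a * Q ^ (k - 1))"

definition qbinom2 :: "nat \<Rightarrow> nat \<Rightarrow> kq" where
  "qbinom2 m k = (if k \<le> m
     then qpoch (q^2) (q^2) m / (qpoch (q^2) (q^2) k * qpoch (q^2) (q^2) (m - k)) else 0)"

section \<open>The 3D operators\<close>

text \<open>The argument order is: upper indices \<open>a b c\<close>, then lower indices \<open>i j k\<close>.\<close>

definition S3R :: "nat \<Rightarrow> nat \<Rightarrow> nat \<Rightarrow> nat \<Rightarrow> nat \<Rightarrow> nat \<Rightarrow> kq" where
  "S3R a b c i j k = (if a + b = i + j \<and> b + c = j + k then
     (\<Sum>(la, mu)\<in>{(la, mu). la + mu = b}.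
        (-1) ^ la
        * q powi (int i * (int c - int j) + (int k + 1) * int la + int mu * (int mu - int k))
        * (qpoch (q^2) (q^2) (c + mu) / qpoch (q^2) (q^2) c)
        * qbinom2 i mu * qbinom2 j la)
     else 0)"

definition S3L :: "nat \<Rightarrow> nat \<Rightarrow> nat \<Rightarrow> nat \<Rightarrow> nat \<Rightarrow> nat \<Rightarrow> kq" where
  "S3L a b c i j k =
    (if (a, b, i, j) = (0, 0, 0, 0) \<or> (a, b, i, j) = (1, 1, 1, 1) then of_bool (c = k)
     else if (a, b, i, j) = (0, 1, 0, 1) then - of_bool (c = k) * q ^ (k + 1)
     else if (a, b, i, j) = (1, 0, 1, 0) then of_bool (c = k) * q ^ k
     else if (a, b, i, j) = (0, 1, 1, 0) then of_bool (c + 1 = k) * (1 - q ^ (2 * k))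
     else if (a, b, i, j) = (1, 0, 0, 1) then of_bool (c = k + 1)
     else 0)"

definition S3 :: "nat \<Rightarrow> nat \<Rightarrow> nat \<Rightarrow> nat \<Rightarrow> nat \<Rightarrow> nat \<Rightarrow> nat \<Rightarrow> kq" where
  "S3 e = (if e = 0 then S3R else S3L)"

section \<open>The spaces\<close>

text \<open>
  A multi-index \<open>(m\<^sub>1, \<dots>, m\<^sub>n)\<close> is a function that vanishes outside \<open>{1..n}\<close>; a vector is a
  finitely supported coefficient function on multi-indices (or on pairs of them).
\<close>

type_synonym mindex = "nat \<Rightarrow> nat"
type_synonym vec = "mindex \<Rightarrow>\<^sub>0 kxy"
type_synonym vec2 = "(mindex \<times> mindex) \<Rightarrow>\<^sub>0 kxy"

definition wbasis :: "nat \<Rightarrow> (nat \<Rightarrow> nat) \<Rightarrow> mindex set" where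
  "wbasis n eps = {m. (\<forall>i. i \<notin> {1..n} \<longrightarrow> m i = 0) \<and> (\<forall>i\<in>{1..n}. eps i = 1 \<longrightarrow> m i \<le> 1)}"

definition wt :: "nat \<Rightarrow> mindex \<Rightarrow> nat" where
  "wt n m = (\<Sum>i=1..n. m i)"

definition W2 :: "nat \<Rightarrow> (nat \<Rightarrow> nat) \<Rightarrow> vec2 set" where
  "W2 n eps = {v. Poly_Mapping.keys v \<subseteq> wbasis n eps \<times> wbasis n eps}"

definition W2_graded :: "nat \<Rightarrow> (nat \<Rightarrow> nat) \<Rightarrow> nat \<Rightarrow> nat \<Rightarrow> vec2 set" where
  "W2_graded n eps l m = {v. Poly_Mapping.keys v \<subseteq>
     {i \<in> wbasis n eps. wt n i = l} \<times> {j \<in> wbasis n eps. wt n j = m}}"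

definition scl :: "'a::semiring_0 \<Rightarrow> ('b \<Rightarrow>\<^sub>0 'a) \<Rightarrow> ('b \<Rightarrow>\<^sub>0 'a)" where
  "scl c v = Poly_Mapping.map (\<lambda>d. c * d) v"

definition ket :: "'b \<Rightarrow> ('b \<Rightarrow>\<^sub>0 kxy)" where
  "ket b = Poly_Mapping.single b 1"

definition lin :: "('b \<Rightarrow> ('c \<Rightarrow>\<^sub>0 kxy)) \<Rightarrow> ('b \<Rightarrow>\<^sub>0 kxy) \<Rightarrow> ('c \<Rightarrow>\<^sub>0 kxy)" where
  "lin f v = (\<Sum>b\<in>Poly_Mapping.keys v. scl (Poly_Mapping.lookup v b) (f b))"

definition tens :: "('b \<Rightarrow>\<^sub>0 kxy) \<Rightarrow> ('c \<Rightarrow>\<^sub>0 kxy) \<Rightarrow> ('b \<times> 'c \<Rightarrow>\<^sub>0 kxy)" (infixr "\<otimes>\<^sub>v" 75) where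
  "v \<otimes>\<^sub>v w = lin (\<lambda>b. lin (\<lambda>c. ket (b, c)) w) v"

definition tens_op :: "(vec \<Rightarrow> vec) \<Rightarrow> (vec \<Rightarrow> vec) \<Rightarrow> vec2 \<Rightarrow> vec2" where
  "tens_op A B = lin (\<lambda>(i, j). A (ket i) \<otimes>\<^sub>v B (ket j))"

section \<open>The solutions of the Yang-Baxter equation\<close>

text \<open>
  Matrix elements are first formed in the field of formal Laurent series in \<open>z\<close> over \<open>kq\<close>. For
  fixed \<open>c\<^sub>0\<close> and fixed \<open>a, b, i, j\<close> only finitely many summands are nonzero, because the factors
  force \<open>b\<^sub>k + c\<^sub>k\<^sub>-\<^sub>1 = j\<^sub>k + c\<^sub>k\<close>; \<open>Sum_any\<close> is the sum over these.
\<close>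

definition zc :: "kq \<Rightarrow> kq fls" where "zc = fls_const"
definition zX :: "kq fls" where "zX = fls_X"

definition series_tr ::
  "nat \<Rightarrow> (nat \<Rightarrow> nat) \<Rightarrow> mindex \<Rightarrow> mindex \<Rightarrow> mindex \<Rightarrow> mindex \<Rightarrow> kq fls" where
  "series_tr n eps a b i j = fps_to_fls (Abs_fps (\<lambda>N.
     Sum_any (\<lambda>c. if c \<in> {0..<n} \<rightarrow>\<^sub>E UNIV \<and> c 0 = N
       then (\<Prod>k=1..n. S3 (eps k) (a k) (b k) (c (k - 1)) (i k) (j k) (c (k mod n)))
       else 0)))"

definition series_11 ::
  "nat \<Rightarrow> (nat \<Rightarrow> nat) \<Rightarrow> mindex \<Rightarrow> mindex \<Rightarrow> mindex \<Rightarrow> mindex \<Rightarrow> kq fls" where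
  "series_11 n eps a b i j = fps_to_fls (Abs_fps (\<lambda>N.
     Sum_any (\<lambda>c. if c \<in> {0..n} \<rightarrow>\<^sub>E UNIV \<and> c 0 = N
       then qpoch (q^2) (q^2) (c 0) / (qpoch q q (c 0) * qpoch q q (c n))
         * (\<Prod>k=1..n. S3 (eps k) (a k) (b k) (c (k - 1)) (i k) (j k) (c k))
       else 0)))"

definition rho_tr :: "nat \<Rightarrow> (nat \<Rightarrow> nat) \<Rightarrow> nat \<Rightarrow> nat \<Rightarrow> kq fls" where
  "rho_tr n eps l m =
    (if \<forall>i\<in>{1..n}. eps i = 1
     then zc ((- q) powi (- max (int m - int l) 0)) * (1 - zc (q powi \<bar>int l - int m\<bar>) * zX)
     else zX powi (- int m) * qpoch (zc (q powi (int l - int m)) * zX) (zc (q^2)) (m + 1)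
          / qpoch (zc (q powi (int l - int m + 2)) * inverse zX) (zc (q^2)) m)"

text \<open>
  As \<open>q\<close> is an indeterminate, \<open>(a; q)\<^sub>\<infinity>\<close> is the limit of the finite products in the \<open>t\<close>-adic
  sense, \<open>t = q\<^sup>1\<^sup>/\<^sup>2\<close>, taken for each coefficient of a power of \<open>z\<close>: \<open>q_adic_small r f\<close> says that
  \<open>f\<close> has order at least \<open>r\<close> at \<open>t = 0\<close>.
\<close>

definition q_adic_small :: "nat \<Rightarrow> kq \<Rightarrow> bool" where
  "q_adic_small r f \<longleftrightarrow>
     (\<exists>u v. poly v 0 \<noteq> 0 \<and> f = sqrt_q ^ r * to_fract u / to_fract v)"

definition q_adic_limit :: "(nat \<Rightarrow> kq) \<Rightarrow> kq \<Rightarrow> bool" where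
  "q_adic_limit s L \<longleftrightarrow> (\<forall>r. \<exists>N0. \<forall>N\<ge>N0. q_adic_small r (s N - L))"

definition qpoch_inf :: "kq \<Rightarrow> kq fps" where
  \<comment> \<open>\<open>(a z; q)\<^sub>\<infinity>\<close> as a power series in \<open>z\<close>\<close>
  "qpoch_inf a = (THE F. \<forall>d. q_adic_limit
     (\<lambda>N. fps_nth (qpoch (fps_const a * fps_X) (fps_const q) N) d) (fps_nth F d))"

definition rho_11 :: "kq fls" where
  "rho_11 = fps_to_fls (qpoch_inf 1) / fps_to_fls (qpoch_inf (- q))"

text \<open>
  The value at \<open>z = w\<close> of a Laurent series that is the expansion of a rational function \<open>P / Q\<close>,
  for \<open>w\<close> transcendental over \<open>kq\<close>.
\<close>

definition rat_value :: "kxy \<Rightarrow> kq fls \<Rightarrow> kxy" where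
  "rat_value w S = (THE u. \<exists>P Q. Q \<noteq> 0
     \<and> S = fps_to_fls (fps_of_poly P) / fps_to_fls (fps_of_poly Q)
     \<and> u = poly (map_poly emb P) w / poly (map_poly emb Q) w)"

definition matrix_op :: "nat \<Rightarrow> (nat \<Rightarrow> nat) \<Rightarrow>
    (mindex \<Rightarrow> mindex \<Rightarrow> mindex \<Rightarrow> mindex \<Rightarrow> kxy) \<Rightarrow> vec2 \<Rightarrow> vec2" where
  "matrix_op n eps M = lin (\<lambda>(i, j). Abs_poly_mapping
     (\<lambda>(a, b). if a \<in> wbasis n eps \<and> b \<in> wbasis n eps then M a b i j else 0))"

definition S_tr :: "nat \<Rightarrow> (nat \<Rightarrow> nat) \<Rightarrow> nat \<Rightarrow> nat \<Rightarrow> kxy \<Rightarrow> vec2 \<Rightarrow> vec2" where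
  \<comment> \<open>with the normalization for \<open>W\<^sub>l \<otimes> W\<^sub>m\<close>\<close>
  "S_tr n eps l m z = matrix_op n eps
     (\<lambda>a b i j. rat_value z (rho_tr n eps l m * series_tr n eps a b i j))"

definition S_11 :: "nat \<Rightarrow> (nat \<Rightarrow> nat) \<Rightarrow> kxy \<Rightarrow> vec2 \<Rightarrow> vec2" where
  "S_11 n eps z = matrix_op n eps
     (\<lambda>a b i j. rat_value z (rho_11 * series_11 n eps a b i j))"

definition opK :: "nat \<Rightarrow> vec \<Rightarrow> vec" where
  "opK n = lin (\<lambda>m. scl (pp powi (- int (wt n m))) (ket m))"

definition opK_inv :: "nat \<Rightarrow> vec \<Rightarrow> vec" where
  "opK_inv n = lin (\<lambda>m. scl (pp powi (int (wt n m))) (ket m))"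

definition S_11_tilde :: "nat \<Rightarrow> (nat \<Rightarrow> nat) \<Rightarrow> kxy \<Rightarrow> vec2 \<Rightarrow> vec2" where
  "S_11_tilde n eps z = tens_op (opK n) id \<circ> S_11 n eps z \<circ> tens_op id (opK_inv n)"

section \<open>The algebras\<close>

datatype gen = E nat | F nat | K nat | Kinv nat

datatype gword = Word (letters: "gen list")

instantiation gword :: monoid_add
begin

definition zero_gword :: gword where "zero_gword = Word []"

definition plus_gword :: "gword \<Rightarrow> gword \<Rightarrow> gword" where
  "plus_gword u v = Word (letters u @ letters v)"

instance
  by standard (simp_all add: zero_gword_def plus_gword_def)

end

text \<open>
  Since addition of words is concatenation, the product on \<^typ>\<open>gword \<Rightarrow>\<^sub>0 kxy\<close> is that of the free
  algebra, and the product on \<^typ>\<open>gword \<times> gword \<Rightarrow>\<^sub>0 kxy\<close> is that of its tensor square.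
\<close>

type_synonym free = "gword \<Rightarrow>\<^sub>0 kxy"
type_synonym free2 = "gword \<times> gword \<Rightarrow>\<^sub>0 kxy"

fun gidx :: "gen \<Rightarrow> nat" where
  "gidx (E i) = i" | "gidx (F i) = i" | "gidx (K i) = i" | "gidx (Kinv i) = i"

definition words :: "nat \<Rightarrow> gword set" where
  "words N = {w. \<forall>s\<in>set (letters w). gidx s \<le> N}"

definition free_ring :: "nat \<Rightarrow> free ring" where
  "free_ring N = \<lparr>carrier = {g. Poly_Mapping.keys g \<subseteq> words N},
     mult = (*), one = 1, zero = 0, add = (+)\<rparr>"

definition free_ring2 :: "nat \<Rightarrow> free2 ring" where
  "free_ring2 N = \<lparr>carrier = {g. Poly_Mapping.keys g \<subseteq> words N \<times> words N},
     mult = (*), one = 1, zero = 0, add = (+)\<rparr>"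

definition gn :: "gen \<Rightarrow> free" where "gn s = ket (Word [s])"

definition relators :: "nat \<Rightarrow> (nat \<Rightarrow> nat \<Rightarrow> kxy) \<Rightarrow> (nat \<Rightarrow> kxy) \<Rightarrow> free set" where
  "relators N D r = (\<Union>i\<in>{..N}. \<Union>j\<in>{..N}.
    { gn (K i) * gn (Kinv i) - 1,
      gn (Kinv i) * gn (K i) - 1,
      gn (K i) * gn (K j) - gn (K j) * gn (K i),
      gn (K i) * gn (E j) - scl (D i j) (gn (E j) * gn (K i)),
      gn (K i) * gn (F j) - scl (inverse (D i j)) (gn (F j) * gn (K i)),
      gn (E i) * gn (F j) - gn (F j) * gn (E i)
        - scl (of_bool (i = j) / (r i - inverse (r i))) (gn (K i) - gn (Kinv i)) })"

definition rel_ideal :: "nat \<Rightarrow> (nat \<Rightarrow> nat \<Rightarrow> kxy) \<Rightarrow> (nat \<Rightarrow> kxy) \<Rightarrow> free set" where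
  "rel_ideal N D r = genideal (free_ring N) (relators N D r)"

definition rel_ideal2 :: "nat \<Rightarrow> (nat \<Rightarrow> nat \<Rightarrow> kxy) \<Rightarrow> (nat \<Rightarrow> kxy) \<Rightarrow> free2 set" where
  "rel_ideal2 N D r = genideal (free_ring2 N)
     ((\<lambda>g. g \<otimes>\<^sub>v 1) ` rel_ideal N D r \<union> (\<lambda>g. 1 \<otimes>\<^sub>v g) ` rel_ideal N D r)"

text \<open>The elements of the algebra \<open>U\<close> and of \<open>U \<otimes> U\<close> are cosets.\<close>

definition Ualg :: "nat \<Rightarrow> (nat \<Rightarrow> nat \<Rightarrow> kxy) \<Rightarrow> (nat \<Rightarrow> kxy) \<Rightarrow> free set ring" where
  "Ualg N D r = free_ring N Quot rel_ideal N D r"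

definition Ualg2 :: "nat \<Rightarrow> (nat \<Rightarrow> nat \<Rightarrow> kxy) \<Rightarrow> (nat \<Rightarrow> kxy) \<Rightarrow> free2 set ring" where
  "Ualg2 N D r = free_ring2 N Quot rel_ideal2 N D r"

fun cop_gen :: "gen \<Rightarrow> free2" where
  "cop_gen (E i) = 1 \<otimes>\<^sub>v gn (E i) + gn (E i) \<otimes>\<^sub>v gn (K i)"
| "cop_gen (F i) = gn (F i) \<otimes>\<^sub>v 1 + gn (Kinv i) \<otimes>\<^sub>v gn (F i)"
| "cop_gen (K i) = gn (K i) \<otimes>\<^sub>v gn (K i)"
| "cop_gen (Kinv i) = gn (Kinv i) \<otimes>\<^sub>v gn (Kinv i)"

definition cop_free :: "free \<Rightarrow> free2" where
  "cop_free = lin (\<lambda>w. prod_list (map cop_gen (letters w)))"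

text \<open>The coproduct of the coset \<open>C\<close>: the cosets obtained from different representatives coincide, since the
  coproduct respects the relations.\<close>

definition cop :: "nat \<Rightarrow> (nat \<Rightarrow> nat \<Rightarrow> kxy) \<Rightarrow> (nat \<Rightarrow> kxy) \<Rightarrow> free set \<Rightarrow> free2 set" where
  "cop N D r C = (\<Union>g\<in>C. rel_ideal2 N D r +>\<^bsub>free_ring2 N\<^esub> cop_free g)"

definition cop_op :: "nat \<Rightarrow> (nat \<Rightarrow> nat \<Rightarrow> kxy) \<Rightarrow> (nat \<Rightarrow> kxy) \<Rightarrow> free set \<Rightarrow> free2 set" where
  "cop_op N D r C = Poly_Mapping.map_key prod.swap ` cop N D r C"

subsection \<open>Structure constants of the two families\<close>

definition qi :: "(nat \<Rightarrow> nat) \<Rightarrow> nat \<Rightarrow> kxy" where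
  "qi eps i = (if eps i = 0 then qq else - inverse qq)"

definition cyc :: "nat \<Rightarrow> nat \<Rightarrow> nat" where
  \<comment> \<open>the representative in \<open>{1..n}\<close> of a residue class modulo \<open>n\<close>\<close>
  "cyc n i = (if i mod n = 0 then n else i mod n)"

definition angA :: "nat \<Rightarrow> nat \<Rightarrow> nat set" where
  "angA n i = {cyc n i, cyc n (i + 1)}"

definition angB :: "nat \<Rightarrow> nat \<Rightarrow> nat set" where
  "angB n i = {i, i + 1} \<inter> {1..n}"

definition DA :: "nat \<Rightarrow> (nat \<Rightarrow> nat) \<Rightarrow> nat \<Rightarrow> nat \<Rightarrow> kxy" where
  "DA n eps i j = (\<Prod>k\<in>angA n i \<inter> angA n j. qi eps k powi (2 * of_bool (i = j) - 1))"

definition DB :: "nat \<Rightarrow> (nat \<Rightarrow> nat) \<Rightarrow> nat \<Rightarrow> nat \<Rightarrow> kxy" where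
  "DB n eps i j = (\<Prod>k\<in>angB n i \<inter> angB n j. qi eps k powi (2 * of_bool (i = j) - 1))"

definition rA :: "nat \<Rightarrow> kxy" where "rA i = qq"

definition rB :: "nat \<Rightarrow> nat \<Rightarrow> kxy" where
  "rB n i = (if i = 0 \<or> i = n then pp else qq)"

definition UA :: "nat \<Rightarrow> (nat \<Rightarrow> nat) \<Rightarrow> free set ring" where
  "UA n eps = Ualg (n - 1) (DA n eps) rA"

definition copA :: "nat \<Rightarrow> (nat \<Rightarrow> nat) \<Rightarrow> free set \<Rightarrow> free2 set" where
  "copA n eps = cop (n - 1) (DA n eps) rA"

definition copA_op :: "nat \<Rightarrow> (nat \<Rightarrow> nat) \<Rightarrow> free set \<Rightarrow> free2 set" where
  "copA_op n eps = cop_op (n - 1) (DA n eps) rA"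

definition UB :: "nat \<Rightarrow> (nat \<Rightarrow> nat) \<Rightarrow> free set ring" where
  "UB n eps = Ualg n (DB n eps) (rB n)"

definition copB :: "nat \<Rightarrow> (nat \<Rightarrow> nat) \<Rightarrow> free set \<Rightarrow> free2 set" where
  "copB n eps = cop n (DB n eps) (rB n)"

definition copB_op :: "nat \<Rightarrow> (nat \<Rightarrow> nat) \<Rightarrow> free set \<Rightarrow> free2 set" where
  "copB_op n eps = cop_op n (DB n eps) (rB n)"

section \<open>The representations\<close>

definition qint :: "nat \<Rightarrow> kxy" where
  "qint m = (qq ^ m - inverse qq ^ m) / (qq - inverse qq)"

definition ketZ :: "nat \<Rightarrow> (nat \<Rightarrow> nat) \<Rightarrow> (nat \<Rightarrow> int) \<Rightarrow> vec" where
  \<comment> \<open>zero for indices out of range\<close>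
  "ketZ n eps v = (if (\<exists>m\<in>wbasis n eps. v = int \<circ> m) then ket (nat \<circ> v) else 0)"

definition unitv :: "nat \<Rightarrow> nat \<Rightarrow> int" where
  "unitv i j = of_bool (j = i)"

definition kA :: "nat \<Rightarrow> (nat \<Rightarrow> nat) \<Rightarrow> nat \<Rightarrow> mindex \<Rightarrow> kxy" where
  "kA n eps i m = qi eps (cyc n i) powi (- int (m (cyc n i)))
     * qi eps (cyc n (i + 1)) powi int (m (cyc n (i + 1)))"

fun genA :: "nat \<Rightarrow> (nat \<Rightarrow> nat) \<Rightarrow> kxy \<Rightarrow> gen \<Rightarrow> mindex \<Rightarrow> vec" where
  "genA n eps x (E i) m = scl (x powi of_bool (i = 0) * qint (m (cyc n i)))
     (ketZ n eps (\<lambda>j. int (m j) - unitv (cyc n i) j + unitv (cyc n (i + 1)) j))"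
| "genA n eps x (F i) m = scl (x powi (- of_bool (i = 0)) * qint (m (cyc n (i + 1))))
     (ketZ n eps (\<lambda>j. int (m j) + unitv (cyc n i) j - unitv (cyc n (i + 1)) j))"
| "genA n eps x (K i) m = scl (kA n eps i m) (ket m)"
| "genA n eps x (Kinv i) m = scl (inverse (kA n eps i m)) (ket m)"

definition kB :: "nat \<Rightarrow> (nat \<Rightarrow> nat) \<Rightarrow> nat \<Rightarrow> mindex \<Rightarrow> kxy" where
  "kB n eps i m = (if i = 0 then inverse pp * qi eps 1 powi int (m 1)
     else if i = n then pp * qi eps n powi (- int (m n))
     else kA n eps i m)"

fun genB :: "nat \<Rightarrow> (nat \<Rightarrow> nat) \<Rightarrow> kxy \<Rightarrow> gen \<Rightarrow> mindex \<Rightarrow> vec" where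
  "genB n eps x (E i) m =
     (if i = 0 then scl x (ketZ n eps (\<lambda>j. int (m j) + unitv 1 j))
      else if i = n then scl (qint (m n)) (ketZ n eps (\<lambda>j. int (m j) - unitv n j))
      else genA n eps x (E i) m)"
| "genB n eps x (F i) m =
     (if i = 0 then scl (inverse x * qint (m 1)) (ketZ n eps (\<lambda>j. int (m j) - unitv 1 j))
      else if i = n then ketZ n eps (\<lambda>j. int (m j) + unitv n j)
      else genA n eps x (F i) m)"
| "genB n eps x (K i) m = scl (kB n eps i m) (ket m)"
| "genB n eps x (Kinv i) m = scl (inverse (kB n eps i m)) (ket m)"

definition rep_word :: "(gen \<Rightarrow> mindex \<Rightarrow> vec) \<Rightarrow> gword \<Rightarrow> vec \<Rightarrow> vec" where
  "rep_word R w = foldr (\<lambda>s. lin (R s)) (letters w)"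

definition rep2_free ::
  "(gen \<Rightarrow> mindex \<Rightarrow> vec) \<Rightarrow> (gen \<Rightarrow> mindex \<Rightarrow> vec) \<Rightarrow> free2 \<Rightarrow> vec2 \<Rightarrow> vec2" where
  "rep2_free R R' t v = lin (\<lambda>(u, w). tens_op (rep_word R u) (rep_word R' w) v) t"

text \<open>
  The action of an element of \<open>U \<otimes> U\<close> on a vector: the common value on \<open>v\<close> of the representatives
  of the coset \<open>X\<close>.
\<close>

definition rep2 ::
  "(gen \<Rightarrow> mindex \<Rightarrow> vec) \<Rightarrow> (gen \<Rightarrow> mindex \<Rightarrow> vec) \<Rightarrow> free2 set \<Rightarrow> vec2 \<Rightarrow> vec2" where
  "rep2 R R' X v = the_elem ((\<lambda>t. rep2_free R R' t v) ` X)"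

definition pi2A :: "nat \<Rightarrow> (nat \<Rightarrow> nat) \<Rightarrow> kxy \<Rightarrow> kxy \<Rightarrow> free2 set \<Rightarrow> vec2 \<Rightarrow> vec2" where
  "pi2A n eps x y = rep2 (genA n eps x) (genA n eps y)"

definition pi2B :: "nat \<Rightarrow> (nat \<Rightarrow> nat) \<Rightarrow> kxy \<Rightarrow> kxy \<Rightarrow> free2 set \<Rightarrow> vec2 \<Rightarrow> vec2" where
  "pi2B n eps x y = rep2 (genB n eps x) (genB n eps y)"

end

theory Submission
  imports Defs
begin

text \<open>
  Both solutions contract one 3D operator per site along a chain of auxiliary indices
  \<open>c\<^sub>0, c\<^sub>1, \<dots>\<close>, and a generator of the algebra changes the occupation numbers of at most two
  neighbouring sites. Commutation is therefore a local matter. A matrix element at one site obeys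
  eight linear relations, from \<open>S3Z_j_up\<close> to \<open>S3Z_j_down\<close>; each of them relates elements
  whose outer indices are shifted by one, and all of them hold for the 3D \<open>R\<close>, as contiguity relations of
  a terminating \<open>q\<close>-hypergeometric sum, and in the same form for the 3D \<open>L\<close>. For \<open>e\<^sub>i\<close> and \<open>f\<^sub>i\<close>
  acting on two sites with a common link, expanding the factor of one site on the left-hand side and
  the factor of the other site on the right-hand side by these relations produces the same products on
  both sides, already for fixed auxiliary indices (\<open>pair_e\<close>, \<open>pair_f\<close>). If the common link
  carries \<open>c\<^sub>0\<close>, which happens for \<open>i = 0\<close> and the trace, the shift of \<open>c\<^sub>0\<close> by one becomes the
  factor \<open>z = x / y\<close>. At an end of the open chain only one site is involved, and the commutation relation
  depends on the boundary weights \<open>(q\<^sup>2)\<^sub>c / (q)\<^sub>c\<close> and \<open>1 / (q)\<^sub>c\<close>, through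
  their first-order recurrences in \<open>c\<close>; the factor \<open>- 1 / q = p\<^sup>2\<close> that arises there is the
  reason for the conjugation by \<open>K\<close>.

  These are relations between coefficients of power series in \<open>z\<close>, while the operators contain the values
  of rational functions at \<open>z = x / y\<close>. The conservation law \<open>b\<^sub>k + c\<^sub>k\<^sub>-\<^sub>1 = j\<^sub>k + c\<^sub>k\<close> leaves a single
  free auxiliary index \<open>N\<close>, and the product over the sites is a linear combination of functions
  \<open>q\<^sup>r\<^sup>N\<close> of it. So the trace is a sum of geometric series; with boundary
  vectors, the \<open>q\<close>-binomial theorem shows that the series becomes rational after multiplication by the
  normalization (\<open>rational_rho_series_11\<close>). Since \<open>x / y\<close> is transcendental over the field of coefficients, the value
  at \<open>x / y\<close> is a ring homomorphism on rational series, and the relations between coefficients become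
  relations between matrix elements: \<open>elem_tr_e\<close>, \<open>elem_tr_f\<close> and their
  counterparts for \<open>elem_11\<close>.

  What remains is algebra. Elements of \<open>U\<close> and their coproducts are cosets modulo the defining relations. The
  representations satisfy these relations (\<open>represents\<close>), and so does their tensor product
  (\<open>represents_tensor\<close>), so that a coset acts through any of its representatives, and the action of a coproduct is
  multiplicative. Hence it suffices to compare both sides for the generators and on basis
  vectors (\<open>commutation\<close>, \<open>intertwining\<close>), where they are the four-term relations above.
\<close>

section \<open>Powers of the indeterminate\<close>

lemma sqrt_q_power: "sqrt_q ^ m = to_fract (monom 1 m)"
proof (induction m)
  case (Suc m)
  have "monom (1::complex) (Suc m) = [:0, 1:] * monom 1 m"
    by (simp add: monom_Suc)
  then show ?case using Suc by (metis sqrt_q_def power_Suc to_fract_mult)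
qed (simp add: monom_0 one_pCons[symmetric])

lemma sqrt_q_neq0 [simp]: "sqrt_q \<noteq> 0"
  unfolding sqrt_q_def by simp

lemma sqrt_q_power_neq1: "m > 0 \<Longrightarrow> sqrt_q ^ m \<noteq> 1"
proof
  assume "m > 0" "sqrt_q ^ m = 1"
  then have "monom (1::complex) m = 1"
    unfolding sqrt_q_power by (metis to_fract_eq_iff to_fract_1)
  then have "degree (monom (1::complex) m) = degree (1 :: complex poly)" by simp
  then show False using \<open>m > 0\<close> by (simp add: degree_monom_eq)
qed

lemma q_neq0 [simp]: "q \<noteq> 0"
  by (simp add: q_def)

lemma q_power_neq1 [simp]: "m > 0 \<Longrightarrow> q ^ m \<noteq> 1"
  unfolding q_def power_mult[symmetric] by (rule sqrt_q_power_neq1) simp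

lemma q_powi_eq1_iff: "q powi m = 1 \<longleftrightarrow> m = 0"
proof
  assume h: "q powi m = 1"
  show "m = 0"
  proof (rule ccontr)
    assume "m \<noteq> 0"
    show False
    proof (cases "m > 0")
      case True
      then have "q ^ nat m = 1" using h by (simp add: power_int_def)
      then show False using q_power_neq1[of "nat m"] True by simp
    next
      case False
      then have "inverse q ^ nat (-m) = 1" using h \<open>m \<noteq> 0\<close> by (simp add: power_int_def)
      then have "q ^ nat (-m) = 1" by (simp add: power_inverse)
      then show False using q_power_neq1[of "nat (-m)"] False \<open>m \<noteq> 0\<close> by simp
    qed
  qed
qed simp

lemma q_powi_add: "q powi (a + b) = q powi a * q powi b"
  by (rule power_int_add) simp
lemma q_powi_diff: "q powi (a - b) = q powi a / q powi b"
  by (rule power_int_diff) simp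
lemma q_powi_2: "q powi (2 * a) = (q powi a)\<^sup>2"
  by (metis mult.commute power_int_mult power_int_numeral)
lemma q_powi_neq0 [simp]: "q powi a \<noteq> 0"
  by simp

lemma q_powi_2': "q powi (a * 2) = (q powi a)\<^sup>2"
  by (metis mult.commute q_powi_2)

lemmas q_powi_simps = q_powi_2' power_add power_mult_distrib q_powi_add q_powi_diff q_powi_2 power_int_minus

section \<open>Gaussian binomials\<close>

lemma qpoch_0 [simp]: "qpoch a Q 0 = 1"
  by (simp add: qpoch_def)

lemma qpoch_Suc: "qpoch a Q (Suc m) = qpoch a Q m * (1 - a * Q ^ m)"
  by (simp add: qpoch_def)

lemma qpoch2_neq0 [simp]: "qpoch (q\<^sup>2) (q\<^sup>2) m \<noteq> 0"
proof (induction m)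
  case (Suc m)
  have "q\<^sup>2 * (q\<^sup>2) ^ m = q ^ (2 * Suc m)" by (simp only: power_mult power_Suc)
  also have "\<dots> \<noteq> 1" by (rule q_power_neq1) simp
  finally show ?case using Suc by (simp add: qpoch_Suc)
qed simp

lemma qpoch2_Suc: "qpoch (q\<^sup>2) (q\<^sup>2) (Suc m) = qpoch (q\<^sup>2) (q\<^sup>2) m * (1 - (q ^ Suc m)\<^sup>2)"
  by (simp add: qpoch_Suc power_mult_distrib power_mult[symmetric] mult.commute)

lemma qbinom2_above [simp]: "m < k \<Longrightarrow> qbinom2 m k = 0"
  by (simp add: qbinom2_def)

lemma one_minus_q2_neq0: "1 - (q ^ Suc m)\<^sup>2 \<noteq> 0"
  using q_power_neq1[of "Suc m * 2"] unfolding power_mult by simp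

text \<open>
  The ratios of neighbouring Gaussian binomials, multiplied out so that they also hold at the
  ends of the range.
\<close>

lemma qbinom2_down:
  "(1 - (q ^ m)\<^sup>2) * qbinom2 (m - 1) k = (1 - (q powi (int m - int k))\<^sup>2) * qbinom2 m k"
proof (cases m)
  case 0
  then show ?thesis by (cases k) (auto simp: qbinom2_def)
next
  case (Suc l)
  show ?thesis
  proof (cases "k \<le> l")
    case True
    then obtain d where d: "l = k + d" using le_Suc_ex by blast
    have "int m - int k = int (Suc d)" using d Suc by simp
    then have "q powi (int m - int k) = q ^ Suc d" by (metis power_int_of_nat)
    moreover have "m - k = Suc d" using d Suc by simp
    moreover note one_minus_q2_neq0[of d]
    ultimately show ?thesis unfolding qbinom2_def using d Suc
      by (simp add: qpoch2_Suc[of d] qpoch2_Suc[of "k + d"] del: power_Suc)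
  next
    case False
    then show ?thesis using Suc by (cases "k = m") auto
  qed
qed

lemma qbinom2_up:
  "(1 - (q ^ Suc k)\<^sup>2) * qbinom2 m (Suc k) = (1 - (q powi (int m - int k))\<^sup>2) * qbinom2 m k"
proof (cases "k < m")
  case True
  then obtain d where d: "m = Suc (k + d)" using less_imp_Suc_add by blast
  have "int m - int k = int (Suc d)" using d by simp
  then have "q powi (int m - int k) = q ^ Suc d" by (metis power_int_of_nat)
  moreover have "m - k = Suc d" using d by simp
  moreover note one_minus_q2_neq0[of d] one_minus_q2_neq0[of k]
  ultimately show ?thesis unfolding qbinom2_def using d
    by (simp add: qpoch2_Suc[of d] qpoch2_Suc[of k] del: power_Suc)
next
  case False
  then show ?thesis by (cases "k = m") auto
qed

lemma qbinom2_0 [simp]: "qbinom2 m 0 = 1"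
  by (simp add: qbinom2_def)

section \<open>The summands of the 3D R\<close>

text \<open>
  For \<open>c \<ge> 0\<close> this is \<open>(q\<^sup>2)\<^sub>c\<^sub>+\<^sub>m /
  (q\<^sup>2)\<^sub>c\<close>; the product also makes sense for negative \<open>c\<close>.
\<close>

definition qprod :: "int \<Rightarrow> nat \<Rightarrow> kq" where
  "qprod c m = (\<Prod>s=1..m. 1 - (q powi (c + int s))\<^sup>2)"

lemma qprod_0 [simp]: "qprod c 0 = 1"
  by (simp add: qprod_def)

lemma qprod_Suc: "qprod c (Suc m) = qprod c m * (1 - (q powi c * q ^ m * q)\<^sup>2)"
  by (simp add: qprod_def q_powi_add algebra_simps)

lemma qprod_Suc': "qprod c (Suc m) = (1 - (q powi (c + 1))\<^sup>2) * qprod (c + 1) m"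
proof (induction m)
  case (Suc m)
  then show ?case
    by (simp add: qprod_Suc[of c "Suc m"] qprod_Suc[of "c + 1" m] q_powi_add mult_ac)
qed (simp add: qprod_def)

lemma qprod_down:
  "qprod (c - 1) (Suc m) = qprod c (Suc m) - (q powi c)\<^sup>2 * (1 - (q ^ Suc m)\<^sup>2) * qprod c m"
  using qprod_Suc'[of "c - 1" m] by (simp add: qprod_Suc[of c] algebra_simps power_mult_distrib)

text \<open>
  The summand of the 3D R. The auxiliary indices \<open>c\<close> and \<open>k\<close> are
  integers, because shifts of them leave the natural numbers.
\<close>

definition trm :: "nat \<Rightarrow> nat \<Rightarrow> int \<Rightarrow> int \<Rightarrow> nat \<Rightarrow> nat \<Rightarrow> kq" where
  "trm i j c k la mu = (-1) ^ la
     * q powi (int i * (c - int j) + (k + 1) * int la + int mu * (int mu - k))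
     * qprod c mu * qbinom2 i mu * qbinom2 j la"

text \<open>
  In each ratio of neighbouring summands below, only one power of \<open>q\<close> and one
  factor change.
\<close>

lemma swap_factor:
  fixes A B C D s x e p z :: kq
  assumes "A * B = C * D"
  shows "A * (s * (x * e) * p * B * z) = x * C * (s * e * p * D * z)"
    and "A * (s * (x * e) * p * z * B) = x * C * (s * e * p * z * D)"
proof -
  have "(s * x * e * p * z) * (A * B) = (s * x * e * p * z) * (C * D)" using assms by simp
  then show "A * (s * (x * e) * p * B * z) = x * C * (s * e * p * D * z)"
    and "A * (s * (x * e) * p * z * B) = x * C * (s * e * p * z * D)"
    by (simp_all only: mult_ac)
qed

lemma trm_k: "trm i j c k' la mu = q powi ((k' - k) * (int la - int mu)) * trm i j c k la mu"
proof -
  have "int i * (c - int j) + (k' + 1) * int la + int mu * (int mu - k')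
    = (k' - k) * (int la - int mu) + (int i * (c - int j) + (k + 1) * int la + int mu * (int mu - k))"
    by (simp add: algebra_simps)
  then show ?thesis unfolding trm_def by (simp only: q_powi_add mult_ac)
qed

text \<open>
  Ratios of neighbouring summands. They are kept free of denominators, so that the summands that
  vanish need no separate treatment.
\<close>

lemma trm_i_down: "(1 - (q ^ i)\<^sup>2) * trm (i - 1) j c k la mu
    = q powi (int j - c) * (1 - (q powi (int i - int mu))\<^sup>2) * trm i j c k la mu"
proof (cases i)
  case 0
  then show ?thesis by (cases mu) (auto simp: trm_def)
next
  case (Suc l)
  have e: "int (i - 1) * (c - int j) + (k + 1) * int la + int mu * (int mu - k)
    = (int j - c) + (int i * (c - int j) + (k + 1) * int la + int mu * (int mu - k))"
    using Suc by (simp add: algebra_simps)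
  show ?thesis unfolding trm_def e q_powi_add[of "int j - c"]
    by (rule swap_factor(1)[OF qbinom2_down])
qed

lemma trm_j_down: "(1 - (q ^ j)\<^sup>2) * trm i (j - 1) c k la mu
    = q ^ i * (1 - (q powi (int j - int la))\<^sup>2) * trm i j c k la mu"
proof (cases j)
  case 0
  then show ?thesis by (cases la) (auto simp: trm_def)
next
  case (Suc l)
  have e: "int i * (c - int (j - 1)) + (k + 1) * int la + int mu * (int mu - k)
    = int i + (int i * (c - int j) + (k + 1) * int la + int mu * (int mu - k))"
    using Suc by (simp add: algebra_simps)
  show ?thesis unfolding trm_def e q_powi_add[of "int i"] power_int_of_nat
    by (rule swap_factor(2)[OF qbinom2_down])
qed

lemma trm_la_up: "(1 - (q ^ Suc la)\<^sup>2) * trm i j c k (Suc la) mu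
    = - (q powi (k + 1) * (1 - (q powi (int j - int la))\<^sup>2) * trm i j c k la mu)"
proof -
  have e: "int i * (c - int j) + (k + 1) * int (Suc la) + int mu * (int mu - k)
    = (k + 1) + (int i * (c - int j) + (k + 1) * int la + int mu * (int mu - k))"
    by (simp add: algebra_simps)
  show ?thesis unfolding trm_def e q_powi_add[of "k + 1"] power_Suc[of "-1"]
    using swap_factor(2)[OF qbinom2_up[of la j], of "- ((-1) ^ la)" "q powi (k + 1)"
        "q powi (int i * (c - int j) + (k + 1) * int la + int mu * (int mu - k))" "qprod c mu" "qbinom2 i mu"]
    by (simp only: mult_minus_left mult_minus_right mult_1)
qed

lemma trm_mu_up: "(1 - (q ^ Suc mu)\<^sup>2) * trm i j c k la (Suc mu)
    = q powi (2 * int mu + 1 - k) * (1 - (q powi (int i - int mu))\<^sup>2)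
      * (1 - (q powi c * q ^ mu * q)\<^sup>2) * trm i j c k la mu"
proof -
  have e: "int i * (c - int j) + (k + 1) * int la + int (Suc mu) * (int (Suc mu) - k)
    = (2 * int mu + 1 - k) + (int i * (c - int j) + (k + 1) * int la + int mu * (int mu - k))"
    by (simp add: algebra_simps)
  have gen: "A * (s * (x * e) * (p * y) * B * z) = x * C * y * (s * e * p * D * z)"
    if "A * B = C * D" for A B C D s x e p y z :: kq
    using swap_factor(1)[OF that, of s x e "p * y" z] by (simp only: mult_ac)
  show ?thesis unfolding trm_def e q_powi_add[of "2 * int mu + 1 - k"] qprod_Suc
    by (rule gen[OF qbinom2_up])
qed

lemma trm_c_down_0: "trm i j (c - 1) k la 0 = trm i j c k la 0 / q ^ i"
proof -
  have e: "int i * (c - int j) + (k + 1) * int la + int 0 * (int 0 - k)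
    = int i + (int i * (c - 1 - int j) + (k + 1) * int la + int 0 * (int 0 - k))"
    by (simp add: algebra_simps)
  show ?thesis unfolding trm_def e q_powi_add[of "int i"] power_int_of_nat by simp
qed

lemma trm_c_down_Suc: "trm i j (c - 1) k la (Suc mu) = (trm i j c k la (Suc mu)
    - (q powi c)\<^sup>2 * q powi (2 * int mu + 1 - k) * (1 - (q powi (int i - int mu))\<^sup>2)
      * trm i j c k la mu) / q ^ i"
proof -
  have e: "int i * (c - int j) + (k + 1) * int la + int (Suc mu) * (int (Suc mu) - k)
    = int i + (int i * (c - 1 - int j) + (k + 1) * int la + int (Suc mu) * (int (Suc mu) - k))"
    by (simp add: algebra_simps)
  have e': "int i + (int i * (c - 1 - int j) + (k + 1) * int la + int (Suc mu) * (int (Suc mu) - k))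
    = (2 * int mu + 1 - k) + (int i * (c - int j) + (k + 1) * int la + int mu * (int mu - k))"
    by (simp add: algebra_simps)
  have gen: "qi * (s * e * (p1 - cc * A * p0) * B * z) = s * (qi * e) * p1 * B * z - cc * x * C * (s * f * p0 * D * z)"
    if "qi * e = x * f" "A * B = C * D" for A B C D s x e f p0 p1 cc z qi :: kq
  proof -
    have "qi * (s * e * (p1 - cc * A * p0) * B * z)
        = s * (qi * e) * p1 * B * z - cc * s * p0 * z * ((qi * e) * (A * B))"
      by (simp add: algebra_simps)
    also have "\<dots> = s * (qi * e) * p1 * B * z - cc * x * C * (s * f * p0 * D * z)"
      unfolding that by (simp add: mult_ac)
    finally show ?thesis .
  qed
  have "q ^ i * trm i j (c - 1) k la (Suc mu) = trm i j c k la (Suc mu)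
    - (q powi c)\<^sup>2 * q powi (2 * int mu + 1 - k) * (1 - (q powi (int i - int mu))\<^sup>2)
      * trm i j c k la mu"
    unfolding trm_def e
    unfolding q_powi_add[of "int i"] power_int_of_nat qprod_down
    by (rule gen[OF arg_cong[OF e', of "(powi) q", unfolded q_powi_add[of "int i"] power_int_of_nat
        q_powi_add[of "2 * int mu + 1 - k"]] qbinom2_up])
  then show ?thesis by (simp add: field_simps)
qed

section \<open>Sums over an antidiagonal\<close>

text \<open>
  Removing either end of the antidiagonal \<open>la + mu = b + 1\<close> leaves a shifted copy
  of \<open>la + mu = b\<close>; all recursions in \<open>b\<close> rest on this.
\<close>

definition antidiag :: "nat \<Rightarrow> (nat \<Rightarrow> nat \<Rightarrow> kq) \<Rightarrow> kq" where
  "antidiag b f = (\<Sum>mu\<le>b. f (b - mu) mu)"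

lemma antidiag_0 [simp]: "antidiag 0 f = f 0 0"
  by (simp add: antidiag_def)

lemma antidiag_Suc_mu: "antidiag (Suc b) f = f (Suc b) 0 + antidiag b (\<lambda>la mu. f la (Suc mu))"
  unfolding antidiag_def sum.atMost_Suc_shift by simp

lemma antidiag_Suc_la: "antidiag (Suc b) f = f 0 (Suc b) + antidiag b (\<lambda>la mu. f (Suc la) mu)"
  unfolding antidiag_def by (simp add: Suc_diff_le)

lemma antidiag_cong: "(\<And>la mu. la + mu = b \<Longrightarrow> f la mu = g la mu) \<Longrightarrow> antidiag b f = antidiag b g"
  unfolding antidiag_def by (intro sum.cong) auto

lemma antidiag_cong': "(\<And>la mu. b = la + mu \<Longrightarrow> f la mu = g la mu) \<Longrightarrow> antidiag b f = antidiag b g"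
  by (rule antidiag_cong) simp

lemma antidiag_add: "antidiag b f + antidiag b g = antidiag b (\<lambda>la mu. f la mu + g la mu)"
  unfolding antidiag_def by (simp add: sum.distrib)
lemma antidiag_diff: "antidiag b f - antidiag b g = antidiag b (\<lambda>la mu. f la mu - g la mu)"
  unfolding antidiag_def by (simp add: sum_subtractf)
lemma antidiag_mult: "a * antidiag b f = antidiag b (\<lambda>la mu. a * f la mu)"
  unfolding antidiag_def by (simp add: sum_distrib_left)
lemma antidiag_uminus: "- antidiag b f = antidiag b (\<lambda>la mu. - f la mu)"
  unfolding antidiag_def by (simp add: sum_negf)

lemmas antidiag_lin = antidiag_add antidiag_diff antidiag_mult antidiag_uminus

text \<open>
  Summation by parts: the factor \<open>1 - q\<^sup>2\<^sup>l\<^sup>a\<close> removes the end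
  \<open>la = 0\<close>, and the ratio of neighbouring summands moves the other terms to the
  antidiagonal of \<open>b\<close>.
\<close>

lemma antidiag_la_shift: "antidiag (Suc b) (\<lambda>la mu. A la mu * (1 - (q ^ la)\<^sup>2) * trm i j c k la mu)
    = antidiag b (\<lambda>la mu. - (A (Suc la) mu * q powi (k + 1) * (1 - (q powi (int j - int la))\<^sup>2) * trm i j c k la mu))"
  unfolding antidiag_Suc_la mult.assoc trm_la_up by (simp add: mult_ac)

lemma antidiag_mu_shift: "antidiag (Suc b) (\<lambda>la mu. A la mu * (1 - (q ^ mu)\<^sup>2) * trm i j c k la mu)
    = antidiag b (\<lambda>la mu. A la (Suc mu) * q powi (2 * int mu + 1 - k) * (1 - (q powi (int i - int mu))\<^sup>2)
      * (1 - (q powi c * q ^ mu * q)\<^sup>2) * trm i j c k la mu)"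
  unfolding antidiag_Suc_mu mult.assoc trm_mu_up by (simp add: mult_ac)

text \<open>
  Lowering \<open>c\<close> changes a summand by a multiple of its neighbour
  (\<open>trm_c_down_Suc\<close>), because \<open>qprod\<close> obeys a recurrence of Pascal
  type.
\<close>

lemma antidiag_c_down: "antidiag (Suc b) (\<lambda>la mu. q ^ i * A la mu * trm i j (c - 1) k la mu)
    = antidiag (Suc b) (\<lambda>la mu. A la mu * trm i j c k la mu)
       - antidiag b (\<lambda>la mu. A la (Suc mu) * (q powi c)\<^sup>2 * q powi (2 * int mu + 1 - k)
           * (1 - (q powi (int i - int mu))\<^sup>2) * trm i j c k la mu)"
  unfolding antidiag_Suc_mu trm_c_down_0 trm_c_down_Suc add_diff_eq[symmetric] antidiag_diff
  by (simp add: mult.assoc right_diff_distrib[symmetric])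

section \<open>Contiguity relations of the 3D R\<close>

text \<open>
  The matrix element of the 3D R as a function of the indices that the conservation laws leave
  free.
\<close>

definition H :: "nat \<Rightarrow> nat \<Rightarrow> nat \<Rightarrow> int \<Rightarrow> kq" where
  "H i j b c = antidiag b (trm i j c (int b + c - int j))"

text \<open>Then the upper index \<open>a = i + j - b\<close> would be negative.\<close>

lemma H_above: "b > i + j \<Longrightarrow> H i j b c = 0"
  unfolding H_def antidiag_def trm_def
proof (intro sum.neutral ballI)
  fix mu assume "b > i + j" "mu \<in> {..b}"
  then have "i < mu \<or> j < b - mu" by auto
  then have "qbinom2 i mu = 0 \<or> qbinom2 j (b - mu) = 0" by auto
  then show "(- 1) ^ (b - mu) * q powi (int i * (c - int j) + (int b + c - int j + 1) * int (b - mu) +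
         int mu * (int mu - (int b + c - int j))) * qprod c mu * qbinom2 i mu * qbinom2 j (b - mu) = 0"
    by auto
qed

lemma trm_c_up: "(1 - (q powi (c + 1))\<^sup>2) * trm i j (c + 1) k la mu
    = q ^ i * (1 - (q powi c * q ^ mu * q)\<^sup>2) * trm i j c k la mu"
proof -
  have e: "int i * (c + 1 - int j) + (k + 1) * int la + int mu * (int mu - k)
    = int i + (int i * (c - int j) + (k + 1) * int la + int mu * (int mu - k))"
    by (simp add: algebra_simps)
  have "(1 - (q powi (c + 1))\<^sup>2) * qprod (c + 1) mu = (1 - (q powi c * q ^ mu * q)\<^sup>2) * qprod c mu"
    using qprod_Suc[of c mu] qprod_Suc'[of c mu] by simp
  from swap_factor(1)[OF this, of "(-1) ^ la" "q ^ i"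
      "q powi (int i * (c - int j) + (k + 1) * int la + int mu * (int mu - k))" 1 "qbinom2 i mu * qbinom2 j la"]
  show ?thesis unfolding trm_def e q_powi_add[of "int i"] power_int_of_nat
    by (simp only: mult_ac mult_1)
qed

text \<open>The \<open>q\<close>-number without its denominators, see \<open>qn_br\<close>.\<close>

definition br :: "int \<Rightarrow> kq" where "br m = 1 - (q powi m)\<^sup>2"

lemma br_0 [simp]: "br 0 = 0" by (simp add: br_def)

lemma br_eq0_iff: "br m = 0 \<longleftrightarrow> m = 0"
  unfolding br_def using q_powi_eq1_iff[of "2 * m"] by (auto simp: q_powi_2)

text \<open>
  The bracket turns the Gaussian binomials with a lowered index into those with the original
  one. So the matrix elements in a contiguity relation become sums over multiples of one and the
  same summand.
\<close>

lemma br_H_j_down: "br (int j) * H i (j - 1) b c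
    = antidiag b (\<lambda>la mu. q ^ i * (1 - (q powi (int j - int la))\<^sup>2) * trm i j c (int b + c - int j + 1) la mu)"
proof -
  have "br (int j) * H i (j - 1) b c
     = br (int j) * antidiag b (trm i (j - 1) c (int b + c - int j + 1))"
    by (cases j) (simp_all add: H_def algebra_simps)
  also have "\<dots> = antidiag b (\<lambda>la mu. (1 - (q ^ j)\<^sup>2) * trm i (j - 1) c (int b + c - int j + 1) la mu)"
    unfolding antidiag_mult br_def by simp
  finally show ?thesis unfolding trm_j_down .
qed

lemma br_H_i_down: "br (int i) * H (i - 1) j b c
    = antidiag b (\<lambda>la mu. q powi (int j - c) * (1 - (q powi (int i - int mu))\<^sup>2) * trm i j c (int b + c - int j) la mu)"
proof -
  have "br (int i) * H (i - 1) j b c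
     = antidiag b (\<lambda>la mu. (1 - (q ^ i)\<^sup>2) * trm (i - 1) j c (int b + c - int j) la mu)"
    unfolding antidiag_mult br_def H_def by simp
  then show ?thesis unfolding trm_i_down .
qed

lemma br_H_ij_down: "br (int i) * (br (int j) * H (i - 1) (j - 1) b c)
    = antidiag b (\<lambda>la mu. q powi (int i - 1) * q powi (int j - c) * (1 - (q powi (int j - int la))\<^sup>2)
        * (1 - (q powi (int i - int mu))\<^sup>2) * trm i j c (int b + c - int j + 1) la mu)"
proof (cases i)
  case 0
  have "antidiag b (\<lambda>la mu. q powi (int i - 1) * q powi (int j - c) * (1 - (q powi (int j - int la))\<^sup>2)
        * (1 - (q powi (int i - int mu))\<^sup>2) * trm i j c (int b + c - int j + 1) la mu)
     = antidiag b (\<lambda>la mu. 0)"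
    by (rule antidiag_cong) (metis (no_types, opaque_lifting) 0 diff_self br_def br_0 gr0I mult_eq_0_iff of_nat_0 qbinom2_above trm_def)
  then show ?thesis using 0 by (simp add: antidiag_def)
next
  case (Suc l)
  then have e: "q powi (int i - 1) = q ^ (i - 1)" by simp
  show ?thesis unfolding br_H_j_down antidiag_mult e
  proof (rule antidiag_cong)
    fix la mu
    have "br (int i) * (q ^ (i - 1) * (1 - (q powi (int j - int la))\<^sup>2) * trm (i - 1) j c (int b + c - int j + 1) la mu)
      = q ^ (i - 1) * (1 - (q powi (int j - int la))\<^sup>2) * ((1 - (q ^ i)\<^sup>2) * trm (i - 1) j c (int b + c - int j + 1) la mu)"
      by (simp add: br_def mult_ac)
    then show "br (int i) * (q ^ (i - 1) * (1 - (q powi (int j - int la))\<^sup>2) * trm (i - 1) j c (int b + c - int j + 1) la mu)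
      = q ^ (i - 1) * q powi (int j - c) * (1 - (q powi (int j - int la))\<^sup>2)
        * (1 - (q powi (int i - int mu))\<^sup>2) * trm i j c (int b + c - int j + 1) la mu"
      unfolding trm_i_down by (simp only: mult_ac)
  qed
qed

text \<open>
  The eight contiguity relations are proved in the same way. After multiplication by brackets,
  all terms are antidiagonal sums of multiples of one summand. Where antidiagonals of two
  neighbouring lengths occur, the coefficient over the longer one is, up to terms common to both
  sides, a combination of \<open>1 - q\<^sup>2\<^sup>l\<^sup>a\<close> and \<open>1 -
  q\<^sup>2\<^sup>m\<^sup>u\<close>, so that summation by parts moves everything to the shorter
  one, and there the coefficients agree. Relations that contain \<open>b - 1\<close> get a
  separate version for \<open>b = 0\<close>.
\<close>

lemma H_j_up_0: "H i (Suc j) 0 c = H i j 0 (c - 1)"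
  unfolding H_def by (simp add: trm_def) (simp add: algebra_simps)

lemma H_j_up: "H i (Suc j) (Suc b) c
    = H i j (Suc b) (c - 1) - q powi (int i + int j - int b + c + 1) * H i j b c"
proof -
  define k where "k = int b + c - int j"
  let ?J = "int (Suc j)"
  have x: "br ?J \<noteq> 0" by (simp add: br_eq0_iff)
  let ?t = "trm i (Suc j) c k"
  have e: "int (Suc b) + (c - 1) - ?J + 1 = k" "int b + c - ?J + 1 = k" "int (Suc b) + c - int (Suc j) = k"
    by (simp_all add: k_def)
  have 1: "br ?J * H i j (Suc b) (c - 1)
    = antidiag (Suc b) (\<lambda>la mu. q ^ i * (1 - (q powi (?J - int la))\<^sup>2) * trm i (Suc j) (c - 1) k la mu)"
    using br_H_j_down[of "Suc j" i "Suc b" "c - 1"] unfolding e by simp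
  have 2: "br ?J * H i j b c = antidiag b (\<lambda>la mu. q ^ i * (1 - (q powi (?J - int la))\<^sup>2) * ?t la mu)"
    using br_H_j_down[of "Suc j" i b c] unfolding e by simp
  have 3: "br ?J * H i (Suc j) (Suc b) c = antidiag (Suc b) (\<lambda>la mu. (1 - (q powi (?J - int la))\<^sup>2) * ?t la mu)
      + antidiag (Suc b) (\<lambda>la mu. (q powi (?J - int la))\<^sup>2 * (1 - (q ^ la)\<^sup>2) * ?t la mu)"
    unfolding H_def e antidiag_lin by (rule antidiag_cong) (simp add: br_def q_powi_simps field_simps)
  have "br ?J * H i (Suc j) (Suc b) c = br ?J * H i j (Suc b) (c - 1) - q powi (int i + int j - int b + c + 1) * (br ?J * H i j b c)"
    unfolding 1 2 3 antidiag_c_down antidiag_la_shift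
    unfolding diff_conv_add_uminus add.assoc add_left_cancel antidiag_lin
    by (rule antidiag_cong') (simp add: k_def q_powi_simps field_simps power2_eq_square)
  then have "br ?J * H i (Suc j) (Suc b) c
      = br ?J * (H i j (Suc b) (c - 1) - q powi (int i + int j - int b + c + 1) * H i j b c)"
    by (simp only: right_diff_distrib mult.left_commute)
  then show ?thesis using x by simp
qed

lemma H_i_up_0: "q ^ j * H (Suc i) j 0 c = q powi c * H i j 0 c"
  unfolding H_def by (simp add: trm_def distrib_right q_powi_add q_powi_diff)

lemma H_i_up: "q ^ j * H (Suc i) j (Suc b) c
    = q powi c * H i j (Suc b) c + q powi (int i + int j - int b) * br (c + 1) * H i j b (c + 1)"
proof -
  define k where "k = int (Suc b) + c - int j"
  let ?I = "int (Suc i)"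
  have x: "br ?I \<noteq> 0" by (simp add: br_eq0_iff)
  let ?t = "trm (Suc i) j c k"
  have e: "int b + (c + 1) - int j = k" "int (Suc b) + c - int j = k"
    by (simp_all add: k_def)
  have 1: "br ?I * H i j (Suc b) c
    = antidiag (Suc b) (\<lambda>la mu. q powi (int j - c) * (1 - (q powi (?I - int mu))\<^sup>2) * ?t la mu)"
    using br_H_i_down[of "Suc i" j "Suc b" c] unfolding e by simp
  have 2: "br (c + 1) * (br ?I * H i j b (c + 1)) = antidiag b (\<lambda>la mu. q powi (int j - (c + 1)) * (1 - (q powi (?I - int mu))\<^sup>2)
     * (q ^ Suc i * (1 - (q powi c * q ^ mu * q)\<^sup>2) * ?t la mu))"
    using br_H_i_down[of "Suc i" j b "c + 1"] unfolding e trm_c_up[symmetric]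
    by (simp add: antidiag_mult br_def mult_ac)
  have 3: "br ?I * (q ^ j * H (Suc i) j (Suc b) c) = q powi c * antidiag (Suc b) (\<lambda>la mu. q powi (int j - c) * (1 - (q powi (?I - int mu))\<^sup>2) * ?t la mu)
      + antidiag (Suc b) (\<lambda>la mu. q ^ j * (q powi (?I - int mu))\<^sup>2 * (1 - (q ^ mu)\<^sup>2) * ?t la mu)"
    unfolding H_def e antidiag_lin by (rule antidiag_cong) (simp add: br_def q_powi_simps field_simps)
  have "br ?I * (q ^ j * H (Suc i) j (Suc b) c) = q powi c * (br ?I * H i j (Suc b) c)
     + q powi (int i + int j - int b) * (br (c + 1) * (br ?I * H i j b (c + 1)))"
    unfolding 1 2 3 antidiag_mu_shift
    unfolding antidiag_mult add_left_cancel
    by (rule antidiag_cong') (simp add: k_def q_powi_simps field_simps power2_eq_square)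
  then have "br ?I * (q ^ j * H (Suc i) j (Suc b) c)
      = br ?I * (q powi c * H i j (Suc b) c + q powi (int i + int j - int b) * br (c + 1) * H i j b (c + 1))"
    by (simp only: distrib_left mult_ac)
  then show ?thesis using x by simp
qed

lemma H_a_up: "br (int i + int j - int b) * H i j b c = q powi (int i - int b) * (br (int j) * H i (j - 1) b c)
   + q powi (c - int j) * (br (int i) * H (i - 1) j b c)"
  unfolding br_H_j_down br_H_i_down trm_k[of _ _ _ "int b + c - int j + 1" _ _ "int b + c - int j"]
  unfolding H_def antidiag_lin
    by (rule antidiag_cong') (simp add: br_def q_powi_simps field_simps power2_eq_square)

lemma H_b_up: "br (int b + 1) * H i j (Suc b) c
    = br (int b + c - int j + 1) * (br (int i) * H (i - 1) j b c)
      - q powi (int b + c - int j + 2 + int i) * (br (int j) * H i (j - 1) b c)"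
proof -
  define k where "k = int (Suc b) + c - int j"
  have e: "int b + c - int j = k - 1" "int (Suc b) + c - int j = k" by (simp_all add: k_def)
  have A: "br (int b + 1) * H i j (Suc b) c = antidiag (Suc b) (\<lambda>la mu. 1 * (1 - (q ^ mu)\<^sup>2) * trm i j c k la mu)
     + antidiag (Suc b) (\<lambda>la mu. (q ^ mu)\<^sup>2 * (1 - (q ^ la)\<^sup>2) * trm i j c k la mu)"
    unfolding H_def e antidiag_lin
  proof (rule antidiag_cong)
    fix la mu assume "la + mu = Suc b"
    then have "int b + 1 = int la + int mu" by simp
    then show "br (int b + 1) * trm i j c k la mu
      = 1 * (1 - (q ^ mu)\<^sup>2) * trm i j c k la mu + (q ^ mu)\<^sup>2 * (1 - (q ^ la)\<^sup>2) * trm i j c k la mu"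
      by (simp add: br_def q_powi_simps algebra_simps)
  qed
  show ?thesis unfolding A[unfolded antidiag_la_shift antidiag_mu_shift]
    unfolding br_H_j_down br_H_i_down e trm_k[of _ _ _ "k - 1" _ _ k] antidiag_lin
    by (rule antidiag_cong') (simp add: br_def k_def q_powi_simps field_simps power2_eq_square)
qed

text \<open>
  In the next two relations both lower indices change. The coefficient identities for them are
  polynomial identities in \<open>l = q\<^sup>l\<^sup>a\<close>, \<open>m =
  q\<^sup>m\<^sup>u\<close> and the powers of \<open>q\<close> at \<open>i\<close>,
  \<open>j\<close> and \<open>c\<close>; here \<open>x\<close> stands for \<open>q\<close>
  itself.
\<close>

lemma coef_b_down_split:
  fixes c l m i j x y :: "'a :: field"
  assumes "c \<noteq> 0" "l \<noteq> 0" "m \<noteq> 0" "i \<noteq> 0" "j \<noteq> 0" "x \<noteq> 0"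
  shows "(1 - (x * i)\<^sup>2) * (x * i * (1 - (x * j / l)\<^sup>2) * (l / m * y))
      - i * l * m * c / j * ((1 - (x * j)\<^sup>2) * (x * j / c * (1 - (x * i / m)\<^sup>2) * y))
    = - (x * i * l * m * (x * j / l)\<^sup>2 * (1 - (x * i / m)\<^sup>2)) * (1 - l\<^sup>2) * y
      + (x * i * l / m * (1 - (x * j / l)\<^sup>2)) * (1 - m\<^sup>2) * y"
proof -
  have "(1 - (x * i)\<^sup>2) * (x * i * (1 - (x * j / l)\<^sup>2) * (l / m))
      - i * l * m * c / j * ((1 - (x * j)\<^sup>2) * (x * j / c * (1 - (x * i / m)\<^sup>2)))
    = - (x * i * l * m * (x * j / l)\<^sup>2 * (1 - (x * i / m)\<^sup>2)) * (1 - l\<^sup>2)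
      + (x * i * l / m * (1 - (x * j / l)\<^sup>2)) * (1 - m\<^sup>2)"
    using assms by (simp add: divide_simps) (simp add: algebra_simps power2_eq_square)
  from arg_cong[OF this, of "\<lambda>u. u * y"] show ?thesis by (simp only: ring_distribs mult_ac)
qed

lemma coef_b_down:
  fixes c l m i j x y :: "'a :: field"
  assumes "c \<noteq> 0" "l \<noteq> 0" "m \<noteq> 0" "i \<noteq> 0" "j \<noteq> 0" "x \<noteq> 0"
  shows "i * (x * j / c) * (1 - (x * j / l)\<^sup>2) * (1 - (x * i / m)\<^sup>2) * y
    = - (- (x * i * (l * x) * m * (j / l)\<^sup>2 * (1 - (x * i / m)\<^sup>2)) * (l * m * c / j * x) * (1 - (x * j / l)\<^sup>2) * y)
      + (x * i * l / (m * x) * (1 - (x * j / l)\<^sup>2)) * (m * m * x / (l * m * c / j)) * (1 - (x * i / m)\<^sup>2)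
        * (1 - (c * m * x)\<^sup>2) * y"
proof -
  have "i * (x * j / c) 
    = x * i * (l * x) * m * (j / l)\<^sup>2 * (l * m * c / j * x)
      + x * i * l / (m * x) * (m * m * x / (l * m * c / j)) * (1 - (c * m * x)\<^sup>2)"
    using assms by (simp add: divide_simps) (simp add: algebra_simps power2_eq_square)
  from arg_cong[OF this, of "\<lambda>u. u * ((1 - (x * j / l)\<^sup>2) * (1 - (x * i / m)\<^sup>2) * y)"]
  show ?thesis by (simp only: distrib_right distrib_left mult_ac mult_minus_left mult_minus_right minus_minus)
qed

lemma coef_a_down_split:
  fixes c l m i j x y :: "'a :: field"
  assumes "c \<noteq> 0" "l \<noteq> 0" "m \<noteq> 0" "i \<noteq> 0" "j \<noteq> 0" "x \<noteq> 0"
  shows "l * m * ((i * (x * j / c)) * (1 - (x * j / l)\<^sup>2) * (1 - (x * i / m)\<^sup>2) * (l / m * y))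
     - l * m * c / j * ((1 - (x * i)\<^sup>2) * (x * i * (1 - (x * j / l)\<^sup>2) * (l / m * y)))
     - i * (1 - (l * m * c / j)\<^sup>2) * ((1 - (x * j)\<^sup>2) * (x * j / c * (1 - (x * i / m)\<^sup>2) * y))
   = - (i * x * j / c * (1 - (x * i / m)\<^sup>2) * (1 - (c * x * m)\<^sup>2)) * (1 - l\<^sup>2) * y
     + - (i * x * j / c * (c / j * l)\<^sup>2 * (1 - (x * j / l)\<^sup>2)) * (1 - m\<^sup>2) * y"
proof -
  have "l * m * ((i * (x * j / c)) * (1 - (x * j / l)\<^sup>2) * (1 - (x * i / m)\<^sup>2) * (l / m))
     - l * m * c / j * ((1 - (x * i)\<^sup>2) * (x * i * (1 - (x * j / l)\<^sup>2) * (l / m)))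
     - i * (1 - (l * m * c / j)\<^sup>2) * ((1 - (x * j)\<^sup>2) * (x * j / c * (1 - (x * i / m)\<^sup>2)))
   = - (i * x * j / c * (1 - (x * i / m)\<^sup>2) * (1 - (c * x * m)\<^sup>2)) * (1 - l\<^sup>2)
     + - (i * x * j / c * (c / j * l)\<^sup>2 * (1 - (x * j / l)\<^sup>2)) * (1 - m\<^sup>2)"
    using assms by (simp add: divide_simps) (simp add: algebra_simps power2_eq_square)
  from arg_cong[OF this, of "\<lambda>u. u * y"] show ?thesis by (simp only: ring_distribs mult_ac)
qed

lemma H_b_down_0: "H (Suc i) j 0 c = q powi (int i + c - int j) * H i (Suc j) 0 c"
  unfolding H_def by (simp add: trm_def q_powi_simps ring_distribs)

lemma H_b_down: "H i j b c = H (Suc i) j (Suc b) c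
    - q powi (int i + int b + c - int j + 1) * H i (Suc j) (Suc b) c"
proof -
  define k where "k = int b + c - int j"
  let ?I = "int (Suc i)" and ?J = "int (Suc j)"
  have x: "br ?I * br ?J \<noteq> 0" by (simp add: br_eq0_iff)
  let ?t = "trm (Suc i) (Suc j) c k"
  have e: "int (Suc b) + c - ?J + 1 = k + 1" "int (Suc b) + c - ?J = k"
    "int b + c - ?J + 1 = k" by (simp_all add: k_def)
  have 1: "br ?J * H (Suc i) j (Suc b) c = antidiag (Suc b) (\<lambda>la mu. q ^ Suc i * (1 - (q powi (?J - int la))\<^sup>2)
      * trm (Suc i) (Suc j) c (k + 1) la mu)"
    using br_H_j_down[of "Suc j" "Suc i" "Suc b" c] unfolding e by simp
  have 2: "br ?I * H i (Suc j) (Suc b) c = antidiag (Suc b) (\<lambda>la mu. q powi (?J - c) * (1 - (q powi (?I - int mu))\<^sup>2) * ?t la mu)"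
    using br_H_i_down[of "Suc i" "Suc j" "Suc b" c] unfolding e by simp
  have 3: "br ?I * (br ?J * H i j b c) = antidiag b (\<lambda>la mu. q ^ i * q powi (?J - c) * (1 - (q powi (?J - int la))\<^sup>2)
        * (1 - (q powi (?I - int mu))\<^sup>2) * ?t la mu)"
    using br_H_ij_down[of "Suc i" "Suc j" b c] unfolding e by simp
  have 4: "br ?I * (br ?J * H (Suc i) j (Suc b) c)
      - q powi (int i + int b + c - int j + 1) * (br ?J * (br ?I * H i (Suc j) (Suc b) c))
    = antidiag (Suc b) (\<lambda>la mu. - (q powi (?I + int la + int mu) * (q powi (?J - int la))\<^sup>2 * (1 - (q powi (?I - int mu))\<^sup>2)) * (1 - (q ^ la)\<^sup>2) * ?t la mu)
     + antidiag (Suc b) (\<lambda>la mu. (q powi (?I + int la - int mu) * (1 - (q powi (?J - int la))\<^sup>2)) * (1 - (q ^ mu)\<^sup>2) * ?t la mu)"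
    unfolding 1 2 trm_k[of _ _ _ "k + 1" _ _ k] antidiag_lin
  proof (rule antidiag_cong)
    fix la mu assume "la + mu = Suc b"
    then have b: "int b = int la + int mu - 1" by simp
    show "br ?I * (q ^ Suc i * (1 - (q powi (?J - int la))\<^sup>2) * (q powi ((k + 1 - k) * (int la - int mu)) * ?t la mu))
      - q powi (int i + int b + c - int j + 1) * (br ?J * (q powi (?J - c) * (1 - (q powi (?I - int mu))\<^sup>2) * ?t la mu))
      = - (q powi (?I + int la + int mu) * (q powi (?J - int la))\<^sup>2 * (1 - (q powi (?I - int mu))\<^sup>2)) * (1 - (q ^ la)\<^sup>2) * ?t la mu
      + (q powi (?I + int la - int mu) * (1 - (q powi (?J - int la))\<^sup>2)) * (1 - (q ^ mu)\<^sup>2) * ?t la mu"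
    proof -
      have p: "q ^ Suc i = q * q ^ i" "q powi (?J - int la) = q * q ^ j / q ^ la" "q powi (?I - int mu) = q * q ^ i / q ^ mu"
        "q powi ((k + 1 - k) * (int la - int mu)) = q ^ la / q ^ mu" "q powi ?I = q * q ^ i" "q powi ?J = q * q ^ j"
        "q powi (int i + int b + c - int j + 1) = q ^ i * q ^ la * q ^ mu * q powi c / q ^ j"
        "q powi (?J - c) = q * q ^ j / q powi c" "q powi (?I + int la + int mu) = q * q ^ i * q ^ la * q ^ mu"
        "q powi (?I + int la - int mu) = q * q ^ i * q ^ la / q ^ mu"
        by (simp_all add: b q_powi_simps)
      show ?thesis unfolding br_def p by (rule coef_b_down_split) simp_all
    qed
  qed
  have "br ?I * (br ?J * H i j b c) = br ?I * (br ?J * H (Suc i) j (Suc b) c)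
      - q powi (int i + int b + c - int j + 1) * (br ?J * (br ?I * H i (Suc j) (Suc b) c))"
    unfolding 3 4 antidiag_la_shift antidiag_mu_shift antidiag_lin
  proof (rule antidiag_cong')
    fix la mu assume b: "b = la + mu"
    have p: "q powi (?J - int la) = q * q ^ j / q ^ la" "q powi (?I - int mu) = q * q ^ i / q ^ mu"
      "q powi (?J - c) = q * q ^ j / q powi c" "q powi (?I + int (Suc la) + int mu) = q * q ^ i * (q ^ la * q) * q ^ mu"
      "q powi (?J - int (Suc la)) = q ^ j / q ^ la"
      "q powi (?I + int la - int (Suc mu)) = q * q ^ i * q ^ la / (q ^ mu * q)"
      "q powi (k + 1) = q ^ la * q ^ mu * q powi c / q ^ j * q"
      "q powi (2 * int mu + 1 - k) = q ^ mu * q ^ mu * q / (q ^ la * q ^ mu * q powi c / q ^ j)"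
      by (simp_all add: k_def b q_powi_simps power2_eq_square)
    show "q ^ i * q powi (?J - c) * (1 - (q powi (?J - int la))\<^sup>2) * (1 - (q powi (?I - int mu))\<^sup>2) * ?t la mu
      = - (- (q powi (?I + int (Suc la) + int mu) * (q powi (?J - int (Suc la)))\<^sup>2 * (1 - (q powi (?I - int mu))\<^sup>2))
            * q powi (k + 1) * (1 - (q powi (?J - int la))\<^sup>2) * ?t la mu)
       + q powi (?I + int la - int (Suc mu)) * (1 - (q powi (?J - int la))\<^sup>2)
            * q powi (2 * int mu + 1 - k) * (1 - (q powi (?I - int mu))\<^sup>2) * (1 - (q powi c * q ^ mu * q)\<^sup>2) * ?t la mu"
      unfolding p by (rule coef_b_down) simp_all
  qed
  then have "br ?I * br ?J * H i j b c = br ?I * br ?J * (H (Suc i) j (Suc b) c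
      - q powi (int i + int b + c - int j + 1) * H i (Suc j) (Suc b) c)"
    by (simp only: right_diff_distrib mult_ac)
  then show ?thesis using x by simp
qed

text \<open>
  All terms are sums over the same antidiagonal here. The difference of the two sides splits
  into two sums, which cancel each other after summation by parts.
\<close>

lemma H_a_down: "q ^ b * H i j b c = q powi (int b + c - int j) * H (Suc i) j b c
    + q ^ i * br (int b + c - int j) * H i (Suc j) b c"
proof -
  define k where "k = int b + c - int j - 1"
  let ?I = "int (Suc i)" and ?J = "int (Suc j)"
  have x: "br ?I * br ?J \<noteq> 0" by (simp add: br_eq0_iff)
  let ?t = "trm (Suc i) (Suc j) c k"
  have e: "int b + c - ?J + 1 = k + 1" "int b + c - ?J = k" by (simp_all add: k_def)
  have e': "int b + c - int j = k + 1" by (simp add: k_def)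
  have 1: "br ?J * H (Suc i) j b c = antidiag b (\<lambda>la mu. q ^ Suc i * (1 - (q powi (?J - int la))\<^sup>2)
      * trm (Suc i) (Suc j) c (k + 1) la mu)"
    using br_H_j_down[of "Suc j" "Suc i" b c] unfolding e by simp
  have 2: "br ?I * H i (Suc j) b c = antidiag b (\<lambda>la mu. q powi (?J - c) * (1 - (q powi (?I - int mu))\<^sup>2) * ?t la mu)"
    using br_H_i_down[of "Suc i" "Suc j" b c] unfolding e by simp
  have 3: "br ?I * (br ?J * H i j b c) = antidiag b (\<lambda>la mu. q ^ i * q powi (?J - c) * (1 - (q powi (?J - int la))\<^sup>2)
        * (1 - (q powi (?I - int mu))\<^sup>2) * trm (Suc i) (Suc j) c (k + 1) la mu)"
    using br_H_ij_down[of "Suc i" "Suc j" b c] unfolding e by simp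
  let ?f = "\<lambda>la mu. - (q powi (int i + ?J - c) * (1 - (q powi (?I - int mu))\<^sup>2) * (1 - (q powi (c + 1 + int mu))\<^sup>2)) * (1 - (q ^ la)\<^sup>2) * ?t la mu"
  let ?g = "\<lambda>la mu. - (q powi (int i + ?J - c) * (q powi (c - int j + int la))\<^sup>2 * (1 - (q powi (?J - int la))\<^sup>2)) * (1 - (q ^ mu)\<^sup>2) * ?t la mu"
  have "q ^ b * (br ?I * (br ?J * H i j b c)) - q powi (k + 1) * (br ?I * (br ?J * H (Suc i) j b c))
      - q ^ i * br (k + 1) * (br ?J * (br ?I * H i (Suc j) b c))
    = antidiag b ?f + antidiag b ?g"
    unfolding 1 2 3 trm_k[of _ _ _ "k + 1" _ _ k] antidiag_lin
  proof (rule antidiag_cong')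
    fix la mu assume b: "b = la + mu"
    have p: "q ^ Suc i = q * q ^ i" "q ^ b = q ^ la * q ^ mu" "q powi (?J - int la) = q * q ^ j / q ^ la" "q powi (?I - int mu) = q * q ^ i / q ^ mu"
      "q powi ((k + 1 - k) * (int la - int mu)) = q ^ la / q ^ mu" "q powi ?I = q * q ^ i" "q powi ?J = q * q ^ j"
      "q powi (?J - c) = q * q ^ j / q powi c" "q powi (int i + ?J - c) = q ^ i * q * q ^ j / q powi c"
      "q powi (k + 1) = q ^ la * q ^ mu * q powi c / q ^ j" "q powi (c + 1 + int mu) = q powi c * q * q ^ mu"
      "q powi (c - int j + int la) = q powi c / q ^ j * q ^ la"
      by (simp_all add: k_def b q_powi_simps)
    show "q ^ b * (q ^ i * q powi (?J - c) * (1 - (q powi (?J - int la))\<^sup>2) * (1 - (q powi (?I - int mu))\<^sup>2)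
          * (q powi ((k + 1 - k) * (int la - int mu)) * ?t la mu))
       - q powi (k + 1) * (br ?I * (q ^ Suc i * (1 - (q powi (?J - int la))\<^sup>2)
          * (q powi ((k + 1 - k) * (int la - int mu)) * ?t la mu)))
       - q ^ i * br (k + 1) * (br ?J * (q powi (?J - c) * (1 - (q powi (?I - int mu))\<^sup>2) * ?t la mu))
       = ?f la mu + ?g la mu"
      unfolding br_def p by (rule coef_a_down_split) simp_all
  qed
  also have "\<dots> = 0"
  proof (cases b)
    case (Suc b')
    show ?thesis unfolding Suc antidiag_la_shift antidiag_mu_shift antidiag_lin
      unfolding antidiag_def
    proof (intro sum.neutral ballI)
      fix mu assume "mu \<in> {..b'}"
      then have "int b = int (b' - mu) + int mu + 1" using Suc by simp
      then have k: "k = int (b' - mu) + int mu + c - int j" unfolding k_def by linarith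
      show "- (- (q powi (int i + ?J - c) * (1 - (q powi (?I - int mu))\<^sup>2) * (1 - (q powi (c + 1 + int mu))\<^sup>2)) *
            q powi (k + 1) * (1 - (q powi (?J - int (b' - mu)))\<^sup>2) * ?t (b' - mu) mu) +
         - (q powi (int i + ?J - c) * (q powi (c - int j + int (b' - mu)))\<^sup>2 * (1 - (q powi (?J - int (b' - mu)))\<^sup>2)) *
         q powi (2 * int mu + 1 - k) * (1 - (q powi (?I - int mu))\<^sup>2) * (1 - (q powi c * q ^ mu * q)\<^sup>2) * ?t (b' - mu) mu = 0"
        proof -
        let ?la = "b' - mu"
        have p: "q powi (c + 1 + int mu) = q powi c * q ^ mu * q"
          by (simp add: q_powi_simps)
        have "q powi (c - int j + int ?la) * q powi (c - int j + int ?la) * q powi (2 * int mu + 1 - k) = q powi (k + 1)"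
          unfolding q_powi_add[symmetric] k by (rule arg_cong[of _ _ "(powi) q"]) simp
        then have p': "(q powi (c - int j + int ?la))\<^sup>2 * q powi (2 * int mu + 1 - k) = q powi (k + 1)"
          by (simp add: power2_eq_square)
        show ?thesis unfolding p p'[symmetric] by (simp add: mult_ac)
      qed
    qed
  qed simp
  finally have "br ?I * br ?J * (q ^ b * H i j b c) = br ?I * br ?J * (q powi (k + 1) * H (Suc i) j b c
      + q ^ i * br (k + 1) * H i (Suc j) b c)"
    by (simp only: distrib_left diff_diff_eq right_minus_eq mult_ac)
  then show ?thesis using x unfolding e' by simp
qed

lemma H_i_down: "q powi (int i + int j - int b - 1) * br (int b + 1) * H i j (Suc b) (c - 1)
     + q powi c * br (int i + int j - int b) * H i j b c = q ^ j * (br (int i) * H (i - 1) j b c)"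
proof -
  define k where "k = int b + c - int j"
  have e: "int (Suc b) + (c - 1) - int j = k" "int b + c - int j = k" by (simp_all add: k_def)
  have 1: "q ^ i * (br (int b + 1) * H i j (Suc b) (c - 1))
    = antidiag (Suc b) (\<lambda>la mu. q ^ i * br (int b + 1) * trm i j (c - 1) k la mu)"
    unfolding H_def e antidiag_mult by (rule antidiag_cong) (simp only: mult_ac)
  have 2: "antidiag (Suc b) (\<lambda>la mu. br (int b + 1) * trm i j c k la mu)
     = antidiag (Suc b) (\<lambda>la mu. (q ^ la)\<^sup>2 * (1 - (q ^ mu)\<^sup>2) * trm i j c k la mu)
     + antidiag (Suc b) (\<lambda>la mu. 1 * (1 - (q ^ la)\<^sup>2) * trm i j c k la mu)"
    unfolding antidiag_lin
  proof (rule antidiag_cong)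
    fix la mu assume "la + mu = Suc b"
    then have "int b + 1 = int la + int mu" by simp
    then show "br (int b + 1) * trm i j c k la mu
      = (q ^ la)\<^sup>2 * (1 - (q ^ mu)\<^sup>2) * trm i j c k la mu + 1 * (1 - (q ^ la)\<^sup>2) * trm i j c k la mu"
      by (simp add: br_def q_powi_simps algebra_simps)
  qed
  have "q powi (int i + int j - int b - 1) * (q ^ i * (br (int b + 1) * H i j (Suc b) (c - 1)))
     + q ^ i * (q powi c * br (int i + int j - int b) * H i j b c) = q ^ i * (q ^ j * (br (int i) * H (i - 1) j b c))"
    unfolding 1 antidiag_c_down 2 antidiag_la_shift antidiag_mu_shift br_H_i_down
    unfolding H_def e antidiag_lin
    by (rule antidiag_cong') (simp add: br_def k_def q_powi_simps field_simps power2_eq_square)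
  then have "q ^ i * (q powi (int i + int j - int b - 1) * br (int b + 1) * H i j (Suc b) (c - 1)
     + q powi c * br (int i + int j - int b) * H i j b c) = q ^ i * (q ^ j * (br (int i) * H (i - 1) j b c))"
    by (simp only: distrib_left mult_ac)
  then show ?thesis by simp
qed

lemma H_j_down: "br c * br (int i + int j - int b) * H i j b c
     - q powi (c + int i + int j - int b - 1) * br (int b + 1) * H i j (Suc b) (c - 1)
    = br (int j) * H i (j - 1) b (c - 1)"
proof -
  define k where "k = int b + c - int j"
  have e: "int (Suc b) + (c - 1) - int j = k" "int b + c - int j = k" "int b + (c - 1) - int j + 1 = k"
    by (simp_all add: k_def)
  have 1: "br (int b + 1) * H i j (Suc b) (c - 1)
     = antidiag (Suc b) (\<lambda>la mu. 1 * (1 - (q ^ mu)\<^sup>2) * trm i j (c - 1) k la mu)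
     + antidiag (Suc b) (\<lambda>la mu. (q ^ mu)\<^sup>2 * (1 - (q ^ la)\<^sup>2) * trm i j (c - 1) k la mu)"
    unfolding H_def e antidiag_lin
  proof (rule antidiag_cong)
    fix la mu assume "la + mu = Suc b"
    then have "int b + 1 = int la + int mu" by simp
    then show "br (int b + 1) * trm i j (c - 1) k la mu
      = 1 * (1 - (q ^ mu)\<^sup>2) * trm i j (c - 1) k la mu + (q ^ mu)\<^sup>2 * (1 - (q ^ la)\<^sup>2) * trm i j (c - 1) k la mu"
      by (simp add: br_def q_powi_simps algebra_simps)
  qed
  have 2: "br c * H i j b c = antidiag b (\<lambda>la mu. q ^ i * (1 - (q powi (c - 1) * q ^ mu * q)\<^sup>2) * trm i j (c - 1) k la mu)"
    unfolding H_def e antidiag_mult using trm_c_up[of "c - 1"] by (simp add: br_def)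
  have "br (int i + int j - int b) * (br c * H i j b c)
     - q powi (c + int i + int j - int b - 1) * (br (int b + 1) * H i j (Suc b) (c - 1))
    = br (int j) * H i (j - 1) b (c - 1)"
    unfolding 1 2 antidiag_la_shift antidiag_mu_shift br_H_j_down e antidiag_lin
    by (rule antidiag_cong') (simp add: br_def k_def q_powi_simps field_simps power2_eq_square)
  then show ?thesis by (simp only: mult_ac)
qed

section \<open>Relations at one site\<close>

text \<open>
  The parameter \<open>q\<^sub>i\<close> of a site with \<open>\<epsilon>\<^sub>i = e\<close>,
  in the field of coefficients.
\<close>

definition tq :: "nat \<Rightarrow> kq" where "tq e = (if e = 0 then q else - inverse q)"

definition allowed :: "nat \<Rightarrow> int \<Rightarrow> bool" where "allowed e m \<longleftrightarrow> 0 \<le> m \<and> (e = 0 \<or> m \<le> 1)"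

definition qn :: "int \<Rightarrow> kq" where "qn m = (q powi m - q powi (- m)) / (q - inverse q)"

text \<open>
  The matrix element \<open>S3\<close> with integer indices. It vanishes as soon as an outer
  index is out of range, while the auxiliary indices \<open>c\<close> and \<open>k\<close> are
  arbitrary integers. Thus shifted indices never need a case distinction in the relations below.
\<close>

definition S3Z :: "nat \<Rightarrow> int \<Rightarrow> int \<Rightarrow> int \<Rightarrow> int \<Rightarrow> int \<Rightarrow> int \<Rightarrow> kq" where
  "S3Z e a b c i j k =
    (if allowed e a \<and> allowed e b \<and> allowed e i \<and> allowed e j \<and> a + b = i + j \<and> b + c = j + k then
       if e = 0 then H (nat i) (nat j) (nat b) c
       else if a = i then (if i = j then 1 else if i = 0 then - (q powi (k + 1)) else q powi k)
       else if i = 1 then br k else 1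
     else 0)"

lemma tq_neq0 [simp]: "tq e \<noteq> 0"
  by (simp add: tq_def)

lemma q_minus_inv_neq0: "q - inverse q \<noteq> 0"
proof
  assume "q - inverse q = 0"
  then have "q * q = 1" using q_neq0 by (metis eq_iff_diff_eq_0 right_inverse)
  then show False using q_power_neq1[of 2] by (simp add: power2_eq_square)
qed

definition kap :: kq where "kap = - inverse (q - inverse q)"

lemma qn_br: "qn m = kap * (br m / q powi m)"
proof -
  have "q powi m - q powi (- m) = - (br m / q powi m)"
    unfolding br_def power_int_minus using q_powi_neq0[of m]
    by (simp add: field_simps power2_eq_square)
  then show ?thesis unfolding qn_def kap_def by (simp add: divide_inverse)
qed

lemma qn_0 [simp]: "qn 0 = 0" by (simp add: qn_def)
lemma qn_1 [simp]: "qn 1 = 1" using q_minus_inv_neq0 by (simp add: qn_def)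

lemma tq_0 [simp]: "tq 0 = q" by (simp add: tq_def)

lemma S3Z_boson: "S3Z 0 a b c i j k = (if 0 \<le> b \<and> 0 \<le> i \<and> 0 \<le> j \<and> a + b = i + j \<and> b + c = j + k
    then H (nat i) (nat j) (nat b) c else 0)"
proof (cases "0 \<le> b \<and> 0 \<le> i \<and> 0 \<le> j \<and> a + b = i + j \<and> b + c = j + k \<and> a < 0")
  case True
  then have "H (nat i) (nat j) (nat b) c = 0" by (intro H_above) linarith
  then show ?thesis by (simp add: S3Z_def allowed_def)
next
  case False
  then show ?thesis by (auto simp: S3Z_def allowed_def)
qed

lemma S3Z_outside: "\<not> (a + b = i + j \<and> b + c = j + k) \<Longrightarrow> S3Z e a b c i j k = 0"
  by (auto simp: S3Z_def)

lemma allowed_fermi: "e \<noteq> 0 \<Longrightarrow> allowed e m \<longleftrightarrow> m = 0 \<or> m = 1"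
  by (auto simp: allowed_def)

context
  fixes e :: nat and a b c i j k :: int
  assumes r: "allowed e a" "allowed e b" "allowed e i" "allowed e j"
begin

lemma r_nat: assumes "e = 0"
  obtains A B I J where "a = int A" "b = int B" "i = int I" "j = int J"
  using r assms unfolding allowed_def by (metis nonneg_int_cases)

text \<open>
  The eight relations for a single site, uniform in the kind of the site. At a bosonic site they are the
  contiguity relations for \<open>H\<close>; at a fermionic site there are finitely many cases.
\<close>

lemma S3Z_j_up: "S3Z e a b c i (j + 1) k = S3Z e (a - 1) b (c - 1) i j k
    - q * tq e powi a * q powi c * S3Z e a (b - 1) c i j k"
proof (cases "a + b = i + j + 1 \<and> b + c = j + 1 + k")
  case True
  show ?thesis
  proof (cases "e = 0")
    case e: True
    then obtain A B I J where n: "a = int A" "b = int B" "i = int I" "j = int J" by (rule r_nat)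
    show ?thesis
    proof (cases B)
      case 0
      then show ?thesis using True H_j_up_0[of I J c] by (simp add: e n S3Z_boson nat_add_distrib)
    next
      case (Suc B')
      have "q powi (int I + int J - int B' + c + 1) = q * q powi (int A) * q powi c"
      proof -
        have "int I + int J - int B' + c + 1 = 1 + int A + c" using True Suc by (simp add: n)
        then show ?thesis by (simp only: q_powi_add power_int_1_right)
      qed
      then show ?thesis using True H_j_up[of I J B' c] Suc
        by (simp add: e n S3Z_boson nat_add_distrib)
    qed
  next
    case e: False
    from True have c: "c = j + 1 + k - b" and a: "a = i + j + 1 - b" by auto
    show ?thesis using r e unfolding allowed_fermi[OF e]
      unfolding c S3Z_def allowed_fermi[OF e] a
      by (elim disjE) (simp_all add: tq_def br_def q_powi_simps field_simps power2_eq_square)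
  qed
next
  case False
  then show ?thesis by (subst (1 2 3) S3Z_outside) auto
qed

lemma S3Z_i_up: "tq e powi j * S3Z e a b c (i + 1) j k = q powi c * S3Z e (a - 1) b c i j k
    + tq e powi a * br (c + 1) * S3Z e a (b - 1) (c + 1) i j k"
proof (cases "a + b = i + 1 + j \<and> b + c = j + k")
  case True
  show ?thesis
  proof (cases "e = 0")
    case e: True
    then obtain A B I J where n: "a = int A" "b = int B" "i = int I" "j = int J" by (rule r_nat)
    show ?thesis
    proof (cases B)
      case 0
      then show ?thesis using True H_i_up_0[of J I c] by (simp add: e n S3Z_boson nat_add_distrib)
    next
      case (Suc B')
      have "int I + int J - int B' = int A" using True Suc by (simp add: n)
      then show ?thesis using True H_i_up[of J I B' c] Suc
        by (simp add: e n S3Z_boson nat_add_distrib)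
    qed
  next
    case e: False
    from True have c: "c = j + k - b" and a: "a = i + 1 + j - b" by auto
    show ?thesis using r e unfolding allowed_fermi[OF e]
      unfolding c S3Z_def allowed_fermi[OF e] a
      by (elim disjE) (simp_all add: tq_def br_def q_powi_simps field_simps power2_eq_square)
  qed
next
  case False
  then show ?thesis by (subst (1 2 3) S3Z_outside) auto
qed

lemma S3Z_a_up: "qn (a + 1) * S3Z e (a + 1) b c i j k
    = qn j * S3Z e a b c i (j - 1) (k + 1) + q powi k * tq e powi (- j) * qn i * S3Z e a b c (i - 1) j k"
proof (cases "a + 1 + b = i + j \<and> b + c = j + k")
  case True
  show ?thesis
  proof (cases "e = 0")
    case e: True
    then obtain A B I J where n: "a = int A" "b = int B" "i = int I" "j = int J" by (rule r_nat)
    have 1: "int I + int J - int B = int A + 1" "int B + c - int J = k" "c = int J + k - int B" "int A + 1 = int I + int J - int B"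
      using True by (simp_all add: n)
    have j: "qn j * S3Z e a b c i (j - 1) (k + 1) = kap / q powi j * (br (int J) * H I (J - 1) B c)"
      using True by (cases J) (simp_all add: e n S3Z_boson qn_br nat_diff_distrib')
    have i: "qn i * S3Z e a b c (i - 1) j k = kap / q powi i * (br (int I) * H (I - 1) J B c)"
      using True by (cases I) (simp_all add: e n S3Z_boson qn_br nat_diff_distrib')
    have a: "qn (a + 1) * S3Z e (a + 1) b c i j k = kap / q powi (a + 1) * (br (int I + int J - int B) * H I J B c)"
      using True by (simp add: e n S3Z_boson qn_br 1(4))
    show ?thesis unfolding mult.assoc i j a H_a_up
      unfolding distrib_left e n 1(4) using 1(3)
      by (simp add: q_powi_simps) (simp add: divide_simps mult_ac)
  next
    case e: False
    from True have c: "c = j + k - b" and a: "a = i + j - b - 1" by auto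
    show ?thesis using r e unfolding allowed_fermi[OF e]
      unfolding c S3Z_def allowed_fermi[OF e] a
      by (elim disjE) (simp_all add: tq_def br_def q_powi_simps field_simps power2_eq_square)
  qed
next
  case False
  then show ?thesis by (subst (1 2 3) S3Z_outside) auto
qed

lemma S3Z_b_up: "tq e powi (- a) * qn (b + 1) * S3Z e a (b + 1) c i j (k + 1)
    = tq e powi (- j) * br (k + 1) * qn i * S3Z e a b c (i - 1) j k
      - q powi (k + 2) * qn j * S3Z e a b c i (j - 1) (k + 1)"
proof (cases "a + 1 + b = i + j \<and> b + c = j + k")
  case True
  show ?thesis
  proof (cases "e = 0")
    case e: True
    then obtain A B I J where n: "a = int A" "b = int B" "i = int I" "j = int J" by (rule r_nat)
    have 1: "int B + c - int J = k" "int A = int I + int J - int B - 1"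
      using True by (simp_all add: n)
    have j: "qn j * S3Z e a b c i (j - 1) (k + 1) = kap / q powi j * (br (int J) * H I (J - 1) B c)"
      using True by (cases J) (simp_all add: e n S3Z_boson qn_br nat_diff_distrib')
    have i: "qn i * S3Z e a b c (i - 1) j k = kap / q powi i * (br (int I) * H (I - 1) J B c)"
      using True by (cases I) (simp_all add: e n S3Z_boson qn_br nat_diff_distrib')
    have a: "qn (b + 1) * S3Z e a (b + 1) c i j (k + 1) = kap / q powi (b + 1) * (br (int B + 1) * H I J (Suc B) c)"
      using True by (simp add: e n S3Z_boson qn_br nat_add_distrib)
    show ?thesis unfolding mult.assoc i j a H_b_up
      unfolding e n 1 right_diff_distrib
      by (simp add: q_powi_simps field_simps power2_eq_square)
  next
    case e: False
    from True have c: "c = j + k - b" and a: "a = i + j - b - 1" by auto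
    show ?thesis using r e unfolding allowed_fermi[OF e]
      unfolding c S3Z_def allowed_fermi[OF e] a
      by (elim disjE) (simp_all add: tq_def br_def q_powi_simps field_simps power2_eq_square)
  qed
next
  case False
  then show ?thesis by (subst (1 2 3) S3Z_outside) auto
qed

lemma S3Z_b_down: "S3Z e a (b - 1) c i j k = S3Z e a b c (i + 1) j (k + 1)
    - q * tq e powi i * q powi k * S3Z e a b c i (j + 1) k"
proof (cases "a + b = i + j + 1 \<and> b - 1 + c = j + k")
  case True
  show ?thesis
  proof (cases "e = 0")
    case e: True
    then obtain A B I J where n: "a = int A" "b = int B" "i = int I" "j = int J" by (rule r_nat)
    show ?thesis
    proof (cases B)
      case 0
      have "int I + c - int J = 1 + int I + k" using True 0 by (simp add: n)
      then have "q powi (int I + c - int J) = q * q ^ I * q powi k"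
        by (simp only: q_powi_add power_int_1_right power_int_of_nat)
      then show ?thesis using True H_b_down_0[of I J c] 0 by (simp add: e n S3Z_boson nat_add_distrib)
    next
      case (Suc B')
      have "int I + int B' + c - int J + 1 = 1 + int I + k" using True Suc by (simp add: n)
      then have "q powi (int I + int B' + c - int J + 1) = q * q ^ I * q powi k"
        by (simp only: q_powi_add power_int_1_right power_int_of_nat)
      then show ?thesis using True H_b_down[of I J B' c] Suc
        by (simp add: e n S3Z_boson nat_add_distrib)
    qed
  next
    case e: False
    from True have c: "c = j + 1 + k - b" and a: "a = i + j + 1 - b" by auto
    show ?thesis using r e unfolding allowed_fermi[OF e]
      unfolding c S3Z_def allowed_fermi[OF e] a
      by (elim disjE) (simp_all add: tq_def br_def q_powi_simps field_simps power2_eq_square)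
  qed
next
  case False
  then show ?thesis by (subst (1 2 3) S3Z_outside) auto
qed

lemma S3Z_a_down: "tq e powi b * S3Z e (a - 1) b c i j k = q powi k * S3Z e a b c (i + 1) j k
    + tq e powi i * br k * S3Z e a b c i (j + 1) (k - 1)"
proof (cases "a - 1 + b = i + j \<and> b + c = j + k")
  case True
  show ?thesis
  proof (cases "e = 0")
    case e: True
    then obtain A B I J where n: "a = int A" "b = int B" "i = int I" "j = int J" by (rule r_nat)
    have "int B + c - int J = k" using True by (simp add: n)
    then show ?thesis using True H_a_down[of B I J c]
      by (simp add: e n S3Z_boson nat_add_distrib)
  next
    case e: False
    from True have c: "c = j + k - b" and a: "a = i + j + 1 - b" by auto
    show ?thesis using r e unfolding allowed_fermi[OF e]
      unfolding c S3Z_def allowed_fermi[OF e] a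
      by (elim disjE) (simp_all add: tq_def br_def q_powi_simps field_simps power2_eq_square)
  qed
next
  case False
  then show ?thesis by (subst (1 2 3) S3Z_outside) auto
qed

lemma S3Z_i_down: "qn (b + 1) * S3Z e a (b + 1) (c - 1) i j k + tq e powi (- b) * q powi c * qn (a + 1) * S3Z e (a + 1) b c i j k
    = qn i * S3Z e a b c (i - 1) j k"
proof (cases "a + 1 + b = i + j \<and> b + c = j + k")
  case True
  show ?thesis
  proof (cases "e = 0")
    case e: True
    then obtain A B I J where n: "a = int A" "b = int B" "i = int I" "j = int J" by (rule r_nat)
    have 1: "int A + 1 = int I + int J - int B" using True by (simp_all add: n)
    have i: "qn i * S3Z e a b c (i - 1) j k = kap / q powi i * (br (int I) * H (I - 1) J B c)"
      using True by (cases I) (simp_all add: e n S3Z_boson qn_br nat_diff_distrib')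
    have a: "qn (a + 1) * S3Z e (a + 1) b c i j k = kap / q powi (a + 1) * (br (int I + int J - int B) * H I J B c)"
      using True by (simp add: e n S3Z_boson qn_br 1)
    have b: "qn (b + 1) * S3Z e a (b + 1) (c - 1) i j k = kap / q powi (b + 1) * (br (int B + 1) * H I J (Suc B) (c - 1))"
      using True by (simp add: e n S3Z_boson qn_br nat_add_distrib)
    have "br (int I) * H (I - 1) J B c = (q powi (int I + int J - int B - 1) * br (int B + 1) * H I J (Suc B) (c - 1)
     + q powi c * br (int I + int J - int B) * H I J B c) / q ^ J"
      unfolding H_i_down by simp
    note eq = this
    show ?thesis unfolding mult.assoc i b a eq
      unfolding e n 1 distrib_left by (simp add: q_powi_simps field_simps)
  next
    case e: False
    from True have c: "c = j + k - b" and a: "a = i + j - b - 1" by auto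
    show ?thesis using r e unfolding allowed_fermi[OF e]
      unfolding c S3Z_def allowed_fermi[OF e] a
      by (elim disjE) (simp_all add: tq_def br_def q_powi_simps field_simps power2_eq_square)
  qed
next
  case False
  then show ?thesis by (subst (1 2 3) S3Z_outside) auto
qed

lemma S3Z_j_down: "tq e powi (- b) * br c * qn (a + 1) * S3Z e (a + 1) b c i j k - q powi c * qn (b + 1) * S3Z e a (b + 1) (c - 1) i j k
    = tq e powi (- i) * qn j * S3Z e a b (c - 1) i (j - 1) k"
proof (cases "a + 1 + b = i + j \<and> b + c = j + k")
  case True
  show ?thesis
  proof (cases "e = 0")
    case e: True
    then obtain A B I J where n: "a = int A" "b = int B" "i = int I" "j = int J" by (rule r_nat)
    have 1: "int A + 1 = int I + int J - int B" using True by (simp_all add: n)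
    have j: "qn j * S3Z e a b (c - 1) i (j - 1) k = kap / q powi j * (br (int J) * H I (J - 1) B (c - 1))"
      using True by (cases J) (simp_all add: e n S3Z_boson qn_br nat_diff_distrib')
    have a: "qn (a + 1) * S3Z e (a + 1) b c i j k = kap / q powi (a + 1) * (br (int I + int J - int B) * H I J B c)"
      using True by (simp add: e n S3Z_boson qn_br 1)
    have b: "qn (b + 1) * S3Z e a (b + 1) (c - 1) i j k = kap / q powi (b + 1) * (br (int B + 1) * H I J (Suc B) (c - 1))"
      using True by (simp add: e n S3Z_boson qn_br nat_add_distrib)
    have gen: "X / B * (c' * (kk / (I * J / B) * (y * h))) - c2 * (kk / (B * x) * (z * g))
       = X / I * (kk / J * (c' * y * h - c2 * I * J / B / x * z * g))"
      if "X = 1" "I \<noteq> 0" "J \<noteq> 0" "B \<noteq> 0" "x \<noteq> 0" for X I J B c' c2 kk y h z g x :: kq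
      using that by (simp add: divide_simps) (simp add: algebra_simps)
    have p: "q powi (a + 1) = q ^ I * q ^ J / q ^ B" "q powi (int B + 1) = q ^ B * q" "q powi - int B = 1 / q ^ B"
      "q powi - int I = 1 / q ^ I" "q powi int J = q ^ J"
      "q powi (c + int I + int J - int B - 1) = q powi c * q ^ I * q ^ J / q ^ B / q"
      by (simp_all add: n 1 q_powi_simps divide_inverse)
    show ?thesis unfolding mult.assoc j b a
      unfolding H_j_down[of c I J B, symmetric] e n(2-4) tq_0 p
      by (rule gen) simp_all
  next
    case e: False
    from True have c: "c = j + k - b" and a: "a = i + j - b - 1" by auto
    show ?thesis using r e unfolding allowed_fermi[OF e]
      unfolding c S3Z_def allowed_fermi[OF e] a
      by (elim disjE) (simp_all add: tq_def br_def q_powi_simps field_simps power2_eq_square)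
  qed
next
  case False
  then show ?thesis by (subst (1 2 3) S3Z_outside) auto
qed

end

lemma qprod_vanish: "c < 0 \<Longrightarrow> 0 \<le> c + int m \<Longrightarrow> qprod c m = 0"
  unfolding qprod_def by (rule prod_zero) (auto intro!: bexI[of _ "nat (- c)"])

text \<open>
  No site leads from a negative auxiliary index to a nonnegative one. In a chain this rules out
  negative indices, see \<open>chain_vanish\<close>.
\<close>

lemma S3Z_vanish:
  assumes "c < 0" "0 \<le> k"
  shows "S3Z e a b c i j k = 0"
proof (cases "allowed e a \<and> allowed e b \<and> allowed e i \<and> allowed e j \<and> a + b = i + j \<and> b + c = j + k")
  case True
  show ?thesis
  proof (cases "e = 0")
    case e: True
    have "H (nat i) (nat j) (nat b) c = 0" unfolding H_def antidiag_def trm_def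
    proof (intro sum.neutral ballI)
      fix mu assume "mu \<in> {..nat b}"
      then have "nat j < nat b - mu \<or> 0 \<le> c + int mu"
        using True assms by (auto simp: allowed_def)
      then have "qbinom2 (nat j) (nat b - mu) = 0 \<or> qprod c mu = 0"
        using assms qprod_vanish by auto
      then show "(- 1) ^ (nat b - mu) * q powi (int (nat i) * (c - int (nat j)) + (int (nat b) + c - int (nat j) + 1) * int (nat b - mu) +
          int mu * (int mu - (int (nat b) + c - int (nat j)))) * qprod c mu * qbinom2 (nat i) mu * qbinom2 (nat j) (nat b - mu) = 0"
        by auto
    qed
    then show ?thesis by (simp add: S3Z_def e)
  next
    case e: False
    have "br k = 0" if "a \<noteq> i" "i = 1"
    proof -
      have "b = j + 1" using True that by (auto simp: allowed_fermi[OF e])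
      then have "k = 0" using True e assms by (auto simp: allowed_fermi[OF e])
      then show ?thesis by simp
    qed
    moreover have "c = k \<or> c = k + 1 \<or> (a \<noteq> i \<and> i = 1)" using True by (auto simp: allowed_fermi[OF e])
    ultimately show ?thesis using assms e True by (auto simp: S3Z_def allowed_fermi[OF e])
  qed
qed (auto simp: S3Z_def)

lemma qprod_qpoch: "qprod (int c) m = qpoch (q\<^sup>2) (q\<^sup>2) (c + m) / qpoch (q\<^sup>2) (q\<^sup>2) c"
proof (induction m)
  case (Suc m)
  then show ?case by (simp add: qprod_Suc qpoch2_Suc power_add mult_ac)
qed simp

lemma S3_S3Z:
  assumes "e \<le> 1"
  shows "S3 e a b c i j k = S3Z e (int a) (int b) (int c) (int i) (int j) (int k)"
proof (cases "e = 0")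
  case True
  have "S3R a b c i j k = H i j b (int c)" if "a + b = i + j" "b + c = j + k"
  proof -
    have k: "int b + int c - int j = int k" using that by simp
    have "(\<Sum>(la, mu)\<in>{(la, mu). la + mu = b}. (-1) ^ la
        * q powi (int i * (int c - int j) + (int k + 1) * int la + int mu * (int mu - int k))
        * (qpoch (q^2) (q^2) (c + mu) / qpoch (q^2) (q^2) c) * qbinom2 i mu * qbinom2 j la)
      = (\<Sum>mu\<le>b. trm i j (int c) (int k) (b - mu) mu)"
      unfolding trm_def qprod_qpoch
      by (rule sum.reindex_bij_witness[of _ "\<lambda>mu. (b - mu, mu)" snd]) auto
    then show ?thesis using that by (simp add: S3R_def H_def antidiag_def k)
  qed
  moreover have "S3R a b c i j k = 0" if "\<not> (a + b = i + j \<and> b + c = j + k)"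
    using that by (auto simp: S3R_def)
  ultimately show ?thesis using True by (auto simp: S3_def S3Z_boson)
next
  case False
  then have e: "e \<noteq> 0" by simp
  show ?thesis
  proof (cases "a \<le> 1 \<and> b \<le> 1 \<and> i \<le> 1 \<and> j \<le> 1")
    case True
    then have "a = 0 \<or> a = 1" "b = 0 \<or> b = 1" "i = 0 \<or> i = 1" "j = 0 \<or> j = 1" by auto
    moreover have "q powi (int k + 1) = q * q ^ k" by (simp add: q_powi_simps)
    ultimately show ?thesis using e
      by (elim disjE) (auto simp: S3_def S3L_def S3Z_def allowed_def br_def power_mult power_mult_distrib mult.commute
         simp flip: power_mult)
  next
    case False
    then show ?thesis using e by (auto simp: S3_def S3L_def S3Z_def allowed_def)
  qed
qed

section \<open>Products along a chain of sites\<close>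

text \<open>
  The site \<open>k\<close> carries the auxiliary indices of the links \<open>L k\<close> and
  \<open>R k\<close>. The closed and the open chain differ only in \<open>R\<close>.
\<close>

definition chain :: "nat set \<Rightarrow> (nat \<Rightarrow> nat) \<Rightarrow> (nat \<Rightarrow> nat) \<Rightarrow> (nat \<Rightarrow> nat)
    \<Rightarrow> (nat \<Rightarrow> int) \<Rightarrow> (nat \<Rightarrow> int) \<Rightarrow> (nat \<Rightarrow> int) \<Rightarrow> (nat \<Rightarrow> int) \<Rightarrow> (nat \<Rightarrow> int) \<Rightarrow> kq" where
  "chain X L R eps a b i j C = (\<Prod>k\<in>X. S3Z (eps k) (a k) (b k) (C (L k)) (i k) (j k) (C (R k)))"

definition bump :: "nat \<Rightarrow> int \<Rightarrow> (nat \<Rightarrow> int) \<Rightarrow> (nat \<Rightarrow> int)" where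
  "bump s d f = f(s := f s + d)"

lemma bump_same [simp]: "bump s d f s = f s + d" by (simp add: bump_def)
lemma bump_other [simp]: "k \<noteq> s \<Longrightarrow> bump s d f k = f k" by (simp add: bump_def)
lemma chain_split2:
  assumes "finite X" "s \<in> X" "s' \<in> X" "s \<noteq> s'"
  shows "chain X L R eps a b i j C = S3Z (eps s) (a s) (b s) (C (L s)) (i s) (j s) (C (R s))
    * S3Z (eps s') (a s') (b s') (C (L s')) (i s') (j s') (C (R s')) * chain (X - {s, s'}) L R eps a b i j C"
proof -
  have "X = insert s (insert s' (X - {s, s'}))" using assms by auto
  then have "chain X L R eps a b i j C = chain (insert s (insert s' (X - {s, s'}))) L R eps a b i j C" by simp
  also have "\<dots> = S3Z (eps s) (a s) (b s) (C (L s)) (i s) (j s) (C (R s))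
    * S3Z (eps s') (a s') (b s') (C (L s')) (i s') (j s') (C (R s')) * chain (X - {s, s'}) L R eps a b i j C"
    unfolding chain_def using assms by (simp add: mult.assoc)
  finally show ?thesis .
qed

lemma chain_split1:
  assumes "finite X" "s \<in> X"
  shows "chain X L R eps a b i j C = S3Z (eps s) (a s) (b s) (C (L s)) (i s) (j s) (C (R s))
    * chain (X - {s}) L R eps a b i j C"
  unfolding chain_def using assms by (simp add: prod.remove)

lemma chain_cong:
  assumes "\<And>k. k \<in> X \<Longrightarrow> a k = a' k \<and> b k = b' k \<and> i k = i' k \<and> j k = j' k
     \<and> C (L k) = C' (L k) \<and> C (R k) = C' (R k)"
  shows "chain X L R eps a b i j C = chain X L R eps a' b' i' j' C'"
  unfolding chain_def by (rule prod.cong) (auto simp: assms)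

section \<open>Two neighbouring sites\<close>

text \<open>The sites \<open>s\<close> and \<open>s'\<close> share the link \<open>p\<close>, which no other site touches.\<close>

locale pair_sites =
  fixes X :: "nat set" and L R :: "nat \<Rightarrow> nat" and eps :: "nat \<Rightarrow> nat" and s s' p :: nat
  assumes fin: "finite X" and s: "s \<in> X" and s': "s' \<in> X" and ne: "s \<noteq> s'"
    and Rs: "R s = p" and Ls': "L s' = p"
    and L: "\<And>k. k \<in> X \<Longrightarrow> k \<noteq> s' \<Longrightarrow> L k \<noteq> p" and R: "\<And>k. k \<in> X \<Longrightarrow> k \<noteq> s \<Longrightarrow> R k \<noteq> p"
begin

abbreviation "G \<equiv> chain X L R eps"
abbreviation t where "t k \<equiv> tq (eps k)"
abbreviation up where "up f \<equiv> bump s' 1 (bump s (-1) f)"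
abbreviation dn where "dn f \<equiv> bump s' (-1) (bump s 1 f)"

lemma links: "L s \<noteq> p" "R s' \<noteq> p" "p \<noteq> L s" "p \<noteq> R s'"
  using L[OF s] R[OF s'] ne by auto

lemma G_local:
  assumes "\<And>k. k \<noteq> s \<Longrightarrow> k \<noteq> s' \<Longrightarrow> a' k = a k \<and> b' k = b k \<and> i' k = i k \<and> j' k = j k"
    and "\<And>k. k \<noteq> p \<Longrightarrow> C' k = C k"
  shows "G a' b' i' j' C' = S3Z (eps s) (a' s) (b' s) (C (L s)) (i' s) (j' s) (C' p)
    * S3Z (eps s') (a' s') (b' s') (C' p) (i' s') (j' s') (C (R s')) * chain (X - {s, s'}) L R eps a b i j C"
proof -
  have "chain (X - {s, s'}) L R eps a' b' i' j' C' = chain (X - {s, s'}) L R eps a b i j C"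
    by (rule chain_cong) (use assms L R in auto)
  then show ?thesis using chain_split2[OF fin s s' ne, of L R eps a' b' i' j' C'] assms(2) links Rs Ls'
    by simp
qed

text \<open>
  Write \<open>X\<close> and \<open>Y\<close> for the two elements at \<open>s'\<close> on the
  left-hand side. On the right-hand side \<open>S3Z_j_up\<close> and \<open>S3Z_i_up\<close>
  express the elements at \<open>s'\<close> by \<open>X\<close> and \<open>Y\<close>; on the
  left-hand side \<open>S3Z_a_up\<close> and \<open>S3Z_b_up\<close> express the elements at
  \<open>s\<close> by those on the right-hand side. The mixed products agree.
\<close>

lemma pair_e:
  assumes r: "allowed (eps s) (a s)" "allowed (eps s) (b s)" "allowed (eps s) (i s)" "allowed (eps s) (j s)"
   "allowed (eps s') (a s')" "allowed (eps s') (b s')" "allowed (eps s') (i s')" "allowed (eps s') (j s')"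
  shows "qn (a s + 1) * G (dn a) b i j C
     + t s powi (- a s) * t s' powi (a s') * qn (b s + 1) * G a (dn b) i j (bump p 1 C)
   = qn (j s) * G a b i (up j) (bump p 1 C)
     + t s powi (- j s) * t s' powi (j s') * qn (i s) * G a b (up i) j C"
proof -
  let ?r = "chain (X - {s, s'}) L R eps a b i j C"
  let ?c0 = "C (L s)" and ?c1 = "C p" and ?c2 = "C (R s')"
  let ?S = "S3Z (eps s)" and ?S' = "S3Z (eps s')"
  let ?X = "?S' (a s' - 1) (b s') ?c1 (i s') (j s') ?c2"
  let ?Y = "?S' (a s') (b s' - 1) (?c1 + 1) (i s') (j s') ?c2"
  have 1: "G (dn a) b i j C = ?S (a s + 1) (b s) ?c0 (i s) (j s) ?c1 * ?X * ?r"
    using G_local[where a = a and b = b and i = i and j = j and C = C] ne by simp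
  have 2: "G a (dn b) i j (bump p 1 C) = ?S (a s) (b s + 1) ?c0 (i s) (j s) (?c1 + 1) * ?Y * ?r"
    using G_local[where a = a and b = b and i = i and j = j and C = C] ne by simp
  have 3: "G a b i (up j) (bump p 1 C) = ?S (a s) (b s) ?c0 (i s) (j s - 1) (?c1 + 1)
      * (?X - q * t s' powi (a s') * q powi (?c1 + 1) * ?Y) * ?r"
    using G_local[where a = a and b = b and i = i and j = j and C = C] ne S3Z_j_up[OF r(5-8), of "?c1 + 1" "?c2"] by simp
  have 4: "t s' powi (j s') * G a b (up i) j C = ?S (a s) (b s) ?c0 (i s - 1) (j s) ?c1
      * (q powi ?c1 * ?X + t s' powi (a s') * br (?c1 + 1) * ?Y) * ?r"
    using G_local[where a = a and b = b and i = i and j = j and C = C] ne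
    unfolding S3Z_i_up[OF r(5-8), of "?c1" "?c2", symmetric] by simp
  have q1: "qn (a s + 1) * ?S (a s + 1) (b s) ?c0 (i s) (j s) ?c1 = 
     qn (j s) * ?S (a s) (b s) ?c0 (i s) (j s - 1) (?c1 + 1)
     + q powi ?c1 * t s powi (- j s) * qn (i s) * ?S (a s) (b s) ?c0 (i s - 1) (j s) ?c1"
    by (rule S3Z_a_up[OF r(1-4)])
  have q2: "t s powi (- a s) * qn (b s + 1) * ?S (a s) (b s + 1) ?c0 (i s) (j s) (?c1 + 1) = 
     t s powi (- j s) * br (?c1 + 1) * qn (i s) * ?S (a s) (b s) ?c0 (i s - 1) (j s) ?c1
     - q powi (?c1 + 2) * qn (j s) * ?S (a s) (b s) ?c0 (i s) (j s - 1) (?c1 + 1)"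
    by (rule S3Z_b_up[OF r(1-4)])
  have e: "q powi (?c1 + 2) = q * q powi (?c1 + 1)"
    using q_powi_add[of 1 "?c1 + 1"] by (simp add: add_ac)
  have "qn (a s + 1) * G (dn a) b i j C
     + t s powi (- a s) * t s' powi (a s') * qn (b s + 1) * G a (dn b) i j (bump p 1 C)
    = (qn (a s + 1) * ?S (a s + 1) (b s) ?c0 (i s) (j s) ?c1) * ?X * ?r
     + t s' powi (a s') * (t s powi (- a s) * qn (b s + 1) * ?S (a s) (b s + 1) ?c0 (i s) (j s) (?c1 + 1)) * ?Y * ?r"
    unfolding 1 2 by (simp only: mult_ac)
  also have "\<dots> = qn (j s) * G a b i (up j) (bump p 1 C)
     + t s powi (- j s) * qn (i s) * (t s' powi (j s') * G a b (up i) j C)"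
    unfolding q1 q2 3 4 e by (simp add: algebra_simps)
  finally show ?thesis by (simp only: mult_ac)
qed

text \<open>
  As for \<open>pair_e\<close> with the two sites exchanged: the elements at \<open>s\<close> on
  the left-hand side are expanded by \<open>S3Z_b_down\<close> and \<open>S3Z_a_down\<close>,
  those at \<open>s'\<close> on the right-hand side by \<open>S3Z_i_down\<close> and
  \<open>S3Z_j_down\<close>.
\<close>

lemma pair_f:
  assumes r: "allowed (eps s) (a s)" "allowed (eps s) (b s)" "allowed (eps s) (i s)" "allowed (eps s) (j s)"
   "allowed (eps s') (a s')" "allowed (eps s') (b s')" "allowed (eps s') (i s')" "allowed (eps s') (j s')"
  shows "qn (b s' + 1) * G a (up b) i j (bump p (-1) C)
     + t s powi (b s) * t s' powi (- b s') * qn (a s' + 1) * G (up a) b i j C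
   = qn (i s') * G a b (dn i) j C
     + t s powi (i s) * t s' powi (- i s') * qn (j s') * G a b i (dn j) (bump p (-1) C)"
proof -
  let ?r = "chain (X - {s, s'}) L R eps a b i j C"
  let ?c0 = "C (L s)" and ?c1 = "C p" and ?c2 = "C (R s')"
  let ?S = "S3Z (eps s)" and ?S' = "S3Z (eps s')"
  let ?X = "?S (a s) (b s) ?c0 (i s + 1) (j s) ?c1"
  let ?Y = "?S (a s) (b s) ?c0 (i s) (j s + 1) (?c1 - 1)"
  have e: "q powi ?c1 = q * q powi (?c1 - 1)"
    using q_powi_add[of 1 "?c1 - 1"] by (simp add: add_ac)
  have 1: "G a (up b) i j (bump p (-1) C) = (?X - q powi ?c1 * t s powi (i s) * ?Y)
      * ?S' (a s') (b s' + 1) (?c1 - 1) (i s') (j s') ?c2 * ?r"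
    using G_local[where a = a and b = b and i = i and j = j and C = C] ne S3Z_b_down[OF r(1-4), of "?c0" "?c1 - 1"]
    by (simp add: e)
  have 2: "t s powi (b s) * G (up a) b i j C = (q powi ?c1 * ?X + t s powi (i s) * br ?c1 * ?Y)
      * ?S' (a s' + 1) (b s') ?c1 (i s') (j s') ?c2 * ?r"
    using G_local[where a = a and b = b and i = i and j = j and C = C] ne
    unfolding S3Z_a_down[OF r(1-4), of "?c0" "?c1", symmetric] by simp
  have 3: "G a b (dn i) j C = ?X * ?S' (a s') (b s') ?c1 (i s' - 1) (j s') ?c2 * ?r"
    using G_local[where a = a and b = b and i = i and j = j and C = C] ne by simp
  have 4: "G a b i (dn j) (bump p (-1) C) = ?Y * ?S' (a s') (b s') (?c1 - 1) (i s') (j s' - 1) ?c2 * ?r"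
    using G_local[where a = a and b = b and i = i and j = j and C = C] ne by simp
  note q1 = S3Z_i_down[OF r(5-8), of "?c1" "?c2"]
  note q2 = S3Z_j_down[OF r(5-8), of "?c1" "?c2"]
  have "qn (i s') * G a b (dn i) j C
     + t s powi (i s) * t s' powi (- i s') * qn (j s') * G a b i (dn j) (bump p (-1) C)
    = ?X * (qn (i s') * ?S' (a s') (b s') ?c1 (i s' - 1) (j s') ?c2) * ?r
     + t s powi (i s) * ?Y * (t s' powi (- i s') * qn (j s') * ?S' (a s') (b s') (?c1 - 1) (i s') (j s' - 1) ?c2) * ?r"
    unfolding 3 4 by (simp only: mult_ac)
  also have "\<dots> = qn (b s' + 1) * G a (up b) i j (bump p (-1) C)
     + t s' powi (- b s') * qn (a s' + 1) * (t s powi (b s) * G (up a) b i j C)"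
    unfolding q1[symmetric] q2[symmetric] 1 2 by (simp add: algebra_simps)
  finally show ?thesis by (simp only: mult_ac)
qed

end

section \<open>One boundary site\<close>

text \<open>
  At an end of the open chain the outermost link \<open>p\<close> belongs to a single site.
  There is no partner to cancel against, so the single-site relations are only transported to
  the whole chain here and combined with the boundary weights later.
\<close>

locale left_site =
  fixes X :: "nat set" and L R :: "nat \<Rightarrow> nat" and eps :: "nat \<Rightarrow> nat" and s p :: nat
  assumes fin: "finite X" and s: "s \<in> X" and Ls: "L s = p"
    and L: "\<And>k. k \<in> X \<Longrightarrow> k \<noteq> s \<Longrightarrow> L k \<noteq> p" and R: "\<And>k. k \<in> X \<Longrightarrow> R k \<noteq> p"
begin

abbreviation "G \<equiv> chain X L R eps"
abbreviation t where "t \<equiv> tq (eps s)"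

lemma G_local:
  assumes "\<And>k. k \<noteq> s \<Longrightarrow> a' k = a k \<and> b' k = b k \<and> i' k = i k \<and> j' k = j k"
    and "\<And>k. k \<noteq> p \<Longrightarrow> C' k = C k"
  shows "G a' b' i' j' C' = S3Z (eps s) (a' s) (b' s) (C' p) (i' s) (j' s) (C (R s))
    * chain (X - {s}) L R eps a b i j C"
proof -
  have "chain (X - {s}) L R eps a' b' i' j' C' = chain (X - {s}) L R eps a b i j C"
    by (rule chain_cong) (use assms L R in auto)
  then show ?thesis using chain_split1[OF fin s, of L R eps a' b' i' j' C'] assms(2) R[OF s] Ls
    by simp
qed

context
  fixes a b i j C :: "nat \<Rightarrow> int"
  assumes r: "allowed (eps s) (a s)" "allowed (eps s) (b s)" "allowed (eps s) (i s)" "allowed (eps s) (j s)"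
begin

lemma left_j_up: "G a b i (bump s 1 j) (bump p 1 C)
    = G (bump s (-1) a) b i j C - q powi (C p + 2) * t powi (a s) * G a (bump s (-1) b) i j (bump p 1 C)"
proof -
  have e: "q powi (C p + 2) = q * q powi (C p + 1)"
    using q_powi_add[of 1 "C p + 1"] by (simp add: add_ac)
  show ?thesis
    using G_local[where a = a and b = b and i = i and j = j and C = C]
    arg_cong[OF S3Z_j_up[OF r, of "C p + 1" "C (R s)"], of "\<lambda>u. u * chain (X - {s}) L R eps a b i j C"]
    by (simp add: algebra_simps e)
qed

lemma left_i_up: "t powi (j s) * G a b (bump s 1 i) j C
    = q powi (C p) * G (bump s (-1) a) b i j C + t powi (a s) * br (C p + 1) * G a (bump s (-1) b) i j (bump p 1 C)"
  using G_local[where a = a and b = b and i = i and j = j and C = C]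
    arg_cong[OF S3Z_i_up[OF r, of "C p" "C (R s)"], of "\<lambda>u. u * chain (X - {s}) L R eps a b i j C"]
  by (simp add: algebra_simps)

lemma left_i_down: "qn (b s + 1) * G a (bump s 1 b) i j (bump p (-1) C)
     + t powi (- b s) * q powi (C p) * qn (a s + 1) * G (bump s 1 a) b i j C
    = qn (i s) * G a b (bump s (-1) i) j C"
  using G_local[where a = a and b = b and i = i and j = j and C = C]
    arg_cong[OF S3Z_i_down[OF r, of "C p" "C (R s)", symmetric], of "\<lambda>u. u * chain (X - {s}) L R eps a b i j C"]
  by (simp add: algebra_simps)

lemma left_j_down: "t powi (- b s) * br (C p) * qn (a s + 1) * G (bump s 1 a) b i j C
    - q powi (C p) * qn (b s + 1) * G a (bump s 1 b) i j (bump p (-1) C)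
   = t powi (- i s) * qn (j s) * G a b i (bump s (-1) j) (bump p (-1) C)"
  using G_local[where a = a and b = b and i = i and j = j and C = C]
    arg_cong[OF S3Z_j_down[OF r, of "C p" "C (R s)", symmetric], of "\<lambda>u. u * chain (X - {s}) L R eps a b i j C"]
  by (simp add: algebra_simps)

end

end

locale right_site =
  fixes X :: "nat set" and L R :: "nat \<Rightarrow> nat" and eps :: "nat \<Rightarrow> nat" and s p :: nat
  assumes fin: "finite X" and s: "s \<in> X" and Rs: "R s = p"
    and L: "\<And>k. k \<in> X \<Longrightarrow> L k \<noteq> p" and R: "\<And>k. k \<in> X \<Longrightarrow> k \<noteq> s \<Longrightarrow> R k \<noteq> p"
begin

abbreviation "G \<equiv> chain X L R eps"
abbreviation t where "t \<equiv> tq (eps s)"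

lemma G_local:
  assumes "\<And>k. k \<noteq> s \<Longrightarrow> a' k = a k \<and> b' k = b k \<and> i' k = i k \<and> j' k = j k"
    and "\<And>k. k \<noteq> p \<Longrightarrow> C' k = C k"
  shows "G a' b' i' j' C' = S3Z (eps s) (a' s) (b' s) (C (L s)) (i' s) (j' s) (C' p)
    * chain (X - {s}) L R eps a b i j C"
proof -
  have "chain (X - {s}) L R eps a' b' i' j' C' = chain (X - {s}) L R eps a b i j C"
    by (rule chain_cong) (use assms L R in auto)
  then show ?thesis using chain_split1[OF fin s, of L R eps a' b' i' j' C'] assms(2) L[OF s] Rs
    by simp
qed

context
  fixes a b i j C :: "nat \<Rightarrow> int"
  assumes r: "allowed (eps s) (a s)" "allowed (eps s) (b s)" "allowed (eps s) (i s)" "allowed (eps s) (j s)"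
begin

lemma right_a_up: "qn (a s + 1) * G (bump s 1 a) b i j C
    = qn (j s) * G a b i (bump s (-1) j) (bump p 1 C)
      + q powi (C p) * t powi (- j s) * qn (i s) * G a b (bump s (-1) i) j C"
  using G_local[where a = a and b = b and i = i and j = j and C = C]
    arg_cong[OF S3Z_a_up[OF r, of "C (L s)" "C p"], of "\<lambda>u. u * chain (X - {s}) L R eps a b i j C"]
  by (simp add: algebra_simps)

lemma right_b_up: "t powi (- a s) * qn (b s + 1) * G a (bump s 1 b) i j (bump p 1 C)
    = t powi (- j s) * br (C p + 1) * qn (i s) * G a b (bump s (-1) i) j C
      - q powi (C p + 2) * qn (j s) * G a b i (bump s (-1) j) (bump p 1 C)"
  using G_local[where a = a and b = b and i = i and j = j and C = C]
    arg_cong[OF S3Z_b_up[OF r, of "C (L s)" "C p"], of "\<lambda>u. u * chain (X - {s}) L R eps a b i j C"]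
  by (simp add: algebra_simps)

lemma right_b_down: "G a (bump s (-1) b) i j (bump p (-1) C)
    = G a b (bump s 1 i) j C - q powi (C p) * t powi (i s) * G a b i (bump s 1 j) (bump p (-1) C)"
proof -
  have e: "q powi (C p) = q * q powi (C p - 1)"
    using q_powi_add[of 1 "C p - 1"] by (simp add: add_ac)
  show ?thesis
    using G_local[where a = a and b = b and i = i and j = j and C = C]
    arg_cong[OF S3Z_b_down[OF r, of "C (L s)" "C p - 1"], of "\<lambda>u. u * chain (X - {s}) L R eps a b i j C"]
    by (simp add: algebra_simps e)
qed

lemma right_a_down: "t powi (b s) * G (bump s (-1) a) b i j C
    = q powi (C p) * G a b (bump s 1 i) j C + t powi (i s) * br (C p) * G a b i (bump s 1 j) (bump p (-1) C)"
  using G_local[where a = a and b = b and i = i and j = j and C = C]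
    arg_cong[OF S3Z_a_down[OF r, of "C (L s)" "C p"], of "\<lambda>u. u * chain (X - {s}) L R eps a b i j C"]
  by (simp add: algebra_simps)

end

end

section \<open>Values of rational Laurent series\<close>

lemma emb_0 [simp]: "emb 0 = 0" by (simp add: emb_def)
lemma emb_1 [simp]: "emb 1 = 1" by (simp add: emb_def flip: one_pCons)
lemma emb_add: "emb (a + b) = emb a + emb b" by (simp add: emb_def flip: to_fract_add)
lemma emb_mult: "emb (a * b) = emb a * emb b" by (simp add: emb_def flip: to_fract_mult)
lemma emb_minus: "emb (- a) = - emb a" by (simp add: emb_def flip: to_fract_uminus)
lemma emb_diff: "emb (a - b) = emb a - emb b" by (simp add: emb_def flip: to_fract_diff)
lemma emb_eq_0_iff [simp]: "emb a = 0 \<longleftrightarrow> a = 0" by (simp add: emb_def)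
lemma emb_inverse: "emb (inverse a) = inverse (emb a)"
  by (cases "a = 0") (simp, metis emb_1 emb_eq_0_iff emb_mult inverse_unique right_inverse)
lemma emb_divide: "emb (a / b) = emb a / emb b"
  by (simp add: divide_inverse emb_mult emb_inverse)
lemma emb_power: "emb (a ^ m) = emb a ^ m" by (induction m) (simp_all add: emb_mult)
lemma emb_powi: "emb (a powi m) = emb a powi m"
  by (simp add: power_int_def emb_power emb_inverse)

text \<open>
  The value at \<open>w\<close> of a polynomial in \<open>z\<close>, as it occurs in
  \<open>rat_value\<close>.
\<close>

definition ev :: "kxy \<Rightarrow> kq poly \<Rightarrow> kxy" where
  "ev w P = poly (map_poly emb P) w"

lemma ev_0 [simp]: "ev w 0 = 0" by (simp add: ev_def)
lemma ev_pCons: "ev w (pCons a P) = emb a + w * ev w P"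
  by (simp add: ev_def map_poly_pCons)
lemma ev_add: "ev w (P + Q) = ev w P + ev w Q"
  by (induction P Q rule: poly_induct2) (simp_all add: ev_pCons emb_add algebra_simps)
lemma ev_smult: "ev w (smult a P) = emb a * ev w P"
  by (induction P) (simp_all add: ev_pCons emb_mult algebra_simps)
lemma ev_mult: "ev w (P * Q) = ev w P * ev w Q"
  by (induction P) (simp_all add: ev_pCons ev_add ev_smult algebra_simps)

abbreviation pf :: "kq poly \<Rightarrow> kq fls" where "pf P \<equiv> fps_to_fls (fps_of_poly P)"

lemma pf_add: "pf (P + Q) = pf P + pf Q" by (simp add: fps_of_poly_add)
lemma pf_mult: "pf (P * Q) = pf P * pf Q" by (simp add: fps_of_poly_mult fls_times_fps_to_fls)
lemma pf_eq_iff [simp]: "pf P = pf Q \<longleftrightarrow> P = Q" by (simp add: fps_of_poly_eq_iff)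
lemma pf_eq_0_iff: "pf P = 0 \<longleftrightarrow> P = 0" using pf_eq_iff[of P 0] by (simp del: pf_eq_iff)

definition rational :: "kq fls \<Rightarrow> bool" where
  "rational f \<longleftrightarrow> (\<exists>P Q. Q \<noteq> 0 \<and> f = pf P / pf Q)"

lemma rationalI: "Q \<noteq> 0 \<Longrightarrow> f * pf Q = pf P \<Longrightarrow> rational f"
  unfolding rational_def using pf_eq_0_iff[of Q] by (metis nonzero_eq_divide_eq)

lemma rationalE: assumes "rational f" obtains P Q where "Q \<noteq> 0" "f = pf P / pf Q"
  using assms unfolding rational_def by blast

lemma rational_pf: "rational (pf P)" by (rule rationalI[of 1 _ P]) simp_all
lemma rational_zc [simp]: "rational (zc a)"
  using rational_pf[of "[:a:]"] by (simp add: zc_def fps_of_poly_const)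
lemma rational_zX [simp]: "rational zX" using rational_pf[of "[:0, 1:]"] by (simp add: zX_def)
lemma zc_0 [simp]: "zc 0 = 0" by (simp add: zc_def)
lemma zc_1 [simp]: "zc 1 = 1" by (simp add: zc_def)
lemma rational_0 [simp]: "rational 0" using rational_zc[of 0] by simp
lemma rational_1 [simp]: "rational 1" using rational_zc[of 1] by simp

lemma rational_add [intro]: assumes "rational f" "rational g" shows "rational (f + g)"
proof -
  obtain P Q P' Q' where h: "Q \<noteq> 0" "f = pf P / pf Q" "Q' \<noteq> 0" "g = pf P' / pf Q'"
    using assms by (metis rationalE)
  then have "(f + g) * pf (Q * Q') = pf (P * Q' + P' * Q)"
    using pf_eq_0_iff[of Q] pf_eq_0_iff[of Q'] by (simp add: pf_mult pf_add field_simps del: pf_eq_iff)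
  then show ?thesis using h by (intro rationalI[of "Q * Q'"]) auto
qed

lemma rational_mult [intro]: assumes "rational f" "rational g" shows "rational (f * g)"
proof -
  obtain P Q P' Q' where h: "Q \<noteq> 0" "f = pf P / pf Q" "Q' \<noteq> 0" "g = pf P' / pf Q'"
    using assms by (metis rationalE)
  then have "(f * g) * pf (Q * Q') = pf (P * P')"
    using pf_eq_0_iff[of Q] pf_eq_0_iff[of Q'] by (simp add: pf_mult)
  then show ?thesis using h by (intro rationalI[of "Q * Q'"]) auto
qed

lemma rational_inverse [intro]: assumes "rational f" shows "rational (inverse f)"
proof -
  obtain P Q where h: "Q \<noteq> 0" "f = pf P / pf Q" using assms by (rule rationalE)
  show ?thesis
  proof (cases "P = 0")
    case False
    then show ?thesis unfolding rational_def using h by (metis inverse_divide)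
  qed (use h in simp)
qed

lemma rational_minus [intro]: assumes "rational f" shows "rational (- f)"
proof -
  obtain P Q where h: "Q \<noteq> 0" "f = pf P / pf Q" using assms by (rule rationalE)
  then show ?thesis unfolding rational_def
    by (intro exI[of _ "- P"] exI[of _ Q]) (simp add: fps_of_poly_uminus)
qed
lemma rational_diff [intro]: "rational f \<Longrightarrow> rational g \<Longrightarrow> rational (f - g)"
  using rational_add[of f "- g"] by auto
lemma rational_divide [intro]: "rational f \<Longrightarrow> rational g \<Longrightarrow> rational (f / g)"
  by (auto simp: divide_inverse)
lemma rational_power [intro]: "rational f \<Longrightarrow> rational (f ^ m)"
  by (induction m) auto
lemma rational_powi [intro]: "rational f \<Longrightarrow> rational (f powi m)"
  by (auto simp: power_int_def)
lemma rational_prod [intro]: "(\<And>x. x \<in> A \<Longrightarrow> rational (f x)) \<Longrightarrow> rational (prod f A)"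
  by (induction A rule: infinite_finite_induct) auto

definition zz :: kxy where "zz = x_gen / y_gen"

lemma x_gen_neq0 [simp]: "x_gen \<noteq> 0" by (simp add: x_gen_def)
lemma y_gen_neq0 [simp]: "y_gen \<noteq> 0" by (simp add: y_gen_def)
lemma to_fract_power: "to_fract (p ^ m) = to_fract p ^ m"
  by (induction m) simp_all

lemma to_fract_sum: "to_fract (sum f A) = (\<Sum>x\<in>A. to_fract (f x))"
  by (induction A rule: infinite_finite_induct) simp_all

lemma ev_altdef: "degree P \<le> d \<Longrightarrow> ev w P = (\<Sum>i\<le>d. emb (coeff P i) * w ^ i)"
proof (induction P arbitrary: d)
  case (pCons a P)
  show ?case
  proof (cases d)
    case 0
    then have "P = 0" using pCons by (metis degree_pCons_eq le_0_eq nat.distinct(1))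
    then show ?thesis using 0 by (simp add: ev_pCons)
  next
    case (Suc d')
    have "degree P \<le> d'" using pCons.prems Suc by (cases "P = 0") simp_all
    then show ?thesis using pCons.IH[of d'] unfolding Suc sum.atMost_Suc_shift
      by (simp add: ev_pCons sum_distrib_left mult_ac)
  qed
qed simp

text \<open>
  The ratio of the two spectral parameters is transcendental over the field of coefficients:
  after clearing denominators, a polynomial relation becomes a relation between distinct
  monomials in \<open>x\<close> and \<open>y\<close>.
\<close>

lemma ev_zz_eq_0_iff: "ev zz P = 0 \<longleftrightarrow> P = 0"
proof
  assume "ev zz P = 0"
  define d where "d = degree P"
  define R :: "kq poly poly" where "R = (\<Sum>i\<le>d. monom (monom (coeff P i) i) (d - i))"
  have "0 = y_gen ^ d * ev zz P" using \<open>ev zz P = 0\<close> by simp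
  also have "\<dots> = (\<Sum>i\<le>d. emb (coeff P i) * x_gen ^ i * y_gen ^ (d - i))"
    unfolding ev_altdef[OF d_def[THEN eq_refl[OF sym]]] sum_distrib_left zz_def
    by (rule sum.cong) (auto simp: power_divide power_diff)
  also have "\<dots> = to_fract R"
    unfolding R_def to_fract_sum
  proof (rule sum.cong)
    fix i assume "i \<in> {..d}"
    have "monom (monom (coeff P i) i) (d - i) = [:[:coeff P i:]:] * [:[:0, 1:]:] ^ i * [:0, 1:] ^ (d - i)"
    proof -
      have "monom (coeff P i) i = [:coeff P i:] * [:0, 1:] ^ i"
        by (simp add: monom_altdef)
      moreover have "[:[:0, 1::kq:]:] ^ i = [:[:0, 1:] ^ i:]"
        by (simp add: poly_const_pow)
      moreover have "monom (monom (coeff P i) i) (d - i) = [:monom (coeff P i) i:] * [:0, 1:] ^ (d - i)"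
        by (simp add: monom_altdef)
      ultimately show ?thesis by (simp add: mult_to_poly)
    qed
    then show "emb (coeff P i) * x_gen ^ i * y_gen ^ (d - i) = to_fract (monom (monom (coeff P i) i) (d - i))"
      by (simp only: emb_def x_gen_def y_gen_def to_fract_power to_fract_mult)
  qed simp
  finally have R0: "R = 0" by simp
  have "coeff P i = 0" if "i \<le> d" for i
  proof -
    have "0 = coeff (coeff R (d - i)) i" using R0 by simp
    also have "\<dots> = (\<Sum>l\<le>d. if l = i then coeff P i else 0)"
      unfolding R_def coeff_sum using that by (intro sum.cong) (auto simp: coeff_monom)
    also have "\<dots> = coeff P i" using that by simp
    finally show ?thesis by simp
  qed
  then show "P = 0" unfolding d_def by (metis leading_coeff_0_iff order_refl)
qed simp

abbreviation val :: "kq fls \<Rightarrow> kxy" where "val \<equiv> rat_value zz"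

text \<open>
  Two fractions for the same series satisfy a polynomial identity, which persists at
  \<open>zz\<close>; no denominator vanishes there by transcendence.
\<close>

lemma val_eq:
  assumes "Q \<noteq> 0" "f = pf P / pf Q"
  shows "val f = ev zz P / ev zz Q"
  unfolding rat_value_def ev_def[symmetric]
proof (rule the_equality)
  show "\<exists>P' Q'. Q' \<noteq> 0 \<and> f = pf P' / pf Q' \<and> ev zz P / ev zz Q = ev zz P' / ev zz Q'"
    using assms by blast
next
  fix u assume "\<exists>P' Q'. Q' \<noteq> 0 \<and> f = pf P' / pf Q' \<and> u = ev zz P' / ev zz Q'"
  then obtain P' Q' where h: "Q' \<noteq> 0" "f = pf P' / pf Q'" "u = ev zz P' / ev zz Q'" by blast
  then have "pf (P * Q') = pf (P' * Q)"
    using assms pf_eq_0_iff[of Q] pf_eq_0_iff[of Q'] by (simp add: pf_mult field_simps del: pf_eq_iff)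
  then have "ev zz (P * Q') = ev zz (P' * Q)" by simp
  then have "ev zz P * ev zz Q' = ev zz P' * ev zz Q" by (simp only: ev_mult)
  moreover have "ev zz Q \<noteq> 0" "ev zz Q' \<noteq> 0" using h(1) assms(1) by (simp_all add: ev_zz_eq_0_iff)
  ultimately show "u = ev zz P / ev zz Q" unfolding h(3) by (simp add: frac_eq_eq)
qed

lemma val_add: assumes "rational f" "rational g" shows "val (f + g) = val f + val g"
proof -
  obtain P Q P' Q' where h: "Q \<noteq> 0" "f = pf P / pf Q" "Q' \<noteq> 0" "g = pf P' / pf Q'"
    using assms by (metis rationalE)
  then have "f + g = pf (P * Q' + P' * Q) / pf (Q * Q')"
    using pf_eq_0_iff[of Q] pf_eq_0_iff[of Q'] by (simp add: pf_mult pf_add field_simps del: pf_eq_iff)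
  from val_eq[OF _ this] have "val (f + g) = ev zz (P * Q' + P' * Q) / ev zz (Q * Q')" using h by simp
  also have "\<dots> = ev zz P / ev zz Q + ev zz P' / ev zz Q'"
    using h(1,3) by (simp add: ev_mult ev_add add_frac_eq ev_zz_eq_0_iff)
  finally show ?thesis using val_eq[OF h(1,2)] val_eq[OF h(3,4)] by simp
qed

lemma val_mult: assumes "rational f" "rational g" shows "val (f * g) = val f * val g"
proof -
  obtain P Q P' Q' where h: "Q \<noteq> 0" "f = pf P / pf Q" "Q' \<noteq> 0" "g = pf P' / pf Q'"
    using assms by (metis rationalE)
  then have "f * g = pf (P * P') / pf (Q * Q')" by (simp add: pf_mult)
  from val_eq[OF _ this] have "val (f * g) = ev zz (P * P') / ev zz (Q * Q')" using h by simp
  then show ?thesis using val_eq[OF h(1,2)] val_eq[OF h(3,4)] by (simp add: ev_mult)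
qed

lemma val_zc [simp]: "val (zc a) = emb a"
  using val_eq[of 1 "zc a" "[:a:]"] by (simp add: zc_def fps_of_poly_const ev_pCons one_pCons)
lemma val_0 [simp]: "val 0 = 0" using val_zc[of 0] by simp
lemma val_zX [simp]: "val zX = zz"
  using val_eq[of 1 zX "[:0, 1:]"] by (simp add: zX_def ev_pCons one_pCons)
section \<open>The single free auxiliary index\<close>

text \<open>
  The conservation law \<open>b\<^sub>k + c\<^sub>k\<^sub>-\<^sub>1 = j\<^sub>k +
  c\<^sub>k\<close> determines all auxiliary indices from \<open>c\<^sub>0 = N\<close>.
\<close>

definition path :: "(nat \<Rightarrow> int) \<Rightarrow> (nat \<Rightarrow> int) \<Rightarrow> int \<Rightarrow> nat \<Rightarrow> int" where
  "path b j N k = N + (\<Sum>l=1..k. b l - j l)"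

lemma path_0 [simp]: "path b j N 0 = N" by (simp add: path_def)
lemma path_Suc: "path b j N (Suc k) = path b j N k + b (Suc k) - j (Suc k)"
  by (simp add: path_def)
lemma path_add: "path b j (N + d) k = path b j N k + d" by (simp add: path_def)

text \<open>
  \<open>m\<close> is the number of independent links: \<open>n\<close> in the closed chain,
  where \<open>R n = 0\<close>, and \<open>n + 1\<close> in the open one.
\<close>

locale links =
  fixes n m :: nat and R :: "nat \<Rightarrow> nat"
  assumes n1: "n \<ge> 1" and m1: "m \<ge> 1" and mn: "m \<le> n + 1" "n \<le> m"
    and R_lt: "\<And>k. 1 \<le> k \<Longrightarrow> k \<le> n \<Longrightarrow> R k < m"
    and R_eq: "\<And>k. 1 \<le> k \<Longrightarrow> k < m \<Longrightarrow> R k = k"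
begin

abbreviation "G \<equiv> chain {1..n} (\<lambda>k. k - 1) R"

text \<open>
  Behind the last link with a negative index there is a site to which \<open>S3Z_vanish\<close>
  applies.
\<close>

lemma chain_vanish:
  assumes "C (R n) \<ge> 0" "k < m" "C k < 0"
  shows "G eps a b i j C = 0"
proof -
  define A where "A = {k. k < m \<and> C k < 0}"
  have A: "finite A" "A \<noteq> {}" using assms by (auto simp: A_def)
  define l where "l = Max A"
  have l: "l < m" "C l < 0" using Max_in[OF A] by (auto simp: A_def l_def)
  have max: "C l' \<ge> 0" if "l < l'" "l' < m" for l'
  proof (rule ccontr)
    assume "\<not> C l' \<ge> 0"
    then have "l' \<in> A" using that by (simp add: A_def)
    then show False using Max_ge[OF A(1), of l'] that by (simp add: l_def)
  qed
  have "l \<noteq> n" using l assms(1) R_eq[of n] mn n1 by force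
  then have ln: "l < n" using l mn by linarith
  have "C (R (Suc l)) \<ge> 0"
  proof (cases "Suc l < m")
    case True
    then show ?thesis using max[of "Suc l"] R_eq[of "Suc l"] by simp
  next
    case False
    then have "Suc l = n" using l ln mn by linarith
    then show ?thesis using assms(1) by simp
  qed
  then have "S3Z (eps (Suc l)) (a (Suc l)) (b (Suc l)) (C (Suc l - 1)) (i (Suc l)) (j (Suc l)) (C (R (Suc l))) = 0"
    using l by (intro S3Z_vanish) simp_all
  then show ?thesis unfolding chain_def using ln by (intro prod_zero) (auto intro!: bexI[of _ "Suc l"])
qed

text \<open>
  Of all configurations of auxiliary indices with \<open>c\<^sub>0 = N\<close>, only the path
  can contribute.
\<close>

lemma sum_any_chain:
  fixes a b i j :: mindex
  assumes e: "\<And>k. k \<in> {1..n} \<Longrightarrow> eps k \<le> 1" and N: "N \<ge> (0::nat)"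
  shows "Sum_any (\<lambda>c. if c \<in> {0..<m} \<rightarrow>\<^sub>E UNIV \<and> c 0 = N
       then w c * (\<Prod>k=1..n. S3 (eps k) (a k) (b k) (c (k - 1)) (i k) (j k) (c (R k)))
       else 0)
    = (if \<forall>k<m. path (int \<circ> b) (int \<circ> j) (int N) k \<ge> 0
       then w (restrict (\<lambda>k. nat (path (int \<circ> b) (int \<circ> j) (int N) k)) {0..<m})
         * G eps (int \<circ> a) (int \<circ> b) (int \<circ> i) (int \<circ> j) (path (int \<circ> b) (int \<circ> j) (int N))
       else 0)" (is "Sum_any ?f = ?r")
proof -
  let ?p = "path (int \<circ> b) (int \<circ> j) (int N)"
  have c_path: "int (c k) = ?p k" if "?f c \<noteq> 0" "k < m" for c k
    using that(2)
  proof (induction k)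
    case 0
    then show ?case using that(1) by (auto split: if_splits)
  next
    case (Suc k)
    then have k: "Suc k \<in> {1..n}" using mn by auto
    from that(1) have "(\<Prod>k=1..n. S3 (eps k) (a k) (b k) (c (k - 1)) (i k) (j k) (c (R k))) \<noteq> 0"
      by (auto split: if_splits)
    then have "S3 (eps (Suc k)) (a (Suc k)) (b (Suc k)) (c (Suc k - 1)) (i (Suc k)) (j (Suc k)) (c (R (Suc k))) \<noteq> 0"
      using k by (meson finite_atLeastAtMost prod_zero)
    then have "S3Z (eps (Suc k)) (int (a (Suc k))) (int (b (Suc k))) (int (c k)) (int (i (Suc k))) (int (j (Suc k))) (int (c (Suc k))) \<noteq> 0"
      using S3_S3Z[OF e[OF k]] R_eq[of "Suc k"] Suc.prems by simp
    then have "int (b (Suc k)) + int (c k) = int (j (Suc k)) + int (c (Suc k))"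
      by (metis S3Z_outside)
    then show ?case using Suc by (simp add: path_Suc)
  qed
  show ?thesis
  proof (cases "\<forall>k<m. ?p k \<ge> 0")
    case True
    let ?c = "restrict (\<lambda>k. nat (?p k)) {0..<m}"
    have "{c. ?f c \<noteq> 0} \<subseteq> {?c}"
    proof
      fix c assume "c \<in> {c. ?f c \<noteq> 0}"
      then have h: "?f c \<noteq> 0" by simp
      then have "c \<in> {0..<m} \<rightarrow>\<^sub>E UNIV" by (auto split: if_splits)
      moreover have "c k = nat (?p k)" if "k < m" for k
        using c_path[OF h that] by linarith
      ultimately have "c = ?c" by (auto simp: fun_eq_iff PiE_def extensional_def)
      then show "c \<in> {?c}" by simp
    qed
    then have "Sum_any ?f = ?f ?c" by (subst Sum_any.expand_superset[of "{?c}"]) auto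
    also have "\<dots> = w ?c * (\<Prod>k=1..n. S3 (eps k) (a k) (b k) (?c (k - 1)) (i k) (j k) (?c (R k)))"
      using m1 by auto
    also have "(\<Prod>k=1..n. S3 (eps k) (a k) (b k) (?c (k - 1)) (i k) (j k) (?c (R k)))
       = G eps (int \<circ> a) (int \<circ> b) (int \<circ> i) (int \<circ> j) ?p"
      unfolding chain_def
    proof (rule prod.cong)
      fix k assume k: "k \<in> {1..n}"
      then have "k - 1 < m" "R k < m" using mn R_lt[of k] by auto
      then show "S3 (eps k) (a k) (b k) (?c (k - 1)) (i k) (j k) (?c (R k))
        = S3Z (eps k) ((int \<circ> a) k) ((int \<circ> b) k) (?p (k - 1)) ((int \<circ> i) k) ((int \<circ> j) k) (?p (R k))"
        using True by (simp add: S3_S3Z[OF e[OF k]])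
    qed simp
    finally show ?thesis unfolding if_P[OF True] .
  next
    case False
    have "?f c = 0" for c
      using c_path[of c] False by (metis of_nat_0_le_iff)
    then have "{c. ?f c \<noteq> 0} \<subseteq> {}" by blast
    then have "Sum_any ?f = sum ?f {}" by (rule Sum_any.expand_superset[OF finite.emptyI])
    then show ?thesis unfolding if_not_P[OF False] by simp
  qed
qed

end

abbreviation chain_tr where
  "chain_tr n \<equiv> chain {1..n} (\<lambda>k. k - 1) (\<lambda>k. k mod n)"
abbreviation chain_11 where
  "chain_11 n \<equiv> chain {1..n} (\<lambda>k. k - 1) (\<lambda>k. k)"

text \<open>
  The coefficient of \<open>z\<^sup>N\<close> for integer \<open>N\<close> and integer
  multi-indices; the value 0 for negative \<open>N\<close> lets \<open>N\<close> be shifted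
  freely.
\<close>

definition coeff_tr where
  "coeff_tr n eps a b i j N = (if N \<ge> 0 then chain_tr n eps a b i j (path b j N) else 0)"

text \<open>
  The weights of the boundary vectors at the left and at the right end of the chain.
\<close>

definition left_weight :: "int \<Rightarrow> kq" where
  "left_weight N = (if N \<ge> 0 then qpoch (q\<^sup>2) (q\<^sup>2) (nat N) / qpoch q q (nat N) else 0)"
definition right_weight :: "int \<Rightarrow> kq" where
  "right_weight N = (if N \<ge> 0 then 1 / qpoch q q (nat N) else 0)"

definition coeff_11 where
  "coeff_11 n eps a b i j N = left_weight N * right_weight (path b j N n) * chain_11 n eps a b i j (path b j N)"

definition series :: "(int \<Rightarrow> kq) \<Rightarrow> kq fls" where
  "series f = fps_to_fls (Abs_fps (\<lambda>N. f (int N)))"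

lemma links_tr: "n \<ge> 1 \<Longrightarrow> links n n (\<lambda>k. k mod n)"
  by unfold_locales auto
lemma links_11: "n \<ge> 1 \<Longrightarrow> links n (n + 1) (\<lambda>k. k)"
  by unfold_locales auto

lemma series_tr_coeff:
  fixes a b i j :: mindex
  assumes "n \<ge> 1" and e: "\<And>k. k \<in> {1..n} \<Longrightarrow> eps k \<le> 1"
  shows "series_tr n eps a b i j = series (coeff_tr n eps (int \<circ> a) (int \<circ> b) (int \<circ> i) (int \<circ> j))"
proof -
  interpret links n n "\<lambda>k. k mod n" by (rule links_tr) fact
  have "Sum_any (\<lambda>c. if c \<in> {0..<n} \<rightarrow>\<^sub>E UNIV \<and> c 0 = N
       then (\<Prod>k=1..n. S3 (eps k) (a k) (b k) (c (k - 1)) (i k) (j k) (c (k mod n)))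
       else 0) = coeff_tr n eps (int \<circ> a) (int \<circ> b) (int \<circ> i) (int \<circ> j) (int N)" for N
  proof -
    let ?p = "path (int \<circ> b) (int \<circ> j) (int N)"
    have "chain_tr n eps (int \<circ> a) (int \<circ> b) (int \<circ> i) (int \<circ> j) ?p = 0" if "\<not> (\<forall>k<n. ?p k \<ge> 0)"
      using that chain_vanish[of ?p] by (auto simp: not_le)
    then show ?thesis using sum_any_chain[of eps N "\<lambda>_. 1" a b i j, OF e le0]
      unfolding mult_1 by (simp only: coeff_tr_def) auto
  qed
  then show ?thesis unfolding series_tr_def series_def by simp
qed

lemma series_11_coeff:
  fixes a b i j :: mindex
  assumes "n \<ge> 1" and e: "\<And>k. k \<in> {1..n} \<Longrightarrow> eps k \<le> 1"
  shows "series_11 n eps a b i j = series (coeff_11 n eps (int \<circ> a) (int \<circ> b) (int \<circ> i) (int \<circ> j))"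
proof -
  interpret links n "n + 1" "\<lambda>k. k" by (rule links_11) fact
  have i: "{0..n} = {0..<n + 1}" by auto
  have "Sum_any (\<lambda>c. if c \<in> {0..n} \<rightarrow>\<^sub>E UNIV \<and> c 0 = N
       then qpoch (q^2) (q^2) (c 0) / (qpoch q q (c 0) * qpoch q q (c n))
       * (\<Prod>k=1..n. S3 (eps k) (a k) (b k) (c (k - 1)) (i k) (j k) (c k))
       else 0) = coeff_11 n eps (int \<circ> a) (int \<circ> b) (int \<circ> i) (int \<circ> j) (int N)" for N
  proof -
    let ?p = "path (int \<circ> b) (int \<circ> j) (int N)"
    have "right_weight (?p n) * chain_11 n eps (int \<circ> a) (int \<circ> b) (int \<circ> i) (int \<circ> j) ?p = 0" if "\<not> (\<forall>k<n + 1. ?p k \<ge> 0)"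
      using that chain_vanish[of ?p] by (auto simp: not_le right_weight_def)
    then show ?thesis
      using sum_any_chain[of eps N "\<lambda>c. qpoch (q^2) (q^2) (c 0) / (qpoch q q (c 0) * qpoch q q (c n))" a b i j, OF e le0]
      unfolding i by (simp only: coeff_11_def left_weight_def right_weight_def) auto
  qed
  then show ?thesis unfolding series_11_def series_def by simp
qed

section \<open>Rationality of the trace\<close>

text \<open>
  The exponential sums \<open>\<Sum>\<^sub>r c\<^sub>r q\<^sup>r\<^sup>N\<close>. They form a
  ring, which contains the matrix elements as functions of the free auxiliary index.
\<close>

inductive qexp :: "(int \<Rightarrow> kq) \<Rightarrow> bool" where
  base: "qexp (\<lambda>N. c * q powi (r * N))"
| sum: "qexp f \<Longrightarrow> qexp g \<Longrightarrow> qexp (\<lambda>N. f N + g N)"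

lemma qexp_const: "qexp (\<lambda>N. c)" using base[of c 0] by simp

lemma qexp_lin: "qexp (\<lambda>N. q powi (r * N + d))"
  using base[of "q powi d" r] by (simp add: q_powi_add mult.commute)

lemma qexp_mult_base: "qexp f \<Longrightarrow> qexp (\<lambda>N. c * q powi (r * N) * f N)"
proof (induction rule: qexp.induct)
  case (base c' r')
  have "(\<lambda>N. c * q powi (r * N) * (c' * q powi (r' * N))) = (\<lambda>N. (c * c') * q powi ((r + r') * N))"
    by (rule ext) (simp add: distrib_right q_powi_add)
  then show ?case by (simp only: qexp.base)
next
  case (sum f g)
  then show ?case using qexp.sum by (simp add: distrib_left)
qed

lemma qexp_mult: "qexp f \<Longrightarrow> qexp g \<Longrightarrow> qexp (\<lambda>N. f N * g N)"
proof (induction rule: qexp.induct)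
  case (base c r)
  then show ?case by (rule qexp_mult_base)
next
  case (sum f f')
  then show ?case using qexp.sum by (simp add: distrib_right)
qed

lemma qexp_diff: "qexp f \<Longrightarrow> qexp g \<Longrightarrow> qexp (\<lambda>N. f N - g N)"
  using qexp.sum[OF _ qexp_mult[OF qexp_const[of "-1"]]] by force

lemma qexp_power: "qexp f \<Longrightarrow> qexp (\<lambda>N. f N ^ m)"
  by (induction m) (auto intro: qexp_mult qexp_const)
lemma qexp_sum: "(\<And>x. x \<in> A \<Longrightarrow> qexp (f x)) \<Longrightarrow> qexp (\<lambda>N. \<Sum>x\<in>A. f x N)"
  by (induction A rule: infinite_finite_induct) (auto intro: qexp.sum qexp_const)
lemma qexp_prod: "(\<And>x. x \<in> A \<Longrightarrow> qexp (f x)) \<Longrightarrow> qexp (\<lambda>N. \<Prod>x\<in>A. f x N)"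
  by (induction A rule: infinite_finite_induct) (auto intro: qexp_mult qexp_const)

lemma qexp_shift: "qexp f \<Longrightarrow> qexp (\<lambda>N. f (N + d))"
proof (induction rule: qexp.induct)
  case (base c r)
  have "(\<lambda>N. c * q powi (r * (N + d))) = (\<lambda>N. (c * q powi (r * d)) * q powi (r * N))"
    by (rule ext) (simp add: distrib_left q_powi_add)
  then show ?case by (simp only: qexp.base)
qed (rule qexp.sum)

lemma qexp_H: "qexp (\<lambda>N. H i j b (N + d))"
proof -
  have "qexp (\<lambda>N. trm i j (N + d) (int b + (N + d) - int j) (b - mu) mu)" if "mu \<le> b" for mu
  proof -
    have e: "int i * (N + d - int j) + (int b + (N + d) - int j + 1) * int (b - mu) + int mu * (int mu - (int b + (N + d) - int j))
      = (int i + int (b - mu) - int mu) * N + (int i * (d - int j) + (int b + d - int j + 1) * int (b - mu) + int mu * (int mu - (int b + d - int j)))" for N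
      by (simp add: algebra_simps)
    have p: "qprod (N + d) mu = (\<Prod>s=1..mu. 1 - (q powi (1 * N + (d + int s)))\<^sup>2)" for N
      unfolding qprod_def by (simp add: add.assoc)
    show ?thesis unfolding trm_def e p
      by (intro qexp_mult qexp_const qexp_lin qexp_prod qexp_diff qexp_power)
  qed
  then show ?thesis unfolding H_def antidiag_def by (intro qexp_sum) auto
qed

lemma qexp_S3Z: "qexp (\<lambda>N. S3Z e a b (N + c) i j (N + k))"
proof (cases "allowed e a \<and> allowed e b \<and> allowed e i \<and> allowed e j \<and> a + b = i + j \<and> b + c = j + k")
  case True
  have 1: "q powi (N + k + 1) = q powi (1 * N + (k + 1))" "q powi (N + k) = q powi (1 * N + k)" for N
    by (simp_all add: add_ac)
  have "(\<lambda>N. S3Z e a b (N + c) i j (N + k)) = (if e = 0 then (\<lambda>N. H (nat i) (nat j) (nat b) (N + c))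
       else if a = i then (if i = j then (\<lambda>N. 1) else if i = 0 then (\<lambda>N. 0 - q powi (N + (k + 1))) else (\<lambda>N. q powi (N + k)))
       else if i = 1 then (\<lambda>N. 1 - (q powi (N + k))\<^sup>2) else (\<lambda>N. 1))"
    using True unfolding S3Z_def br_def by (auto simp: fun_eq_iff add.assoc)
  moreover have "qexp \<dots>"
  proof -
    have l: "qexp (\<lambda>N. q powi (N + d))" for d using qexp_lin[of 1 d] by simp
    have "qexp (\<lambda>N. 0 - q powi (N + (k + 1)))" "qexp (\<lambda>N. 1 - (q powi (N + k))\<^sup>2)"
      by (intro qexp_diff qexp_const qexp_power l)+
    then show ?thesis using l qexp_H qexp_const by (simp only: split: if_split) blast
  qed
  ultimately show ?thesis by simp
next
  case False
  then have "(\<lambda>N. S3Z e a b (N + c) i j (N + k)) = (\<lambda>N. 0)" by (auto simp: S3Z_def fun_eq_iff)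
  then show ?thesis using qexp_const[of 0] by simp
qed

lemma qexp_chain: "qexp (\<lambda>N. chain X L R eps a b i j (path b' j' N))"
  unfolding chain_def path_def by (intro qexp_prod qexp_S3Z)

text \<open>The generating function of an exponential sum is a sum of geometric series.\<close>

lemma rational_qexp: "qexp s \<Longrightarrow> rational (series s)"
proof (induction rule: qexp.induct)
  case (base c r)
  have "Abs_fps (\<lambda>N. c * q powi (r * int N)) * fps_of_poly [:1, - (q powi r):] = fps_of_poly [:c:]"
  proof (rule fps_ext)
    fix N
    have "q powi (r * int (Suc N)) = q powi r * q powi (r * int N)" for N
      by (simp add: distrib_left q_powi_add)
    then show "fps_nth (Abs_fps (\<lambda>N. c * q powi (r * int N)) * fps_of_poly [:1, - (q powi r):]) N = fps_nth (fps_of_poly [:c:]) N"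
      by (cases N) (simp_all add: fps_of_poly_pCons algebra_simps)
  qed
  then have "series (\<lambda>N. c * q powi (r * N)) * pf [:1, - (q powi r):] = pf [:c:]"
    unfolding series_def by (simp only: fls_times_fps_to_fls[symmetric])
  then show ?case by (rule rationalI[rotated]) simp
next
  case (sum f g)
  have "series (\<lambda>N. f N + g N) = series f + series g"
    unfolding series_def by (simp add: fps_plus_def flip: fps_to_fls_plus)
  then show ?case using sum by auto
qed

lemma rational_series_tr: "rational (series (coeff_tr n eps a b i j))"
proof -
  have "series (coeff_tr n eps a b i j) = series (\<lambda>N. chain_tr n eps a b i j (path b j N))"
    by (simp add: series_def coeff_tr_def)
  then show ?thesis using rational_qexp[OF qexp_chain] by simp
qed

lemma rational_rho_tr: "rational (rho_tr n eps l m)"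
  unfolding rho_tr_def qpoch_def
  by (auto intro!: rational_mult rational_diff rational_divide rational_powi rational_prod rational_power rational_inverse)

section \<open>The infinite products\<close>

lemma small_0: "q_adic_small r 0"
  unfolding q_adic_small_def by (intro exI[of _ 0] exI[of _ 1]) simp

lemma small_add: assumes "q_adic_small r f" "q_adic_small r g" shows "q_adic_small r (f + g)"
proof -
  obtain u v u' v' where h: "poly v 0 \<noteq> 0" "f = sqrt_q ^ r * to_fract u / to_fract v"
    "poly v' 0 \<noteq> 0" "g = sqrt_q ^ r * to_fract u' / to_fract v'"
    using assms unfolding q_adic_small_def by metis
  then have "v \<noteq> 0" "v' \<noteq> 0" by auto
  then have "f + g = sqrt_q ^ r * to_fract (u * v' + u' * v) / to_fract (v * v')"
    unfolding h by (simp add: field_simps)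
  moreover have "poly (v * v') 0 \<noteq> 0" using h by simp
  ultimately show ?thesis unfolding q_adic_small_def by metis
qed

lemma small_mult: assumes "q_adic_small r f" "q_adic_small s g" shows "q_adic_small (r + s) (f * g)"
proof -
  obtain u v u' v' where h: "poly v 0 \<noteq> 0" "f = sqrt_q ^ r * to_fract u / to_fract v"
    "poly v' 0 \<noteq> 0" "g = sqrt_q ^ s * to_fract u' / to_fract v'"
    using assms unfolding q_adic_small_def by metis
  then have "f * g = sqrt_q ^ (r + s) * to_fract (u * u') / to_fract (v * v')"
    unfolding h by (simp add: power_add)
  moreover have "poly (v * v') 0 \<noteq> 0" using h by simp
  ultimately show ?thesis unfolding q_adic_small_def by metis
qed

lemma small_mono: assumes "q_adic_small r f" "s \<le> r" shows "q_adic_small s f"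
proof -
  obtain u v where h: "poly v 0 \<noteq> 0" "f = sqrt_q ^ r * to_fract u / to_fract v"
    using assms unfolding q_adic_small_def by metis
  then have "f = sqrt_q ^ s * to_fract (monom 1 (r - s) * u) / to_fract v"
    using assms(2) by (simp add: sqrt_q_power[symmetric] power_add[symmetric] mult.assoc[symmetric])
  then show ?thesis using h unfolding q_adic_small_def by metis
qed

lemma small_poly: "q_adic_small 0 (to_fract u)"
  unfolding q_adic_small_def by (intro exI[of _ u] exI[of _ 1]) simp

lemma small_uminus: "q_adic_small r f \<Longrightarrow> q_adic_small r (- f)"
  using small_mult[OF small_poly[of "- 1"], of r f] by simp

lemma small_diff: "q_adic_small r f \<Longrightarrow> q_adic_small r g \<Longrightarrow> q_adic_small r (f - g)"
  using small_add[OF _ small_uminus] by force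

lemma small_q_power: "q_adic_small m (q ^ m)"
proof -
  have "q ^ m = sqrt_q ^ m * to_fract (monom 1 m) / to_fract 1"
    by (simp add: q_def sqrt_q_power[symmetric] power_mult[symmetric] power_add[symmetric] mult_2)
  then show ?thesis unfolding q_adic_small_def by (intro exI[of _ "monom 1 m"] exI[of _ 1]) simp
qed

lemma small_inv: "q_adic_small 0 (inverse (1 - q ^ Suc m))"
proof -
  have "1 - q ^ Suc m = to_fract (1 - monom 1 (2 * Suc m))"
    unfolding q_def power_mult[symmetric] by (simp only: sqrt_q_power to_fract_diff to_fract_1)
  then have "inverse (1 - q ^ Suc m) = sqrt_q ^ 0 * to_fract 1 / to_fract (1 - monom 1 (2 * Suc m))"
    by (simp add: divide_inverse)
  moreover have "poly (1 - monom 1 (2 * Suc m)) (0::complex) \<noteq> 0" by (simp add: poly_monom)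
  ultimately show ?thesis unfolding q_adic_small_def by metis
qed

text \<open>
  A nonzero element of the field has a finite order at \<open>q\<^sup>1\<^sup>/\<^sup>2 =
  0\<close>. Limits are unique for this reason.
\<close>

lemma small_all_0: assumes "\<And>r. q_adic_small r f" shows "f = 0"
proof (rule ccontr)
  assume "f \<noteq> 0"
  obtain U V where UV: "V \<noteq> 0" "f = to_fract U / to_fract V"
    by (cases f) (metis Fract_conv_to_fract)
  with \<open>f \<noteq> 0\<close> have U: "U \<noteq> 0" by auto
  define r where "r = Suc (Polynomial.order 0 U)"
  obtain u v where h: "poly v 0 \<noteq> 0" "f = sqrt_q ^ r * to_fract u / to_fract v"
    using assms[of r] unfolding q_adic_small_def by metis
  then have v: "v \<noteq> 0" by auto
  have "to_fract U / to_fract V = to_fract (monom 1 r * u) / to_fract v"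
    using h(2) UV(2) by (simp add: sqrt_q_power)
  then have "to_fract (U * v) = to_fract (monom 1 r * u * V)"
    using UV v by (simp add: frac_eq_eq)
  then have e: "U * v = monom 1 r * u * V" by (simp only: to_fract_eq_iff)
  have ord: "Polynomial.order 0 (U * v) = Polynomial.order 0 U"
    using U v h(1) by (simp add: Polynomial.order_mult Polynomial.order_0I)
  have "[:- 0, 1:] ^ r dvd U * v" unfolding e by (simp add: monom_altdef)
  then have "r \<le> Polynomial.order 0 (U * v)" using U v by (subst (asm) Polynomial.order_divides) auto
  then show False unfolding ord r_def by simp
qed

lemma limit_unique: assumes "q_adic_limit s L" "q_adic_limit s L'" shows "L = L'"
proof -
  have "q_adic_small r (L - L')" for r
  proof -
    obtain N N' where "\<forall>n\<ge>N. q_adic_small r (s n - L)" "\<forall>n\<ge>N'. q_adic_small r (s n - L')"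
      using assms unfolding q_adic_limit_def by metis
    then have "q_adic_small r (s (max N N') - L)" "q_adic_small r (s (max N N') - L')" by simp_all
    then have "q_adic_small r ((s (max N N') - L') - (s (max N N') - L))" by (rule small_diff[rotated])
    then show ?thesis by simp
  qed
  then show ?thesis using small_all_0 by fastforce
qed

text \<open>
  By Euler the coefficients of \<open>(a z; q)\<^sub>\<infinity>\<close> satisfy this
  recurrence.
\<close>

fun euler_coeff :: "kq \<Rightarrow> nat \<Rightarrow> kq" where
  "euler_coeff a 0 = 1"
| "euler_coeff a (Suc d) = - a * q ^ d * inverse (1 - q ^ Suc d) * euler_coeff a d"

definition qpoch_coeff :: "kq \<Rightarrow> nat \<Rightarrow> nat \<Rightarrow> kq" where
  "qpoch_coeff a N d = fps_nth (qpoch (fps_const a * fps_X) (fps_const q) N) d"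

lemma qpoch_coeff_0: "qpoch_coeff a 0 d = of_bool (d = 0)" by (simp add: qpoch_coeff_def)

lemma qpoch_coeff_Suc: "qpoch_coeff a (Suc N) d = qpoch_coeff a N d - (if d = 0 then 0 else a * q ^ N * qpoch_coeff a N (d - 1))"
proof -
  have "qpoch (fps_const a * fps_X) (fps_const q) (Suc N)
    = qpoch (fps_const a * fps_X) (fps_const q) N
      - fps_const (a * q ^ N) * (fps_X * qpoch (fps_const a * fps_X) (fps_const q) N)"
    by (simp add: qpoch_Suc algebra_simps fps_const_power[symmetric] flip: fps_const_mult del: fps_const_mult fps_const_power)
  then show ?thesis unfolding qpoch_coeff_def by (simp only: fps_sub_nth fps_mult_left_const_nth fps_X_mult_nth) simp
qed

lemma qpoch_coeff_at_0: "qpoch_coeff a N 0 = 1" by (induction N) (simp_all add: qpoch_coeff_0 qpoch_coeff_Suc)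

text \<open>
  The recurrence in the degree for the finite products; as \<open>N\<close> grows,
  \<open>q\<^sup>N\<close> tends to 0 and it becomes that of \<open>euler_coeff\<close>.
\<close>

lemma qpoch_coeff_rec: "(1 - q ^ Suc d) * qpoch_coeff a N (Suc d) = a * (q ^ N - q ^ d) * qpoch_coeff a N d"
proof (induction N arbitrary: d)
  case 0
  show ?case by (cases d) (simp_all add: qpoch_coeff_0)
next
  case (Suc N)
  show ?case
  proof (cases d)
    case 0
    then show ?thesis using Suc[of 0] by (simp add: qpoch_coeff_Suc qpoch_coeff_at_0 algebra_simps)
  next
    case (Suc d')
    have 1: "(1 - q * q ^ d) * qpoch_coeff a N (Suc d) = a * (q ^ N - q ^ d) * qpoch_coeff a N d"
      using Suc.IH[of d] by simp
    have 2: "(1 - q ^ d) * qpoch_coeff a N d = a * (q ^ N - q ^ d') * qpoch_coeff a N d'"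
      using Suc.IH[of d'] Suc by simp
    have "(1 - q ^ Suc d) * qpoch_coeff a (Suc N) (Suc d)
        = (1 - q * q ^ d) * qpoch_coeff a N (Suc d) - (1 - q * q ^ d) * (a * q ^ N * qpoch_coeff a N d)"
      by (simp add: qpoch_coeff_Suc right_diff_distrib)
    also have "\<dots> = a * (q * q ^ N - q ^ d) * qpoch_coeff a N d - a * q * q ^ N * ((1 - q ^ d) * qpoch_coeff a N d)"
      unfolding 1 by (simp add: algebra_simps)
    also have "\<dots> = a * (q * q ^ N - q ^ d) * qpoch_coeff a N d - a * (q * q ^ N - q ^ d) * (a * q ^ N * qpoch_coeff a N d')"
      unfolding 2 using Suc by (simp add: algebra_simps)
    finally show ?thesis using Suc by (simp add: qpoch_coeff_Suc right_diff_distrib)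
  qed
qed

text \<open>
  The two claims are proved together by induction on the degree: the limit has to be bounded in
  order to control the error terms.
\<close>

lemma qpoch_coeff_limit:
  assumes a: "q_adic_small 0 a"
  shows "q_adic_small N (qpoch_coeff a N d - euler_coeff a d)" and "q_adic_small 0 (euler_coeff a d)"
proof (induction d)
  case 0
  show "q_adic_small N (qpoch_coeff a N 0 - euler_coeff a 0)" by (simp add: qpoch_coeff_at_0 small_0)
  show "q_adic_small 0 (euler_coeff a 0)" using small_poly[of 1] by simp
next
  case (Suc d)
  have qd: "q_adic_small 0 (q ^ d)" using small_mono[OF small_q_power[of d], of 0] by simp
  have "q_adic_small (0 + 0 + 0 + 0) (- a * q ^ d * inverse (1 - q ^ Suc d) * euler_coeff a d)"
    by (intro small_mult small_uminus a qd small_inv Suc.IH)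
  then show "q_adic_small 0 (euler_coeff a (Suc d))" by simp
  have p: "q_adic_small 0 (qpoch_coeff a N d)"
    using small_add[OF small_mono[OF Suc.IH(1), of 0] Suc.IH(2)] by simp
  have n: "1 - q ^ Suc d \<noteq> 0" using q_power_neq1[of "Suc d"] by (metis eq_iff_diff_eq_0 zero_less_Suc)
  have "qpoch_coeff a N (Suc d) = inverse (1 - q ^ Suc d) * (a * (q ^ N - q ^ d) * qpoch_coeff a N d)"
    unfolding qpoch_coeff_rec[symmetric] using n by simp
  then have "qpoch_coeff a N (Suc d) - euler_coeff a (Suc d)
    = a * inverse (1 - q ^ Suc d) * (q ^ N * qpoch_coeff a N d - q ^ d * (qpoch_coeff a N d - euler_coeff a d))"
    by (simp add: algebra_simps del: power_Suc)
  moreover have "q_adic_small (0 + 0 + N) (a * inverse (1 - q ^ Suc d) * (q ^ N * qpoch_coeff a N d - q ^ d * (qpoch_coeff a N d - euler_coeff a d)))"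
    using small_mult[OF small_q_power p, of N] small_mult[OF qd Suc.IH(1)]
    by (intro small_mult a small_inv small_diff) simp_all
  ultimately show "q_adic_small N (qpoch_coeff a N (Suc d) - euler_coeff a (Suc d))" by simp
qed

lemma qpoch_inf_eq: assumes a: "q_adic_small 0 a" shows "qpoch_inf a = Abs_fps (euler_coeff a)"
  unfolding qpoch_inf_def qpoch_coeff_def[symmetric]
proof (rule the_equality)
  have lim: "q_adic_limit (\<lambda>N. qpoch_coeff a N d) (euler_coeff a d)" for d
    unfolding q_adic_limit_def using small_mono[OF qpoch_coeff_limit(1)[OF a]] by blast
  then show "\<forall>d. q_adic_limit (\<lambda>N. qpoch_coeff a N d) (fps_nth (Abs_fps (euler_coeff a)) d)" by simp
  fix F assume "\<forall>d. q_adic_limit (\<lambda>N. qpoch_coeff a N d) (fps_nth F d)"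
  then show "F = Abs_fps (euler_coeff a)" using limit_unique[OF _ lim] by (simp add: fps_eq_iff)
qed

section \<open>Rationality of the series with boundary vectors\<close>

text \<open>The series \<open>f(q z)\<close>.\<close>

definition dilate :: "kq fps \<Rightarrow> kq fps" where "dilate f = Abs_fps (\<lambda>m. q ^ m * fps_nth f m)"

lemma dilate_mult: "dilate (f * g) = dilate f * dilate g"
  unfolding dilate_def fps_compose_linear[symmetric]
  by (rule fps_compose_mult_distrib) simp

definition one_minus :: "kq \<Rightarrow> kq fps" where "one_minus a = 1 - fps_const a * fps_X"

lemma nth_one_minus_mult: "fps_nth (one_minus a * f) d = fps_nth f d - (if d = 0 then 0 else a * fps_nth f (d - 1))"
  unfolding one_minus_def left_diff_distrib mult.assoc by simp

lemma one_minus_nth_0 [simp]: "fps_nth (one_minus a) 0 = 1"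
  by (simp add: one_minus_def)

definition euler_series :: "kq \<Rightarrow> kq fps" where "euler_series a = Abs_fps (euler_coeff a)"

lemma one_minus_q_neq0: "1 - q ^ Suc d \<noteq> 0"
  using q_power_neq1[of "Suc d"] by (metis eq_iff_diff_eq_0 zero_less_Suc)

text \<open>
  The functional equation \<open>(a z; q)\<^sub>\<infinity> = (1 - a z) (a q z;
  q)\<^sub>\<infinity>\<close>.
\<close>

lemma euler_series_dilate: "euler_series a = one_minus a * dilate (euler_series a)"
proof (rule fps_ext)
  fix d
  show "fps_nth (euler_series a) d = fps_nth (one_minus a * dilate (euler_series a)) d"
  proof (cases d)
    case (Suc d')
    then show ?thesis using one_minus_q_neq0[of d']
      by (simp add: nth_one_minus_mult euler_series_def dilate_def field_simps)
  qed (simp add: nth_one_minus_mult euler_series_def dilate_def)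
qed

text \<open>
  The series \<open>\<Sum>\<^sub>m (a; q)\<^sub>m / (q)\<^sub>m z\<^sup>m\<close> of the
  \<open>q\<close>-binomial theorem.
\<close>

definition qbinom_series :: "kq \<Rightarrow> kq fps" where "qbinom_series a = Abs_fps (\<lambda>m. qpoch a q m / qpoch q q m)"

lemma qpoch_q_neq0 [simp]: "qpoch q q m \<noteq> 0"
  using one_minus_q_neq0 by (induction m) (simp_all add: qpoch_Suc)

lemma qbinom_series_dilate: "one_minus 1 * qbinom_series a = one_minus a * dilate (qbinom_series a)"
proof (rule fps_ext)
  fix d
  show "fps_nth (one_minus 1 * qbinom_series a) d = fps_nth (one_minus a * dilate (qbinom_series a)) d"
  proof (cases d)
    case (Suc d')
    have e: "qpoch a q (Suc d') / qpoch q q (Suc d') = (1 - a * q ^ d') / (1 - q ^ Suc d') * (qpoch a q d' / qpoch q q d')"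
      by (simp add: qpoch_Suc mult_ac)
    have nth: "fps_nth (qbinom_series a) m = qpoch a q m / qpoch q q m" for m by (simp add: qbinom_series_def)
    have "fps_nth (one_minus 1 * qbinom_series a) d - fps_nth (one_minus a * dilate (qbinom_series a)) d
      = (1 - q ^ Suc d') * fps_nth (qbinom_series a) (Suc d') - (1 - a * q ^ d') * fps_nth (qbinom_series a) d'"
      unfolding Suc nth_one_minus_mult dilate_def by (simp add: algebra_simps)
    also have "\<dots> = (1 - q ^ Suc d') * (qpoch a q (Suc d') / qpoch q q (Suc d')) - (1 - a * q ^ d') * (qpoch a q d' / qpoch q q d')"
      unfolding nth ..
    also have "\<dots> = 0" unfolding e using one_minus_q_neq0[of d'] by simp
    finally show ?thesis by simp
  qed (simp add: nth_one_minus_mult qbinom_series_def dilate_def)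
qed

lemma qpoch_shift: "qpoch a q (Suc m) = (1 - a) * qpoch (a * q) q m"
  by (induction m) (simp_all add: qpoch_Suc mult_ac)

lemma qbinom_series_shift: "qbinom_series a = one_minus a * qbinom_series (a * q)"
proof (rule fps_ext)
  fix d
  show "fps_nth (qbinom_series a) d = fps_nth (one_minus a * qbinom_series (a * q)) d"
  proof (cases d)
    case (Suc d')
    have "qpoch (a * q) q (Suc d') / qpoch q q (Suc d') - a * (qpoch (a * q) q d' / qpoch q q d')
       = (1 - a * q * q ^ d' - a * (1 - q ^ Suc d')) * (qpoch (a * q) q d' / qpoch q q (Suc d'))"
      using one_minus_q_neq0[of d'] by (simp add: qpoch_Suc field_simps)
    also have "\<dots> = (1 - a) * qpoch (a * q) q d' / qpoch q q (Suc d')" by (simp add: algebra_simps)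
    finally show ?thesis unfolding Suc nth_one_minus_mult qbinom_series_def qpoch_shift[symmetric] by simp
  qed (simp add: nth_one_minus_mult qbinom_series_def)
qed

text \<open>
  The \<open>q\<close>-binomial theorem for the parameter \<open>- q\<close>. Both sides satisfy
  \<open>f(z) = (1 + q z) f(q z)\<close> and have constant term 1; the functional equation
  determines all further coefficients, since \<open>1 - q\<^sup>d\<close> does not vanish for
  \<open>d > 0\<close>.
\<close>

lemma q_binomial: "euler_series 1 * qbinom_series (- q) = euler_series (- q)"
proof -
  let ?f = "euler_series 1 * qbinom_series (- q)"
  have "?f = one_minus (- q) * dilate ?f"
  proof -
    have "?f = dilate (euler_series 1) * (one_minus 1 * qbinom_series (- q))" by (subst euler_series_dilate) (simp only: mult_ac)
    also have "\<dots> = one_minus (- q) * dilate ?f" unfolding qbinom_series_dilate dilate_mult by (simp only: mult_ac)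
    finally show ?thesis .
  qed
  have uniq: "fps_nth f d = fps_nth g d" if f: "f = one_minus (- q) * dilate f" and g: "g = one_minus (- q) * dilate g"
    and "fps_nth f 0 = fps_nth g 0" for f g :: "kq fps" and d
  proof (induction d)
    case (Suc d)
    have rec: "(1 - q ^ Suc d) * fps_nth h (Suc d) = q * q ^ d * fps_nth h d" if h: "h = one_minus (- q) * dilate h" for h
      using arg_cong[OF h, of "\<lambda>u. fps_nth u (Suc d)"] unfolding nth_one_minus_mult dilate_def by (simp add: algebra_simps)
    show ?case using rec[OF f] rec[OF g] Suc one_minus_q_neq0[of d] by (metis mult_left_cancel)
  qed (fact that(3))
  show ?thesis
    by (rule fps_ext, rule uniq) (fact, rule euler_series_dilate, simp add: euler_series_def qbinom_series_def)
qed

abbreviation fl :: "kq fps \<Rightarrow> kq fls" where "fl \<equiv> fps_to_fls"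

lemma fl_mult: "fl (f * g) = fl f * fl g" by (simp add: fls_times_fps_to_fls)

lemma rational_one_minus: "rational (fl (one_minus a))"
proof -
  have "one_minus a = fps_of_poly [:1, - a:]" by (simp add: one_minus_def fps_of_poly_pCons)
  then show ?thesis using rational_pf by metis
qed

lemma one_minus_neq0: "fl (one_minus a) \<noteq> 0"
  using one_minus_nth_0[of a] by (metis fps_to_fls_eq_0_iff fps_zero_nth zero_neq_one)

definition dilate_powi :: "int \<Rightarrow> kq fps \<Rightarrow> kq fps" where
  "dilate_powi r f = Abs_fps (\<lambda>m. (q powi r) ^ m * fps_nth f m)"

lemma dilate_powi_mult: "dilate_powi r (f * g) = dilate_powi r f * dilate_powi r g"
  unfolding dilate_powi_def fps_compose_linear[symmetric]
  by (rule fps_compose_mult_distrib) simp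

lemma dilate_powi_dilate: "dilate_powi r (dilate f) = dilate_powi (r + 1) f"
  by (simp add: dilate_powi_def dilate_def q_powi_add power_mult_distrib mult_ac)

lemma dilate_powi_one_minus: "dilate_powi r (one_minus a) = one_minus (a * q powi r)"
proof (rule fps_ext)
  fix m
  show "fps_nth (dilate_powi r (one_minus a)) m = fps_nth (one_minus (a * q powi r)) m"
    by (cases "m = 1") (auto simp: dilate_powi_def one_minus_def fps_X_nth)
qed

lemma dilate_powi_0: "dilate_powi 0 f = f" by (rule fps_ext) (simp add: dilate_powi_def)

definition rho_rational :: "kq fps \<Rightarrow> bool" where "rho_rational f \<longleftrightarrow> rational (rho_11 * fl f)"

text \<open>
  Linear factors do not matter. This is what moves the parameters of
  \<open>qbinom_series\<close> by powers of \<open>q\<close> in the next lemmas.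
\<close>

lemma rho_rational_one_minus_mult: "rho_rational (one_minus a * f) \<longleftrightarrow> rho_rational f"
proof -
  have 1: "rho_11 * fl (one_minus a * f) = fl (one_minus a) * (rho_11 * fl f)" by (simp add: fl_mult mult_ac)
  have "rho_11 * fl f = inverse (fl (one_minus a)) * (rho_11 * fl (one_minus a * f))"
    unfolding 1 using one_minus_neq0[of a] by simp
  then show ?thesis unfolding rho_rational_def using 1 rational_one_minus by (metis rational_inverse rational_mult)
qed

lemma rho_11_eq: "rho_11 = fl (euler_series 1) / fl (euler_series (- q))"
proof -
  have "q_adic_small 0 1" using small_poly[of 1] by simp
  moreover have "q_adic_small 0 (- q)"
    using small_uminus[OF small_mono[OF small_q_power[of 1], of 0]] by simp
  ultimately show ?thesis unfolding rho_11_def euler_series_def by (simp add: qpoch_inf_eq)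
qed

text \<open>
  The normalization is chosen such that the product is even 1 here, by the
  \<open>q\<close>-binomial theorem.
\<close>

lemma rho_rational_qbinom_series_q: "rho_rational (qbinom_series (- q))"
proof -
  have "fl (euler_series (- q)) \<noteq> 0"
    by (metis euler_series_def fps_to_fls_eq_0_iff fps_nth_Abs_fps fps_zero_nth euler_coeff.simps(1) zero_neq_one)
  moreover have "fl (euler_series 1) * fl (qbinom_series (- q)) = fl (euler_series (- q))" by (simp only: fl_mult[symmetric] q_binomial)
  ultimately have "rho_11 * fl (qbinom_series (- q)) = 1" by (simp add: rho_11_eq)
  then show ?thesis by (simp add: rho_rational_def)
qed

lemma rho_rational_qbinom_series: "rho_rational (qbinom_series (- (q powi d)))"
proof (induction d rule: int_induct[where k = 1])
  case base
  then show ?case using rho_rational_qbinom_series_q by simp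
next
  case (step1 i)
  have "qbinom_series (- (q powi i)) = one_minus (- (q powi i)) * qbinom_series (- (q powi (i + 1)))"
    using qbinom_series_shift[of "- (q powi i)"] by (simp add: q_powi_add)
  then show ?case using step1 rho_rational_one_minus_mult by metis
next
  case (step2 i)
  have "qbinom_series (- (q powi (i - 1))) = one_minus (- (q powi (i - 1))) * qbinom_series (- (q powi i))"
    using qbinom_series_shift[of "- (q powi (i - 1))"] q_powi_add[of "i - 1" 1] by simp
  then show ?case using step2 rho_rational_one_minus_mult by metis
qed

lemma rho_rational_dilate_qbinom_series: "rho_rational (dilate_powi r (qbinom_series (- (q powi d))))"
proof -
  have step: "rho_rational (dilate_powi (r + 1) (qbinom_series a)) \<longleftrightarrow> rho_rational (dilate_powi r (qbinom_series a))" for r a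
  proof -
    have "one_minus (1 * q powi r) * dilate_powi r (qbinom_series a) = one_minus (a * q powi r) * dilate_powi (r + 1) (qbinom_series a)"
      unfolding dilate_powi_one_minus[symmetric] dilate_powi_dilate[symmetric] dilate_powi_mult[symmetric] qbinom_series_dilate ..
    then show ?thesis using rho_rational_one_minus_mult by metis
  qed
  show ?thesis
  proof (induction r rule: int_induct[where k = 0])
    case base
    then show ?case by (simp add: dilate_powi_0 rho_rational_qbinom_series)
  next
    case (step1 i)
    then show ?case using step by simp
  next
    case (step2 i)
    then show ?case using step[of "i - 1"] by simp
  qed
qed

lemma rho_rational_qexp: "qexp s \<Longrightarrow> rho_rational (Abs_fps (\<lambda>M. s (int M) * fps_nth (qbinom_series (- (q powi d))) M))"
proof (induction rule: qexp.induct)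
  case (base c r)
  have p: "q powi (r * int M) = (q powi r) ^ M" for M
    by (simp add: power_int_mult)
  have "Abs_fps (\<lambda>M. c * q powi (r * int M) * fps_nth (qbinom_series (- (q powi d))) M) = fps_const c * dilate_powi r (qbinom_series (- (q powi d)))"
    by (rule fps_ext) (simp add: dilate_powi_def p mult_ac)
  moreover have "rho_11 * fl (fps_const c * dilate_powi r (qbinom_series (- (q powi d)))) = zc c * (rho_11 * fl (dilate_powi r (qbinom_series (- (q powi d)))))"
    by (simp add: fl_mult zc_def mult_ac)
  ultimately show ?case using rho_rational_dilate_qbinom_series[of r d] unfolding rho_rational_def by (metis rational_mult rational_zc)
next
  case (sum f g)
  have "Abs_fps (\<lambda>M. (f (int M) + g (int M)) * fps_nth (qbinom_series (- (q powi d))) M)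
    = Abs_fps (\<lambda>M. f (int M) * fps_nth (qbinom_series (- (q powi d))) M) + Abs_fps (\<lambda>M. g (int M) * fps_nth (qbinom_series (- (q powi d))) M)"
    by (rule fps_ext) (simp add: distrib_right)
  then show ?case using sum.IH unfolding rho_rational_def by (simp add: distrib_left rational_add)
qed

lemma one_plus_q_powi_neq0: "1 + q powi e \<noteq> 0"
proof
  assume h: "1 + q powi e = 0"
  then have e: "q powi e = - 1" by (metis add.commute eq_neg_iff_add_eq_0)
  then have "q powi (2 * e) = 1" unfolding q_powi_2 by simp
  then have "e = 0" by (simp add: q_powi_eq1_iff)
  with h have "(2 :: kq) = 0" by simp
  moreover have "to_fract (1 + 1 :: complex poly) = 1 + 1" by (simp only: to_fract_add to_fract_1)
  ultimately have "to_fract (1 + 1 :: complex poly) = 0" by simp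
  then have "(1 + 1 :: complex poly) = 0" by (simp only: to_fract_eq_0_iff)
  then show False by simp
qed

lemma qpoch_neq0: "qpoch (- (q powi d)) q m \<noteq> 0"
proof (induction m)
  case (Suc m)
  have "1 - - (q powi d) * q ^ m = 1 + q powi (d + int m)" by (simp add: q_powi_add)
  then show ?case using Suc one_plus_q_powi_neq0[of "d + int m"] by (simp add: qpoch_Suc)
qed simp

lemma qpoch_add: "qpoch a q (m + l) = qpoch a q m * qpoch (a * q ^ m) q l"
  by (induction l) (simp_all add: qpoch_Suc power_add mult_ac)

lemma qpoch_plus_minus: "qpoch (q\<^sup>2) (q\<^sup>2) m = qpoch q q m * qpoch (- q) q m"
  by (induction m) (simp_all add: qpoch_Suc power2_eq_square power_mult_distrib algebra_simps)

lemma left_weight_nat: "left_weight (int m) = qpoch (- q) q m"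
  by (simp add: left_weight_def qpoch_plus_minus)

text \<open>
  In terms of \<open>M = c\<^sub>n\<close> the left weight is a multiple of \<open>(-
  q\<^sup>1\<^sup>-\<^sup>d; q)\<^sub>M\<close>, where \<open>d = c\<^sub>n - c\<^sub>0\<close>;
  together with the right weight it is a coefficient of \<open>qbinom_series\<close>.
\<close>

lemma left_weight_shift: "\<exists>K. \<forall>M. M - d \<ge> 0 \<longrightarrow> M \<ge> 0 \<longrightarrow> left_weight (M - d) = K * qpoch (- (q powi (1 - d))) q (nat M)"
proof (cases "d \<ge> 0")
  case True
  then obtain D where D: "d = int D" using nonneg_int_cases by blast
  let ?a = "- (q powi (1 - d))"
  have a: "?a * q ^ D = - q" using q_powi_add[of "1 - d" d] D by simp
  have "left_weight (M - d) = 1 / qpoch ?a q D * qpoch ?a q (nat M)" if "M - d \<ge> 0" for M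
  proof -
    from that obtain N where N: "M - d = int N" using nonneg_int_cases by blast
    then have "nat M = D + N" using D by simp
    then show ?thesis unfolding N left_weight_nat using qpoch_add[of ?a D N] a qpoch_neq0[of "1 - d" D] by simp
  qed
  then show ?thesis by blast
next
  case False
  then obtain D where D: "d = - int D" by (metis nonneg_int_cases linorder_le_cases minus_minus neg_0_le_iff_le)
  have a: "- q * q ^ D = - (q powi (1 - d))" using D by (simp add: q_powi_add)
  have "left_weight (M - d) = qpoch (- q) q D * qpoch (- (q powi (1 - d))) q (nat M)" if "M \<ge> 0" for M
  proof -
    from that obtain N where N: "M = int N" using nonneg_int_cases by blast
    have e: "M - d = int (D + N)" using D N by simp
    show ?thesis unfolding e left_weight_nat using qpoch_add[of "- q" D N] a N by simp
  qed
  then show ?thesis by blast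
qed

text \<open>
  Summation over \<open>M = c\<^sub>n\<close> instead of \<open>c\<^sub>0\<close> gives
  \<open>z\<^sup>-\<^sup>d\<close> times a series whose coefficients are an exponential sum
  times those of \<open>qbinom_series\<close>. The additional terms with \<open>c\<^sub>0 < 0
  \<le> c\<^sub>n\<close> vanish by \<open>chain_vanish\<close>.
\<close>

lemma rational_rho_series_11:
  assumes n: "n \<ge> 1"
  shows "rational (rho_11 * series (coeff_11 n eps a b i j))"
proof -
  interpret links n "n + 1" "\<lambda>k. k" by (rule links_11) fact
  define d where "d = path b j 0 n"
  define s where "s M = chain_11 n eps a b i j (path b j (M - d))" for M
  have pn: "path b j N n = N + d" for N by (simp add: d_def path_def)
  obtain K where K: "\<And>M. M - d \<ge> 0 \<Longrightarrow> M \<ge> 0 \<Longrightarrow> left_weight (M - d) = K * qpoch (- (q powi (1 - d))) q (nat M)"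
    using left_weight_shift by blast
  have qs: "qexp s" unfolding s_def using qexp_shift[OF qexp_chain, of "{1..n}" "\<lambda>k. k - 1" "\<lambda>k. k" eps a b i j b j "- d"] by simp
  define F where "F = Abs_fps (\<lambda>M. s (int M) * fps_nth (qbinom_series (- (q powi (1 - d)))) M)"
  have "rho_rational F" unfolding F_def by (rule rho_rational_qexp[OF qs])
  have "series (coeff_11 n eps a b i j) = zc K * (zX powi (- d) * fl F)"
  proof (rule fls_eqI)
    fix N
    have "zX powi (- d) * fl F = fls_shift d (fl F)"
      by (simp add: zX_def fls_shifted_times_simps)
    then have "fls_nth (zc K * (zX powi (- d) * fl F)) N = K * (if N + d < 0 then 0 else fps_nth F (nat (N + d)))"
      by (simp add: zc_def)
    also have "\<dots> = (if N < 0 then 0 else coeff_11 n eps a b i j N)"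
    proof (cases "N + d < 0")
      case True
      then show ?thesis by (simp add: coeff_11_def right_weight_def pn)
    next
      case False
      have z: "s (N + d) = 0" if "N < 0"
        unfolding s_def using that False pn[of N] by (intro chain_vanish[of _ 0]) auto
      show ?thesis
      proof (cases "N < 0")
        case True
        then show ?thesis using z False by (simp add: F_def)
      next
        case False': False
        then show ?thesis using False K[of "N + d"]
          by (simp add: F_def qbinom_series_def coeff_11_def right_weight_def pn s_def)
      qed
    qed
    finally show "fls_nth (series (coeff_11 n eps a b i j)) N = fls_nth (zc K * (zX powi (- d) * fl F)) N"
      by (simp add: series_def)
  qed
  then have e: "rho_11 * series (coeff_11 n eps a b i j) = zc K * (zX powi (- d) * (rho_11 * fl F))"
    by (simp only: mult_ac)
  show ?thesis unfolding e using \<open>rho_rational F\<close> unfolding rho_rational_def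
    by (rule rational_mult[OF rational_zc rational_mult[OF rational_powi[OF rational_zX]]])
qed

section \<open>From coefficients to values\<close>

text \<open>
  Taking the value at \<open>x / y\<close> is a ring homomorphism on rational series, so linear
  relations between coefficients become relations between values.
\<close>

lemma series_comb:
  assumes "\<And>N. N \<ge> 0 \<Longrightarrow> c1 * F1 N + c2 * F2 N = c3 * F3 N + c4 * F4 N"
    and r: "rational (rho * series F1)" "rational (rho * series F2)" "rational (rho * series F3)" "rational (rho * series F4)"
  shows "emb c1 * val (rho * series F1) + emb c2 * val (rho * series F2)
    = emb c3 * val (rho * series F3) + emb c4 * val (rho * series F4)"
proof -
  have "zc c1 * series F1 + zc c2 * series F2 = zc c3 * series F3 + zc c4 * series F4"
    by (rule fls_eqI) (simp add: zc_def series_def assms(1))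
  then have "rho * (zc c1 * series F1 + zc c2 * series F2) = rho * (zc c3 * series F3 + zc c4 * series F4)" by simp
  then have "zc c1 * (rho * series F1) + zc c2 * (rho * series F2) = zc c3 * (rho * series F3) + zc c4 * (rho * series F4)"
    by (simp only: distrib_left mult_ac)
  from arg_cong[OF this, of val] show ?thesis
    by (simp add: val_add val_mult r rational_mult)
qed

text \<open>
  A relation between coefficients of neighbouring degrees produces a factor \<open>zz\<close>.
  Its instance \<open>N = - 1\<close> is the relation between the constant terms.
\<close>

lemma series_comb1:
  assumes "\<And>N. N \<ge> - 1 \<Longrightarrow> c1 * F1 N + c2 * F2 (N + 1) = c3 * F3 (N + 1) + c4 * F4 N"
    and z: "F1 (- 1) = 0" "F4 (- 1) = 0"
    and r: "rational (rho * series F1)" "rational (rho * series F2)" "rational (rho * series F3)" "rational (rho * series F4)"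
  shows "zz * (emb c1 * val (rho * series F1)) + emb c2 * val (rho * series F2)
    = emb c3 * val (rho * series F3) + zz * (emb c4 * val (rho * series F4))"
proof -
  have sh: "fls_nth (zX * (zc c * series F)) N = (if N \<ge> 1 then c * F (N - 1) else 0)" for c F N
  proof -
    have "zX * (zc c * series F) = fls_shift (- 1) (zc c * series F)"
      by (simp add: zX_def fls_X_times_conv_shift)
    then show ?thesis by (simp add: zc_def series_def)
  qed
  have "zX * (zc c1 * series F1) + zc c2 * series F2 = zc c3 * series F3 + zX * (zc c4 * series F4)"
  proof (rule fls_eqI)
    fix N
    show "fls_nth (zX * (zc c1 * series F1) + zc c2 * series F2) N = fls_nth (zc c3 * series F3 + zX * (zc c4 * series F4)) N"
      using assms(1)[of "N - 1"] z unfolding fls_plus_nth sh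
      by (cases "N = 0") (auto simp: zc_def series_def)
  qed
  then have "rho * (zX * (zc c1 * series F1) + zc c2 * series F2) = rho * (zc c3 * series F3 + zX * (zc c4 * series F4))" by simp
  then have "zX * (zc c1 * (rho * series F1)) + zc c2 * (rho * series F2) = zc c3 * (rho * series F3) + zX * (zc c4 * (rho * series F4))"
    by (simp only: distrib_left mult_ac)
  from arg_cong[OF this, of val] show ?thesis
    by (simp add: val_add val_mult r rational_mult)
qed

lemma sum_bump: "(\<Sum>l=1..k. bump s d f l) = (\<Sum>l=1..k. f l) + (if 1 \<le> s \<and> s \<le> k then d else 0)"
  for f :: "nat \<Rightarrow> int"
proof -
  have "(\<Sum>l=1..k. bump s d f l) = (\<Sum>l=1..k. f l + (if l = s then d else 0))"
    by (rule sum.cong) (auto simp: bump_def)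
  then show ?thesis by (auto simp: sum.distrib)
qed

lemma path_bump_b: "path (bump s d b) j N k = path b j N k + (if 1 \<le> s \<and> s \<le> k then d else 0)"
  unfolding path_def sum_subtractf sum_bump by simp
lemma path_bump_j: "path b (bump s d j) N k = path b j N k - (if 1 \<le> s \<and> s \<le> k then d else 0)"
  unfolding path_def sum_subtractf sum_bump by simp
lemma bump_apply: "bump s d f k = f k + (if k = s then d else 0)"
  by (simp add: bump_def)

definition elem_tr where "elem_tr n eps l m a b i j = val (rho_tr n eps l m * series (coeff_tr n eps a b i j))"
definition elem_11 where "elem_11 n eps a b i j = val (rho_11 * series (coeff_11 n eps a b i j))"

lemma rational_rho_series_tr: "rational (rho_tr n eps l m * series (coeff_tr n eps a b i j))"
  by (rule rational_mult[OF rational_rho_tr rational_series_tr])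

definition all_allowed :: "nat \<Rightarrow> (nat \<Rightarrow> nat) \<Rightarrow> (nat \<Rightarrow> int) \<Rightarrow> bool" where
  "all_allowed n eps a \<longleftrightarrow> (\<forall>k\<in>{1..n}. allowed (eps k) (a k))"

lemma chain_tr_cong: "n \<ge> 1 \<Longrightarrow> (\<And>k. k < n \<Longrightarrow> C k = C' k) \<Longrightarrow> chain_tr n eps a b i j C = chain_tr n eps a b i j C'"
  by (rule chain_cong) auto
lemma chain_11_cong: "(\<And>k. k \<le> n \<Longrightarrow> C k = C' k) \<Longrightarrow> chain_11 n eps a b i j C = chain_11 n eps a b i j C'"
  by (rule chain_cong) auto

section \<open>Commutation relations for the trace\<close>

text \<open>The left neighbour of the site \<open>r + 1\<close> in the closed chain.\<close>

definition prev_site :: "nat \<Rightarrow> nat \<Rightarrow> nat" where "prev_site n r = (if r = 0 then n else r)"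

abbreviation shift_up where "shift_up n r f \<equiv> bump (Suc r) 1 (bump (prev_site n r) (-1) f)"
abbreviation shift_dn where "shift_dn n r f \<equiv> bump (Suc r) (-1) (bump (prev_site n r) 1 f)"

context
  fixes n r :: nat and eps :: "nat \<Rightarrow> nat" and a b i j :: "nat \<Rightarrow> int"
  assumes n: "n \<ge> 2" and rn: "r < n"
    and rg: "all_allowed n eps a" "all_allowed n eps b" "all_allowed n eps i" "all_allowed n eps j"
begin

interpretation ln: links n n "\<lambda>k. k mod n" by (rule links_tr) (use n in simp)

interpretation pr: pair_sites "{1..n}" "\<lambda>k. k - 1" "\<lambda>k. k mod n" eps "prev_site n r" "Suc r" r
  using n rn by unfold_locales (auto simp: prev_site_def mod_if split: if_splits)

lemma prev_site_in: "prev_site n r \<in> {1..n}" "Suc r \<in> {1..n}"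
  using n rn by (auto simp: prev_site_def)

lemma allowed_pair: "allowed (eps (prev_site n r)) (a (prev_site n r))" "allowed (eps (prev_site n r)) (b (prev_site n r))" "allowed (eps (prev_site n r)) (i (prev_site n r))" "allowed (eps (prev_site n r)) (j (prev_site n r))"
   "allowed (eps (Suc r)) (a (Suc r))" "allowed (eps (Suc r)) (b (Suc r))" "allowed (eps (Suc r)) (i (Suc r))" "allowed (eps (Suc r)) (j (Suc r))"
  using rg prev_site_in unfolding all_allowed_def by blast+

lemma path_shift_tr:
  assumes "k < n"
  shows "path (shift_dn n r b) j (N + of_bool (r = 0)) k = bump r 1 (path b j N) k"
    and "path b (shift_up n r j) (N + of_bool (r = 0)) k = bump r 1 (path b j N) k"
    and "path (shift_up n r b) j (N - of_bool (r = 0)) k = bump r (-1) (path b j N) k"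
    and "path b (shift_dn n r j) (N - of_bool (r = 0)) k = bump r (-1) (path b j N) k"
  using assms rn path_add[of _ _ N 1] path_add[of _ _ N "-1"]
  by (auto simp: path_bump_b path_bump_j bump_apply prev_site_def)

lemma chain_tr_zero_link:
  assumes "C 0 < 0" "\<And>l. 1 \<le> l \<Longrightarrow> l < n \<Longrightarrow> C l \<ge> 0"
  shows "chain_tr n eps a' b' i' j' C = 0"
proof -
  have "S3Z (eps 1) (a' 1) (b' 1) (C (1 - 1)) (i' 1) (j' 1) (C (1 mod n)) = 0"
    using assms n by (intro S3Z_vanish) auto
  then show ?thesis unfolding chain_def using n by (intro prod_zero) (auto intro!: bexI[of _ 1])
qed

text \<open>
  This is \<open>pair_e\<close> along the path. For \<open>r = 0\<close> the common link carries
  \<open>c\<^sub>0\<close> itself, so the degree moves along with it. In degree \<open>N = -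
  1\<close> only the two terms with the raised link are left. Then either all chains along the
  path vanish, and \<open>pair_e\<close> becomes the claim, or those along the raised path do,
  and the claim is trivial.
\<close>

lemma coeff_tr_e: "qn (a (prev_site n r) + 1) * coeff_tr n eps (shift_dn n r a) b i j N
     + tq (eps (prev_site n r)) powi (- a (prev_site n r)) * tq (eps (Suc r)) powi (a (Suc r)) * qn (b (prev_site n r) + 1) * coeff_tr n eps a (shift_dn n r b) i j (N + of_bool (r = 0))
   = qn (j (prev_site n r)) * coeff_tr n eps a b i (shift_up n r j) (N + of_bool (r = 0))
     + tq (eps (prev_site n r)) powi (- j (prev_site n r)) * tq (eps (Suc r)) powi (j (Suc r)) * qn (i (prev_site n r)) * coeff_tr n eps a b (shift_up n r i) j N"
proof -
  let ?C = "path b j N"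
  let ?C' = "bump r 1 ?C"
  note id = pr.pair_e[OF allowed_pair, of ?C]
  have 2: "chain_tr n eps a (shift_dn n r b) i j (path (shift_dn n r b) j (N + of_bool (r = 0))) = chain_tr n eps a (shift_dn n r b) i j ?C'"
    using n by (intro chain_tr_cong path_shift_tr) auto
  have 3: "chain_tr n eps a b i (shift_up n r j) (path b (shift_up n r j) (N + of_bool (r = 0))) = chain_tr n eps a b i (shift_up n r j) ?C'"
    using n by (intro chain_tr_cong path_shift_tr) auto
  consider "N \<ge> 0" | "N + of_bool (r = 0) < 0" | "r = 0" "N = - 1" by (cases "r = 0") force+
  then show ?thesis
  proof cases
    case 1
    then have "N + of_bool (r = 0) \<ge> 0" by simp
    then show ?thesis using 1 id unfolding coeff_tr_def by (simp only: 2 3 if_True)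
  next
    case 2
    then have "N < 0" by (cases "r = 0") auto
    then show ?thesis using 2 unfolding coeff_tr_def by simp
  next
    case r0: 3
    have "(\<forall>a' b' i' j'. chain_tr n eps a' b' i' j' ?C = 0) \<or> (\<forall>a' b' i' j'. chain_tr n eps a' b' i' j' ?C' = 0)"
    proof (cases "\<forall>l. 1 \<le> l \<longrightarrow> l < n \<longrightarrow> ?C l \<ge> 0")
      case True
      then show ?thesis using chain_tr_zero_link[of ?C] r0 by simp
    next
      case False
      then obtain l where "1 \<le> l" "l < n" "?C l < 0" by (auto simp: not_le)
      then have "chain_tr n eps a' b' i' j' ?C' = 0" for a' b' i' j'
        using r0 by (intro ln.chain_vanish[of _ l]) (simp_all add: bump_apply)
      then show ?thesis by simp
    qed
    then have "tq (eps (prev_site n r)) powi (- a (prev_site n r)) * tq (eps (Suc r)) powi (a (Suc r)) * qn (b (prev_site n r) + 1) * chain_tr n eps a (shift_dn n r b) i j ?C'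
      = qn (j (prev_site n r)) * chain_tr n eps a b i (shift_up n r j) ?C'"
      using id by auto
    moreover have "\<not> N \<ge> 0" "N + of_bool (r = 0) \<ge> 0" using r0 by auto
    ultimately show ?thesis unfolding coeff_tr_def by (simp only: 2 3 if_True if_False mult_zero_right add_0 add_0_right)
  qed
qed

text \<open>
  As for \<open>coeff_tr_e\<close>; the exceptional degree is \<open>N = 0\<close>, where the
  lowered link has the index \<open>- 1\<close>.
\<close>

lemma coeff_tr_f: "qn (b (Suc r) + 1) * coeff_tr n eps a (shift_up n r b) i j (N - of_bool (r = 0))
     + tq (eps (prev_site n r)) powi (b (prev_site n r)) * tq (eps (Suc r)) powi (- b (Suc r)) * qn (a (Suc r) + 1) * coeff_tr n eps (shift_up n r a) b i j N
   = qn (i (Suc r)) * coeff_tr n eps a b (shift_dn n r i) j N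
     + tq (eps (prev_site n r)) powi (i (prev_site n r)) * tq (eps (Suc r)) powi (- i (Suc r)) * qn (j (Suc r)) * coeff_tr n eps a b i (shift_dn n r j) (N - of_bool (r = 0))"
proof -
  let ?C = "path b j N"
  let ?C' = "bump r (-1) ?C"
  note id = pr.pair_f[OF allowed_pair, of ?C]
  have 2: "chain_tr n eps a (shift_up n r b) i j (path (shift_up n r b) j (N - of_bool (r = 0))) = chain_tr n eps a (shift_up n r b) i j ?C'"
    using n by (intro chain_tr_cong path_shift_tr) auto
  have 3: "chain_tr n eps a b i (shift_dn n r j) (path b (shift_dn n r j) (N - of_bool (r = 0))) = chain_tr n eps a b i (shift_dn n r j) ?C'"
    using n by (intro chain_tr_cong path_shift_tr) auto
  consider "N - of_bool (r = 0) \<ge> 0" | "N < 0" | "r = 0" "N = 0" by (cases "r = 0") force+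
  then show ?thesis
  proof cases
    case 1
    then have "N \<ge> 0" by (cases "r = 0") auto
    then show ?thesis using 1 id unfolding coeff_tr_def by (simp only: 2 3 if_True)
  next
    case 2
    then have "N - of_bool (r = 0) < 0" by (cases "r = 0") auto
    then show ?thesis using 2 unfolding coeff_tr_def by simp
  next
    case r0: 3
    have "(\<forall>a' b' i' j'. chain_tr n eps a' b' i' j' ?C = 0) \<or> (\<forall>a' b' i' j'. chain_tr n eps a' b' i' j' ?C' = 0)"
    proof (cases "\<forall>l. 1 \<le> l \<longrightarrow> l < n \<longrightarrow> ?C l \<ge> 0")
      case True
      then show ?thesis using chain_tr_zero_link[of ?C'] r0 by (simp add: bump_apply)
    next
      case False
      then obtain l where "1 \<le> l" "l < n" "?C l < 0" by (auto simp: not_le)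
      then have "chain_tr n eps a' b' i' j' ?C = 0" for a' b' i' j'
        using r0 by (intro ln.chain_vanish[of _ l]) simp_all
      then show ?thesis by simp
    qed
    then have "tq (eps (prev_site n r)) powi (b (prev_site n r)) * tq (eps (Suc r)) powi (- b (Suc r)) * qn (a (Suc r) + 1) * chain_tr n eps (shift_up n r a) b i j ?C
      = qn (i (Suc r)) * chain_tr n eps a b (shift_dn n r i) j ?C"
      using id by auto
    moreover have "N \<ge> 0" "\<not> N - of_bool (r = 0) \<ge> 0" using r0 by auto
    ultimately show ?thesis unfolding coeff_tr_def by (simp only: 2 3 if_True if_False mult_zero_right add_0 add_0_right)
  qed
qed

lemma elem_tr_e: "zz powi of_bool (r = 0) * (emb (qn (a (prev_site n r) + 1)) * elem_tr n eps l m (shift_dn n r a) b i j)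
     + emb (tq (eps (prev_site n r)) powi (- a (prev_site n r)) * tq (eps (Suc r)) powi (a (Suc r)) * qn (b (prev_site n r) + 1)) * elem_tr n eps l m a (shift_dn n r b) i j
   = emb (qn (j (prev_site n r))) * elem_tr n eps l m a b i (shift_up n r j)
     + zz powi of_bool (r = 0) * (emb (tq (eps (prev_site n r)) powi (- j (prev_site n r)) * tq (eps (Suc r)) powi (j (Suc r)) * qn (i (prev_site n r))) * elem_tr n eps l m a b (shift_up n r i) j)"
proof (cases "r = 0")
  case True
  have z: "coeff_tr n eps a' b' i' j' (- 1) = 0" for a' b' i' j' by (simp add: coeff_tr_def)
  have o: "zz powi of_bool (r = 0) = zz" "N + of_bool (r = 0) = N + 1" for N :: int using True by simp_all
  show ?thesis unfolding elem_tr_def o(1)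
    by (rule series_comb1) (rule coeff_tr_e[unfolded o(2)] z rational_rho_series_tr)+
next
  case False
  have o: "zz powi of_bool (r = 0) = 1" "N + of_bool (r = 0) = N" for N :: int using False by simp_all
  show ?thesis unfolding elem_tr_def o(1) mult_1
    by (rule series_comb) (rule coeff_tr_e[unfolded o(2)] rational_rho_series_tr)+
qed

lemma elem_tr_f: "zz powi of_bool (r = 0) * (emb (qn (b (Suc r) + 1)) * elem_tr n eps l m a (shift_up n r b) i j)
     + emb (tq (eps (prev_site n r)) powi (b (prev_site n r)) * tq (eps (Suc r)) powi (- b (Suc r)) * qn (a (Suc r) + 1)) * elem_tr n eps l m (shift_up n r a) b i j
   = emb (qn (i (Suc r))) * elem_tr n eps l m a b (shift_dn n r i) j
     + zz powi of_bool (r = 0) * (emb (tq (eps (prev_site n r)) powi (i (prev_site n r)) * tq (eps (Suc r)) powi (- i (Suc r)) * qn (j (Suc r))) * elem_tr n eps l m a b i (shift_dn n r j))"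
proof (cases "r = 0")
  case True
  have z: "coeff_tr n eps a' b' i' j' (- 1) = 0" for a' b' i' j' by (simp add: coeff_tr_def)
  have o: "zz powi of_bool (r = 0) = zz" "N + 1 - of_bool (r = 0) = N" for N :: int using True by simp_all
  show ?thesis unfolding elem_tr_def o(1)
    by (rule series_comb1) (rule coeff_tr_f[where N = "N + 1" for N, unfolded o(2)] z rational_rho_series_tr)+
next
  case False
  have o: "zz powi of_bool (r = 0) = 1" "N - of_bool (r = 0) = N" for N :: int using False by simp_all
  show ?thesis unfolding elem_tr_def o(1) mult_1
    by (rule series_comb) (rule coeff_tr_f[unfolded o(2)] rational_rho_series_tr)+
qed

end

section \<open>Commutation relations with boundary vectors\<close>

text \<open>
  The two recurrences of the boundary weights. The first one holds for all integers, since its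
  factor vanishes at \<open>k = - 1\<close>.
\<close>

lemma right_weight_rec: "right_weight k = (1 - q powi (k + 1)) * right_weight (k + 1)"
proof -
  consider "k \<ge> 0" | "k = - 1" | "k < - 1" by linarith
  then show ?thesis
  proof cases
    case 1
    then obtain m where m: "k = int m" using nonneg_int_cases by blast
    then have "right_weight (k + 1) = 1 / qpoch q q (Suc m)" by (simp add: right_weight_def nat_add_distrib)
    then show ?thesis using one_minus_q_neq0[of m] m by (simp add: right_weight_def qpoch_Suc q_powi_add mult.commute)
  qed (simp_all add: right_weight_def)
qed

lemma left_weight_rec: "N \<ge> 0 \<Longrightarrow> left_weight (N + 1) = (1 + q powi (N + 1)) * left_weight N"
proof -
  assume "N \<ge> 0"
  then obtain m where m: "N = int m" using nonneg_int_cases by blast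
  then have "N + 1 = int (Suc m)" by simp
  then have "left_weight (N + 1) = qpoch (- q) q (Suc m)" by (simp only: left_weight_nat)
  then show ?thesis unfolding m left_weight_nat by (simp add: qpoch_Suc q_powi_add mult.commute)
qed

lemma left_weight_neg [simp]: "N < 0 \<Longrightarrow> left_weight N = 0" by (simp add: left_weight_def)
lemma left_weight_0 [simp]: "left_weight 0 = 1" by (simp add: left_weight_def)

context
  fixes n :: nat and eps :: "nat \<Rightarrow> nat" and a b i j :: "nat \<Rightarrow> int"
  assumes n: "n \<ge> 1"
    and rg: "all_allowed n eps a" "all_allowed n eps b" "all_allowed n eps i" "all_allowed n eps j"
begin

interpretation ln: links n "n + 1" "\<lambda>k. k" by (rule links_11) (use n in simp)

abbreviation "G \<equiv> chain_11 n eps"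

text \<open>
  With the right weight as a factor, a negative index \<open>c\<^sub>0\<close> always gives 0:
  either \<open>c\<^sub>n\<close> is negative, or \<open>chain_vanish\<close> applies.
\<close>

lemma zero_11: "C 0 < 0 \<Longrightarrow> right_weight (C n) * G a' b' i' j' C = 0"
  using ln.chain_vanish[of C 0] by (cases "C n \<ge> 0") (auto simp: right_weight_def)

lemma elem_11_inner_e:
  assumes r: "1 \<le> r" "r < n"
  shows "emb (qn (a r + 1)) * elem_11 n eps (shift_dn n r a) b i j
     + emb (tq (eps r) powi (- a r) * tq (eps (Suc r)) powi (a (Suc r)) * qn (b r + 1)) * elem_11 n eps a (shift_dn n r b) i j
   = emb (qn (j r)) * elem_11 n eps a b i (shift_up n r j)
     + emb (tq (eps r) powi (- j r) * tq (eps (Suc r)) powi (j (Suc r)) * qn (i r)) * elem_11 n eps a b (shift_up n r i) j"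
  unfolding elem_11_def
proof (rule series_comb)
  interpret pr: pair_sites "{1..n}" "\<lambda>k. k - 1" "\<lambda>k. k" eps r "Suc r" r
    using r by unfold_locales auto
  have lo: "prev_site n r = r" using r by (simp add: prev_site_def)
  have ir: "allowed (eps r) (a r)" "allowed (eps r) (b r)" "allowed (eps r) (i r)" "allowed (eps r) (j r)"
   "allowed (eps (Suc r)) (a (Suc r))" "allowed (eps (Suc r)) (b (Suc r))" "allowed (eps (Suc r)) (i (Suc r))" "allowed (eps (Suc r)) (j (Suc r))"
    using rg r unfolding all_allowed_def by auto
  fix N
  let ?C = "path b j N"
  have p: "path (shift_dn n r b) j N k = bump r 1 ?C k" "path b (shift_up n r j) N k = bump r 1 ?C k" for k
    using r by (auto simp: path_bump_b path_bump_j bump_apply prev_site_def)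
  have "bump r 1 ?C n = ?C n" using r by simp
  then have w: "path (shift_dn n r b) j N n = ?C n" "path b (shift_up n r j) N n = ?C n" by (simp_all only: p)
  have 2: "G a (shift_dn n r b) i j (path (shift_dn n r b) j N) = G a (shift_dn n r b) i j (bump r 1 ?C)"
    by (rule chain_11_cong) (rule p)
  have 3: "G a b i (shift_up n r j) (path b (shift_up n r j) N) = G a b i (shift_up n r j) (bump r 1 ?C)"
    by (rule chain_11_cong) (rule p)
  from arg_cong[OF pr.pair_e[OF ir, of ?C], of "\<lambda>u. left_weight N * right_weight (?C n) * u"]
  show "qn (a r + 1) * coeff_11 n eps (shift_dn n r a) b i j N
     + tq (eps r) powi (- a r) * tq (eps (Suc r)) powi (a (Suc r)) * qn (b r + 1) * coeff_11 n eps a (shift_dn n r b) i j N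
   = qn (j r) * coeff_11 n eps a b i (shift_up n r j) N
     + tq (eps r) powi (- j r) * tq (eps (Suc r)) powi (j (Suc r)) * qn (i r) * coeff_11 n eps a b (shift_up n r i) j N"
    unfolding coeff_11_def w 2 3 unfolding lo by (simp only: distrib_left mult_ac)
qed (rule rational_rho_series_11[OF n])+

lemma elem_11_inner_f:
  assumes r: "1 \<le> r" "r < n"
  shows "emb (qn (b (Suc r) + 1)) * elem_11 n eps a (shift_up n r b) i j
     + emb (tq (eps r) powi (b r) * tq (eps (Suc r)) powi (- b (Suc r)) * qn (a (Suc r) + 1)) * elem_11 n eps (shift_up n r a) b i j
   = emb (qn (i (Suc r))) * elem_11 n eps a b (shift_dn n r i) j
     + emb (tq (eps r) powi (i r) * tq (eps (Suc r)) powi (- i (Suc r)) * qn (j (Suc r))) * elem_11 n eps a b i (shift_dn n r j)"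
  unfolding elem_11_def
proof (rule series_comb)
  interpret pr: pair_sites "{1..n}" "\<lambda>k. k - 1" "\<lambda>k. k" eps r "Suc r" r
    using r by unfold_locales auto
  have lo: "prev_site n r = r" using r by (simp add: prev_site_def)
  have ir: "allowed (eps r) (a r)" "allowed (eps r) (b r)" "allowed (eps r) (i r)" "allowed (eps r) (j r)"
   "allowed (eps (Suc r)) (a (Suc r))" "allowed (eps (Suc r)) (b (Suc r))" "allowed (eps (Suc r)) (i (Suc r))" "allowed (eps (Suc r)) (j (Suc r))"
    using rg r unfolding all_allowed_def by auto
  fix N
  let ?C = "path b j N"
  have p: "path (shift_up n r b) j N k = bump r (-1) ?C k" "path b (shift_dn n r j) N k = bump r (-1) ?C k" for k
    using r by (auto simp: path_bump_b path_bump_j bump_apply prev_site_def)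
  have "bump r (-1) ?C n = ?C n" using r by simp
  then have w: "path (shift_up n r b) j N n = ?C n" "path b (shift_dn n r j) N n = ?C n" by (simp_all only: p)
  have 2: "G a (shift_up n r b) i j (path (shift_up n r b) j N) = G a (shift_up n r b) i j (bump r (-1) ?C)"
    by (rule chain_11_cong) (rule p)
  have 3: "G a b i (shift_dn n r j) (path b (shift_dn n r j) N) = G a b i (shift_dn n r j) (bump r (-1) ?C)"
    by (rule chain_11_cong) (rule p)
  from arg_cong[OF pr.pair_f[OF ir, of ?C], of "\<lambda>u. left_weight N * right_weight (?C n) * u"]
  show "qn (b (Suc r) + 1) * coeff_11 n eps a (shift_up n r b) i j N
     + tq (eps r) powi (b r) * tq (eps (Suc r)) powi (- b (Suc r)) * qn (a (Suc r) + 1) * coeff_11 n eps (shift_up n r a) b i j N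
   = qn (i (Suc r)) * coeff_11 n eps a b (shift_dn n r i) j N
     + tq (eps r) powi (i r) * tq (eps (Suc r)) powi (- i (Suc r)) * qn (j (Suc r)) * coeff_11 n eps a b i (shift_dn n r j) N"
    unfolding coeff_11_def w 2 3 unfolding lo by (simp only: distrib_left mult_ac)
qed (rule rational_rho_series_11[OF n])+

interpretation lf: left_site "{1..n}" "\<lambda>k. k - 1" "\<lambda>k. k" eps 1 0
  using n by unfold_locales auto
interpretation rs: right_site "{1..n}" "\<lambda>k. k - 1" "\<lambda>k. k" eps n n
  using n by unfold_locales auto

lemma allowed_1: "allowed (eps 1) (a 1)" "allowed (eps 1) (b 1)" "allowed (eps 1) (i 1)" "allowed (eps 1) (j 1)"
  using rg n unfolding all_allowed_def by auto
lemma allowed_n: "allowed (eps n) (a n)" "allowed (eps n) (b n)" "allowed (eps n) (i n)" "allowed (eps n) (j n)"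
  using rg n unfolding all_allowed_def by auto

text \<open>
  The relations \<open>left_j_up\<close> and \<open>left_i_up\<close> reduce the four terms to
  two products \<open>A\<close> and \<open>B\<close> with the left weights of \<open>N\<close>
  and \<open>N + 1\<close> as factors; by \<open>left_weight_rec\<close> their coefficients
  cancel. In degree \<open>N = - 1\<close>, which the recurrence does not cover,
  \<open>A\<close> vanishes.
\<close>

lemma elem_11_left_e:
  "zz * (emb (- inverse q) * elem_11 n eps (bump 1 (-1) a) b i j) + emb (tq (eps 1) powi (a 1)) * elem_11 n eps a (bump 1 (-1) b) i j
   = emb (- inverse q) * elem_11 n eps a b i (bump 1 1 j) + zz * (emb (tq (eps 1) powi (j 1)) * elem_11 n eps a b (bump 1 1 i) j)"
  unfolding elem_11_def
proof (rule series_comb1)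
  fix N :: int assume N: "N \<ge> - 1"
  let ?C = "path b j N" and ?C' = "bump 0 1 (path b j N)"
  let ?A = "right_weight (?C n) * G (bump 1 (-1) a) b i j ?C" and ?B = "right_weight (?C n) * G a (bump 1 (-1) b) i j ?C'"
  have p: "path (bump 1 (-1) b) j (N + 1) k = ?C' k" "path b (bump 1 1 j) (N + 1) k = ?C' k" for k
    using path_add[of _ _ N 1 k] by (auto simp: path_bump_b path_bump_j bump_apply)
  have "?C' n = ?C n" using n by simp
  then have w: "path (bump 1 (-1) b) j (N + 1) n = ?C n" "path b (bump 1 1 j) (N + 1) n = ?C n" by (simp_all only: p)
  have g: "G a (bump 1 (-1) b) i j (path (bump 1 (-1) b) j (N + 1)) = G a (bump 1 (-1) b) i j ?C'"
    "G a b i (bump 1 1 j) (path b (bump 1 1 j) (N + 1)) = G a b i (bump 1 1 j) ?C'"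
    by (rule chain_11_cong, rule p)+
  have 1: "coeff_11 n eps (bump 1 (-1) a) b i j N = left_weight N * ?A" by (simp add: coeff_11_def)
  have 2: "coeff_11 n eps a (bump 1 (-1) b) i j (N + 1) = left_weight (N + 1) * ?B" unfolding coeff_11_def w g by simp
  have 3: "coeff_11 n eps a b i (bump 1 1 j) (N + 1) = left_weight (N + 1) * (?A - q powi (N + 2) * tq (eps 1) powi (a 1) * ?B)"
    using arg_cong[OF lf.left_j_up[where a = a and b = b and i = i and j = j and C = ?C, OF allowed_1], of "\<lambda>u. left_weight (N + 1) * (right_weight (?C n) * u)"] unfolding coeff_11_def w g
    by (simp add: algebra_simps)
  have 4: "tq (eps 1) powi (j 1) * coeff_11 n eps a b (bump 1 1 i) j N
      = left_weight N * (q powi N * ?A + tq (eps 1) powi (a 1) * br (N + 1) * ?B)"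
    using arg_cong[OF lf.left_i_up[where a = a and b = b and i = i and j = j and C = ?C, OF allowed_1], of "\<lambda>u. left_weight N * (right_weight (?C n) * u)"] unfolding coeff_11_def
    by (simp add: algebra_simps)
  show "- inverse q * coeff_11 n eps (bump 1 (-1) a) b i j N + tq (eps 1) powi (a 1) * coeff_11 n eps a (bump 1 (-1) b) i j (N + 1)
    = - inverse q * coeff_11 n eps a b i (bump 1 1 j) (N + 1) + tq (eps 1) powi (j 1) * coeff_11 n eps a b (bump 1 1 i) j N"
  proof (cases "N = - 1")
    case True
    then have A0: "?A = 0" by (intro zero_11) simp
    show ?thesis unfolding 1 2 3 4 A0 using True by simp
  next
    case False
    then have W: "left_weight (N + 1) = (1 + q powi (N + 1)) * left_weight N" using N by (intro left_weight_rec) simp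
    have e: "q powi (N + 2) = q * (q * q powi N)" "q powi (N + 1) = q * q powi N"
      by (simp_all add: q_powi_add power2_eq_square)
    have gen: "- inverse q * (w * A) + x * ((1 + q * u) * w * B)
      = - inverse q * ((1 + q * u) * w * (A - q * (q * u) * x * B)) + w * (u * A + x * (1 - (q * u)\<^sup>2) * B)" for w A x u B
      by (simp add: field_simps power2_eq_square)
    show ?thesis unfolding 1 2 3 4 W e br_def by (rule gen)
  qed
next
  show "coeff_11 n eps (bump 1 (-1) a) b i j (- 1) = 0" "coeff_11 n eps a b (bump 1 1 i) j (- 1) = 0"
    by (simp_all add: coeff_11_def)
qed (rule rational_rho_series_11[OF n])+

lemma elem_11_left_f:
  "zz * (emb (qn (b 1 + 1)) * elem_11 n eps a (bump 1 1 b) i j) + emb (tq (eps 1) powi (- b 1) * qn (a 1 + 1)) * elem_11 n eps (bump 1 1 a) b i j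
   = emb (qn (i 1)) * elem_11 n eps a b (bump 1 (-1) i) j + zz * (emb (tq (eps 1) powi (- i 1) * qn (j 1)) * elem_11 n eps a b i (bump 1 (-1) j))"
  unfolding elem_11_def
proof (rule series_comb1)
  fix N :: int assume N: "N \<ge> - 1"
  let ?C = "path b j (N + 1)" and ?C' = "bump 0 (-1) (path b j (N + 1))"
  let ?A = "right_weight (?C n) * (qn (b 1 + 1) * G a (bump 1 1 b) i j ?C')"
    and ?B = "right_weight (?C n) * (tq (eps 1) powi (- b 1) * qn (a 1 + 1) * G (bump 1 1 a) b i j ?C)"
  have p: "path (bump 1 1 b) j N k = ?C' k" "path b (bump 1 (-1) j) N k = ?C' k" for k
    using path_add[of _ _ N 1 k] by (auto simp: path_bump_b path_bump_j bump_apply)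
  have Cn: "?C' n = ?C n" using n by simp
  then have w: "path (bump 1 1 b) j N n = ?C n" "path b (bump 1 (-1) j) N n = ?C n" by (simp_all only: p)
  have g: "G a (bump 1 1 b) i j (path (bump 1 1 b) j N) = G a (bump 1 1 b) i j ?C'"
    "G a b i (bump 1 (-1) j) (path b (bump 1 (-1) j) N) = G a b i (bump 1 (-1) j) ?C'"
    by (rule chain_11_cong, rule p)+
  have 1: "qn (b 1 + 1) * coeff_11 n eps a (bump 1 1 b) i j N = left_weight N * ?A" unfolding coeff_11_def w g by (simp only: mult_ac)
  have 2: "tq (eps 1) powi (- b 1) * qn (a 1 + 1) * coeff_11 n eps (bump 1 1 a) b i j (N + 1) = left_weight (N + 1) * ?B"
    unfolding coeff_11_def by (simp only: mult_ac)
  have 3: "qn (i 1) * coeff_11 n eps a b (bump 1 (-1) i) j (N + 1) = left_weight (N + 1) * (?A + q powi (N + 1) * ?B)"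
    using arg_cong[OF lf.left_i_down[where a = a and b = b and i = i and j = j and C = ?C, OF allowed_1], of "\<lambda>u. left_weight (N + 1) * (right_weight (?C n) * u)"] unfolding coeff_11_def
    by (simp add: algebra_simps)
  have 4: "tq (eps 1) powi (- i 1) * qn (j 1) * coeff_11 n eps a b i (bump 1 (-1) j) N
      = left_weight N * (br (N + 1) * ?B - q powi (N + 1) * ?A)"
    using arg_cong[OF lf.left_j_down[where a = a and b = b and i = i and j = j and C = ?C, OF allowed_1], of "\<lambda>u. left_weight N * (right_weight (?C n) * u)"] unfolding coeff_11_def w g
    by (simp add: algebra_simps)
  show "qn (b 1 + 1) * coeff_11 n eps a (bump 1 1 b) i j N + tq (eps 1) powi (- b 1) * qn (a 1 + 1) * coeff_11 n eps (bump 1 1 a) b i j (N + 1)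
    = qn (i 1) * coeff_11 n eps a b (bump 1 (-1) i) j (N + 1) + tq (eps 1) powi (- i 1) * qn (j 1) * coeff_11 n eps a b i (bump 1 (-1) j) N"
  proof (cases "N = - 1")
    case True
    then have "right_weight (?C' n) * G a (bump 1 1 b) i j ?C' = 0" by (intro zero_11) simp
    then have A0: "?A = 0" unfolding Cn by auto
    show ?thesis unfolding 1 2 3 4 A0 using True by simp
  next
    case False
    then have W: "left_weight (N + 1) = (1 + q powi (N + 1)) * left_weight N" using N by (intro left_weight_rec) simp
    have gen: "w * A + (1 + u) * w * B = (1 + u) * w * (A + u * B) + w * ((1 - u\<^sup>2) * B - u * A)" for w A u B :: kq
      by (simp add: algebra_simps power2_eq_square)
    show ?thesis unfolding 1 2 3 4 W br_def by (rule gen)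
  qed
next
  show "coeff_11 n eps a (bump 1 1 b) i j (- 1) = 0" "coeff_11 n eps a b i (bump 1 (-1) j) (- 1) = 0"
    by (simp_all add: coeff_11_def)
qed (rule rational_rho_series_11[OF n])+

text \<open>
  At the right end the degree does not change, but \<open>c\<^sub>n\<close> does: here
  \<open>right_weight_rec\<close> makes the coefficients of the two products \<open>X\<close>
  and \<open>Y\<close> cancel.
\<close>

lemma elem_11_right_e:
  "emb (qn (a n + 1)) * elem_11 n eps (bump n 1 a) b i j + emb (- inverse q * tq (eps n) powi (- a n) * qn (b n + 1)) * elem_11 n eps a (bump n 1 b) i j
   = emb (qn (j n)) * elem_11 n eps a b i (bump n (-1) j) + emb (- inverse q * tq (eps n) powi (- j n) * qn (i n)) * elem_11 n eps a b (bump n (-1) i) j"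
  unfolding elem_11_def
proof (rule series_comb)
  fix N :: int
  let ?C = "path b j N" and ?C' = "bump n 1 (path b j N)"
  let ?k = "?C n"
  let ?X = "qn (j n) * G a b i (bump n (-1) j) ?C'" and ?Y = "tq (eps n) powi (- j n) * qn (i n) * G a b (bump n (-1) i) j ?C"
  have p: "path (bump n 1 b) j N k = ?C' k" "path b (bump n (-1) j) N k = ?C' k" if "k \<le> n" for k
    using n that by (auto simp: path_bump_b path_bump_j bump_apply)
  have w: "path (bump n 1 b) j N n = ?k + 1" "path b (bump n (-1) j) N n = ?k + 1" by (simp_all add: p)
  have g: "G a (bump n 1 b) i j (path (bump n 1 b) j N) = G a (bump n 1 b) i j ?C'"
    "G a b i (bump n (-1) j) (path b (bump n (-1) j) N) = G a b i (bump n (-1) j) ?C'"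
    by (rule chain_11_cong, erule p)+
  have 1: "qn (a n + 1) * coeff_11 n eps (bump n 1 a) b i j N = left_weight N * right_weight ?k * (?X + q powi ?k * ?Y)"
    using arg_cong[OF rs.right_a_up[where a = a and b = b and i = i and j = j and C = ?C, OF allowed_n], of "\<lambda>u. left_weight N * right_weight ?k * u"] unfolding coeff_11_def
    by (simp add: algebra_simps)
  have 2: "tq (eps n) powi (- a n) * qn (b n + 1) * coeff_11 n eps a (bump n 1 b) i j N = left_weight N * right_weight (?k + 1) * (br (?k + 1) * ?Y - q powi (?k + 2) * ?X)"
    using arg_cong[OF rs.right_b_up[where a = a and b = b and i = i and j = j and C = ?C, OF allowed_n], of "\<lambda>u. left_weight N * right_weight (?k + 1) * u"] unfolding coeff_11_def w g
    by (simp add: algebra_simps)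
  have 3: "qn (j n) * coeff_11 n eps a b i (bump n (-1) j) N = left_weight N * right_weight (?k + 1) * ?X"
    unfolding coeff_11_def w g by (simp only: mult_ac)
  have 4: "tq (eps n) powi (- j n) * qn (i n) * coeff_11 n eps a b (bump n (-1) i) j N = left_weight N * right_weight ?k * ?Y"
    unfolding coeff_11_def by (simp only: mult_ac)
  have e: "q powi (?k + 2) = q * (q * q powi ?k)" "q powi (?k + 1) = q * q powi ?k"
    by (simp_all add: q_powi_add power2_eq_square)
  have gen: "w * ((1 - q * u) * v) * (X + u * Y) + - inverse q * (w * v * ((1 - (q * u)\<^sup>2) * Y - q * (q * u) * X))
    = w * v * X + - inverse q * (w * ((1 - q * u) * v) * Y)" for w u v X Y
    by (simp add: field_simps power2_eq_square)
  show "qn (a n + 1) * coeff_11 n eps (bump n 1 a) b i j N + - inverse q * tq (eps n) powi (- a n) * qn (b n + 1) * coeff_11 n eps a (bump n 1 b) i j N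
   = qn (j n) * coeff_11 n eps a b i (bump n (-1) j) N + - inverse q * tq (eps n) powi (- j n) * qn (i n) * coeff_11 n eps a b (bump n (-1) i) j N"
    unfolding mult.assoc[of "- inverse q" "_ powi _"] mult.assoc[of "- inverse q" "_ powi _ * _"] 1 2 3 4
    unfolding right_weight_rec[of ?k] br_def e by (rule gen)
qed (rule rational_rho_series_11[OF n])+

lemma elem_11_right_f:
  "emb 1 * elem_11 n eps a (bump n (-1) b) i j + emb (tq (eps n) powi (b n)) * elem_11 n eps (bump n (-1) a) b i j
   = emb 1 * elem_11 n eps a b (bump n 1 i) j + emb (tq (eps n) powi (i n)) * elem_11 n eps a b i (bump n 1 j)"
  unfolding elem_11_def
proof (rule series_comb)
  fix N :: int
  let ?C = "path b j N" and ?C' = "bump n (-1) (path b j N)"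
  let ?k = "?C n"
  let ?X = "G a b (bump n 1 i) j ?C" and ?Y = "tq (eps n) powi (i n) * G a b i (bump n 1 j) ?C'"
  have p: "path (bump n (-1) b) j N k = ?C' k" "path b (bump n 1 j) N k = ?C' k" if "k \<le> n" for k
    using n that by (auto simp: path_bump_b path_bump_j bump_apply)
  have w: "path (bump n (-1) b) j N n = ?k - 1" "path b (bump n 1 j) N n = ?k - 1" by (simp_all add: p)
  have g: "G a (bump n (-1) b) i j (path (bump n (-1) b) j N) = G a (bump n (-1) b) i j ?C'"
    "G a b i (bump n 1 j) (path b (bump n 1 j) N) = G a b i (bump n 1 j) ?C'"
    by (rule chain_11_cong, erule p)+
  have 1: "coeff_11 n eps a (bump n (-1) b) i j N = left_weight N * right_weight (?k - 1) * (?X - q powi ?k * ?Y)"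
    using arg_cong[OF rs.right_b_down[where a = a and b = b and i = i and j = j and C = ?C, OF allowed_n], of "\<lambda>u. left_weight N * right_weight (?k - 1) * u"] unfolding coeff_11_def w g
    by (simp add: algebra_simps)
  have 2: "tq (eps n) powi (b n) * coeff_11 n eps (bump n (-1) a) b i j N = left_weight N * right_weight ?k * (q powi ?k * ?X + br ?k * ?Y)"
    using arg_cong[OF rs.right_a_down[where a = a and b = b and i = i and j = j and C = ?C, OF allowed_n], of "\<lambda>u. left_weight N * right_weight ?k * u"] unfolding coeff_11_def
    by (simp add: algebra_simps)
  have 3: "coeff_11 n eps a b (bump n 1 i) j N = left_weight N * right_weight ?k * ?X"
    unfolding coeff_11_def by (simp only: mult_ac)
  have 4: "tq (eps n) powi (i n) * coeff_11 n eps a b i (bump n 1 j) N = left_weight N * right_weight (?k - 1) * ?Y"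
    unfolding coeff_11_def w g by (simp only: mult_ac)
  have v: "right_weight (?k - 1) = (1 - q powi ?k) * right_weight ?k" using right_weight_rec[of "?k - 1"] by simp
  have gen: "1 * (w * ((1 - u) * v) * (X - u * Y)) + w * v * (u * X + (1 - u\<^sup>2) * Y)
    = 1 * (w * v * X) + w * ((1 - u) * v) * Y" for w u v X Y :: kq
    by (simp add: algebra_simps power2_eq_square)
  show "1 * coeff_11 n eps a (bump n (-1) b) i j N + tq (eps n) powi (b n) * coeff_11 n eps (bump n (-1) a) b i j N
   = 1 * coeff_11 n eps a b (bump n 1 i) j N + tq (eps n) powi (i n) * coeff_11 n eps a b i (bump n 1 j) N"
    unfolding 1 2 3 4 v br_def by (rule gen)
qed (rule rational_rho_series_11[OF n])+

end

section \<open>Linear algebra on finitely supported functions\<close>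

lemma lookup_scl [simp]: "Poly_Mapping.lookup (scl c v) k = c * Poly_Mapping.lookup v k"
  for c :: "'a :: semiring_0"
  unfolding scl_def by (simp add: Poly_Mapping.map.rep_eq when_def)

lemma lookup_ket: "Poly_Mapping.lookup (ket b) k = of_bool (b = k)"
  by (simp add: ket_def lookup_single when_def)

lemma lookup_lin: "Poly_Mapping.lookup (lin f v) k
    = (\<Sum>b\<in>Poly_Mapping.keys v. Poly_Mapping.lookup v b * Poly_Mapping.lookup (f b) k)"
  unfolding lin_def by (simp add: lookup_sum)

lemma lookup_lin_superset:
  assumes "finite A" "Poly_Mapping.keys v \<subseteq> A"
  shows "Poly_Mapping.lookup (lin f v) k = (\<Sum>b\<in>A. Poly_Mapping.lookup v b * Poly_Mapping.lookup (f b) k)"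
  unfolding lookup_lin using assms
  by (intro sum.mono_neutral_left) (auto simp: in_keys_iff)

lemma lin_ket [simp]: "lin f (ket b) = f b"
  by (rule poly_mapping_eqI) (simp add: lookup_lin ket_def)

lemma lin_0 [simp]: "lin f 0 = 0" by (simp add: lin_def)

lemma lin_add: "lin f (v + w) = lin f v + lin f w"
proof (rule poly_mapping_eqI)
  fix k
  let ?A = "Poly_Mapping.keys v \<union> Poly_Mapping.keys w"
  have "Poly_Mapping.keys (v + w) \<subseteq> ?A" by (rule keys_add)
  then show "Poly_Mapping.lookup (lin f (v + w)) k = Poly_Mapping.lookup (lin f v + lin f w) k"
    using lookup_lin_superset[of ?A v f k] lookup_lin_superset[of ?A w f k] lookup_lin_superset[of ?A "v + w" f k]
    by (simp add: lookup_add distrib_right sum.distrib)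
qed

lemma keys_scl: "Poly_Mapping.keys (scl c v) \<subseteq> Poly_Mapping.keys v" for c :: kxy
  by (auto simp: in_keys_iff)

lemma lin_scl: "lin f (scl c v) = scl c (lin f v)"
proof (rule poly_mapping_eqI)
  fix k
  show "Poly_Mapping.lookup (lin f (scl c v)) k = Poly_Mapping.lookup (scl c (lin f v)) k"
    unfolding lookup_lin_superset[OF finite_keys keys_scl]
    by (simp add: lookup_lin sum_distrib_left mult.assoc)
qed

lemma scl_1 [simp]: "scl (1 :: kxy) v = v" by (rule poly_mapping_eqI) simp
lemma scl_0 [simp]: "scl (0 :: kxy) v = 0" by (rule poly_mapping_eqI) simp
lemma scl_zero [simp]: "scl (c :: kxy) 0 = 0" by (rule poly_mapping_eqI) simp
lemma scl_scl [simp]: "scl c (scl d v) = scl (c * d) v" for c d :: kxy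
  by (rule poly_mapping_eqI) (simp add: mult.assoc)
lemma scl_add: "scl c (v + w) = scl c v + scl c w" for c :: kxy
  by (rule poly_mapping_eqI) (simp add: lookup_add distrib_left)
lemma scl_diff: "scl c (v - w) = scl c v - scl c w" for c :: kxy
  by (rule poly_mapping_eqI) (simp add: lookup_minus right_diff_distrib)
lemma scl_add_left: "scl (c + d) v = scl c v + scl d v" for c d :: kxy
  by (rule poly_mapping_eqI) (simp add: lookup_add distrib_right)
lemma scl_uminus_1: "scl (- 1 :: kxy) v = - v"
  by (rule poly_mapping_eqI) simp

lemma lin_uminus: "lin f (- v) = - lin f v"
  unfolding scl_uminus_1[symmetric] lin_scl ..
lemma lin_diff: "lin f (v - w) = lin f v - lin f w"
  using lin_add[of f v "- w"] by (simp add: lin_uminus)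

lemma lin_cong: "(\<And>b. b \<in> Poly_Mapping.keys v \<Longrightarrow> f b = g b) \<Longrightarrow> lin f v = lin g v"
  unfolding lin_def by (rule sum.cong) auto

lemma lin_ket_id [simp]: "lin ket v = v"
proof (rule poly_mapping_eqI)
  fix k
  show "Poly_Mapping.lookup (lin ket v) k = Poly_Mapping.lookup v k"
    by (cases "k \<in> Poly_Mapping.keys v") (auto simp: lookup_lin lookup_ket in_keys_iff Int_insert_right)
qed

lemma lin_lin: "lin f (lin g v) = lin (\<lambda>b. lin f (g b)) v"
proof -
  have sum: "lin f (sum h A) = (\<Sum>x\<in>A. lin f (h x))" for h :: "'d \<Rightarrow> _" and A
    by (induction A rule: infinite_finite_induct) (simp_all add: lin_add)
  show ?thesis unfolding lin_def[of g] lin_def[of "\<lambda>b. lin f (g b)"] sum lin_scl ..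
qed

lemma lin_of_add: "lin (\<lambda>b. f b + g b) v = lin f v + lin g v"
  by (rule poly_mapping_eqI) (simp add: lookup_lin lookup_add distrib_left sum.distrib)
lemma lin_of_scl: "lin (\<lambda>b. scl c (f b)) v = scl c (lin f v)"
  by (rule poly_mapping_eqI) (simp add: lookup_lin sum_distrib_left mult_ac)
lemma lin_of_0 [simp]: "lin (\<lambda>b. 0) v = 0"
  by (rule poly_mapping_eqI) (simp add: lookup_lin)

lemma lookup_tens: "Poly_Mapping.lookup (v \<otimes>\<^sub>v w) (b, c) = Poly_Mapping.lookup v b * Poly_Mapping.lookup w c"
proof -
  have "lin (\<lambda>c. ket (b', c)) w = lin (\<lambda>c. ket (b', c)) (lin ket w)" for b' by simp
  have 1: "Poly_Mapping.lookup (lin (\<lambda>c. ket (b', c)) w) (b, c) = (if b' = b then Poly_Mapping.lookup w c else 0)" for b'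
  proof -
    have "Poly_Mapping.lookup (lin (\<lambda>c. ket (b', c)) w) (b, c) = (if b' = b then Poly_Mapping.lookup (lin ket w) c else 0)"
      unfolding lookup_lin lookup_ket by auto
    then show ?thesis by simp
  qed
  have "Poly_Mapping.lookup (v \<otimes>\<^sub>v w) (b, c)
    = (\<Sum>b'\<in>Poly_Mapping.keys v. if b' = b then Poly_Mapping.lookup v b * Poly_Mapping.lookup w c else 0)"
    unfolding tens_def lookup_lin[of _ v] 1 by (rule sum.cong) auto
  then show ?thesis by (auto simp: in_keys_iff)
qed

lemma vec2_eqI: "(\<And>b c. Poly_Mapping.lookup v (b, c) = Poly_Mapping.lookup w (b, c)) \<Longrightarrow> v = w"
  by (rule poly_mapping_eqI) (metis surj_pair)

lemma tens_add_left: "(v + v') \<otimes>\<^sub>v w = v \<otimes>\<^sub>v w + v' \<otimes>\<^sub>v w"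
  by (rule vec2_eqI) (simp add: lookup_tens lookup_add distrib_right)
lemma tens_add_right: "v \<otimes>\<^sub>v (w + w') = v \<otimes>\<^sub>v w + v \<otimes>\<^sub>v w'"
  by (rule vec2_eqI) (simp add: lookup_tens lookup_add distrib_left)
lemma tens_diff_left: "(v - v') \<otimes>\<^sub>v w = v \<otimes>\<^sub>v w - v' \<otimes>\<^sub>v w"
  by (rule vec2_eqI) (simp add: lookup_tens lookup_minus left_diff_distrib)
lemma tens_diff_right: "v \<otimes>\<^sub>v (w - w') = v \<otimes>\<^sub>v w - v \<otimes>\<^sub>v w'"
  by (rule vec2_eqI) (simp add: lookup_tens lookup_minus right_diff_distrib)
lemma tens_scl_left: "scl c v \<otimes>\<^sub>v w = scl c (v \<otimes>\<^sub>v w)"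
  by (rule vec2_eqI) (simp add: lookup_tens)
lemma tens_scl_right: "v \<otimes>\<^sub>v scl c w = scl c (v \<otimes>\<^sub>v w)"
  by (rule vec2_eqI) (simp add: lookup_tens)
lemma tens_0_left [simp]: "0 \<otimes>\<^sub>v w = 0" by (rule vec2_eqI) (simp add: lookup_tens)
lemma tens_0_right [simp]: "v \<otimes>\<^sub>v 0 = 0" by (rule vec2_eqI) (simp add: lookup_tens)
lemma tens_ket: "ket b \<otimes>\<^sub>v ket c = ket (b, c)"
  by (simp add: tens_def)

lemmas tens_simps = tens_add_left tens_add_right tens_diff_left tens_diff_right tens_scl_left tens_scl_right

lemma keys_tens: "Poly_Mapping.keys (v \<otimes>\<^sub>v w) \<subseteq> Poly_Mapping.keys v \<times> Poly_Mapping.keys w"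
  by (auto simp: in_keys_iff lookup_tens)

lemma lin_tens: "lin (\<lambda>(b, c). lin f (ket b) \<otimes>\<^sub>v lin g (ket c)) (v \<otimes>\<^sub>v w) = lin f v \<otimes>\<^sub>v lin g w"
proof (rule vec2_eqI)
  fix b c
  show "Poly_Mapping.lookup (lin (\<lambda>(b, c). lin f (ket b) \<otimes>\<^sub>v lin g (ket c)) (v \<otimes>\<^sub>v w)) (b, c)
    = Poly_Mapping.lookup (lin f v \<otimes>\<^sub>v lin g w) (b, c)"
    unfolding lookup_lin_superset[OF finite_cartesian_product[OF finite_keys finite_keys] keys_tens]
    unfolding lookup_tens lookup_lin[of f] lookup_lin[of g] sum_product sum.cartesian_product
    by (intro sum.cong) (auto simp: lookup_tens mult_ac)
qed

definition kspan :: "'b set \<Rightarrow> ('b \<Rightarrow>\<^sub>0 kxy) set" where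
  "kspan B = {v. Poly_Mapping.keys v \<subseteq> B}"

lemma span_0 [simp]: "0 \<in> kspan B" by (simp add: kspan_def)
lemma span_ket [simp]: "ket b \<in> kspan B \<longleftrightarrow> b \<in> B" by (simp add: kspan_def ket_def)
lemma span_add: "v \<in> kspan B \<Longrightarrow> w \<in> kspan B \<Longrightarrow> v + w \<in> kspan B"
  using keys_add[of v w] by (auto simp: kspan_def)
lemma span_scl: "v \<in> kspan B \<Longrightarrow> scl c v \<in> kspan B"
  using keys_scl[of c v] by (auto simp: kspan_def)
lemma span_diff: "v \<in> kspan B \<Longrightarrow> w \<in> kspan B \<Longrightarrow> v - w \<in> kspan B"
  using span_add[of v B "scl (-1) w"] span_scl[of w B "-1"] by (simp add: scl_uminus_1)
lemma span_sum: "(\<And>x. x \<in> A \<Longrightarrow> f x \<in> kspan B) \<Longrightarrow> sum f A \<in> kspan B"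
  by (induction A rule: infinite_finite_induct) (auto intro: span_add)
lemma span_lin: "v \<in> kspan B \<Longrightarrow> (\<And>b. b \<in> B \<Longrightarrow> f b \<in> kspan B') \<Longrightarrow> lin f v \<in> kspan B'"
  unfolding lin_def by (intro span_sum span_scl) (auto simp: kspan_def)
lemma span_tens: "v \<in> kspan B \<Longrightarrow> w \<in> kspan B' \<Longrightarrow> v \<otimes>\<^sub>v w \<in> kspan (B \<times> B')"
  using keys_tens[of v w] by (auto simp: kspan_def)
lemma lin_cong_span: "v \<in> kspan B \<Longrightarrow> (\<And>b. b \<in> B \<Longrightarrow> f b = g b) \<Longrightarrow> lin f v = lin g v"
  by (rule lin_cong) (auto simp: kspan_def)

section \<open>Representations of the free algebra\<close>

definition act_word :: "(gen \<Rightarrow> 'b \<Rightarrow> ('b \<Rightarrow>\<^sub>0 kxy)) \<Rightarrow> gword \<Rightarrow> ('b \<Rightarrow>\<^sub>0 kxy) \<Rightarrow> ('b \<Rightarrow>\<^sub>0 kxy)" where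
  "act_word S w = foldr (\<lambda>s. lin (S s)) (letters w)"

definition act :: "(gen \<Rightarrow> 'b \<Rightarrow> ('b \<Rightarrow>\<^sub>0 kxy)) \<Rightarrow> free \<Rightarrow> ('b \<Rightarrow>\<^sub>0 kxy) \<Rightarrow> ('b \<Rightarrow>\<^sub>0 kxy)" where
  "act S g v = lin (\<lambda>w. act_word S w v) g"

lemma act_word_lin: "act_word S w v = lin (\<lambda>b. act_word S w (ket b)) v"
proof -
  have "foldr (\<lambda>s. lin (S s)) l v = lin (\<lambda>b. foldr (\<lambda>s. lin (S s)) l (ket b)) v" for l
    by (induction l) (simp_all add: lin_lin)
  then show ?thesis unfolding act_word_def .
qed

lemma act_word_0 [simp]: "act_word S w 0 = 0" by (subst act_word_lin) simp
lemma act_word_zero [simp]: "act_word S 0 v = v" by (simp add: act_word_def zero_gword_def)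
lemma act_word_plus: "act_word S (u + w) v = act_word S u (act_word S w v)" by (simp add: act_word_def plus_gword_def)
lemma act_word_add: "act_word S w (v + v') = act_word S w v + act_word S w v'"
  by (subst (1 2 3) act_word_lin) (simp add: lin_add)
lemma act_word_scl: "act_word S w (scl c v) = scl c (act_word S w v)"
  by (subst (1 2) act_word_lin) (simp add: lin_scl)

lemma act_add: "act S (g + h) v = act S g v + act S h v" by (simp add: act_def lin_add)
lemma act_diff: "act S (g - h) v = act S g v - act S h v" by (simp add: act_def lin_diff)
lemma act_scl: "act S (scl c g) v = scl c (act S g v)" by (simp add: act_def lin_scl)
lemma act_ket: "act S (ket w) v = act_word S w v" by (simp add: act_def)
lemma act_0_right [simp]: "act S g 0 = 0" by (simp add: act_def)
lemma act_add_right: "act S g (v + v') = act S g v + act S g v'" by (simp add: act_def act_word_add lin_of_add)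
lemma act_scl_right: "act S g (scl c v) = scl c (act S g v)" by (simp add: act_def act_word_scl lin_of_scl)

lemma linear_induct [case_names zero add scl ket]:
  assumes "P 0" "\<And>v w. P v \<Longrightarrow> P w \<Longrightarrow> P (v + w)" "\<And>c v. P v \<Longrightarrow> P (scl c v)" "\<And>b. P (ket b)"
  shows "P (v :: 'b \<Rightarrow>\<^sub>0 kxy)"
proof -
  have sumP: "P (sum f A)" if "\<And>x. x \<in> A \<Longrightarrow> P (f x)" for f :: "'b \<Rightarrow> _" and A
    using that by (induction A rule: infinite_finite_induct) (auto intro: assms)
  have "P (lin ket v)" unfolding lin_def by (rule sumP, rule assms(3), rule assms(4))
  then show ?thesis by simp
qed

lemma single_induct [case_names zero add single]:
  assumes "P 0" "\<And>v w. P v \<Longrightarrow> P w \<Longrightarrow> P (v + w)" "\<And>b c. P (Poly_Mapping.single b c)"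
  shows "P (v :: 'b \<Rightarrow>\<^sub>0 kxy)"
proof -
  have s: "scl c (ket b) = Poly_Mapping.single b c" for c and b :: 'b
    by (rule poly_mapping_eqI) (simp add: lookup_ket lookup_single when_def)
  have sumP: "P (sum f A)" if "\<And>x. x \<in> A \<Longrightarrow> P (f x)" for f :: "'b \<Rightarrow> _" and A
    using that by (induction A rule: infinite_finite_induct) (auto intro: assms)
  have "P (lin ket v)" unfolding lin_def s by (rule sumP, rule assms(3))
  then show ?thesis by simp
qed

lemma scl_single: "scl c (Poly_Mapping.single b d) = Poly_Mapping.single b (c * d)" for c :: kxy
  by (rule poly_mapping_eqI) (simp add: lookup_single when_def)

lemma ket_mult: "ket u * ket w = ket (u + w)"
  by (simp add: ket_def mult_single)
lemma scl_mult_left: "scl c v * w = scl c (v * w)" for v :: "'b :: monoid_add \<Rightarrow>\<^sub>0 kxy"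
proof (induction v rule: single_induct)
  case (single b d)
  show ?case
    by (induction w rule: single_induct) (simp_all add: scl_single scl_add distrib_left mult_single mult.assoc)
qed (simp_all add: scl_add distrib_right)

lemma scl_mult_right: "v * scl c w = scl c (v * w)" for v :: "'b :: monoid_add \<Rightarrow>\<^sub>0 kxy"
proof (induction v rule: single_induct)
  case (single b d)
  show ?case
    by (induction w rule: single_induct) (simp_all add: scl_single scl_add distrib_left mult_single mult.left_commute)
qed (simp_all add: scl_add distrib_right)

lemma one_ket: "1 = ket 0"
  by (simp add: ket_def single_one)

lemma act_mult: "act S (g * h) v = act S g (act S h v)"
proof (induction g rule: linear_induct)
  case (ket u)
  show ?case
    by (induction h rule: linear_induct)
      (simp_all add: act_add act_scl distrib_left scl_mult_right ket_mult act_ket act_word_plus act_word_add act_word_scl,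
       simp add: act_def)
next
  case zero
  show ?case by (simp add: act_def)
qed (simp_all add: act_add act_scl distrib_right scl_mult_left)

lemma act_one: "act S 1 v = v"
  by (simp add: one_ket act_ket)

lemma act_gn: "act S (gn s) v = lin (S s) v"
  by (simp add: gn_def act_ket act_word_def)

section \<open>Representations of the quotient algebra\<close>

text \<open>
  An action of the generators on the span of \<open>B\<close> that factors through the quotient algebra.
\<close>

definition represents :: "nat \<Rightarrow> (nat \<Rightarrow> nat \<Rightarrow> kxy) \<Rightarrow> (nat \<Rightarrow> kxy) \<Rightarrow> (gen \<Rightarrow> 'b \<Rightarrow> ('b \<Rightarrow>\<^sub>0 kxy)) \<Rightarrow> 'b set \<Rightarrow> bool" where
  "represents N D r S B \<longleftrightarrow>
    (\<forall>s b. gidx s \<le> N \<longrightarrow> b \<in> B \<longrightarrow> S s b \<in> kspan B) \<and>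
    (\<forall>g\<in>relators N D r. \<forall>b\<in>B. act S g (ket b) = 0)"

lemma act_lin: "act S g v = lin (\<lambda>b. act S g (ket b)) v"
  by (induction v rule: linear_induct) (simp_all add: act_add_right act_scl_right lin_add lin_scl)

lemma represents_span:
  assumes "represents N D r S B" "gidx s \<le> N" "v \<in> kspan B"
  shows "lin (S s) v \<in> kspan B"
  using assms unfolding represents_def by (intro span_lin[of v B]) auto

lemma act_word_span:
  assumes "represents N D r S B" "w \<in> words N" "v \<in> kspan B"
  shows "act_word S w v \<in> kspan B"
proof -
  have "foldr (\<lambda>s. lin (S s)) l v \<in> kspan B" if "\<forall>s\<in>set l. gidx s \<le> N" for l
    using that by (induction l) (auto intro: represents_span[OF assms(1)] assms(3))
  then show ?thesis using assms(2) unfolding act_word_def words_def by auto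
qed

lemma act_span:
  assumes "represents N D r S B" "g \<in> carrier (free_ring N)" "v \<in> kspan B"
  shows "act S g v \<in> kspan B"
  unfolding act_def using assms by (intro span_lin[of g "words N"] act_word_span[OF assms(1)]) (auto simp: free_ring_def kspan_def)

lemma carrier_free: "carrier (free_ring N) = kspan (words N)"
  by (simp add: free_ring_def kspan_def)
lemma carrier_free2: "carrier (free_ring2 N) = kspan (words N \<times> words N)"
  by (simp add: free_ring2_def kspan_def)

lemma span_mult:
  fixes v w :: "'b :: monoid_add \<Rightarrow>\<^sub>0 kxy"
  assumes "\<And>a b. a \<in> A \<Longrightarrow> b \<in> A \<Longrightarrow> a + b \<in> A" "v \<in> kspan A" "w \<in> kspan A"
  shows "v * w \<in> kspan A"
proof -
  have "k \<in> A" if "k \<in> Poly_Mapping.keys (v * w)" for k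
  proof -
    have "k \<in> {a + b |a b. a \<in> Poly_Mapping.keys v \<and> b \<in> Poly_Mapping.keys w}" using that keys_mult by blast
    then show ?thesis using assms unfolding kspan_def by auto
  qed
  then show ?thesis unfolding kspan_def by auto
qed

lemma words_plus: "u \<in> words N \<Longrightarrow> w \<in> words N \<Longrightarrow> u + w \<in> words N"
  by (auto simp: words_def plus_gword_def)
lemma words_zero: "0 \<in> words N" by (simp add: words_def zero_gword_def)

lemma ring_span:
  fixes A :: "'b :: monoid_add set"
  assumes "\<And>a b. a \<in> A \<Longrightarrow> b \<in> A \<Longrightarrow> a + b \<in> A" "0 \<in> A"
  shows "ring \<lparr>carrier = kspan A, mult = (*), one = 1, zero = 0, add = ((+) :: ('b \<Rightarrow>\<^sub>0 kxy) \<Rightarrow> _)\<rparr>"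
proof (rule ringI)
  show "abelian_group \<lparr>carrier = kspan A, mult = (*), one = 1, zero = 0, add = ((+) :: ('b \<Rightarrow>\<^sub>0 kxy) \<Rightarrow> _)\<rparr>"
  proof (rule abelian_groupI)
    fix x assume "x \<in> carrier \<lparr>carrier = kspan A, mult = (*), one = 1, zero = 0, add = ((+) :: ('b \<Rightarrow>\<^sub>0 kxy) \<Rightarrow> _)\<rparr>"
    then have "- x \<in> kspan A" using span_diff[of 0 A x] by simp
    then show "\<exists>y\<in>carrier \<lparr>carrier = kspan A, mult = (*), one = 1, zero = 0, add = ((+) :: ('b \<Rightarrow>\<^sub>0 kxy) \<Rightarrow> _)\<rparr>.
      y \<oplus>\<^bsub>\<lparr>carrier = kspan A, mult = (*), one = 1, zero = 0, add = (+)\<rparr>\<^esub> x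
        = \<zero>\<^bsub>\<lparr>carrier = kspan A, mult = (*), one = 1, zero = 0, add = ((+) :: ('b \<Rightarrow>\<^sub>0 kxy) \<Rightarrow> _)\<rparr>\<^esub>"
      by (auto intro!: bexI[of _ "- x"])
  qed (auto simp: span_add add_ac)
  show "Group.monoid \<lparr>carrier = kspan A, mult = (*), one = 1, zero = 0, add = ((+) :: ('b \<Rightarrow>\<^sub>0 kxy) \<Rightarrow> _)\<rparr>"
  proof -
    have "(1 :: 'b \<Rightarrow>\<^sub>0 kxy) \<in> kspan A" using assms(2) by (simp add: one_ket)
    then show ?thesis by unfold_locales (use assms in \<open>auto simp: mult.assoc intro: span_mult\<close>)
  qed
qed (auto simp: distrib_left distrib_right)

lemma ring_free: "ring (free_ring N)"
  using ring_span[OF words_plus words_zero] unfolding free_ring_def kspan_def .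
lemma ring_free2: "ring (free_ring2 N)"
proof -
  have "ring \<lparr>carrier = kspan (words N \<times> words N), mult = (*), one = 1, zero = 0, add = ((+) :: free2 \<Rightarrow> _)\<rparr>"
    by (rule ring_span) (auto simp: words_plus words_zero zero_prod_def)
  then show ?thesis unfolding free_ring2_def kspan_def .
qed

lemma free_ring_simps:
  "\<zero>\<^bsub>free_ring N\<^esub> = 0" "x \<oplus>\<^bsub>free_ring N\<^esub> y = x + y" "x \<otimes>\<^bsub>free_ring N\<^esub> y = x * y"
  "\<zero>\<^bsub>free_ring2 N\<^esub> = 0" "x' \<oplus>\<^bsub>free_ring2 N\<^esub> y' = x' + y'" "x' \<otimes>\<^bsub>free_ring2 N\<^esub> y' = x' * y'"
  by (simp_all add: free_ring_def free_ring2_def)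

lemma idealI':
  assumes "ring R" "I \<subseteq> carrier R" "\<zero>\<^bsub>R\<^esub> \<in> I" "\<And>x y. x \<in> I \<Longrightarrow> y \<in> I \<Longrightarrow> x \<oplus>\<^bsub>R\<^esub> y \<in> I"
    "\<And>x. x \<in> I \<Longrightarrow> \<ominus>\<^bsub>R\<^esub> x \<in> I"
    "\<And>a x. a \<in> I \<Longrightarrow> x \<in> carrier R \<Longrightarrow> x \<otimes>\<^bsub>R\<^esub> a \<in> I" "\<And>a x. a \<in> I \<Longrightarrow> x \<in> carrier R \<Longrightarrow> a \<otimes>\<^bsub>R\<^esub> x \<in> I"
  shows "ideal I R"
proof (rule idealI)
  show "subgroup I (add_monoid R)"
    using assms by unfold_locales (auto simp: a_inv_def)
qed (use assms in auto)

lemma uminus_free: "x \<in> carrier (free_ring N) \<Longrightarrow> \<ominus>\<^bsub>free_ring N\<^esub> x = - x"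
proof -
  interpret ring "free_ring N" by (rule ring_free)
  assume x: "x \<in> carrier (free_ring N)"
  then have "- x \<in> carrier (free_ring N)" unfolding carrier_free using span_diff[of 0 _ x] by simp
  then show ?thesis using x by (intro minus_equality) (simp_all add: free_ring_simps)
qed
lemma uminus_free2: "x \<in> carrier (free_ring2 N) \<Longrightarrow> \<ominus>\<^bsub>free_ring2 N\<^esub> x = - x"
proof -
  interpret ring "free_ring2 N" by (rule ring_free2)
  assume x: "x \<in> carrier (free_ring2 N)"
  then have "- x \<in> carrier (free_ring2 N)" unfolding carrier_free2 using span_diff[of 0 _ x] by simp
  then show ?thesis using x by (intro minus_equality) (simp_all add: free_ring_simps)
qed

lemma gn_span: "gidx s \<le> N \<Longrightarrow> gn s \<in> kspan (words N)"
  by (simp add: gn_def words_def)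

lemma relators_carrier: "relators N D r \<subseteq> carrier (free_ring N)"
proof -
  have m: "x * y \<in> kspan (words N)" if "x \<in> kspan (words N)" "y \<in> kspan (words N)" for x y
    using that by (intro span_mult words_plus)
  have 1: "1 \<in> kspan (words N)" by (simp add: one_ket words_zero)
  show ?thesis unfolding relators_def carrier_free
    by (auto intro!: span_diff span_scl m gn_span 1)
qed

lemma act_minus: "act S (- g) v = - act S g v"
  by (simp add: act_def lin_uminus)

text \<open>
  The elements of the free algebra that annihilate the span of \<open>B\<close> form an ideal,
  which contains the relators.
\<close>

lemma represents_ideal:
  assumes represents: "represents N D r S B" and g: "g \<in> rel_ideal N D r" and v: "v \<in> kspan B"
  shows "act S g v = 0" and "g \<in> carrier (free_ring N)"
proof -
  define I where "I = {g \<in> carrier (free_ring N). \<forall>v\<in>kspan B. act S g v = 0}"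
  interpret ring "free_ring N" by (rule ring_free)
  have "ideal I (free_ring N)"
  proof (rule idealI'[OF ring_free])
    show "\<zero>\<^bsub>free_ring N\<^esub> \<in> I" by (simp add: I_def free_ring_simps(1) act_def carrier_free)
    show "x \<oplus>\<^bsub>free_ring N\<^esub> y \<in> I" if "x \<in> I" "y \<in> I" for x y
      using that unfolding I_def free_ring_simps carrier_free by (auto simp: act_add span_add)
    show "\<ominus>\<^bsub>free_ring N\<^esub> x \<in> I" if "x \<in> I" for x
    proof -
      have "x \<in> carrier (free_ring N)" using that by (simp add: I_def)
      then have "\<ominus>\<^bsub>free_ring N\<^esub> x \<in> carrier (free_ring N)" "\<ominus>\<^bsub>free_ring N\<^esub> x = - x"
        using a_inv_closed[of x] uminus_free[of x] by auto
      then show ?thesis using that unfolding I_def by (auto simp: act_minus)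
    qed
    show "x \<otimes>\<^bsub>free_ring N\<^esub> a \<in> I" if "a \<in> I" "x \<in> carrier (free_ring N)" for a x
    proof -
      have "x \<otimes>\<^bsub>free_ring N\<^esub> a \<in> carrier (free_ring N)" using that by (intro m_closed) (auto simp: I_def)
      then show ?thesis using that unfolding I_def by (auto simp: free_ring_simps act_mult)
    qed
    show "a \<otimes>\<^bsub>free_ring N\<^esub> x \<in> I" if "a \<in> I" "x \<in> carrier (free_ring N)" for a x
    proof -
      have "a \<otimes>\<^bsub>free_ring N\<^esub> x \<in> carrier (free_ring N)" using that by (intro m_closed) (auto simp: I_def)
      then show ?thesis using that act_span[OF represents that(2)] unfolding I_def by (auto simp: free_ring_simps act_mult)
    qed
  qed (auto simp: I_def)
  moreover have "relators N D r \<subseteq> I"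
  proof
    fix g assume g: "g \<in> relators N D r"
    have "act S g v = 0" if "v \<in> kspan B" for v
      using lin_cong_span[OF that, of "\<lambda>b. act S g (ket b)" "\<lambda>_. 0"] g represents
      unfolding represents_def by (subst act_lin) auto
    then show "g \<in> I" using relators_carrier g unfolding I_def by blast
  qed
  ultimately have "g \<in> I" using g unfolding rel_ideal_def genideal_def by blast
  then show "act S g v = 0" "g \<in> carrier (free_ring N)" using v by (auto simp: I_def)
qed

section \<open>Tensor products\<close>

text \<open>
  With the flag \<open>f\<close> set, the two tensor factors of \<open>t\<close> are exchanged
  first. So the coproduct and its opposite are treated at once.
\<close>

definition act2 :: "bool \<Rightarrow> (gen \<Rightarrow> mindex \<Rightarrow> vec) \<Rightarrow> (gen \<Rightarrow> mindex \<Rightarrow> vec) \<Rightarrow> free2 \<Rightarrow> vec2 \<Rightarrow> vec2" where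
  "act2 f R R' t V = lin (\<lambda>(u, w). tens_op (act_word R (if f then w else u)) (act_word R' (if f then u else w)) V) t"

lemma rep_word_act_word: "rep_word R = act_word R"
  by (simp add: rep_word_def act_word_def fun_eq_iff)

lemma rep2_free_act2: "rep2_free R R' t V = act2 False R R' t V"
  by (simp add: rep2_free_def act2_def rep_word_act_word)

lemma act2_add: "act2 f R R' (t + t') V = act2 f R R' t V + act2 f R R' t' V" by (simp add: act2_def lin_add)
lemma act2_scl: "act2 f R R' (scl c t) V = scl c (act2 f R R' t V)" by (simp add: act2_def lin_scl)
lemma act2_0 [simp]: "act2 f R R' 0 V = 0" by (simp add: act2_def)
lemma act2_uminus: "act2 f R R' (- t) V = - act2 f R R' t V" by (simp add: act2_def lin_uminus)

lemma tens_op_tens: "tens_op (act_word R u) (act_word R' w) (v \<otimes>\<^sub>v v') = act_word R u v \<otimes>\<^sub>v act_word R' w v'"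
  unfolding tens_op_def using lin_tens[of "\<lambda>b. act_word R u (ket b)" "\<lambda>b. act_word R' w (ket b)" v v']
  by (simp flip: act_word_lin)

lemma tens_op_lin: "tens_op A B V = lin (\<lambda>b. tens_op A B (ket b)) V"
  unfolding tens_op_def lin_ket by simp

lemma act2_lin: "act2 f R R' t V = lin (\<lambda>b. act2 f R R' t (ket b)) V"
proof (induction t rule: linear_induct)
  case (ket b)
  obtain u w where b: "b = (u, w)" by (cases b)
  show ?case unfolding act2_def lin_ket b prod.case by (rule tens_op_lin)
qed (simp_all add: act2_add act2_scl lin_of_add lin_of_scl)

lemma act2_add_right: "act2 f R R' t (V + W) = act2 f R R' t V + act2 f R R' t W"
  by (subst (1 2 3) act2_lin) (simp add: lin_add)
lemma act2_scl_right: "act2 f R R' t (scl c V) = scl c (act2 f R R' t V)"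
  by (subst (1 2) act2_lin) (simp add: lin_scl)
lemma act2_0_right [simp]: "act2 f R R' t 0 = 0"
  by (subst act2_lin) simp

lemma act2_ket_tens: "act2 f R R' (ket (u, w)) (v \<otimes>\<^sub>v v')
    = act_word R (if f then w else u) v \<otimes>\<^sub>v act_word R' (if f then u else w) v'"
  by (simp add: act2_def tens_op_tens)

lemma act2_tens: "act2 f R R' (g \<otimes>\<^sub>v h) (v \<otimes>\<^sub>v v')
    = act R (if f then h else g) v \<otimes>\<^sub>v act R' (if f then g else h) v'"
proof (induction g rule: linear_induct)
  case (ket u)
  show ?case
  proof (induction h rule: linear_induct)
    case (ket w)
    show ?case by (simp add: tens_ket act2_ket_tens act_ket)
  qed (simp_all add: tens_simps act2_add act2_scl act_add act_scl, simp add: act_def)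
qed (simp_all add: tens_simps act2_add act2_scl act_add act_scl, simp add: act_def)

lemma act2_mult: "act2 f R R' (t * t') V = act2 f R R' t (act2 f R R' t' V)"
proof (induction V rule: linear_induct)
  case (ket b)
  obtain b1 b2 where b: "b = (b1, b2)" by (cases b)
  show ?case
  proof (induction t rule: linear_induct)
    case k: (ket a)
    obtain a1 a2 where a: "a = (a1, a2)" by (cases a)
    show ?case
    proof (induction t' rule: linear_induct)
      case (ket a')
      obtain a1' a2' where a': "a' = (a1', a2')" by (cases a')
      have "ket a * ket a' = ket (a1 + a1', a2 + a2')" unfolding a a' ket_mult by (simp add: plus_prod_def)
      moreover have "ket b = ket b1 \<otimes>\<^sub>v ket b2" unfolding b by (simp add: tens_ket)
      ultimately show ?case unfolding a a' by (simp only: act2_ket_tens act_word_plus if_distrib split: if_split) simp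
    qed (simp_all add: distrib_left scl_mult_right act2_add act2_scl act2_add_right act2_scl_right)
  qed (simp_all add: distrib_right scl_mult_left act2_add act2_scl)
qed (simp_all add: act2_add_right act2_scl_right)

text \<open>
  The tensor product representation defined by the coproduct, or by its opposite if
  \<open>f\<close> is set.
\<close>

definition cop_act :: "bool \<Rightarrow> (gen \<Rightarrow> mindex \<Rightarrow> vec) \<Rightarrow> (gen \<Rightarrow> mindex \<Rightarrow> vec) \<Rightarrow> gen \<Rightarrow> mindex \<times> mindex \<Rightarrow> vec2" where
  "cop_act f R R' s b = act2 f R R' (cop_gen s) (ket b)"

lemma act2_one: "act2 f R R' 1 V = V"
proof -
  have "act2 f R R' 1 (ket b) = ket b" for b
  proof -
    obtain b1 b2 where b: "b = (b1, b2)" by (cases b)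
    have 1: "(1 :: free2) = ket (0, 0)" by (simp add: one_ket zero_prod_def)
    show ?thesis unfolding b 1 tens_ket[of b1 b2, symmetric] act2_ket_tens by simp
  qed
  then show ?thesis by (subst act2_lin) simp
qed

text \<open>
  The coproduct is multiplicative, so its action is determined by that of the generators.
\<close>

lemma act2_cop_free: "act2 f R R' (cop_free g) V = act (cop_act f R R') g V"
proof -
  have w: "act2 f R R' (prod_list (map cop_gen l)) V = foldr (\<lambda>s. lin (cop_act f R R' s)) l V" for l
  proof (induction l)
    case (Cons s l)
    have "act2 f R R' (cop_gen s) V' = lin (cop_act f R R' s) V'" for V'
      unfolding cop_act_def by (rule act2_lin)
    then show ?case using Cons by (simp add: act2_mult)
  qed (simp add: act2_one)
  show ?thesis
  proof (induction g rule: linear_induct)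
    case (ket u)
    then show ?case by (simp add: cop_free_def act_ket act_word_def w)
  qed (simp_all add: cop_free_def lin_add lin_scl act2_add act2_scl act_add act_scl, simp add: act_def)
qed

lemma cop_act_tens: 
  "lin (cop_act f R R' (E i)) (v \<otimes>\<^sub>v w) = (if f then lin (R (E i)) v \<otimes>\<^sub>v w + lin (R (K i)) v \<otimes>\<^sub>v lin (R' (E i)) w
      else v \<otimes>\<^sub>v lin (R' (E i)) w + lin (R (E i)) v \<otimes>\<^sub>v lin (R' (K i)) w)"
  "lin (cop_act f R R' (F i)) (v \<otimes>\<^sub>v w) = (if f then v \<otimes>\<^sub>v lin (R' (F i)) w + lin (R (F i)) v \<otimes>\<^sub>v lin (R' (Kinv i)) w
      else lin (R (F i)) v \<otimes>\<^sub>v w + lin (R (Kinv i)) v \<otimes>\<^sub>v lin (R' (F i)) w)"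
  "lin (cop_act f R R' (K i)) (v \<otimes>\<^sub>v w) = lin (R (K i)) v \<otimes>\<^sub>v lin (R' (K i)) w"
  "lin (cop_act f R R' (Kinv i)) (v \<otimes>\<^sub>v w) = lin (R (Kinv i)) v \<otimes>\<^sub>v lin (R' (Kinv i)) w"
  unfolding cop_act_def act2_lin[symmetric] by (simp_all add: act2_add act2_tens act_one act_gn)

lemma act2_swap: "act2 False R R' (Poly_Mapping.map_key prod.swap t) V = act2 True R R' t V"
proof (induction t rule: linear_induct)
  case zero
  have "Poly_Mapping.map_key prod.swap (0 :: free2) = 0"
    by (rule poly_mapping_eqI) (simp add: map_key.rep_eq)
  then show ?case by simp
next
  case (add t t')
  have "Poly_Mapping.map_key prod.swap (t + t') = Poly_Mapping.map_key prod.swap t + Poly_Mapping.map_key prod.swap t'"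
    by (rule poly_mapping_eqI) (simp add: map_key.rep_eq lookup_add)
  then show ?case using add by (simp add: act2_add)
next
  case (scl c t)
  have "Poly_Mapping.map_key prod.swap (scl c t) = scl c (Poly_Mapping.map_key prod.swap t)"
    by (rule poly_mapping_eqI) (simp add: map_key.rep_eq)
  then show ?case using scl by (simp add: act2_scl)
next
  case (ket b)
  have "Poly_Mapping.map_key prod.swap (ket b :: free2) = ket (prod.swap b)"
    by (rule poly_mapping_eqI) (cases b, auto simp: map_key.rep_eq lookup_ket)
  then show ?case by (cases b) (simp add: act2_def)
qed

section \<open>The relations on a tensor product\<close>

lemma represents_rel:
  assumes represents: "represents N D r S B" and v: "v \<in> kspan B" and ij: "i \<le> N" "j \<le> N"
  shows "lin (S (K i)) (lin (S (Kinv i)) v) = v"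
    "lin (S (Kinv i)) (lin (S (K i)) v) = v"
    "lin (S (K i)) (lin (S (K j)) v) = lin (S (K j)) (lin (S (K i)) v)"
    "lin (S (K i)) (lin (S (E j)) v) = scl (D i j) (lin (S (E j)) (lin (S (K i)) v))"
    "lin (S (K i)) (lin (S (F j)) v) = scl (inverse (D i j)) (lin (S (F j)) (lin (S (K i)) v))"
    "lin (S (E i)) (lin (S (F j)) v) = lin (S (F j)) (lin (S (E i)) v)
       + scl (of_bool (i = j) / (r i - inverse (r i))) (lin (S (K i)) v - lin (S (Kinv i)) v)"
proof -
  have z: "act S g v = 0" if "g \<in> relators N D r" for g
    using lin_cong_span[OF v, of "\<lambda>b. act S g (ket b)" "\<lambda>_. 0"] that represents
    unfolding represents_def by (subst act_lin) auto
  have m: "g \<in> relators N D r" if "g \<in> { gn (K i) * gn (Kinv i) - 1,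
      gn (Kinv i) * gn (K i) - 1,
      gn (K i) * gn (K j) - gn (K j) * gn (K i),
      gn (K i) * gn (E j) - scl (D i j) (gn (E j) * gn (K i)),
      gn (K i) * gn (F j) - scl (inverse (D i j)) (gn (F j) * gn (K i)),
      gn (E i) * gn (F j) - gn (F j) * gn (E i)
        - scl (of_bool (i = j) / (r i - inverse (r i))) (gn (K i) - gn (Kinv i)) }" for g
    using ij that unfolding relators_def by blast
  note a = act_diff act_mult act_gn act_one act_scl
  show "lin (S (K i)) (lin (S (Kinv i)) v) = v" using z[OF m, of "gn (K i) * gn (Kinv i) - 1"] by (simp add: a)
  show "lin (S (Kinv i)) (lin (S (K i)) v) = v" using z[OF m, of "gn (Kinv i) * gn (K i) - 1"] by (simp add: a)
  show "lin (S (K i)) (lin (S (K j)) v) = lin (S (K j)) (lin (S (K i)) v)"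
    using z[OF m, of "gn (K i) * gn (K j) - gn (K j) * gn (K i)"] by (simp add: a)
  show "lin (S (K i)) (lin (S (E j)) v) = scl (D i j) (lin (S (E j)) (lin (S (K i)) v))"
    using z[OF m, of "gn (K i) * gn (E j) - scl (D i j) (gn (E j) * gn (K i))"] by (simp add: a)
  show "lin (S (K i)) (lin (S (F j)) v) = scl (inverse (D i j)) (lin (S (F j)) (lin (S (K i)) v))"
    using z[OF m, of "gn (K i) * gn (F j) - scl (inverse (D i j)) (gn (F j) * gn (K i))"] by (simp add: a)
  show "lin (S (E i)) (lin (S (F j)) v) = lin (S (F j)) (lin (S (E i)) v)
       + scl (of_bool (i = j) / (r i - inverse (r i))) (lin (S (K i)) v - lin (S (Kinv i)) v)"
    using z[OF m, of "gn (E i) * gn (F j) - gn (F j) * gn (E i)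
        - scl (of_bool (i = j) / (r i - inverse (r i))) (gn (K i) - gn (Kinv i))"]
    unfolding a by (simp add: algebra_simps)
qed

lemma representsI:
  assumes span: "\<And>s b. gidx s \<le> N \<Longrightarrow> b \<in> B \<Longrightarrow> S s b \<in> kspan B"
    and "\<And>i b. i \<le> N \<Longrightarrow> b \<in> B \<Longrightarrow> lin (S (K i)) (S (Kinv i) b) = ket b"
    and "\<And>i b. i \<le> N \<Longrightarrow> b \<in> B \<Longrightarrow> lin (S (Kinv i)) (S (K i) b) = ket b"
    and "\<And>i j b. i \<le> N \<Longrightarrow> j \<le> N \<Longrightarrow> b \<in> B \<Longrightarrow> lin (S (K i)) (S (K j) b) = lin (S (K j)) (S (K i) b)"
    and "\<And>i j b. i \<le> N \<Longrightarrow> j \<le> N \<Longrightarrow> b \<in> B \<Longrightarrow> lin (S (K i)) (S (E j) b) = scl (D i j) (lin (S (E j)) (S (K i) b))"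
    and "\<And>i j b. i \<le> N \<Longrightarrow> j \<le> N \<Longrightarrow> b \<in> B \<Longrightarrow> lin (S (K i)) (S (F j) b) = scl (inverse (D i j)) (lin (S (F j)) (S (K i) b))"
    and "\<And>i j b. i \<le> N \<Longrightarrow> j \<le> N \<Longrightarrow> b \<in> B \<Longrightarrow> lin (S (E i)) (S (F j) b) = lin (S (F j)) (S (E i) b)
       + scl (of_bool (i = j) / (r i - inverse (r i))) (S (K i) b - S (Kinv i) b)"
  shows "represents N D r S B"
  unfolding represents_def
proof (intro conjI allI ballI impI)
  fix g b assume "g \<in> relators N D r" "b \<in> B"
  then obtain i j where ij: "i \<le> N" "j \<le> N" and g: "g \<in> { gn (K i) * gn (Kinv i) - 1,
      gn (Kinv i) * gn (K i) - 1,
      gn (K i) * gn (K j) - gn (K j) * gn (K i),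
      gn (K i) * gn (E j) - scl (D i j) (gn (E j) * gn (K i)),
      gn (K i) * gn (F j) - scl (inverse (D i j)) (gn (F j) * gn (K i)),
      gn (E i) * gn (F j) - gn (F j) * gn (E i)
        - scl (of_bool (i = j) / (r i - inverse (r i))) (gn (K i) - gn (Kinv i)) }"
    unfolding relators_def by auto
  from g show "act S g (ket b) = 0"
    by (elim insertE emptyE)
      (simp_all add: act_diff act_mult act_gn act_one act_scl
        assms(2,3)[OF _ \<open>b \<in> B\<close>] assms(4-7)[OF _ _ \<open>b \<in> B\<close>] ij)
qed (rule span)

text \<open>The relations with \<open>K\<close> imply those with its inverse.\<close>

lemma represents_rel':
  assumes represents: "represents N D r S B" and v: "v \<in> kspan B" and ij: "i \<le> N" "j \<le> N"
  shows "lin (S (E j)) (lin (S (Kinv i)) v) = scl (D i j) (lin (S (Kinv i)) (lin (S (E j)) v))"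
    and "lin (S (F j)) (lin (S (Kinv i)) v) = scl (inverse (D i j)) (lin (S (Kinv i)) (lin (S (F j)) v))"
    and "lin (S (K i)) (lin (S (Kinv j)) v) = lin (S (Kinv j)) (lin (S (K i)) v)"
proof -
  have sp: "lin (S s) w \<in> kspan B" if "gidx s \<le> N" "w \<in> kspan B" for s w by (rule represents_span[OF represents that])
  let ?u = "lin (S (Kinv i)) v"
  have u: "?u \<in> kspan B" using sp v ij by simp
  have "lin (S (Kinv i)) (lin (S (K i)) (lin (S (E j)) ?u)) = lin (S (E j)) ?u"
    using represents_rel(2)[OF represents] sp u ij by simp
  then show "lin (S (E j)) ?u = scl (D i j) (lin (S (Kinv i)) (lin (S (E j)) v))"
    unfolding represents_rel(4)[OF represents u ij] represents_rel(1)[OF represents v ij] lin_scl by simp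
  have "lin (S (Kinv i)) (lin (S (K i)) (lin (S (F j)) ?u)) = lin (S (F j)) ?u"
    using represents_rel(2)[OF represents] sp u ij by simp
  then show "lin (S (F j)) ?u = scl (inverse (D i j)) (lin (S (Kinv i)) (lin (S (F j)) v))"
    unfolding represents_rel(5)[OF represents u ij] represents_rel(1)[OF represents v ij] lin_scl by simp
  let ?w = "lin (S (Kinv j)) v"
  have w: "?w \<in> kspan B" using sp v ij by simp
  have "lin (S (Kinv j)) (lin (S (K j)) (lin (S (K i)) ?w)) = lin (S (K i)) ?w"
    using represents_rel(2)[OF represents] sp w ij by simp
  then show "lin (S (K i)) ?w = lin (S (Kinv j)) (lin (S (K i)) v)"
    unfolding represents_rel(3)[OF represents w ij(2,1)] represents_rel(1)[OF represents v ij(2,1)] by simp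
qed

text \<open>
  The coproduct respects the relations. The only one that takes more than rearrangement is the
  commutator of \<open>E\<close> and \<open>F\<close>: the mixed terms cancel because
  \<open>D\<close> is symmetric, and the remaining ones telescope.
\<close>

lemma represents_tensor:
  assumes R: "represents N D r R B" and R': "represents N D r R' B'"
    and D: "\<And>i j. i \<le> N \<Longrightarrow> j \<le> N \<Longrightarrow> D i j = D j i" "\<And>i j. D i j \<noteq> 0"
  shows "represents N D r (cop_act f R R') (B \<times> B')"
proof -
  have cop_act_ket: "cop_act f R R' s (b, c) = lin (cop_act f R R' s) (ket b \<otimes>\<^sub>v ket c)" for s b c
    by (simp add: tens_ket)
  have sp: "lin (R s) v \<in> kspan B" if "gidx s \<le> N" "v \<in> kspan B" for s v by (rule represents_span[OF R that])
  have sp': "lin (R' s) v \<in> kspan B'" if "gidx s \<le> N" "v \<in> kspan B'" for s v by (rule represents_span[OF R' that])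
  have span: "lin (cop_act f R R' s) (v \<otimes>\<^sub>v w) \<in> kspan (B \<times> B')" if "gidx s \<le> N" "v \<in> kspan B" "w \<in> kspan B'" for s v w
    using that by (cases s) (auto simp: cop_act_tens intro!: span_add span_tens sp sp')
  show ?thesis
  proof (rule representsI)
    fix s and bc :: "mindex \<times> mindex" assume s: "gidx s \<le> N" and "bc \<in> B \<times> B'"
    then obtain b c where bc: "bc = (b, c)" "b \<in> B" "c \<in> B'" by blast
    show "cop_act f R R' s bc \<in> kspan (B \<times> B')" unfolding bc(1) cop_act_ket using bc s by (intro span) auto
  next
    fix i j and bc :: "mindex \<times> mindex" assume ij: "i \<le> N" "j \<le> N" and "bc \<in> B \<times> B'"
    then obtain b c where bc: "bc = (b, c)" "b \<in> B" "c \<in> B'" by blast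
    have v: "ket b \<in> kspan B" "ket c \<in> kspan B'" using bc by auto
    note rels = represents_rel[OF R v(1)] represents_rel[OF R' v(2)] 
    have Dji: "D j i = D i j" using D(1) ij by simp
    show "lin (cop_act f R R' (K i)) (cop_act f R R' (Kinv i) bc) = ket bc"
      unfolding bc cop_act_ket cop_act_tens represents_rel(1)[OF R v(1) ij] represents_rel(1)[OF R' v(2) ij] by (rule tens_ket)
    show "lin (cop_act f R R' (Kinv i)) (cop_act f R R' (K i) bc) = ket bc"
      unfolding bc cop_act_ket cop_act_tens represents_rel(2)[OF R v(1) ij] represents_rel(2)[OF R' v(2) ij] by (rule tens_ket)
    show "lin (cop_act f R R' (K i)) (cop_act f R R' (K j) bc) = lin (cop_act f R R' (K j)) (cop_act f R R' (K i) bc)"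
      unfolding bc cop_act_ket cop_act_tens represents_rel(3)[OF R v(1) ij] represents_rel(3)[OF R' v(2) ij] ..
    show "lin (cop_act f R R' (K i)) (cop_act f R R' (E j) bc) = scl (D i j) (lin (cop_act f R R' (E j)) (cop_act f R R' (K i) bc))"
      unfolding bc cop_act_ket
      by (simp only: cop_act_tens(1,3) lin_add if_distrib[of "lin (cop_act f R R' (K i))"] represents_rel(4)[OF R v(1) ij] represents_rel(4)[OF R' v(2) ij]
        represents_rel(3)[OF R v(1) ij] represents_rel(3)[OF R' v(2) ij] split: if_split)
        (simp add: tens_simps scl_add)
    show "lin (cop_act f R R' (K i)) (cop_act f R R' (F j) bc) = scl (inverse (D i j)) (lin (cop_act f R R' (F j)) (cop_act f R R' (K i) bc))"
      unfolding bc cop_act_ket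
      by (simp only: cop_act_tens(2,3) lin_add if_distrib[of "lin (cop_act f R R' (K i))"] represents_rel(5)[OF R v(1) ij] represents_rel(5)[OF R' v(2) ij]
        represents_rel'(3)[OF R v(1) ij] represents_rel'(3)[OF R' v(2) ij] split: if_split)
        (simp add: tens_simps scl_add)
    let ?c = "of_bool (i = j) / (r i - inverse (r i))"
    have KF: "lin (R (K i)) (lin (R (F j)) (ket b)) = scl (inverse (D i j)) (lin (R (F j)) (lin (R (K i)) (ket b)))"
      "lin (R' (K i)) (lin (R' (F j)) (ket c)) = scl (inverse (D i j)) (lin (R' (F j)) (lin (R' (K i)) (ket c)))"
      by (rule represents_rel(5)[OF R v(1) ij] represents_rel(5)[OF R' v(2) ij])+
    have EK: "lin (R (E i)) (lin (R (Kinv j)) (ket b)) = scl (D i j) (lin (R (Kinv j)) (lin (R (E i)) (ket b)))"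
      "lin (R' (E i)) (lin (R' (Kinv j)) (ket c)) = scl (D i j) (lin (R' (Kinv j)) (lin (R' (E i)) (ket c)))"
      using represents_rel'(1)[OF R v(1) ij(2,1)] represents_rel'(1)[OF R' v(2) ij(2,1)] by (simp_all only: Dji)
    note EF = represents_rel(6)[OF R v(1) ij] represents_rel(6)[OF R' v(2) ij]
    have c: "?c = 0 \<or> i = j" by auto
    show "lin (cop_act f R R' (E i)) (cop_act f R R' (F j) bc) = lin (cop_act f R R' (F j)) (cop_act f R R' (E i) bc)
       + scl ?c (cop_act f R R' (K i) bc - cop_act f R R' (Kinv i) bc)"
    proof (cases f)
      case True
      have eq0: "lin (cop_act f R R' (E i)) (cop_act f R R' (F j) bc) = lin (cop_act f R R' (F j)) (cop_act f R R' (E i) bc)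
        + scl ?c (lin (R (K i)) (ket b) \<otimes>\<^sub>v (lin (R' (K i)) (ket c) - lin (R' (Kinv i)) (ket c))
         + (lin (R (K i)) (ket b) - lin (R (Kinv i)) (ket b)) \<otimes>\<^sub>v lin (R' (Kinv j)) (ket c))"
        unfolding bc cop_act_ket
        by (simp only: cop_act_tens True if_True lin_add EF KF EK)
          (simp add: tens_simps scl_add scl_diff D(2) algebra_simps)
      from c show ?thesis
      proof
        assume "?c = 0"
        then show ?thesis unfolding eq0 by (simp del: of_bool_eq_0_iff divide_eq_0_iff)
      next
        assume "i = j"
        then show ?thesis unfolding eq0
          unfolding bc cop_act_ket by (simp only: cop_act_tens tens_simps scl_add scl_diff) (simp add: algebra_simps)
      qed
    next
      case False
      have eq0: "lin (cop_act f R R' (E i)) (cop_act f R R' (F j) bc) = lin (cop_act f R R' (F j)) (cop_act f R R' (E i) bc)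
        + scl ?c (lin (R (Kinv j)) (ket b) \<otimes>\<^sub>v (lin (R' (K i)) (ket c) - lin (R' (Kinv i)) (ket c))
         + (lin (R (K i)) (ket b) - lin (R (Kinv i)) (ket b)) \<otimes>\<^sub>v lin (R' (K i)) (ket c))"
        unfolding bc cop_act_ket
        by (simp only: cop_act_tens False if_False lin_add EF KF EK)
          (simp add: tens_simps scl_add scl_diff D(2) algebra_simps)
      from c show ?thesis
      proof
        assume "?c = 0"
        then show ?thesis unfolding eq0 by (simp del: of_bool_eq_0_iff divide_eq_0_iff)
      next
        assume "i = j"
        then show ?thesis unfolding eq0
          unfolding bc cop_act_ket by (simp only: cop_act_tens tens_simps scl_add scl_diff) (simp add: algebra_simps)
      qed
    qed
  qed
qed

section \<open>Well-definedness of the action of cosets\<close>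

lemma zero_in_genideal: "ring R \<Longrightarrow> S \<subseteq> carrier R \<Longrightarrow> \<zero>\<^bsub>R\<^esub> \<in> genideal R S"
  unfolding genideal_def by (auto intro: additive_subgroup.zero_closed ideal.axioms(1))

lemma act2_span:
  assumes R: "represents N D r R B" and R': "represents N D r R' B'" and t: "t \<in> carrier (free_ring2 N)" and V: "V \<in> kspan (B \<times> B')"
  shows "act2 f R R' t V \<in> kspan (B \<times> B')"
proof -
  have "act2 f R R' (ket u) (ket b) \<in> kspan (B \<times> B')" if "u \<in> words N \<times> words N" "b \<in> B \<times> B'" for u b
  proof -
    obtain u1 u2 b1 b2 where ub: "u = (u1, u2)" "b = (b1, b2)" by (cases u, cases b)
    show ?thesis using that unfolding ub tens_ket[of b1 b2, symmetric] act2_ket_tens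
      by (intro span_tens act_word_span[OF R] act_word_span[OF R']) auto
  qed
  then have "act2 f R R' (ket u) V \<in> kspan (B \<times> B')" if "u \<in> words N \<times> words N" for u
    using V that by (subst act2_lin) (intro span_lin[of V "B \<times> B'"])
  then have "lin (\<lambda>u. act2 f R R' (ket u) V) t \<in> kspan (B \<times> B')"
    using t unfolding carrier_free2 by (intro span_lin[of t "words N \<times> words N"])
  then show ?thesis unfolding act2_def lin_ket .
qed

text \<open>
  As for \<open>represents_ideal\<close>, with the annihilator in the tensor square of the free
  algebra.
\<close>

lemma ideal2_zero:
  assumes R: "represents N D r R B" and R': "represents N D r R' B'"
    and t: "t \<in> rel_ideal2 N D r" and V: "V \<in> kspan (B \<times> B')"
  shows "act2 f R R' t V = 0"
proof -
  define J where "J = {t \<in> carrier (free_ring2 N). \<forall>f. \<forall>V\<in>kspan (B \<times> B'). act2 f R R' t V = 0}"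
  interpret ring "free_ring2 N" by (rule ring_free2)
  have "ideal J (free_ring2 N)"
  proof (rule idealI'[OF ring_free2])
    show "\<zero>\<^bsub>free_ring2 N\<^esub> \<in> J" by (simp add: J_def free_ring_simps carrier_free2)
    show "x \<oplus>\<^bsub>free_ring2 N\<^esub> y \<in> J" if "x \<in> J" "y \<in> J" for x y
      using that unfolding J_def free_ring_simps carrier_free2 by (auto simp: act2_add span_add)
    show "\<ominus>\<^bsub>free_ring2 N\<^esub> x \<in> J" if "x \<in> J" for x
    proof -
      have "x \<in> carrier (free_ring2 N)" using that by (simp add: J_def)
      then have "\<ominus>\<^bsub>free_ring2 N\<^esub> x \<in> carrier (free_ring2 N)" "\<ominus>\<^bsub>free_ring2 N\<^esub> x = - x"
        using a_inv_closed[of x] uminus_free2[of x] by auto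
      then show ?thesis using that unfolding J_def by (auto simp: act2_uminus)
    qed
    show "x \<otimes>\<^bsub>free_ring2 N\<^esub> a \<in> J" if "a \<in> J" "x \<in> carrier (free_ring2 N)" for a x
    proof -
      have "x \<otimes>\<^bsub>free_ring2 N\<^esub> a \<in> carrier (free_ring2 N)" using that by (intro m_closed) (auto simp: J_def)
      then show ?thesis using that unfolding J_def by (auto simp: free_ring_simps act2_mult)
    qed
    show "a \<otimes>\<^bsub>free_ring2 N\<^esub> x \<in> J" if "a \<in> J" "x \<in> carrier (free_ring2 N)" for a x
    proof -
      have "a \<otimes>\<^bsub>free_ring2 N\<^esub> x \<in> carrier (free_ring2 N)" using that by (intro m_closed) (auto simp: J_def)
      then show ?thesis using that act2_span[OF R R' that(2)] unfolding J_def by (auto simp: free_ring_simps act2_mult)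
    qed
  qed (auto simp: J_def)
  moreover have "(\<lambda>g. g \<otimes>\<^sub>v 1) ` rel_ideal N D r \<union> (\<lambda>g. 1 \<otimes>\<^sub>v g) ` rel_ideal N D r \<subseteq> J"
  proof -
    have 1: "1 \<in> kspan (words N)" by (simp add: one_ket words_zero)
    have z: "t \<in> J" if "t \<in> kspan (words N \<times> words N)"
      "\<And>f b c. b \<in> B \<Longrightarrow> c \<in> B' \<Longrightarrow> act2 f R R' t (ket b \<otimes>\<^sub>v ket c) = 0" for t
    proof -
      have "act2 f R R' t V = 0" if "V \<in> kspan (B \<times> B')" for f V
      proof -
        have "act2 f R R' t (ket b) = 0" if "b \<in> B \<times> B'" for b
          using that \<open>\<And>f b c. b \<in> B \<Longrightarrow> c \<in> B' \<Longrightarrow> act2 f R R' t (ket b \<otimes>\<^sub>v ket c) = 0\<close>[of "fst b" "snd b" f]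
          by (auto simp: tens_ket)
        then show ?thesis using lin_cong_span[OF \<open>V \<in> kspan (B \<times> B')\<close>, of "\<lambda>b. act2 f R R' t (ket b)" "\<lambda>_. 0"]
          by (subst act2_lin) auto
      qed
      then show ?thesis using that(1) by (simp add: J_def carrier_free2)
    qed
    show ?thesis
    proof (intro Un_least subsetI; clarify)
      fix g assume g: "g \<in> rel_ideal N D r"
      have c: "g \<in> kspan (words N)" using represents_ideal(2)[OF R g, of 0] by (simp add: carrier_free)
      have zR: "act R g (ket b) = 0" if "b \<in> B" for b using represents_ideal(1)[OF R g] that by simp
      have zR': "act R' g (ket b) = 0" if "b \<in> B'" for b using represents_ideal(1)[OF R' g] that by simp
      show "g \<otimes>\<^sub>v 1 \<in> J" by (rule z) (auto intro: span_tens c 1 simp: act2_tens zR zR')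
      show "1 \<otimes>\<^sub>v g \<in> J" by (rule z) (auto intro: span_tens c 1 simp: act2_tens zR zR')
    qed
  qed
  ultimately have "t \<in> J" using t unfolding rel_ideal2_def genideal_def by blast
  then show ?thesis using V by (simp add: J_def)
qed

text \<open>
  All representatives of a coset, and of its coproduct, act in the same way, so the action of
  the coset is that of one of them through \<open>cop_act\<close>.
\<close>

lemma rep2_value:
  assumes R: "represents N D r R B" and R': "represents N D r R' B'"
    and D: "\<And>i j. i \<le> N \<Longrightarrow> j \<le> N \<Longrightarrow> D i j = D j i" "\<And>i j. D i j \<noteq> 0"
    and C: "C \<in> carrier (Ualg N D r)"
  obtains g where "g \<in> carrier (free_ring N)"
    "\<And>V. V \<in> kspan (B \<times> B') \<Longrightarrow> rep2 R R' (cop N D r C) V = act (cop_act False R R') g V"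
    "\<And>V. V \<in> kspan (B \<times> B') \<Longrightarrow> rep2 R R' (cop_op N D r C) V = act (cop_act True R R') g V"
proof -
  obtain g where g: "g \<in> carrier (free_ring N)" and Cg: "C = rel_ideal N D r +>\<^bsub>free_ring N\<^esub> g"
    using C unfolding Ualg_def FactRing_def A_RCOSETS_def' by auto
  have C_iff: "h \<in> C \<longleftrightarrow> (\<exists>i\<in>rel_ideal N D r. h = i + g)" for h
    unfolding Cg a_r_coset_def' by (auto simp: free_ring_simps)
  have cop: "cop N D r C = (\<Union>i\<in>rel_ideal N D r. \<Union>t\<in>rel_ideal2 N D r. {t + cop_free (i + g)})"
  proof -
    have "C = (\<lambda>i. i + g) ` rel_ideal N D r" using C_iff by auto
    then show ?thesis unfolding cop_def a_r_coset_def' by (auto simp: free_ring_simps)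
  qed
  have 0: "0 \<in> rel_ideal N D r"
    using zero_in_genideal[OF ring_free relators_carrier] unfolding rel_ideal_def free_ring_simps .
  have "t \<in> kspan (words N \<times> words N)" if "t \<in> (\<lambda>g. g \<otimes>\<^sub>v 1) ` rel_ideal N D r \<union> (\<lambda>g. 1 \<otimes>\<^sub>v g) ` rel_ideal N D r" for t
  proof -
    have 1: "1 \<in> kspan (words N)" by (simp add: one_ket words_zero)
    have c: "g \<in> kspan (words N)" if "g \<in> rel_ideal N D r" for g
      using represents_ideal(2)[OF R that, of 0] by (simp add: carrier_free)
    show ?thesis using that by (auto intro: span_tens c 1)
  qed
  then have 02: "0 \<in> rel_ideal2 N D r"
    using zero_in_genideal[OF ring_free2, of "(\<lambda>g. g \<otimes>\<^sub>v 1) ` rel_ideal N D r \<union> (\<lambda>g. 1 \<otimes>\<^sub>v g) ` rel_ideal N D r" N]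
    unfolding rel_ideal2_def free_ring_simps carrier_free2 by blast
  have v: "act2 f R R' (t + cop_free (i + g)) V = act (cop_act f R R') g V"
    if "i \<in> rel_ideal N D r" "t \<in> rel_ideal2 N D r" "V \<in> kspan (B \<times> B')" for i t V f
    using ideal2_zero[OF R R' that(2,3)] represents_ideal(1)[OF represents_tensor[OF R R' D] that(1,3)]
    by (simp add: act2_add act2_cop_free act_add)
  show ?thesis
  proof (rule that[OF g])
    fix V assume V: "V \<in> kspan (B \<times> B')"
    have "(\<lambda>t. rep2_free R R' t V) ` cop N D r C = {act (cop_act False R R') g V}"
      unfolding cop rep2_free_act2 using v[OF _ _ V] 0 02 by (auto simp: image_UN)
    then show "rep2 R R' (cop N D r C) V = act (cop_act False R R') g V" unfolding rep2_def by simp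
    have "(\<lambda>t. rep2_free R R' t V) ` cop_op N D r C = {act (cop_act True R R') g V}"
      unfolding cop cop_op_def rep2_free_act2 image_image act2_swap using v[OF _ _ V] 0 02 by (auto simp: image_UN)
    then show "rep2 R R' (cop_op N D r C) V = act (cop_act True R R') g V" unfolding rep2_def by simp
  qed
qed

text \<open>
  Since the coproduct acts multiplicatively, an operator that commutes with the generators on a
  subspace invariant under them commutes with every word in them.
\<close>

lemma commutation:
  assumes R: "represents N D r R B" and R': "represents N D r R' B'"
    and D: "\<And>i j. i \<le> N \<Longrightarrow> j \<le> N \<Longrightarrow> D i j = D j i" "\<And>i j. D i j \<noteq> 0"
    and S: "\<And>V. S V = lin (\<lambda>b. S (ket b)) V"
    and Bg: "Bg \<subseteq> B \<times> B'" "\<And>s b. gidx s \<le> N \<Longrightarrow> b \<in> Bg \<Longrightarrow> cop_act False R R' s b \<in> kspan Bg"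
    and SB: "\<And>b. b \<in> Bg \<Longrightarrow> S (ket b) \<in> kspan (B \<times> B')"
    and com: "\<And>s b. gidx s \<le> N \<Longrightarrow> b \<in> Bg \<Longrightarrow> lin (cop_act True R R' s) (S (ket b)) = S (cop_act False R R' s b)"
    and C: "C \<in> carrier (Ualg N D r)" and V: "V \<in> kspan Bg"
  shows "rep2 R R' (cop_op N D r C) (S V) = S (rep2 R R' (cop N D r C) V)"
proof -
  obtain g where g: "g \<in> carrier (free_ring N)"
    and g1: "\<And>V. V \<in> kspan (B \<times> B') \<Longrightarrow> rep2 R R' (cop N D r C) V = act (cop_act False R R') g V"
    and g2: "\<And>V. V \<in> kspan (B \<times> B') \<Longrightarrow> rep2 R R' (cop_op N D r C) V = act (cop_act True R R') g V"
    using rep2_value[OF R R' D C] by blast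
  have VB: "V \<in> kspan (B \<times> B')" using V Bg(1) by (auto simp: kspan_def)
  have SV: "S V \<in> kspan (B \<times> B')" using V SB by (subst S) (intro span_lin[of V Bg])
  have Slin: "S (lin f v) = lin (\<lambda>b. S (f b)) v" for f :: "'x \<Rightarrow> _" and v
  proof -
    have "S (lin f v) = lin (\<lambda>b. S (ket b)) (lin f v)" by (rule S)
    also have "\<dots> = lin (\<lambda>b. S (f b)) v" unfolding lin_lin by (rule lin_cong) (rule S[symmetric])
    finally show ?thesis .
  qed
  have w: "foldr (\<lambda>s. lin (cop_act False R R' s)) l V \<in> kspan Bg \<and>
     foldr (\<lambda>s. lin (cop_act True R R' s)) l (S V) = S (foldr (\<lambda>s. lin (cop_act False R R' s)) l V)"
    if "\<forall>s\<in>set l. gidx s \<le> N" for l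
    using that
  proof (induction l)
    case (Cons s l)
    let ?v = "foldr (\<lambda>s. lin (cop_act False R R' s)) l V"
    have s: "gidx s \<le> N" and IH: "?v \<in> kspan Bg" "foldr (\<lambda>s. lin (cop_act True R R' s)) l (S V) = S ?v"
      using Cons by auto
    have "lin (cop_act True R R' s) (S ?v) = lin (\<lambda>b. lin (cop_act True R R' s) (S (ket b))) ?v"
      by (subst S) (simp add: lin_lin)
    also have "\<dots> = lin (\<lambda>b. S (cop_act False R R' s b)) ?v"
      using com[OF s] by (intro lin_cong_span[OF IH(1)])
    also have "\<dots> = S (lin (cop_act False R R' s) ?v)" by (simp add: Slin)
    finally have "lin (cop_act True R R' s) (S ?v) = S (lin (cop_act False R R' s) ?v)" .
    moreover have "lin (cop_act False R R' s) ?v \<in> kspan Bg"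
      using Bg(2)[OF s] by (intro span_lin[OF IH(1)])
    ultimately show ?case using IH(2) by simp
  qed (use V in simp)
  have "act (cop_act True R R') g (S V) = lin (\<lambda>u. S (act_word (cop_act False R R') u V)) g"
    unfolding act_def using g w unfolding carrier_free
    by (intro lin_cong_span[of g "words N"]) (auto simp: act_word_def words_def)
  also have "\<dots> = S (act (cop_act False R R') g V)" unfolding act_def Slin ..
  finally show ?thesis unfolding g1[OF VB] g2[OF SV] .
qed

section \<open>Representations by shift operators\<close>

definition wbasisZ :: "nat \<Rightarrow> (nat \<Rightarrow> nat) \<Rightarrow> (nat \<Rightarrow> int) \<Rightarrow> bool" where
  "wbasisZ n eps v \<longleftrightarrow> (\<forall>k. k \<notin> {1..n} \<longrightarrow> v k = 0) \<and> all_allowed n eps v"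

locale shape =
  fixes n :: nat and eps :: "nat \<Rightarrow> nat"
  assumes eps01: "\<And>k. k \<in> {1..n} \<Longrightarrow> eps k = 0 \<or> eps k = 1"
begin

abbreviation "W \<equiv> wbasis n eps"
abbreviation "WZ \<equiv> wbasisZ n eps"
abbreviation "kz \<equiv> ketZ n eps"

lemma wbasisZ_int: "m \<in> W \<Longrightarrow> WZ (int \<circ> m)"
  using eps01 unfolding wbasis_def wbasisZ_def all_allowed_def allowed_def by force

lemma wbasisZ_nat: "WZ v \<Longrightarrow> nat \<circ> v \<in> W" "WZ v \<Longrightarrow> int \<circ> (nat \<circ> v) = v"
proof -
  assume v: "WZ v"
  have "v k \<ge> 0" for k using v unfolding wbasisZ_def all_allowed_def allowed_def by (cases "k \<in> {1..n}") auto
  then show e: "int \<circ> (nat \<circ> v) = v" by auto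
  show "nat \<circ> v \<in> W" using v unfolding wbasis_def wbasisZ_def all_allowed_def allowed_def by auto
qed

lemma ketZ_wbasisZ: "kz v = (if WZ v then ket (nat \<circ> v) else 0)"
  unfolding ketZ_def using wbasisZ_int wbasisZ_nat by metis

lemma ketZ_int: "m \<in> W \<Longrightarrow> kz (int \<circ> m) = ket m"
  using wbasisZ_int[of m] by (simp add: ketZ_wbasisZ) (simp add: comp_def)

lemma kz_span [simp]: "kz v \<in> kspan W"
  by (simp add: ketZ_wbasisZ wbasisZ_nat)

end

text \<open>
  The operator \<open>e\<^sub>i\<close> lowers the occupation number of the site \<open>lo i\<close> and raises that of \<open>hi i\<close>, and \<open>f\<^sub>i\<close> does
  the opposite; a site outside \<open>{1..n}\<close> is absent. This covers both families: only the boundary generators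
  of the second one have an absent site. The spectral parameter enters through \<open>cE\<close>.
\<close>

locale shift_rep = shape +
  fixes N :: nat and lo hi :: "nat \<Rightarrow> nat" and cE cK rr :: "nat \<Rightarrow> kxy" and R :: "gen \<Rightarrow> mindex \<Rightarrow> vec"
    and D :: "nat \<Rightarrow> nat \<Rightarrow> kxy"
  assumes lohi: "\<And>i. i \<le> N \<Longrightarrow> lo i \<noteq> hi i"
    and inj: "\<And>i j. i \<le> N \<Longrightarrow> j \<le> N \<Longrightarrow> i \<noteq> j \<Longrightarrow> lo i \<noteq> lo j \<and> hi i \<noteq> hi j"
    and cE0: "\<And>i. i \<le> N \<Longrightarrow> cE i \<noteq> 0"
    and cases: "\<And>i. i \<le> N \<Longrightarrow>
       (lo i \<in> {1..n} \<and> hi i \<in> {1..n} \<and> cK i = 1 \<and> rr i = qq)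
       \<or> (lo i \<notin> {1..n} \<and> hi i \<in> {1..n} \<and> cK i = inverse pp \<and> rr i = pp)
       \<or> (lo i \<in> {1..n} \<and> hi i \<notin> {1..n} \<and> cK i = pp \<and> rr i = pp)"
begin

definition dl :: "nat \<Rightarrow> nat \<Rightarrow> int" where
  "dl i k = (if k \<in> {1..n} then of_bool (k = hi i) - of_bool (k = lo i) else 0)"

definition kE :: "nat \<Rightarrow> (nat \<Rightarrow> int) \<Rightarrow> kxy" where
  "kE i v = cE i * (if lo i \<in> {1..n} then emb (qn (v (lo i))) else 1)"
definition kF :: "nat \<Rightarrow> (nat \<Rightarrow> int) \<Rightarrow> kxy" where
  "kF i v = inverse (cE i) * (if hi i \<in> {1..n} then emb (qn (v (hi i))) else 1)"
definition kK :: "nat \<Rightarrow> (nat \<Rightarrow> int) \<Rightarrow> kxy" where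
  "kK i v = cK i * (\<Prod>k\<in>{1..n}. emb (tq (eps k)) powi (dl i k * v k))"

definition Dd :: "nat \<Rightarrow> nat \<Rightarrow> kxy" where
  "Dd i j = (\<Prod>k\<in>{1..n}. emb (tq (eps k)) powi (dl i k * dl j k))"

lemma pp_neq0 [simp]: "pp \<noteq> 0"
proof -
  have "to_fract [:\<i>:] * inverse sqrt_q \<noteq> 0" by simp
  then show ?thesis unfolding pp_def emb_eq_0_iff .
qed

lemma cK0: "i \<le> N \<Longrightarrow> cK i \<noteq> 0" using cases[of i] by auto

lemma kK0: "i \<le> N \<Longrightarrow> kK i v \<noteq> 0"
  unfolding kK_def using cK0 by simp

lemma Dd_sym: "Dd i j = Dd j i" by (simp add: Dd_def mult.commute)

lemma kK_shift: "kK i (\<lambda>k. v k + dl j k) = Dd i j * kK i v"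
  unfolding kK_def Dd_def
  by (simp add: distrib_left power_int_add prod.distrib mult_ac)

lemma kK_shift': "kK i (\<lambda>k. v k - dl j k) = inverse (Dd i j) * kK i v"
  unfolding kK_def Dd_def
  by (simp add: right_diff_distrib power_int_diff prod_dividef divide_inverse[of "prod _ _"])

lemma wbasisZ_add: "WZ v \<Longrightarrow> (\<And>k. k \<in> {1..n} \<Longrightarrow> allowed (eps k) (v k + d k)) \<Longrightarrow> (\<And>k. k \<notin> {1..n} \<Longrightarrow> d k = 0) \<Longrightarrow> WZ (\<lambda>k. v k + d k)"
  by (auto simp: wbasisZ_def all_allowed_def)

lemma allowed_mono: "allowed e a \<Longrightarrow> 0 \<le> b \<Longrightarrow> b \<le> a \<Longrightarrow> allowed e b" by (auto simp: allowed_def)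

lemma dl_out: "k \<notin> {1..n} \<Longrightarrow> dl i k = 0" by (simp only: dl_def if_False)

lemma wbasisZ_allowed: "WZ v \<Longrightarrow> k \<in> {1..n} \<Longrightarrow> allowed (eps k) (v k)" by (auto simp: wbasisZ_def all_allowed_def)
lemma wbasisZ_pos: "WZ v \<Longrightarrow> 0 \<le> v k"
  unfolding wbasisZ_def all_allowed_def allowed_def by (cases "k \<in> {1..n}") auto

text \<open>
  For \<open>i \<noteq> j\<close> a site that both \<open>e\<^sub>i\<close> and
  \<open>f\<^sub>j\<close> affect is lowered by both or raised by both, so the coefficients have
  the same product in either order. The truncation at fermionic sites does no harm either: if
  the coefficients do not vanish and the final vector is in range, then so are both intermediate
  ones.
\<close>

lemma EF_neq:
  assumes v: "WZ v" and ij: "i \<le> N" "j \<le> N" "i \<noteq> j"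
  shows "scl (kF j v) (if WZ (\<lambda>k. v k - dl j k) then scl (kE i (\<lambda>k. v k - dl j k)) (kz (\<lambda>k. v k - dl j k + dl i k)) else 0)
    = scl (kE i v) (if WZ (\<lambda>k. v k + dl i k) then scl (kF j (\<lambda>k. v k + dl i k)) (kz (\<lambda>k. v k + dl i k - dl j k)) else 0)"
proof -
  let ?u = "\<lambda>k. v k + dl i k - dl j k"
  have u: "(\<lambda>k. v k - dl j k + dl i k) = ?u" by (simp add: fun_eq_iff)
  have ne: "lo i \<noteq> lo j" "hi i \<noteq> hi j" "lo i \<noteq> hi i" "lo j \<noteq> hi j" using inj[OF ij] lohi ij by auto
  have c: "kF j v * kE i (\<lambda>k. v k - dl j k) = kE i v * kF j (\<lambda>k. v k + dl i k)"
    unfolding kF_def kE_def dl_def using ne by auto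
  show ?thesis
  proof (cases "WZ ?u \<and> (hi j \<in> {1..n} \<longrightarrow> v (hi j) \<noteq> 0) \<and> (lo i \<in> {1..n} \<longrightarrow> v (lo i) \<noteq> 0)")
    case True
    have p: "hi j \<in> {1..n} \<Longrightarrow> v (hi j) \<ge> 1" "lo i \<in> {1..n} \<Longrightarrow> v (lo i) \<ge> 1"
      using True wbasisZ_pos[OF v, of "hi j"] wbasisZ_pos[OF v, of "lo i"] by auto
    have u': "allowed (eps k) (v k + dl i k - dl j k)" if "k \<in> {1..n}" for k using True that wbasisZ_allowed[of ?u k] by simp
    have 1: "WZ (\<lambda>k. v k + - dl j k)"
    proof (rule wbasisZ_add[OF v])
      fix k assume k: "k \<in> {1..n}"
      show "allowed (eps k) (v k + - dl j k)"
      proof (cases "k = hi j \<or> k \<noteq> lo j")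
        case True
        then show ?thesis using p k ne wbasisZ_pos[OF v, of k] by (intro allowed_mono[OF wbasisZ_allowed[OF v k]]) (auto simp: dl_def)
      next
        case False
        then show ?thesis using p k ne wbasisZ_pos[OF v, of k] by (intro allowed_mono[OF u'[OF k]]) (auto simp: dl_def)
      qed
    qed (simp add: dl_out)
    have 2: "WZ (\<lambda>k. v k + dl i k)"
    proof (rule wbasisZ_add[OF v])
      fix k assume k: "k \<in> {1..n}"
      show "allowed (eps k) (v k + dl i k)"
      proof (cases "k = lo i \<or> k \<noteq> hi i")
        case True
        then show ?thesis using p k ne wbasisZ_pos[OF v, of k] by (intro allowed_mono[OF wbasisZ_allowed[OF v k]]) (auto simp: dl_def)
      next
        case False
        then show ?thesis using p k ne wbasisZ_pos[OF v, of k] by (intro allowed_mono[OF u'[OF k]]) (auto simp: dl_def)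
      qed
    qed (simp add: dl_out)
    from 1 2 show ?thesis unfolding u using c by simp
  next
    case False
    then consider "\<not> WZ ?u" | "hi j \<in> {1..n} \<and> v (hi j) = 0" | "lo i \<in> {1..n} \<and> v (lo i) = 0" by blast
    then show ?thesis
    proof cases
      case 1
      then show ?thesis unfolding u by (simp add: ketZ_wbasisZ)
    next
      case 2
      then have "kF j v = 0" by (simp add: kF_def)
      then show ?thesis using c by (auto simp: scl_0)
    next
      case 3
      then have "kE i v = 0" by (simp add: kE_def)
      then show ?thesis using c by (auto simp: scl_0)
    qed
  qed
qed

end

text \<open>
  In terms of \<open>u = q\<^sub>i\<^sup>m\<close> the \<open>q\<close>-numbers look the same at both kinds of sites, also after the truncation at a
  fermionic site. So the commutator of \<open>e\<^sub>i\<close> and \<open>f\<^sub>i\<close> needs no distinction between them.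
\<close>

lemma qn_tq: "allowed e m \<Longrightarrow> qn m = (tq e powi m - inverse (tq e powi m)) / (q - inverse q)"
proof (cases "e = 0")
  case False
  assume "allowed e m"
  with False have "m = 0 \<or> m = 1" by (simp add: allowed_fermi)
  then show ?thesis using False q_minus_inv_neq0 by (auto simp: tq_def)
qed (simp add: qn_def power_int_minus)

lemma qn_tq_up: "allowed e m \<Longrightarrow> (if allowed e (m + 1) then qn (m + 1) else 0)
    = (q * tq e powi m - inverse (q * tq e powi m)) / (q - inverse q)"
proof (cases "e = 0")
  case True
  assume "allowed e m"
  then have "allowed e (m + 1)" using True by (simp add: allowed_def)
  then show ?thesis unfolding True qn_def power_int_minus q_powi_add by (simp add: mult.commute)
next
  case False
  assume "allowed e m"
  with False have "m = 0 \<or> m = 1" by (simp add: allowed_fermi)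
  then show ?thesis using False q_minus_inv_neq0 by (auto simp: tq_def allowed_fermi)
qed

text \<open>The element \<open>pp\<close> in the field of coefficients.\<close>

definition p0 :: kq where "p0 = to_fract [:\<i>:] * inverse sqrt_q"

lemma pp_p0: "pp = emb p0" by (simp add: pp_def p0_def)
lemma qq_q: "qq = emb q" by (simp add: qq_def)

lemma p0_sq: "p0\<^sup>2 = - inverse q"
proof -
  have "(to_fract [:\<i>:])\<^sup>2 = - (1 :: kq)"
    by (simp add: power2_eq_square flip: to_fract_mult to_fract_uminus)
      (metis (no_types) one_pCons to_fract_1 to_fract_uminus minus_pCons minus_zero)
  then show ?thesis by (simp add: p0_def q_def power_mult_distrib power_inverse)
qed

lemma p0_neq0: "p0 \<noteq> 0" using p0_sq by auto

text \<open>
  The commutator of \<open>e\<^sub>i\<close> and \<open>f\<^sub>i\<close> with two sites and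
  with one site; \<open>u\<close> and \<open>U\<close> are the powers at the lowered and the
  raised site.
\<close>

lemma EF_id_both:
  assumes "u \<noteq> 0" "U \<noteq> (0 :: kq)"
  defines "h \<equiv> q - inverse q"
  shows "(U - inverse U) / h * ((q * u - inverse (q * u)) / h) - (u - inverse u) / h * ((q * U - inverse (q * U)) / h)
    = 1 / h * (U / u - inverse (U / u))"
proof -
  have h: "h \<noteq> 0" unfolding h_def by (rule q_minus_inv_neq0)
  have "(U - inverse U) * (q * u - inverse (q * u)) - (u - inverse u) * (q * U - inverse (q * U))
    = h * (U / u - inverse (U / u))"
    unfolding h_def using assms(1,2) by (simp add: field_simps)
  then have "((U - inverse U) * (q * u - inverse (q * u)) - (u - inverse u) * (q * U - inverse (q * U))) / (h * h)
    = h * (U / u - inverse (U / u)) / (h * h)" by simp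
  also have "\<dots> = 1 / h * (U / u - inverse (U / u))" using h by simp
  finally show ?thesis unfolding times_divide_times_eq diff_divide_distrib[symmetric] .
qed

lemma EF_id_one:
  assumes "U \<noteq> (0 :: kq)"
  defines "h \<equiv> q - inverse q"
  shows "(U - inverse U) / h - (q * U - inverse (q * U)) / h
    = 1 / (p0 - inverse p0) * (inverse p0 * U - inverse (inverse p0 * U))"
proof -
  have h: "h \<noteq> 0" unfolding h_def by (rule q_minus_inv_neq0)
  have p: "p0 \<noteq> 0" by (rule p0_neq0)
  have q1: "1 + q \<noteq> 0" using one_plus_q_powi_neq0[of 1] by simp
  have i: "inverse p0 = - (q * p0)" using p0_sq p by (simp add: field_simps power2_eq_square)
  have d: "p0 - inverse p0 = (1 + q) * p0" unfolding i by (simp add: algebra_simps)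
  have "((U - inverse U) - (q * U - inverse (q * U))) * (1 + q) = h * (- q * U - inverse U)"
    unfolding h_def using assms(1) by (simp add: field_simps)
  then have 1: "((U - inverse U) - (q * U - inverse (q * U))) / h = (- q * U - inverse U) / (1 + q)"
    using h q1 by (simp add: frac_eq_eq mult.commute)
  have "inverse p0 * U - inverse (inverse p0 * U) = p0 * (- q * U - inverse U)"
  proof -
    have "inverse (inverse p0 * U) = p0 * inverse U" using p by simp
    then show ?thesis unfolding i by (simp add: algebra_simps)
  qed
  then have "1 / (p0 - inverse p0) * (inverse p0 * U - inverse (inverse p0 * U)) = (- q * U - inverse U) / (1 + q)"
    unfolding d using p by simp
  then show ?thesis using 1 by (simp add: diff_divide_distrib)
qed

context shift_rep
begin

lemma prod_dl: assumes i: "i \<le> N"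
  shows "(\<Prod>k\<in>{1..n}. emb (tq (eps k)) powi (dl i k * v k))
    = (if lo i \<in> {1..n} then emb (inverse (tq (eps (lo i)) powi v (lo i))) else 1)
    * (if hi i \<in> {1..n} then emb (tq (eps (hi i)) powi v (hi i)) else 1)"
proof -
  have ne: "lo i \<noteq> hi i" using lohi i by auto
  let ?f = "\<lambda>k. emb (tq (eps k)) powi (dl i k * v k)"
  have "(\<Prod>k\<in>{1..n}. ?f k) = (\<Prod>k\<in>{1..n} \<inter> {lo i, hi i}. ?f k)"
    by (rule prod.mono_neutral_right) (auto simp: dl_def)
  also have "\<dots> = (if lo i \<in> {1..n} then ?f (lo i) else 1) * (if hi i \<in> {1..n} then ?f (hi i) else 1)"
  proof -
    let ?L = "if lo i \<in> {1..n} then {lo i} else {}" and ?H = "if hi i \<in> {1..n} then {hi i} else {}"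
    have u: "{1..n} \<inter> {lo i, hi i} = ?L \<union> ?H" by auto
    have "prod ?f (?L \<union> ?H) = prod ?f ?L * prod ?f ?H"
      using ne by (intro prod.union_disjoint) auto
    moreover have "prod ?f ?L = (if lo i \<in> {1..n} then ?f (lo i) else 1)"
      "prod ?f ?H = (if hi i \<in> {1..n} then ?f (hi i) else 1)"
      by (simp_all only: if_distrib[of "prod ?f"] prod.empty prod.insert[OF finite.emptyI] empty_iff not_False_eq_True mult_1_right)
    ultimately show ?thesis unfolding u by simp
  qed
  finally show ?thesis using ne by (simp add: dl_def emb_inverse emb_powi power_int_minus)
qed

lemma EF_same_scalar:
  assumes v: "WZ v" and i: "i \<le> N"
  shows "kF i v * (if WZ (\<lambda>k. v k - dl i k) then kE i (\<lambda>k. v k - dl i k) else 0)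
    = kE i v * (if WZ (\<lambda>k. v k + dl i k) then kF i (\<lambda>k. v k + dl i k) else 0)
      + 1 / (rr i - inverse (rr i)) * (kK i v - inverse (kK i v))"
proof -
  have ne: "lo i \<noteq> hi i" using lohi i by auto
  let ?l = "lo i \<in> {1..n}" and ?h = "hi i \<in> {1..n}"
  let ?u = "tq (eps (lo i)) powi v (lo i)" and ?U = "tq (eps (hi i)) powi v (hi i)"
  let ?up = "\<lambda>k. if allowed (eps k) (v k + 1) then qn (v k + 1) else 0"
  have W1: "WZ (\<lambda>k. v k + - dl i k) \<longleftrightarrow> (?h \<longrightarrow> v (hi i) \<noteq> 0) \<and> (?l \<longrightarrow> allowed (eps (lo i)) (v (lo i) + 1))" (is "?A \<longleftrightarrow> ?B")
  proof
    assume A: ?A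
    show ?B using wbasisZ_pos[OF A, of "hi i"] wbasisZ_allowed[OF A, of "lo i"] ne by (auto simp: dl_def)
  next
    assume B: ?B
    show ?A
    proof (rule wbasisZ_add[OF v])
      fix k assume k: "k \<in> {1..n}"
      show "allowed (eps k) (v k + - dl i k)"
      proof (cases "k = lo i")
        case True
        then show ?thesis using B k ne by (simp add: dl_def)
      next
        case False
        have "k = hi i \<Longrightarrow> v k > 0" using B k wbasisZ_pos[OF v, of k] by auto
        then show ?thesis using False k wbasisZ_pos[OF v, of k] by (intro allowed_mono[OF wbasisZ_allowed[OF v k]]) (auto simp: dl_def)
      qed
    qed (simp add: dl_out)
  qed
  have W2: "WZ (\<lambda>k. v k + dl i k) \<longleftrightarrow> (?l \<longrightarrow> v (lo i) \<noteq> 0) \<and> (?h \<longrightarrow> allowed (eps (hi i)) (v (hi i) + 1))" (is "?A \<longleftrightarrow> ?B")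
  proof
    assume A: ?A
    show ?B using wbasisZ_pos[OF A, of "lo i"] wbasisZ_allowed[OF A, of "hi i"] ne by (auto simp: dl_def)
  next
    assume B: ?B
    show ?A
    proof (rule wbasisZ_add[OF v])
      fix k assume k: "k \<in> {1..n}"
      show "allowed (eps k) (v k + dl i k)"
      proof (cases "k = hi i")
        case True
        then show ?thesis using B k ne by (simp add: dl_def)
      next
        case False
        have "k = lo i \<Longrightarrow> v k > 0" using B k wbasisZ_pos[OF v, of k] by auto
        then show ?thesis using False k wbasisZ_pos[OF v, of k] by (intro allowed_mono[OF wbasisZ_allowed[OF v k]]) (auto simp: dl_def)
      qed
    qed (simp add: dl_out)
  qed
  have L1: "kF i v * (if WZ (\<lambda>k. v k - dl i k) then kE i (\<lambda>k. v k - dl i k) else 0)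
    = emb ((if ?h then qn (v (hi i)) else 1) * (if ?l then ?up (lo i) else 1))"
    using W1 ne cE0[OF i] unfolding kF_def kE_def by (auto simp: dl_def emb_mult)
  have L2: "kE i v * (if WZ (\<lambda>k. v k + dl i k) then kF i (\<lambda>k. v k + dl i k) else 0)
    = emb ((if ?l then qn (v (lo i)) else 1) * (if ?h then ?up (hi i) else 1))"
    using W2 ne cE0[OF i] unfolding kF_def kE_def by (auto simp: dl_def emb_mult)
  have K: "kK i v = cK i * ((if ?l then emb (inverse ?u) else 1) * (if ?h then emb ?U else 1))"
    unfolding kK_def prod_dl[OF i] ..
  have l: "?l \<Longrightarrow> qn (v (lo i)) = (?u - inverse ?u) / (q - inverse q)" "?l \<Longrightarrow> ?up (lo i) = (q * ?u - inverse (q * ?u)) / (q - inverse q)"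
    using qn_tq qn_tq_up wbasisZ_allowed[OF v, of "lo i"] by auto
  have h: "?h \<Longrightarrow> qn (v (hi i)) = (?U - inverse ?U) / (q - inverse q)" "?h \<Longrightarrow> ?up (hi i) = (q * ?U - inverse (q * ?U)) / (q - inverse q)"
    using qn_tq qn_tq_up wbasisZ_allowed[OF v, of "hi i"] by auto
  have u0: "?u \<noteq> 0" "?U \<noteq> 0" by simp_all
  note e = emb_mult emb_divide emb_diff emb_inverse emb_1
  from cases[OF i] show ?thesis
  proof (elim disjE conjE)
    assume c: ?l ?h "cK i = 1" "rr i = qq"
    have "emb ((if ?h then qn (v (hi i)) else 1) * (if ?l then ?up (lo i) else 1))
       - emb ((if ?l then qn (v (lo i)) else 1) * (if ?h then ?up (hi i) else 1))
      = emb (1 / (q - inverse q) * (?U / ?u - inverse (?U / ?u)))"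
      unfolding EF_id_both[OF u0, symmetric] emb_diff[symmetric] by (simp only: c if_True l[OF c(1)] h[OF c(2)])
    also have "\<dots> = 1 / (rr i - inverse (rr i)) * (kK i v - inverse (kK i v))"
    proof -
      have "kK i v = emb (inverse ?u) * emb ?U" unfolding K by (simp only: c if_True mult_1_left)
      then show ?thesis unfolding c(4) qq_q by (simp add: e divide_inverse mult.commute)
    qed
    finally show ?thesis unfolding L1 L2 by (simp add: algebra_simps)
  next
    assume c: "\<not> ?l" ?h "cK i = inverse pp" "rr i = pp"
    have "emb ((if ?h then qn (v (hi i)) else 1) * (if ?l then ?up (lo i) else 1))
       - emb ((if ?l then qn (v (lo i)) else 1) * (if ?h then ?up (hi i) else 1))
      = emb (1 / (p0 - inverse p0) * (inverse p0 * ?U - inverse (inverse p0 * ?U)))"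
      unfolding EF_id_one[OF u0(2), symmetric] emb_diff[symmetric] by (simp only: c if_True if_False h[OF c(2)] mult_1_left mult_1_right)
    also have "\<dots> = 1 / (rr i - inverse (rr i)) * (kK i v - inverse (kK i v))"
    proof -
      have "kK i v = inverse pp * emb ?U" unfolding K by (simp only: c if_True if_False mult_1_left)
      then show ?thesis unfolding c(4) pp_p0 by (simp add: e)
    qed
    finally show ?thesis unfolding L1 L2 by (simp add: algebra_simps)
  next
    assume c: ?l "\<not> ?h" "cK i = pp" "rr i = pp"
    have "emb ((if ?h then qn (v (hi i)) else 1) * (if ?l then ?up (lo i) else 1))
       - emb ((if ?l then qn (v (lo i)) else 1) * (if ?h then ?up (hi i) else 1))
      = - emb (1 / (p0 - inverse p0) * (inverse p0 * ?u - inverse (inverse p0 * ?u)))"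
      unfolding EF_id_one[OF u0(1), symmetric] emb_minus[symmetric] emb_diff[symmetric] minus_diff_eq by (simp only: c if_True if_False l[OF c(1)] mult_1_left mult_1_right)
    also have "\<dots> = 1 / (rr i - inverse (rr i)) * (kK i v - inverse (kK i v))"
    proof -
      have "kK i v = pp * emb (inverse ?u)" unfolding K by (simp only: c if_True if_False mult_1_right)
      then show ?thesis unfolding c(4) pp_p0 by (simp add: e minus_divide_left)
    qed
    finally show ?thesis unfolding L1 L2 by (simp add: algebra_simps)
  qed
qed

end

locale shift_rep_ops = shift_rep +
  assumes RE: "\<And>i m. i \<le> N \<Longrightarrow> m \<in> W \<Longrightarrow> R (E i) m = scl (kE i (int \<circ> m)) (kz (\<lambda>k. int (m k) + dl i k))"
    and RF: "\<And>i m. i \<le> N \<Longrightarrow> m \<in> W \<Longrightarrow> R (F i) m = scl (kF i (int \<circ> m)) (kz (\<lambda>k. int (m k) - dl i k))"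
    and RK: "\<And>i m. i \<le> N \<Longrightarrow> m \<in> W \<Longrightarrow> R (K i) m = scl (kK i (int \<circ> m)) (ket m)"
    and RKi: "\<And>i m. i \<le> N \<Longrightarrow> m \<in> W \<Longrightarrow> R (Kinv i) m = scl (inverse (kK i (int \<circ> m))) (ket m)"
    and DD: "\<And>i j. i \<le> N \<Longrightarrow> j \<le> N \<Longrightarrow> D i j = Dd i j"
begin

lemma lin_RE: "i \<le> N \<Longrightarrow> lin (R (E i)) (kz v) = (if WZ v then scl (kE i v) (kz (\<lambda>k. v k + dl i k)) else 0)"
  using wbasisZ_nat[of v] by (auto simp: ketZ_wbasisZ[of v] RE wbasisZ_pos)
lemma lin_RF: "i \<le> N \<Longrightarrow> lin (R (F i)) (kz v) = (if WZ v then scl (kF i v) (kz (\<lambda>k. v k - dl i k)) else 0)"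
  using wbasisZ_nat[of v] by (auto simp: ketZ_wbasisZ[of v] RF wbasisZ_pos)
lemma lin_RK: "i \<le> N \<Longrightarrow> lin (R (K i)) (kz v) = scl (kK i v) (kz v)"
  using wbasisZ_nat[of v] by (auto simp: ketZ_wbasisZ[of v] RK)
lemma lin_RKi: "i \<le> N \<Longrightarrow> lin (R (Kinv i)) (kz v) = scl (inverse (kK i v)) (kz v)"
  using wbasisZ_nat[of v] by (auto simp: ketZ_wbasisZ[of v] RKi)

lemma represents: "represents N D rr R W"
proof (rule representsI)
  fix s m assume "gidx s \<le> N" "m \<in> W"
  then show "R s m \<in> kspan W"
    by (cases s) (auto simp: RE RF RK RKi intro: span_scl)
next
  fix i j m assume ij: "i \<le> N" "j \<le> N" and m: "m \<in> W"
  define v0 where "v0 = int \<circ> m"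
  let ?v = v0
  have v: "WZ ?v" unfolding v0_def by (rule wbasisZ_int[OF m])
  have km: "ket m = kz ?v" by (simp add: ketZ_int m v0_def)
  have R: "R s m = lin (R s) (kz ?v)" for s by (simp add: ketZ_int m v0_def)
  note ops = lin_RE lin_RF lin_RK lin_RKi
  show "lin (R (K i)) (R (Kinv i) m) = ket m" "lin (R (Kinv i)) (R (K i) m) = ket m"
    unfolding R km using ij kK0[of i ?v] by (simp_all add: ops lin_scl)
  show "lin (R (K i)) (R (K j) m) = lin (R (K j)) (R (K i) m)"
    unfolding R using ij by (simp add: ops lin_scl mult.commute)
  show "lin (R (K i)) (R (E j) m) = scl (D i j) (lin (R (E j)) (R (K i) m))"
    unfolding R using ij v by (simp add: ops lin_scl kK_shift DD mult_ac)
  show "lin (R (K i)) (R (F j) m) = scl (inverse (D i j)) (lin (R (F j)) (R (K i) m))"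
    unfolding R using ij v by (simp add: ops lin_scl kK_shift' DD mult_ac)
  show "lin (R (E i)) (R (F j) m) = lin (R (F j)) (R (E i) m)
     + scl (of_bool (i = j) / (rr i - inverse (rr i))) (R (K i) m - R (Kinv i) m)"
  proof (cases "i = j")
    case False
    have "lin (R (E i)) (R (F j) m) = scl (kF j ?v) (if WZ (\<lambda>k. ?v k - dl j k) then scl (kE i (\<lambda>k. ?v k - dl j k)) (kz (\<lambda>k. ?v k - dl j k + dl i k)) else 0)"
      unfolding R lin_RF[OF ij(2)] if_P[OF v] lin_scl lin_RE[OF ij(1)] ..
    also have "\<dots> = scl (kE i ?v) (if WZ (\<lambda>k. ?v k + dl i k) then scl (kF j (\<lambda>k. ?v k + dl i k)) (kz (\<lambda>k. ?v k + dl i k - dl j k)) else 0)"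
      by (rule EF_neq[OF v ij False])
    also have "\<dots> = lin (R (F j)) (R (E i) m)"
      unfolding R lin_RE[OF ij(1)] if_P[OF v] lin_scl lin_RF[OF ij(2)] ..
    finally show ?thesis using False by simp
  next
    case True
    have "lin (R (E i)) (R (F i) m) = scl (kF i ?v * (if WZ (\<lambda>k. ?v k - dl i k) then kE i (\<lambda>k. ?v k - dl i k) else 0)) (kz ?v)"
      unfolding R lin_RF[OF ij(1)] if_P[OF v] lin_scl lin_RE[OF ij(1)] by (simp add: comp_def)
    moreover have "lin (R (F i)) (R (E i) m) = scl (kE i ?v * (if WZ (\<lambda>k. ?v k + dl i k) then kF i (\<lambda>k. ?v k + dl i k) else 0)) (kz ?v)"
      unfolding R lin_RE[OF ij(1)] if_P[OF v] lin_scl lin_RF[OF ij(1)] by (simp add: comp_def)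
    moreover have "R (K i) m - R (Kinv i) m = scl (kK i ?v - inverse (kK i ?v)) (kz ?v)"
      unfolding R lin_RK[OF ij(1)] lin_RKi[OF ij(1)]
      by (rule poly_mapping_eqI) (simp add: lookup_minus left_diff_distrib)
    ultimately show ?thesis using True EF_same_scalar[OF v ij(1)]
      by (simp add: scl_add_left[symmetric])
  qed
qed

end

section \<open>Reduction to relations between matrix elements\<close>

text \<open>
  The matrix elements \<open>V\<close> are extended to integer multi-indices and vanish out of
  range. In this form \<open>idE\<close>, \<open>idF\<close> and \<open>idK\<close> are the
  commutation relations for basis vectors without exceptions at the boundary of the range.
\<close>

locale intertwiner =
  X: shift_rep_ops n eps N lo hi cX cK rr RX D + Y: shift_rep_ops n eps N lo hi cY cK rr RY D
  for n eps N lo hi cX cY cK rr RX RY D +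
  fixes S :: "vec2 \<Rightarrow> vec2" and V :: "(nat \<Rightarrow> int) \<Rightarrow> (nat \<Rightarrow> int) \<Rightarrow> (nat \<Rightarrow> int) \<Rightarrow> (nat \<Rightarrow> int) \<Rightarrow> kxy"
  assumes S_lin: "\<And>v. S v = lin (\<lambda>b. S (ket b)) v"
    and S_ket: "\<And>i j. i \<in> X.W \<Longrightarrow> j \<in> X.W \<Longrightarrow> S (ket (i, j)) \<in> kspan (X.W \<times> X.W)"
    and S_lookup: "\<And>i j a b. i \<in> X.W \<Longrightarrow> j \<in> X.W \<Longrightarrow> a \<in> X.W \<Longrightarrow> b \<in> X.W \<Longrightarrow>
       Poly_Mapping.lookup (S (ket (i, j))) (a, b) = V (int \<circ> a) (int \<circ> b) (int \<circ> i) (int \<circ> j)"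
    and V0: "\<And>a b i j. \<not> (all_allowed n eps a \<and> all_allowed n eps b \<and> all_allowed n eps i \<and> all_allowed n eps j) \<Longrightarrow> V a b i j = 0"
    and idE: "\<And>r a b i j. r \<le> N \<Longrightarrow> X.WZ a \<Longrightarrow> X.WZ b \<Longrightarrow> X.WZ i \<Longrightarrow> X.WZ j \<Longrightarrow>
       X.kE r (\<lambda>k. a k - X.dl r k) * V (\<lambda>k. a k - X.dl r k) b i j
         + X.kK r a * Y.kE r (\<lambda>k. b k - X.dl r k) * V a (\<lambda>k. b k - X.dl r k) i j
       = Y.kE r j * V a b i (\<lambda>k. j k + X.dl r k) + X.kE r i * X.kK r j * V a b (\<lambda>k. i k + X.dl r k) j"
    and idF: "\<And>r a b i j. r \<le> N \<Longrightarrow> X.WZ a \<Longrightarrow> X.WZ b \<Longrightarrow> X.WZ i \<Longrightarrow> X.WZ j \<Longrightarrow>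
       Y.kF r (\<lambda>k. b k + X.dl r k) * V a (\<lambda>k. b k + X.dl r k) i j
         + X.kF r (\<lambda>k. a k + X.dl r k) * inverse (X.kK r b) * V (\<lambda>k. a k + X.dl r k) b i j
       = X.kF r i * V a b (\<lambda>k. i k - X.dl r k) j + inverse (X.kK r i) * Y.kF r j * V a b i (\<lambda>k. j k - X.dl r k)"
    and idK: "\<And>r a b i j. r \<le> N \<Longrightarrow> X.WZ a \<Longrightarrow> X.WZ b \<Longrightarrow> X.WZ i \<Longrightarrow> X.WZ j \<Longrightarrow>
       X.kK r a * X.kK r b * V a b i j = X.kK r i * X.kK r j * V a b i j"
begin

lemma all_allowed_WZ: "(\<And>k. k \<notin> {1..n} \<Longrightarrow> v k = 0) \<Longrightarrow> X.WZ v \<longleftrightarrow> all_allowed n eps v"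
  by (auto simp: wbasisZ_def)

lemma lookup_kz: "a \<in> X.W \<Longrightarrow> Poly_Mapping.lookup (X.kz v) a = of_bool (v = int \<circ> a)"
proof -
  assume a: "a \<in> X.W"
  have "v = int \<circ> a \<longleftrightarrow> X.WZ v \<and> nat \<circ> v = a"
  proof
    assume "v = int \<circ> a"
    then show "X.WZ v \<and> nat \<circ> v = a" using X.wbasisZ_int[OF a] by (auto simp: comp_def)
  next
    assume "X.WZ v \<and> nat \<circ> v = a"
    then show "v = int \<circ> a" using X.wbasisZ_nat(2)[of v] by (metis (no_types))
  qed
  then show ?thesis by (auto simp: X.ketZ_wbasisZ lookup_ket)
qed

lemma lookup_S_kz:
  assumes "a \<in> X.W" "b \<in> X.W" "\<And>k. k \<notin> {1..n} \<Longrightarrow> u k = 0" "\<And>k. k \<notin> {1..n} \<Longrightarrow> w k = 0"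
  shows "Poly_Mapping.lookup (S (X.kz u \<otimes>\<^sub>v X.kz w)) (a, b) = V (int \<circ> a) (int \<circ> b) u w"
proof (cases "X.WZ u \<and> X.WZ w")
  case True
  then show ?thesis using assms S_lookup[of "nat \<circ> u" "nat \<circ> w" a b] X.wbasisZ_nat[of u] X.wbasisZ_nat[of w]
    by (simp add: X.ketZ_wbasisZ tens_ket)
next
  case False
  then have "\<not> (all_allowed n eps u \<and> all_allowed n eps w)" using all_allowed_WZ[OF assms(3)] all_allowed_WZ[OF assms(4)] by simp
  then have "V (int \<circ> a) (int \<circ> b) u w = 0" using V0 by blast
  moreover have "X.kz u \<otimes>\<^sub>v X.kz w = 0" using False by (auto simp: X.ketZ_wbasisZ)
  ultimately show ?thesis by (subst S_lin) simp
qed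

text \<open>
  A shift operator after \<open>S\<close> moves the upper indices of the matrix elements back by
  the shift.
\<close>

lemma lookup_shift:
  assumes ij: "i \<in> X.W" "j \<in> X.W" and ab: "a \<in> X.W" "b \<in> X.W"
    and d: "\<And>k. k \<notin> {1..n} \<Longrightarrow> d1 k = 0" "\<And>k. k \<notin> {1..n} \<Longrightarrow> d2 k = 0"
  shows "Poly_Mapping.lookup (lin (\<lambda>(b', c'). scl (c1 (int \<circ> b')) (X.kz (\<lambda>k. int (b' k) + d1 k))
      \<otimes>\<^sub>v scl (c2 (int \<circ> c')) (X.kz (\<lambda>k. int (c' k) + d2 k))) (S (ket (i, j)))) (a, b)
    = c1 (\<lambda>k. int (a k) - d1 k) * c2 (\<lambda>k. int (b k) - d2 k)
      * V (\<lambda>k. int (a k) - d1 k) (\<lambda>k. int (b k) - d2 k) (int \<circ> i) (int \<circ> j)"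
    (is "_ = c1 ?u * c2 ?w * _")
proof -
  let ?U = "S (ket (i, j))"
  have U: "Poly_Mapping.keys ?U \<subseteq> X.W \<times> X.W" using S_ket[OF ij] by (simp add: kspan_def)
  have eq: "(\<lambda>k. int (b' k) + d k) = int \<circ> a' \<longleftrightarrow> int \<circ> b' = (\<lambda>k. int (a' k) - d k)" for b' a' :: mindex and d
    by (auto simp: fun_eq_iff algebra_simps)
  have sum: "Poly_Mapping.lookup (lin (\<lambda>(b', c'). scl (c1 (int \<circ> b')) (X.kz (\<lambda>k. int (b' k) + d1 k))
      \<otimes>\<^sub>v scl (c2 (int \<circ> c')) (X.kz (\<lambda>k. int (c' k) + d2 k))) ?U) (a, b)
    = (\<Sum>(b', c')\<in>Poly_Mapping.keys ?U. if int \<circ> b' = ?u \<and> int \<circ> c' = ?w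
         then Poly_Mapping.lookup ?U (b', c') * (c1 ?u * c2 ?w) else 0)"
    unfolding lookup_lin
    by (rule sum.cong) (auto simp: lookup_tens lookup_kz[OF ab(1)] lookup_kz[OF ab(2)] eq)
  have su: "\<And>k. k \<notin> {1..n} \<Longrightarrow> ?u k = 0" "\<And>k. k \<notin> {1..n} \<Longrightarrow> ?w k = 0"
    using d ab X.wbasisZ_int[of a] X.wbasisZ_int[of b] unfolding wbasisZ_def by auto
  show ?thesis
  proof (cases "X.WZ ?u \<and> X.WZ ?w")
    case True
    let ?b = "nat \<circ> ?u" and ?c = "nat \<circ> ?w"
    have bc: "?b \<in> X.W" "?c \<in> X.W" "int \<circ> ?b = ?u" "int \<circ> ?c = ?w"
      using True X.wbasisZ_nat by blast+
    have "int \<circ> b' = ?u \<and> int \<circ> c' = ?w \<longleftrightarrow> (b', c') = (?b, ?c)" for b' c' :: mindex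
    proof
      assume h: "int \<circ> b' = ?u \<and> int \<circ> c' = ?w"
      show "(b', c') = (?b, ?c)"
        unfolding conjunct1[OF h, symmetric] conjunct2[OF h, symmetric] by (simp add: fun_eq_iff)
    next
      assume "(b', c') = (?b, ?c)"
      then show "int \<circ> b' = ?u \<and> int \<circ> c' = ?w" using bc(3,4) by blast
    qed
    then have "(\<Sum>(b', c')\<in>Poly_Mapping.keys ?U. if int \<circ> b' = ?u \<and> int \<circ> c' = ?w
         then Poly_Mapping.lookup ?U (b', c') * (c1 ?u * c2 ?w) else 0)
      = (\<Sum>p\<in>Poly_Mapping.keys ?U. if p = (?b, ?c) then Poly_Mapping.lookup ?U (?b, ?c) * (c1 ?u * c2 ?w) else 0)"
      by (intro sum.cong) (auto split: prod.splits)
    also have "\<dots> = Poly_Mapping.lookup ?U (?b, ?c) * (c1 ?u * c2 ?w)"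
      by (auto simp: in_keys_iff)
    also have "Poly_Mapping.lookup ?U (?b, ?c) = V ?u ?w (int \<circ> i) (int \<circ> j)"
      using S_lookup[OF ij bc(1,2)] unfolding bc(3,4) .
    finally show ?thesis unfolding sum by (simp only: mult_ac)
  next
    case False
    have "\<not> (all_allowed n eps ?u \<and> all_allowed n eps ?w)" using False all_allowed_WZ[OF su(1)] all_allowed_WZ[OF su(2)] by simp
    then have v: "V ?u ?w (int \<circ> i) (int \<circ> j) = 0" using V0 by blast
    have "(\<Sum>(b', c')\<in>Poly_Mapping.keys ?U. if int \<circ> b' = ?u \<and> int \<circ> c' = ?w
         then Poly_Mapping.lookup ?U (b', c') * (c1 ?u * c2 ?w) else 0) = 0"
    proof (rule sum.neutral, safe)
      fix b' c' assume "(b', c') \<in> Poly_Mapping.keys ?U"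
      then have "X.WZ (int \<circ> b')" "X.WZ (int \<circ> c')" using U X.wbasisZ_int by auto
      then show "(if int \<circ> b' = ?u \<and> int \<circ> c' = ?w
         then Poly_Mapping.lookup ?U (b', c') * (c1 ?u * c2 ?w) else 0) = 0" using False by metis
    qed
    then show ?thesis unfolding sum v by simp
  qed
qed

lemma intertwine_ket:
  assumes s: "gidx s \<le> N" and ij: "i \<in> X.W" "j \<in> X.W"
  shows "lin (cop_act True RX RY s) (S (ket (i, j))) = S (cop_act False RX RY s (i, j))"
proof -
  let ?U = "S (ket (i, j))"
  have U: "?U \<in> kspan (X.W \<times> X.W)" by (rule S_ket[OF ij])
  have S_add: "S (v + w) = S v + S w" for v w by (subst (1 2 3) S_lin) (rule lin_add)
  have S_scl: "S (scl c v) = scl c (S v)" for c v by (subst (1 2) S_lin) (rule lin_scl)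
  have cDk: "cop_act f RX RY s (b, c) = lin (cop_act f RX RY s) (ket b \<otimes>\<^sub>v ket c)" for f s b c by (simp add: tens_ket)
  define i0 j0 where "i0 = int \<circ> i" and "j0 = int \<circ> j"
  have W0: "X.WZ i0" "X.WZ j0" using X.wbasisZ_int ij by (simp_all add: i0_def j0_def)
  have z: "k \<notin> {1..n} \<Longrightarrow> X.dl r k = 0" for r k by (rule X.dl_out)
  have z0: "k \<notin> {1..n} \<Longrightarrow> i0 k = 0" "k \<notin> {1..n} \<Longrightarrow> j0 k = 0" for k using W0 unfolding wbasisZ_def by auto
  have ki: "ket i = X.kz i0" "ket j = X.kz j0" using ij by (simp_all add: i0_def j0_def X.ketZ_int)
  have kb: "b \<in> X.W \<Longrightarrow> ket b = scl 1 (X.kz (\<lambda>k. int (b k) + 0))" for b using X.ketZ_int[of b] by (simp add: comp_def)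
  have out: "v \<in> kspan (X.W \<times> X.W) \<Longrightarrow> \<not> (a \<in> X.W \<and> b \<in> X.W) \<Longrightarrow> Poly_Mapping.lookup v (a, b) = 0" for v :: vec2 and a b
    unfolding kspan_def by (auto simp: in_keys_iff)
  have S_span: "v \<in> kspan (X.W \<times> X.W) \<Longrightarrow> S v \<in> kspan (X.W \<times> X.W)" for v
    by (subst S_lin) (auto intro: span_lin S_ket)
  have satX: "represents N D rr RX X.W" and satY: "represents N D rr RY X.W" by (rule X.represents, rule Y.represents)
  have spD: "lin (cop_act f RX RY s) (v \<otimes>\<^sub>v w) \<in> kspan (X.W \<times> X.W)" if "v \<in> kspan X.W" "w \<in> kspan X.W" for f v w
    using that s by (cases s) (auto simp: cop_act_tens intro!: span_add span_tens represents_span[OF satX] represents_span[OF satY])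
  show ?thesis
  proof (rule vec2_eqI)
    fix a b
    show "Poly_Mapping.lookup (lin (cop_act True RX RY s) ?U) (a, b) = Poly_Mapping.lookup (S (cop_act False RX RY s (i, j))) (a, b)"
    proof (cases "a \<in> X.W \<and> b \<in> X.W")
      case False
      have "lin (cop_act True RX RY s) ?U \<in> kspan (X.W \<times> X.W)"
        by (rule span_lin[OF U]) (auto simp: cDk intro!: spD)
      moreover have "S (cop_act False RX RY s (i, j)) \<in> kspan (X.W \<times> X.W)"
        unfolding cDk by (intro S_span spD) (use ij in auto)
      ultimately show ?thesis using False by (simp add: out)
    next
      case True
      then have ab: "a \<in> X.W" "b \<in> X.W" by auto
      define a0 b0 where "a0 = int \<circ> a" and "b0 = int \<circ> b"
      have Wab: "X.WZ a0" "X.WZ b0" using X.wbasisZ_int ab by (simp_all add: a0_def b0_def)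
      have look: "Poly_Mapping.lookup (lin f ?U) (a, b) = c1 (\<lambda>k. a0 k - d1 k) * c2 (\<lambda>k. b0 k - d2 k)
          * V (\<lambda>k. a0 k - d1 k) (\<lambda>k. b0 k - d2 k) i0 j0"
        if f: "\<And>b' c'. b' \<in> X.W \<Longrightarrow> c' \<in> X.W \<Longrightarrow> f (b', c') = scl (c1 (int \<circ> b')) (X.kz (\<lambda>k. int (b' k) + d1 k))
            \<otimes>\<^sub>v scl (c2 (int \<circ> c')) (X.kz (\<lambda>k. int (c' k) + d2 k))"
          and d: "\<And>k. k \<notin> {1..n} \<Longrightarrow> d1 k = 0" "\<And>k. k \<notin> {1..n} \<Longrightarrow> d2 k = 0"
        for f c1 c2 d1 d2
      proof -
        have "lin f ?U = lin (\<lambda>(b', c'). scl (c1 (int \<circ> b')) (X.kz (\<lambda>k. int (b' k) + d1 k))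
            \<otimes>\<^sub>v scl (c2 (int \<circ> c')) (X.kz (\<lambda>k. int (c' k) + d2 k))) ?U"
          by (rule lin_cong_span[OF U]) (auto simp: f)
        then show ?thesis using lookup_shift[OF ij ab d] by (simp add: a0_def b0_def i0_def j0_def)
      qed
      have lookS: "Poly_Mapping.lookup (S (X.kz u \<otimes>\<^sub>v X.kz w)) (a, b) = V a0 b0 u w"
        if "\<And>k. k \<notin> {1..n} \<Longrightarrow> u k = 0" "\<And>k. k \<notin> {1..n} \<Longrightarrow> w k = 0" for u w
        using lookup_S_kz[OF ab that] by (simp add: a0_def b0_def)
      have zs: "k \<notin> {1..n} \<Longrightarrow> i0 k + X.dl r k = 0" "k \<notin> {1..n} \<Longrightarrow> j0 k + X.dl r k = 0"
        "k \<notin> {1..n} \<Longrightarrow> i0 k - X.dl r k = 0" "k \<notin> {1..n} \<Longrightarrow> j0 k - X.dl r k = 0" for k r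
        using z0[of k] z[of k r] by simp_all
      have lookups: "Poly_Mapping.lookup (S (X.kz i0 \<otimes>\<^sub>v X.kz (\<lambda>k. j0 k + X.dl r k))) (a, b) = V a0 b0 i0 (\<lambda>k. j0 k + X.dl r k)"
        "Poly_Mapping.lookup (S (X.kz (\<lambda>k. i0 k + X.dl r k) \<otimes>\<^sub>v X.kz j0)) (a, b) = V a0 b0 (\<lambda>k. i0 k + X.dl r k) j0"
        "Poly_Mapping.lookup (S (X.kz i0 \<otimes>\<^sub>v X.kz (\<lambda>k. j0 k - X.dl r k))) (a, b) = V a0 b0 i0 (\<lambda>k. j0 k - X.dl r k)"
        "Poly_Mapping.lookup (S (X.kz (\<lambda>k. i0 k - X.dl r k) \<otimes>\<^sub>v X.kz j0)) (a, b) = V a0 b0 (\<lambda>k. i0 k - X.dl r k) j0"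
        "Poly_Mapping.lookup (S (X.kz i0 \<otimes>\<^sub>v X.kz j0)) (a, b) = V a0 b0 i0 j0" for r
        by (rule lookS; erule zs z0)+
      show ?thesis
      proof (cases s)
        case (E r)
        then have r: "r \<le> N" using s by simp
        have "lin (cop_act True RX RY s) ?U = lin (\<lambda>(b', c'). RX (E r) b' \<otimes>\<^sub>v ket c') ?U + lin (\<lambda>(b', c'). RX (K r) b' \<otimes>\<^sub>v RY (E r) c') ?U"
          unfolding lin_of_add[symmetric] by (rule lin_cong) (auto simp: E cDk cop_act_tens)
        then have "Poly_Mapping.lookup (lin (cop_act True RX RY s) ?U) (a, b)
          = X.kE r (\<lambda>k. a0 k - X.dl r k) * V (\<lambda>k. a0 k - X.dl r k) b0 i0 j0
         + X.kK r a0 * Y.kE r (\<lambda>k. b0 k - X.dl r k) * V a0 (\<lambda>k. b0 k - X.dl r k) i0 j0"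
          unfolding lookup_add
          using look[of "\<lambda>(b', c'). RX (E r) b' \<otimes>\<^sub>v ket c'" "X.kE r" "X.dl r" "\<lambda>_. 1" "\<lambda>_. 0"]
            look[of "\<lambda>(b', c'). RX (K r) b' \<otimes>\<^sub>v RY (E r) c'" "X.kK r" "\<lambda>_. 0" "Y.kE r" "X.dl r"]
          by (simp add: X.RE[OF r] X.RK[OF r] Y.RE[OF r] kb z lookup_add)
        also have "\<dots> = Y.kE r j0 * V a0 b0 i0 (\<lambda>k. j0 k + X.dl r k) + X.kE r i0 * X.kK r j0 * V a0 b0 (\<lambda>k. i0 k + X.dl r k) j0"
          by (rule idE[OF r Wab W0])
        also have "\<dots> = Poly_Mapping.lookup (S (cop_act False RX RY s (i, j))) (a, b)"
          unfolding E cDk cop_act_tens if_False ki X.lin_RE[OF r] Y.lin_RE[OF r] Y.lin_RK[OF r] if_P[OF W0(1)] if_P[OF W0(2)]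
            tens_simps S_add S_scl lookup_add lookup_scl scl_scl
          by (simp add: lookups mult_ac)
        finally show ?thesis .
      next
        case (F r)
        then have r: "r \<le> N" using s by simp
        have "lin (cop_act True RX RY s) ?U = lin (\<lambda>(b', c'). ket b' \<otimes>\<^sub>v RY (F r) c') ?U + lin (\<lambda>(b', c'). RX (F r) b' \<otimes>\<^sub>v RY (Kinv r) c') ?U"
          unfolding lin_of_add[symmetric] by (rule lin_cong) (auto simp: F cDk cop_act_tens)
        then have "Poly_Mapping.lookup (lin (cop_act True RX RY s) ?U) (a, b)
          = Y.kF r (\<lambda>k. b0 k + X.dl r k) * V a0 (\<lambda>k. b0 k + X.dl r k) i0 j0
         + X.kF r (\<lambda>k. a0 k + X.dl r k) * inverse (X.kK r b0) * V (\<lambda>k. a0 k + X.dl r k) b0 i0 j0"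
          unfolding lookup_add
          using look[of "\<lambda>(b', c'). ket b' \<otimes>\<^sub>v RY (F r) c'" "\<lambda>_. 1" "\<lambda>_. 0" "Y.kF r" "\<lambda>k. - X.dl r k"]
            look[of "\<lambda>(b', c'). RX (F r) b' \<otimes>\<^sub>v RY (Kinv r) c'" "X.kF r" "\<lambda>k. - X.dl r k" "\<lambda>v. inverse (X.kK r v)" "\<lambda>_. 0"]
          by (simp add: X.RF[OF r] Y.RKi[OF r] Y.RF[OF r] kb z lookup_add)
        also have "\<dots> = X.kF r i0 * V a0 b0 (\<lambda>k. i0 k - X.dl r k) j0 + inverse (X.kK r i0) * Y.kF r j0 * V a0 b0 i0 (\<lambda>k. j0 k - X.dl r k)"
          by (rule idF[OF r Wab W0])
        also have "\<dots> = Poly_Mapping.lookup (S (cop_act False RX RY s (i, j))) (a, b)"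
          unfolding F cDk cop_act_tens if_False ki X.lin_RF[OF r] Y.lin_RF[OF r] X.lin_RKi[OF r] if_P[OF W0(1)] if_P[OF W0(2)]
            tens_simps S_add S_scl lookup_add lookup_scl scl_scl
          by (simp add: lookups mult_ac)
        finally show ?thesis .
      next
        case (K r)
        then have r: "r \<le> N" using s by simp
        have "lin (cop_act True RX RY s) ?U = lin (\<lambda>(b', c'). RX (K r) b' \<otimes>\<^sub>v RY (K r) c') ?U"
          by (rule lin_cong) (auto simp: K cDk cop_act_tens)
        then have "Poly_Mapping.lookup (lin (cop_act True RX RY s) ?U) (a, b) = X.kK r a0 * X.kK r b0 * V a0 b0 i0 j0"
          using look[of "\<lambda>(b', c'). RX (K r) b' \<otimes>\<^sub>v RY (K r) c'" "X.kK r" "\<lambda>_. 0" "X.kK r" "\<lambda>_. 0"]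
          by (simp add: X.RK[OF r] Y.RK[OF r] kb)
        also have "\<dots> = X.kK r i0 * X.kK r j0 * V a0 b0 i0 j0"
          by (rule idK[OF r Wab W0])
        also have "\<dots> = Poly_Mapping.lookup (S (cop_act False RX RY s (i, j))) (a, b)"
          unfolding K cDk cop_act_tens ki X.lin_RK[OF r] Y.lin_RK[OF r] tens_simps S_scl lookup_scl scl_scl
          by (simp add: lookups mult_ac)
        finally show ?thesis .
      next
        case (Kinv r)
        then have r: "r \<le> N" using s by simp
        have "lin (cop_act True RX RY s) ?U = lin (\<lambda>(b', c'). RX (Kinv r) b' \<otimes>\<^sub>v RY (Kinv r) c') ?U"
          by (rule lin_cong) (auto simp: Kinv cDk cop_act_tens)
        then have "Poly_Mapping.lookup (lin (cop_act True RX RY s) ?U) (a, b) = inverse (X.kK r a0) * inverse (X.kK r b0) * V a0 b0 i0 j0"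
          using look[of "\<lambda>(b', c'). RX (Kinv r) b' \<otimes>\<^sub>v RY (Kinv r) c'" "\<lambda>v. inverse (X.kK r v)" "\<lambda>_. 0" "\<lambda>v. inverse (X.kK r v)" "\<lambda>_. 0"]
          by (simp add: X.RKi[OF r] Y.RKi[OF r] kb)
        also have "\<dots> = inverse (X.kK r i0) * inverse (X.kK r j0) * V a0 b0 i0 j0"
          using idK[OF r Wab W0] X.kK0[OF r] by (simp add: field_simps)
        also have "\<dots> = Poly_Mapping.lookup (S (cop_act False RX RY s (i, j))) (a, b)"
          unfolding Kinv cDk cop_act_tens ki X.lin_RKi[OF r] Y.lin_RKi[OF r] tens_simps S_scl lookup_scl scl_scl
          by (simp add: lookups mult_ac)
        finally show ?thesis .
      qed
    qed
  qed
qed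

theorem intertwining:
  assumes D0: "\<And>i j. D i j \<noteq> 0"
    and Bg: "Bg \<subseteq> X.W \<times> X.W" "\<And>s b. gidx s \<le> N \<Longrightarrow> b \<in> Bg \<Longrightarrow> cop_act False RX RY s b \<in> kspan Bg"
    and C: "C \<in> carrier (Ualg N D rr)" and v: "v \<in> kspan Bg"
  shows "rep2 RX RY (cop_op N D rr C) (S v) = S (rep2 RX RY (cop N D rr C) v)"
proof (rule commutation[OF X.represents Y.represents _ D0 S_lin Bg _ _ C v])
  show "D i j = D j i" if "i \<le> N" "j \<le> N" for i j
    using that by (simp add: X.DD X.Dd_sym)
  show "S (ket b) \<in> kspan (X.W \<times> X.W)" if "b \<in> Bg" for b
    using that Bg(1) S_ket by (cases b) auto
  show "lin (cop_act True RX RY s) (S (ket b)) = S (cop_act False RX RY s b)" if "gidx s \<le> N" "b \<in> Bg" for s b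
    using that Bg(1) intertwine_ket by (cases b) auto
qed

end

section \<open>Matrix elements and matrix operators\<close>

lemma S3Z_nonzero: "S3Z e a b c i j k \<noteq> 0 \<Longrightarrow> allowed e a \<and> allowed e b \<and> allowed e i \<and> allowed e j \<and> a + b = i + j"
  by (auto simp: S3Z_def split: if_splits)

definition conserving :: "nat \<Rightarrow> (nat \<Rightarrow> nat) \<Rightarrow> (nat \<Rightarrow> int) \<Rightarrow> (nat \<Rightarrow> int) \<Rightarrow> (nat \<Rightarrow> int) \<Rightarrow> (nat \<Rightarrow> int) \<Rightarrow> bool" where
  "conserving n eps a b i j \<longleftrightarrow> all_allowed n eps a \<and> all_allowed n eps b \<and> all_allowed n eps i \<and> all_allowed n eps j
     \<and> (\<forall>k\<in>{1..n}. a k + b k = i k + j k)"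

text \<open>Each factor of the chain enforces its conservation law.\<close>

lemma chain_conserving: "chain {1..n} L R' eps a b i j C \<noteq> 0 \<Longrightarrow> conserving n eps a b i j"
proof -
  assume "chain {1..n} L R' eps a b i j C \<noteq> 0"
  then have "S3Z (eps k) (a k) (b k) (C (L k)) (i k) (j k) (C (R' k)) \<noteq> 0" if "k \<in> {1..n}" for k
    using that unfolding chain_def by auto
  from S3Z_nonzero[OF this] show ?thesis unfolding conserving_def all_allowed_def by blast
qed

lemma series_zero: "(\<And>N. f N = 0) \<Longrightarrow> series f = 0"
  by (simp add: series_def fps_eq_iff)

lemma elem_tr_conserving: "elem_tr n eps l m a b i j \<noteq> 0 \<Longrightarrow> conserving n eps a b i j"
proof (rule ccontr)
  assume nc: "\<not> conserving n eps a b i j"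
  have c: "chain {1..n} L R' eps a b i j C = 0" for L R' C
    using chain_conserving nc by blast
  have "series (coeff_tr n eps a b i j) = 0"
    by (rule series_zero) (simp only: coeff_tr_def c mult_zero_right if_cancel)
  moreover assume "elem_tr n eps l m a b i j \<noteq> 0"
  ultimately show False by (simp add: elem_tr_def val_0)
qed

lemma elem_11_conserving: "elem_11 n eps a b i j \<noteq> 0 \<Longrightarrow> conserving n eps a b i j"
proof (rule ccontr)
  assume nc: "\<not> conserving n eps a b i j"
  have c: "chain {1..n} L R' eps a b i j C = 0" for L R' C
    using chain_conserving nc by blast
  have "series (coeff_11 n eps a b i j) = 0"
    by (rule series_zero) (simp only: coeff_11_def c mult_zero_right if_cancel)
  moreover assume "elem_11 n eps a b i j \<noteq> 0"
  ultimately show False by (simp add: elem_11_def val_0)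
qed

text \<open>
  By conservation of the occupation numbers, \<open>i\<close> and \<open>j\<close> leave
  finitely many \<open>a\<close> and \<open>b\<close>. Hence the coefficient function in
  \<open>matrix_op\<close> has finite support, so that \<open>Abs_poly_mapping\<close> is
  applied to an admissible argument.
\<close>

lemma
  assumes M: "\<And>a b. M a b i j \<noteq> 0 \<Longrightarrow> conserving n eps (int \<circ> a) (int \<circ> b) (int \<circ> i) (int \<circ> j)"
  shows lookup_matrix_op: "Poly_Mapping.lookup (matrix_op n eps M (ket (i, j))) (a, b)
      = (if a \<in> wbasis n eps \<and> b \<in> wbasis n eps then M a b i j else 0)"
    and matrix_op_span: "matrix_op n eps M (ket (i, j)) \<in> kspan (wbasis n eps \<times> wbasis n eps)"
proof -
  let ?f = "\<lambda>(a, b). if a \<in> wbasis n eps \<and> b \<in> wbasis n eps then M a b i j else 0"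
  define A where "A = {f :: mindex. \<forall>k. (k \<in> {1..n} \<longrightarrow> f k \<in> {..\<Sum>k\<in>{1..n}. i k + j k}) \<and> (k \<notin> {1..n} \<longrightarrow> f k = 0)}"
  have fA: "finite A" unfolding A_def by (rule finite_set_of_finite_funs) simp_all
  have sub: "{x. ?f x \<noteq> 0} \<subseteq> A \<times> A"
  proof (clarsimp split: if_splits)
    fix a b assume W: "a \<in> wbasis n eps" "b \<in> wbasis n eps" and "M a b i j \<noteq> 0"
    from M[OF this(3)] have e: "a k + b k = i k + j k" if "k \<in> {1..n}" for k
    proof -
      have "int (a k) + int (b k) = int (i k) + int (j k)"
        using \<open>conserving n eps (int \<circ> a) (int \<circ> b) (int \<circ> i) (int \<circ> j)\<close> that by (simp add: conserving_def)
      then show ?thesis by linarith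
    qed
    have s: "i k + j k \<le> (\<Sum>k\<in>{1..n}. i k + j k)" if "k \<in> {1..n}" for k
      using that by (intro member_le_sum) auto
    have "a k \<le> (\<Sum>k\<in>{1..n}. i k + j k) \<and> b k \<le> (\<Sum>k\<in>{1..n}. i k + j k)" if "k \<in> {1..n}" for k
      using e[OF that] s[OF that] by linarith
    then show "a \<in> A \<and> b \<in> A" using W unfolding A_def wbasis_def by simp
  qed
  have fin: "finite {x. ?f x \<noteq> 0}"
    by (rule finite_subset[OF sub finite_cartesian_product[OF fA fA]])
  show l: "Poly_Mapping.lookup (matrix_op n eps M (ket (i, j))) (a, b)
      = (if a \<in> wbasis n eps \<and> b \<in> wbasis n eps then M a b i j else 0)" for a b
    unfolding matrix_op_def lin_ket prod.case lookup_Abs_poly_mapping[OF fin] ..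
  show "matrix_op n eps M (ket (i, j)) \<in> kspan (wbasis n eps \<times> wbasis n eps)"
    unfolding kspan_def by (auto simp: in_keys_iff l split: if_splits)
qed

lemma W2_graded_kspan: "W2_graded n eps l m = kspan ({i \<in> wbasis n eps. wt n i = l} \<times> {j \<in> wbasis n eps. wt n j = m})"
  by (simp add: W2_graded_def kspan_def)
lemma W2_kspan: "W2 n eps = kspan (wbasis n eps \<times> wbasis n eps)"
  by (simp add: W2_def kspan_def)

lemma qint_qn: "qint m = emb (qn (int m))"
  unfolding qint_def qn_def qq_def
  by (simp add: emb_divide emb_diff emb_power emb_inverse power_int_minus power_inverse)

lemma qi_tq: "qi eps k = emb (tq (eps k))"
  by (simp add: qi_def tq_def qq_def emb_minus emb_inverse)

lemma cyc_prev_site: "i < n \<Longrightarrow> cyc n i = prev_site n i" "i < n \<Longrightarrow> cyc n (i + 1) = Suc i"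
proof -
  assume i: "i < n"
  show "cyc n i = prev_site n i" using i by (simp add: cyc_def prev_site_def)
  show "cyc n (i + 1) = Suc i"
  proof (cases "Suc i = n")
    case True
    then show ?thesis by (simp add: cyc_def)
  next
    case False
    then have "Suc i mod n = Suc i" using i by simp
    then show ?thesis by (simp add: cyc_def)
  qed
qed

context shift_rep
begin

text \<open>
  For \<open>i = j\<close> the shifts have square 1. For \<open>i \<noteq> j\<close> a common
  site is lowered by one of \<open>e\<^sub>i\<close> and \<open>e\<^sub>j\<close> and raised by
  the other.
\<close>

lemma Dd_eq:
  assumes ij: "i \<le> N" "j \<le> N"
  shows "Dd i j = (\<Prod>k\<in>{1..n} \<inter> {lo i, hi i} \<inter> {lo j, hi j}. emb (tq (eps k)) powi (2 * of_bool (i = j) - 1))"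
proof -
  have "Dd i j = (\<Prod>k\<in>{1..n} \<inter> {lo i, hi i} \<inter> {lo j, hi j}. emb (tq (eps k)) powi (dl i k * dl j k))"
    unfolding Dd_def by (rule prod.mono_neutral_right) (auto simp: dl_def)
  also have "\<dots> = (\<Prod>k\<in>{1..n} \<inter> {lo i, hi i} \<inter> {lo j, hi j}. emb (tq (eps k)) powi (2 * of_bool (i = j) - 1))"
  proof (rule prod.cong[OF refl])
    fix k assume "k \<in> {1..n} \<inter> {lo i, hi i} \<inter> {lo j, hi j}"
    then have "dl i k * dl j k = 2 * of_bool (i = j) - 1"
      using lohi[OF ij(1)] lohi[OF ij(2)] inj[OF ij] by (cases "i = j") (auto simp: dl_def)
    then show "emb (tq (eps k)) powi (dl i k * dl j k) = emb (tq (eps k)) powi (2 * of_bool (i = j) - 1)" by simp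
  qed
  finally show ?thesis .
qed

lemma kK_conserve:
  assumes "\<And>k. k \<in> {1..n} \<Longrightarrow> a k + b k = i k + j k"
  shows "kK r a * kK r b = kK r i * kK r j"
proof -
  have e: "kK r u * kK r v = cK r * cK r * (\<Prod>k\<in>{1..n}. emb (tq (eps k)) powi (dl r k * (u k + v k)))" for u v
  proof -
    have "(\<Prod>k\<in>{1..n}. emb (tq (eps k)) powi (dl r k * (u k + v k)))
      = (\<Prod>k\<in>{1..n}. emb (tq (eps k)) powi (dl r k * u k)) * (\<Prod>k\<in>{1..n}. emb (tq (eps k)) powi (dl r k * v k))"
      by (simp add: distrib_left power_int_add prod.distrib)
    then show ?thesis unfolding kK_def by (simp only: mult_ac)
  qed
  have "(\<Prod>k\<in>{1..n}. emb (tq (eps k)) powi (dl r k * (a k + b k))) = (\<Prod>k\<in>{1..n}. emb (tq (eps k)) powi (dl r k * (i k + j k)))"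
    by (rule prod.cong[OF refl]) (simp add: assms)
  then show ?thesis unfolding e by simp
qed

lemma kK_eq:
  assumes "r \<le> N"
  shows "kK r v = cK r * ((if lo r \<in> {1..n} then emb (tq (eps (lo r)) powi (- v (lo r))) else 1)
    * (if hi r \<in> {1..n} then emb (tq (eps (hi r)) powi v (hi r)) else 1))"
  unfolding kK_def prod_dl[OF assms] by (simp add: power_int_minus)

end

section \<open>The first commutation relation\<close>

context shape
begin

lemma A_rep:
  assumes n: "n \<ge> 2" and x: "x \<noteq> 0"
  shows "shift_rep_ops n eps (n - 1) (prev_site n) Suc (\<lambda>r. x powi of_bool (r = 0)) (\<lambda>_. 1) rA (genA n eps x) (DA n eps)"
proof -
  interpret shift_rep n eps "n - 1" "prev_site n" Suc "\<lambda>r. x powi of_bool (r = 0)" "\<lambda>_. 1" rA "genA n eps x" "DA n eps"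
    using n x by unfold_locales (auto simp: prev_site_def rA_def)
  have r: "prev_site n i \<in> {1..n}" "Suc i \<in> {1..n}" "prev_site n i \<noteq> Suc i" if "i \<le> n - 1" for i
    using n that by (auto simp: prev_site_def)
  have d: "dl i k = unitv (Suc i) k - unitv (prev_site n i) k" if "i \<le> n - 1" for i k
    using r[OF that] by (auto simp: dl_def unitv_def)
  have k: "kA n eps i m = kK i (int \<circ> m)" if "i \<le> n - 1" for i m
  proof -
    have "i < n" using that n by simp
    then show ?thesis using r[OF that]
      unfolding kK_eq[OF that] kA_def cyc_prev_site[OF \<open>i < n\<close>] qi_tq by (simp add: emb_powi emb_power)
  qed
  show ?thesis
  proof unfold_locales
    fix i m assume i: "i \<le> n - 1" and "m \<in> W"
    have i': "i < n" using i n by simp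
    have s: "(\<lambda>j. int (m j) - unitv (prev_site n i) j + unitv (Suc i) j) = (\<lambda>k. int (m k) + dl i k)"
      "(\<lambda>j. int (m j) + unitv (prev_site n i) j - unitv (Suc i) j) = (\<lambda>k. int (m k) - dl i k)"
      by (simp_all add: fun_eq_iff d[OF i])
    show "genA n eps x (E i) m = scl (kE i (int \<circ> m)) (kz (\<lambda>k. int (m k) + dl i k))"
      unfolding genA.simps cyc_prev_site[OF i'] s kE_def using r[OF i] by (simp add: qint_qn)
    show "genA n eps x (F i) m = scl (kF i (int \<circ> m)) (kz (\<lambda>k. int (m k) - dl i k))"
      unfolding genA.simps cyc_prev_site[OF i'] s kF_def using r[OF i] by (simp add: qint_qn power_int_minus)
    show "genA n eps x (K i) m = scl (kK i (int \<circ> m)) (ket m)"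
      "genA n eps x (Kinv i) m = scl (inverse (kK i (int \<circ> m))) (ket m)"
      by (simp_all add: k[OF i])
  next
    fix i j assume ij: "i \<le> n - 1" "j \<le> n - 1"
    then have l: "i < n" "j < n" using n by simp_all
    have "{1..n} \<inter> {prev_site n i, Suc i} \<inter> {prev_site n j, Suc j} = angA n i \<inter> angA n j"
      unfolding angA_def cyc_prev_site[OF l(1)] cyc_prev_site[OF l(2)] using r[OF ij(1)] by auto
    then show "DA n eps i j = Dd i j"
      unfolding Dd_eq[OF ij] DA_def qi_tq by simp
  qed
qed

lemma A_intertwiner:
  assumes n: "n \<ge> 2"
  shows "intertwiner n eps (n - 1) (prev_site n) Suc (\<lambda>r. x_gen powi of_bool (r = 0)) (\<lambda>r. y_gen powi of_bool (r = 0)) (\<lambda>_. 1) rA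
    (genA n eps x_gen) (genA n eps y_gen) (DA n eps) (S_tr n eps l m zz) (elem_tr n eps l m)"
proof -
  interpret X: shift_rep_ops n eps "n - 1" "prev_site n" Suc "\<lambda>r. x_gen powi of_bool (r = 0)" "\<lambda>_. 1" rA "genA n eps x_gen" "DA n eps"
    by (rule A_rep[OF n]) simp
  interpret Y: shift_rep_ops n eps "n - 1" "prev_site n" Suc "\<lambda>r. y_gen powi of_bool (r = 0)" "\<lambda>_. 1" rA "genA n eps y_gen" "DA n eps"
    by (rule A_rep[OF n]) simp
  have rng: "prev_site n i \<in> {1..n}" "Suc i \<in> {1..n}" "prev_site n i \<noteq> Suc i" if "i \<le> n - 1" for i
    using n that by (auto simp: prev_site_def)
  have dn: "(\<lambda>k. f k - X.dl r k) = shift_dn n r f" and up: "(\<lambda>k. f k + X.dl r k) = shift_up n r f" if "r \<le> n - 1" for f r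
    using rng[OF that] by (auto simp: X.dl_def bump_apply fun_eq_iff)
  have K: "X.kK r v = emb (tq (eps (prev_site n r)) powi (- v (prev_site n r)) * tq (eps (Suc r)) powi v (Suc r))" if "r \<le> n - 1" for r v
    using rng[OF that] unfolding X.kK_eq[OF that] by (simp add: emb_mult)
  have Ki: "inverse (X.kK r v) = emb (tq (eps (prev_site n r)) powi v (prev_site n r) * tq (eps (Suc r)) powi (- v (Suc r)))" if "r \<le> n - 1" for r v
    unfolding K[OF that] emb_inverse[symmetric] by (simp add: power_int_minus)
  have zxy: "y_gen powi of_bool (r = 0) * zz powi of_bool (r = 0) = x_gen powi of_bool (r = (0::nat))" for r
    by (simp add: zz_def)
  have xz: "inverse (x_gen powi of_bool (r = 0)) * zz powi of_bool (r = 0) = inverse (y_gen powi of_bool (r = (0::nat)))" for r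
    by (simp add: zz_def field_simps)
  let ?M = "\<lambda>a b i j. rat_value zz (rho_tr n eps l m * series_tr n eps a b i j)"
  have "eps k \<le> 1" if "k \<in> {1..n}" for k using eps01[OF that] by auto
  then have M: "?M a b i j = elem_tr n eps l m (int \<circ> a) (int \<circ> b) (int \<circ> i) (int \<circ> j)" for a b i j
    using series_tr_coeff[of n eps a b i j] n by (simp add: elem_tr_def)
  have cons: "?M a b i j \<noteq> 0 \<Longrightarrow> conserving n eps (int \<circ> a) (int \<circ> b) (int \<circ> i) (int \<circ> j)" for a b i j
    unfolding M by (rule elem_tr_conserving)
  show ?thesis
  proof unfold_locales
    show "S_tr n eps l m zz v = lin (\<lambda>b. S_tr n eps l m zz (ket b)) v" for v
      unfolding S_tr_def matrix_op_def lin_ket ..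
    show "S_tr n eps l m zz (ket (i, j)) \<in> kspan (W \<times> W)" for i j
      unfolding S_tr_def by (rule matrix_op_span[OF cons])
    show "Poly_Mapping.lookup (S_tr n eps l m zz (ket (i, j))) (a, b) = elem_tr n eps l m (int \<circ> a) (int \<circ> b) (int \<circ> i) (int \<circ> j)"
      if "a \<in> W" "b \<in> W" for i j a b
    proof -
      have "Poly_Mapping.lookup (matrix_op n eps ?M (ket (i, j))) (a, b) = ?M a b i j"
        using lookup_matrix_op[of ?M i j n eps, OF cons] that by simp
      then show ?thesis unfolding S_tr_def M .
    qed
    show "elem_tr n eps l m a b i j = 0" if "\<not> (all_allowed n eps a \<and> all_allowed n eps b \<and> all_allowed n eps i \<and> all_allowed n eps j)" for a b i j
      using that elem_tr_conserving unfolding conserving_def by blast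
  next
    fix r a b i j
    assume r: "r \<le> n - 1" and wz: "WZ a" "WZ b" "WZ i" "WZ j"
    have rn: "r < n" using r n by simp
    have rg: "all_allowed n eps a" "all_allowed n eps b" "all_allowed n eps i" "all_allowed n eps j" using wz by (simp_all add: wbasisZ_def)
    note rr = rng[OF r]
    show "X.kE r (\<lambda>k. a k - X.dl r k) * elem_tr n eps l m (\<lambda>k. a k - X.dl r k) b i j
         + X.kK r a * Y.kE r (\<lambda>k. b k - X.dl r k) * elem_tr n eps l m a (\<lambda>k. b k - X.dl r k) i j
       = Y.kE r j * elem_tr n eps l m a b i (\<lambda>k. j k + X.dl r k) + X.kE r i * X.kK r j * elem_tr n eps l m a b (\<lambda>k. i k + X.dl r k) j"
      using arg_cong[OF elem_tr_e[OF n rn rg, of l m], of "\<lambda>t. y_gen powi of_bool (r = 0) * t"] rr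
      unfolding dn[OF r] up[OF r] X.kE_def Y.kE_def K[OF r] unfolding zxy[symmetric]
      by (simp only: if_True bump_apply) (simp add: emb_mult algebra_simps)
    show "Y.kF r (\<lambda>k. b k + X.dl r k) * elem_tr n eps l m a (\<lambda>k. b k + X.dl r k) i j
         + X.kF r (\<lambda>k. a k + X.dl r k) * inverse (X.kK r b) * elem_tr n eps l m (\<lambda>k. a k + X.dl r k) b i j
       = X.kF r i * elem_tr n eps l m a b (\<lambda>k. i k - X.dl r k) j + inverse (X.kK r i) * Y.kF r j * elem_tr n eps l m a b i (\<lambda>k. j k - X.dl r k)"
      using arg_cong[OF elem_tr_f[OF n rn rg, of l m], of "\<lambda>t. inverse (x_gen powi of_bool (r = 0)) * t"] rr
      unfolding dn[OF r] up[OF r] X.kF_def Y.kF_def Ki[OF r] unfolding xz[symmetric]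
      by (simp only: if_True bump_apply) (simp add: emb_mult algebra_simps)
    show "X.kK r a * X.kK r b * elem_tr n eps l m a b i j = X.kK r i * X.kK r j * elem_tr n eps l m a b i j"
    proof (cases "elem_tr n eps l m a b i j = 0")
      case False
      then have "X.kK r a * X.kK r b = X.kK r i * X.kK r j"
        using elem_tr_conserving unfolding conserving_def by (intro X.kK_conserve) blast
      then show ?thesis by simp
    qed simp
  qed
qed

lemma wt_shift:
  assumes "WZ v" "(\<Sum>k=1..n. v k) = int l"
  shows "kz v \<in> kspan {i \<in> W. wt n i = l}"
proof -
  have "int (wt n (nat \<circ> v)) = (\<Sum>k=1..n. (int \<circ> (nat \<circ> v)) k)" by (simp add: wt_def)
  also have "\<dots> = int l" unfolding wbasisZ_nat(2)[OF assms(1)] by (rule assms(2))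
  finally show ?thesis using assms(1) wbasisZ_nat(1)[OF assms(1)] by (simp add: ketZ_wbasisZ)
qed

text \<open>
  A generator of the first family moves one unit between two sites, so it preserves the weight.
\<close>

lemma A_graded:
  assumes n: "n \<ge> 2" and x: "x \<noteq> 0" and s: "gidx s \<le> n - 1" and v: "v \<in> kspan {i \<in> W. wt n i = l}"
  shows "lin (genA n eps x s) v \<in> kspan {i \<in> W. wt n i = l}"
proof (rule span_lin[OF v])
  interpret shift_rep_ops n eps "n - 1" "prev_site n" Suc "\<lambda>r. x powi of_bool (r = 0)" "\<lambda>_. 1" rA "genA n eps x" "DA n eps"
    by (rule A_rep[OF n x])
  fix m assume m: "m \<in> {i \<in> W. wt n i = l}"
  have l: "(\<Sum>k=1..n. int (m k)) = int l" using m by (simp add: wt_def flip: of_nat_sum)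
  have d: "(\<Sum>k=1..n. dl i k) = 0" if "i \<le> n - 1" for i
  proof -
    have "prev_site n i \<in> {1..n}" "Suc i \<in> {1..n}" using n that by (auto simp: prev_site_def)
    then show ?thesis unfolding dl_def by (simp add: sum_subtractf)
  qed
  have z: "kz v \<in> kspan {i \<in> W. wt n i = l}" if "(\<Sum>k=1..n. v k) = int l" for v
    using wt_shift[OF _ that] by (cases "WZ v") (auto simp: ketZ_wbasisZ)
  show "genA n eps x s m \<in> kspan {i \<in> W. wt n i = l}"
    using s m by (cases s) (auto simp: RE RF RK RKi sum.distrib sum_subtractf l d simp del: genA.simps One_nat_def intro!: span_scl z)
qed

lemma A_commutes:
  assumes n: "n \<ge> 2" and C: "C \<in> carrier (UA n eps)" and v: "v \<in> W2_graded n eps l m"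
  shows "pi2A n eps x_gen y_gen (copA_op n eps C) (S_tr n eps l m zz v)
    = S_tr n eps l m zz (pi2A n eps x_gen y_gen (copA n eps C) v)"
proof -
  interpret intertwiner n eps "n - 1" "prev_site n" Suc "\<lambda>r. x_gen powi of_bool (r = 0)" "\<lambda>r. y_gen powi of_bool (r = 0)" "\<lambda>_. 1" rA
    "genA n eps x_gen" "genA n eps y_gen" "DA n eps" "S_tr n eps l m zz" "elem_tr n eps l m"
    by (rule A_intertwiner[OF n])
  let ?Wl = "{i \<in> W. wt n i = l}" and ?Wm = "{i \<in> W. wt n i = m}"
  show ?thesis unfolding pi2A_def copA_op_def copA_def
  proof (rule intertwining)
    show "DA n eps i j \<noteq> 0" for i j
    proof -
      have "finite (angA n i)" for i by (simp add: angA_def)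
      then show ?thesis unfolding DA_def qi_tq by simp
    qed
    show "C \<in> carrier (Ualg (n - 1) (DA n eps) rA)" using C by (simp add: UA_def)
    show "v \<in> kspan (?Wl \<times> ?Wm)" using v by (simp add: W2_graded_kspan)
    show "?Wl \<times> ?Wm \<subseteq> W \<times> W" by auto
    fix s b assume s: "gidx s \<le> n - 1" and "b \<in> ?Wl \<times> ?Wm"
    then obtain i j where b: "b = (i, j)" "i \<in> ?Wl" "j \<in> ?Wm" by blast
    have ij: "ket i \<in> kspan ?Wl" "ket j \<in> kspan ?Wm" using b by simp_all
    have "lin (cop_act False (genA n eps x_gen) (genA n eps y_gen) s) (ket i \<otimes>\<^sub>v ket j) \<in> kspan (?Wl \<times> ?Wm)"
      using s ij by (cases s) (auto simp del: lin_ket genA.simps simp: cop_act_tens intro!: span_add span_tens A_graded[OF n])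
    then show "cop_act False (genA n eps x_gen) (genA n eps y_gen) s b \<in> kspan (?Wl \<times> ?Wm)"
      unfolding b(1) by (simp add: tens_ket)
  qed
qed

end

section \<open>The second commutation relation\<close>

lemma pp_sq: "pp * pp = emb (- inverse q)"
  unfolding pp_p0 emb_mult[symmetric] using p0_sq by (simp add: power2_eq_square)

context shape
begin

lemma B_rep:
  assumes n: "n \<ge> 1" and x: "x \<noteq> 0"
  shows "shift_rep_ops n eps n (\<lambda>r. r) Suc (\<lambda>r. if r = 0 then x else 1)
    (\<lambda>r. if r = 0 then inverse pp else if r = n then pp else 1) (rB n) (genB n eps x) (DB n eps)"
proof -
  interpret shift_rep n eps n "\<lambda>r. r" Suc "\<lambda>r. if r = 0 then x else 1"
    "\<lambda>r. if r = 0 then inverse pp else if r = n then pp else 1" "rB n" "genB n eps x" "DB n eps"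
    using n x by unfold_locales (auto simp: rB_def)
  have d: "dl i k = (if i < n then unitv (Suc i) k else 0) - (if i = 0 then 0 else unitv i k)" if "i \<le> n" for i k
    using that by (auto simp: dl_def unitv_def)
  have k: "kB n eps i m = kK i (int \<circ> m)" if "i \<le> n" for i m
  proof -
    consider "i = 0" | "i = n" "i \<noteq> 0" | "i < n" "i \<noteq> 0" using \<open>i \<le> n\<close> by linarith
    then show ?thesis
    proof cases
      case 1
      then show ?thesis using n unfolding kK_eq[OF that] kB_def qi_tq by (simp add: emb_powi emb_power)
    next
      case 2
      then show ?thesis using n unfolding kK_eq[OF that] kB_def qi_tq by (simp add: emb_powi emb_power)
    next
      case 3
      then show ?thesis unfolding kK_eq[OF that] kB_def kA_def cyc_prev_site[OF 3(1)] qi_tq by (simp add: emb_powi emb_power prev_site_def)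
    qed
  qed
  show ?thesis
  proof unfold_locales
    fix i m assume i: "i \<le> n" and "m \<in> W"
    have "genB n eps x (E i) m = scl (kE i (int \<circ> m)) (kz (\<lambda>k. int (m k) + dl i k))
      \<and> genB n eps x (F i) m = scl (kF i (int \<circ> m)) (kz (\<lambda>k. int (m k) - dl i k))"
    proof -
      consider "i = 0" | "i = n" "i \<noteq> 0" | "i < n" "i \<noteq> 0" using i by linarith
      then show ?thesis
      proof cases
        case 1
        then show ?thesis using n unfolding kE_def kF_def d[OF i] by (simp add: qint_qn)
      next
        case 2
        then show ?thesis using n unfolding kE_def kF_def d[OF i] by (simp add: qint_qn)
      next
        case 3
        have s: "(\<lambda>j. int (m j) - unitv i j + unitv (Suc i) j) = (\<lambda>k. int (m k) + dl i k)"
          "(\<lambda>j. int (m j) + unitv i j - unitv (Suc i) j) = (\<lambda>k. int (m k) - dl i k)"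
          using 3 by (simp_all add: fun_eq_iff d[OF i])
        have c: "cyc n i = i" "cyc n (i + 1) = Suc i" using cyc_prev_site[OF 3(1)] 3(2) by (simp_all add: prev_site_def)
        show ?thesis using 3 unfolding kE_def kF_def genB.simps genA.simps c s
          by (simp add: qint_qn)
      qed
    qed
    then show "genB n eps x (E i) m = scl (kE i (int \<circ> m)) (kz (\<lambda>k. int (m k) + dl i k))"
      "genB n eps x (F i) m = scl (kF i (int \<circ> m)) (kz (\<lambda>k. int (m k) - dl i k))" by blast+
    show "genB n eps x (K i) m = scl (kK i (int \<circ> m)) (ket m)"
      "genB n eps x (Kinv i) m = scl (inverse (kK i (int \<circ> m))) (ket m)"
      by (simp_all add: k[OF i])
  next
    fix i j assume ij: "i \<le> n" "j \<le> n"
    have "{1..n} \<inter> {i, Suc i} \<inter> {j, Suc j} = angB n i \<inter> angB n j"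
      unfolding angB_def by auto
    then show "DB n eps i j = Dd i j"
      unfolding Dd_eq[OF ij] DB_def qi_tq by simp
  qed
qed

text \<open>
  Conjugation by \<open>K\<close> multiplies the matrix element by
  \<open>p\<^sup>|\<^sup>j\<^sup>|\<^sup>-\<^sup>|\<^sup>a\<^sup>|\<close>.
\<close>

definition elem_tilde where "elem_tilde a b i j = pp powi (- (\<Sum>k=1..n. a k)) * pp powi (\<Sum>k=1..n. j k) * elem_11 n eps a b i j"

lemma S_11_tilde_eq: "S_11_tilde n eps zz v = lin (\<lambda>(i, j). opK n (ket i) \<otimes>\<^sub>v ket j)
   (S_11 n eps zz (lin (\<lambda>(i, j). scl (pp powi (int (wt n j))) (ket (i, j))) v))"
proof -
  have e: "(\<lambda>(i, j). id (ket i) \<otimes>\<^sub>v opK_inv n (ket j)) = (\<lambda>(i, j). scl (pp powi (int (wt n j))) (ket (i, j)))"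
    by (auto simp: opK_inv_def tens_simps tens_ket)
  show ?thesis unfolding S_11_tilde_def tens_op_def comp_apply e unfolding id_apply ..
qed

lemma lookup_opK: "Poly_Mapping.lookup (lin (\<lambda>(i, j). opK n (ket i) \<otimes>\<^sub>v ket j) u) (a, b)
    = pp powi (- int (wt n a)) * Poly_Mapping.lookup u (a, b)"
proof -
  have "Poly_Mapping.lookup (lin (\<lambda>(i, j). opK n (ket i) \<otimes>\<^sub>v ket j) u) (a, b)
    = (\<Sum>p\<in>Poly_Mapping.keys u. if p = (a, b) then pp powi (- int (wt n a)) * Poly_Mapping.lookup u (a, b) else 0)"
    unfolding lookup_lin by (rule sum.cong) (auto simp: opK_def lookup_tens lookup_ket)
  also have "\<dots> = pp powi (- int (wt n a)) * Poly_Mapping.lookup u (a, b)" by (auto simp: in_keys_iff)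
  finally show ?thesis .
qed

text \<open>
  The change of the powers of \<open>p\<close> in the matrix elements, together with those in
  \<open>k\<^sub>0\<close> and \<open>k\<^sub>n\<close>, produces the factor \<open>p\<^sup>2 =
  - 1 / q\<close> of \<open>elem_11_left_e\<close> and \<open>elem_11_right_e\<close>, and no
  factor for the other generators.
\<close>

lemma B_intertwiner:
  assumes n: "n \<ge> 1"
  shows "intertwiner n eps n (\<lambda>r. r) Suc (\<lambda>r. if r = 0 then x_gen else 1) (\<lambda>r. if r = 0 then y_gen else 1)
    (\<lambda>r. if r = 0 then inverse pp else if r = n then pp else 1) (rB n)
    (genB n eps x_gen) (genB n eps y_gen) (DB n eps) (S_11_tilde n eps zz) elem_tilde"
proof -
  let ?cK = "\<lambda>r. if r = 0 then inverse pp else if r = n then pp else 1"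
  interpret X: shift_rep_ops n eps n "\<lambda>r. r" Suc "\<lambda>r. if r = 0 then x_gen else 1" ?cK "rB n" "genB n eps x_gen" "DB n eps"
    by (rule B_rep[OF n]) simp
  interpret Y: shift_rep_ops n eps n "\<lambda>r. r" Suc "\<lambda>r. if r = 0 then y_gen else 1" ?cK "rB n" "genB n eps y_gen" "DB n eps"
    by (rule B_rep[OF n]) simp
  have pp0 [simp]: "pp \<noteq> 0" by (rule X.pp_neq0)
  let ?M = "\<lambda>a b i j. rat_value zz (rho_11 * series_11 n eps a b i j)"
  have "eps k \<le> 1" if "k \<in> {1..n}" for k using eps01[OF that] by auto
  then have M: "?M a b i j = elem_11 n eps (int \<circ> a) (int \<circ> b) (int \<circ> i) (int \<circ> j)" for a b i j
    using series_11_coeff[of n eps a b i j] n by (simp add: elem_11_def)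
  have cons: "?M a b i j \<noteq> 0 \<Longrightarrow> conserving n eps (int \<circ> a) (int \<circ> b) (int \<circ> i) (int \<circ> j)" for a b i j
    unfolding M by (rule elem_11_conserving)
  have elem_tilde_cons: "elem_tilde a b i j \<noteq> 0 \<Longrightarrow> conserving n eps a b i j" for a b i j
    using elem_11_conserving by (auto simp: elem_tilde_def)
  have S_eq: "S_11 n eps zz = matrix_op n eps ?M" by (simp add: S_11_def)
  have S_lin: "matrix_op n eps ?M v = lin (\<lambda>b. matrix_op n eps ?M (ket b)) v" for v
    by (simp add: matrix_op_def)
  have S_scl: "matrix_op n eps ?M (scl c v) = scl c (matrix_op n eps ?M v)" for c v
    by (simp add: matrix_op_def lin_scl)
  have St: "S_11_tilde n eps zz (ket (i, j)) = lin (\<lambda>(i, j). opK n (ket i) \<otimes>\<^sub>v ket j) (scl (pp powi (int (wt n j))) (matrix_op n eps ?M (ket (i, j))))" for i j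
    unfolding S_11_tilde_eq S_eq lin_ket prod.case S_scl ..
  define P where "P a j = pp powi (- (\<Sum>k=1..n. a k)) * pp powi (\<Sum>k=1..n. j k)" for a j :: "nat \<Rightarrow> int"
  have elem_tilde: "elem_tilde a b i j = P a j * elem_11 n eps a b i j" for a b i j by (simp add: elem_tilde_def P_def)
  have sum_b: "(\<Sum>k=1..n. bump s d f k) = (\<Sum>k=1..n. f k) + (if 1 \<le> s \<and> s \<le> n then d else 0)" for s d f
    by (rule sum_bump)
  have Pa: "P (bump s d a) j = pp powi (- d) * P a j" and Pj: "P a (bump s d j) = pp powi d * P a j"
    if "1 \<le> s \<and> s \<le> n" for s d a j
    unfolding P_def sum_b if_P[OF that] by (simp_all add: power_int_add power_int_diff field_simps power_int_minus)
  have zxy: "x_gen = zz * y_gen" by (simp add: zz_def)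
  show ?thesis
  proof unfold_locales
    show "S_11_tilde n eps zz v = lin (\<lambda>b. S_11_tilde n eps zz (ket b)) v" for v
      unfolding S_11_tilde_eq S_eq lin_ket matrix_op_def lin_lin ..
    show "S_11_tilde n eps zz (ket (i, j)) \<in> kspan (W \<times> W)" for i j
      unfolding St
      by (rule span_lin[OF span_scl[OF matrix_op_span[OF cons]]]) (auto simp: opK_def tens_simps tens_ket intro!: span_scl)
    show "Poly_Mapping.lookup (S_11_tilde n eps zz (ket (i, j))) (a, b) = elem_tilde (int \<circ> a) (int \<circ> b) (int \<circ> i) (int \<circ> j)"
      if "a \<in> W" "b \<in> W" for i j a b
    proof -
      have "Poly_Mapping.lookup (matrix_op n eps ?M (ket (i, j))) (a, b) = ?M a b i j"
        using lookup_matrix_op[of ?M i j n eps, OF cons] that by simp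
      then show ?thesis unfolding St lookup_opK lookup_scl M by (simp add: elem_tilde_def wt_def)
    qed
    show "elem_tilde a b i j = 0" if "\<not> (all_allowed n eps a \<and> all_allowed n eps b \<and> all_allowed n eps i \<and> all_allowed n eps j)" for a b i j
      using that elem_tilde_cons unfolding conserving_def by blast
  next
    fix r a b i j
    assume r: "r \<le> n" and wz: "WZ a" "WZ b" "WZ i" "WZ j"
    have rg: "all_allowed n eps a" "all_allowed n eps b" "all_allowed n eps i" "all_allowed n eps j" using wz by (simp_all add: wbasisZ_def)
    show "X.kK r a * X.kK r b * elem_tilde a b i j = X.kK r i * X.kK r j * elem_tilde a b i j"
    proof (cases "elem_tilde a b i j = 0")
      case False
      then have "X.kK r a * X.kK r b = X.kK r i * X.kK r j"
        using elem_tilde_cons unfolding conserving_def by (intro X.kK_conserve) blast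
      then show ?thesis by simp
    qed simp
    have "X.kE r (\<lambda>k. a k - X.dl r k) * elem_tilde (\<lambda>k. a k - X.dl r k) b i j
         + X.kK r a * Y.kE r (\<lambda>k. b k - X.dl r k) * elem_tilde a (\<lambda>k. b k - X.dl r k) i j
       = Y.kE r j * elem_tilde a b i (\<lambda>k. j k + X.dl r k) + X.kE r i * X.kK r j * elem_tilde a b (\<lambda>k. i k + X.dl r k) j
      \<and> Y.kF r (\<lambda>k. b k + X.dl r k) * elem_tilde a (\<lambda>k. b k + X.dl r k) i j
         + X.kF r (\<lambda>k. a k + X.dl r k) * inverse (X.kK r b) * elem_tilde (\<lambda>k. a k + X.dl r k) b i j
       = X.kF r i * elem_tilde a b (\<lambda>k. i k - X.dl r k) j + inverse (X.kK r i) * Y.kF r j * elem_tilde a b i (\<lambda>k. j k - X.dl r k)"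
      (is "?E \<and> ?F")
    proof -
      consider "r = 0" | "r = n" "r \<noteq> 0" | "1 \<le> r" "r < n" using r by linarith
      then show ?thesis
      proof cases
        case 1
        have s: "(\<lambda>k. f k - X.dl r k) = bump 1 (-1) f" "(\<lambda>k. f k + X.dl r k) = bump 1 1 f" for f
          using 1 n by (auto simp: X.dl_def bump_apply fun_eq_iff)
        have K: "X.kK r v = inverse pp * emb (tq (eps 1) powi v 1)" for v
          using 1 n unfolding X.kK_eq[OF r] by simp
        have Ki: "inverse (X.kK r v) = pp * emb (tq (eps 1) powi (- v 1))" for v
          unfolding K by (simp add: emb_inverse power_int_minus)
        have kEF: "X.kE r v = x_gen" "Y.kE r v = y_gen" "X.kF r v = inverse x_gen * emb (qn (v 1))"
          "Y.kF r v = inverse y_gen * emb (qn (v 1))" for v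
          using 1 n unfolding X.kE_def Y.kE_def X.kF_def Y.kF_def by simp_all
        have p1: "1 \<le> (1::nat) \<and> 1 \<le> n" using n by simp
        have ?E
          using arg_cong[OF elem_11_left_e[OF n rg], of "\<lambda>t. y_gen * P a j * inverse pp * t"]
          unfolding s K kEF elem_tilde Pa[OF p1] Pj[OF p1] pp_sq[symmetric] unfolding zxy by (simp add: field_simps)
        moreover have ?F
          using arg_cong[OF elem_11_left_f[OF n rg], of "\<lambda>t. inverse x_gen * P a j * t"]
          unfolding s Ki kEF elem_tilde Pa[OF p1] Pj[OF p1] zz_def by (simp add: field_simps emb_mult)
        ultimately show ?thesis ..
      next
        case 2
        have s: "(\<lambda>k. f k - X.dl r k) = bump n 1 f" "(\<lambda>k. f k + X.dl r k) = bump n (-1) f" for f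
          using 2 n by (auto simp: X.dl_def bump_apply fun_eq_iff)
        have K: "X.kK r v = pp * emb (tq (eps n) powi (- v n))" for v
          using 2 n unfolding X.kK_eq[OF r] by simp
        have Ki: "inverse (X.kK r v) = inverse pp * emb (tq (eps n) powi v n)" for v
          unfolding K by (simp add: emb_inverse power_int_minus)
        have kEF: "X.kE r v = emb (qn (v n))" "Y.kE r v = emb (qn (v n))" "X.kF r v = 1" "Y.kF r v = 1" for v
          using 2 n unfolding X.kE_def Y.kE_def X.kF_def Y.kF_def by simp_all
        have pn: "1 \<le> n \<and> n \<le> n" using n by simp
        have ?E
          using arg_cong[OF elem_11_right_e[OF n rg], of "\<lambda>t. P a j * inverse pp * t"]
          unfolding s K kEF elem_tilde Pa[OF pn] Pj[OF pn] emb_mult pp_sq[symmetric] bump_same by (simp add: field_simps)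
        moreover have ?F
          using arg_cong[OF elem_11_right_f[OF n rg], of "\<lambda>t. P a j * t"]
          unfolding s Ki kEF elem_tilde Pa[OF pn] Pj[OF pn] by (simp add: field_simps)
        ultimately show ?thesis ..
      next
        case 3
        have s: "(\<lambda>k. f k - X.dl r k) = shift_dn n r f" "(\<lambda>k. f k + X.dl r k) = shift_up n r f" for f
          using 3 by (auto simp: X.dl_def bump_apply fun_eq_iff prev_site_def)
        have lo: "prev_site n r = r" using 3 by (simp add: prev_site_def)
        have K: "X.kK r v = emb (tq (eps r) powi (- v r)) * emb (tq (eps (Suc r)) powi v (Suc r))" for v
          using 3 unfolding X.kK_eq[OF r] by simp
        have Ki: "inverse (X.kK r v) = emb (tq (eps r) powi v r) * emb (tq (eps (Suc r)) powi (- v (Suc r)))" for v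
          unfolding K by (simp add: emb_inverse power_int_minus)
        have kEF: "X.kE r v = emb (qn (v r))" "Y.kE r v = emb (qn (v r))" "X.kF r v = emb (qn (v (Suc r)))" "Y.kF r v = emb (qn (v (Suc r)))" for v
          using 3 unfolding X.kE_def Y.kE_def X.kF_def Y.kF_def by simp_all
        have p3: "1 \<le> r \<and> r \<le> n" "1 \<le> Suc r \<and> Suc r \<le> n" using 3 by simp_all
        have ?E
          using arg_cong[OF elem_11_inner_e[OF n rg 3], of "\<lambda>t. P a j * t"]
          unfolding s K kEF elem_tilde lo Pa[OF p3(1)] Pj[OF p3(1)] Pa[OF p3(2)] Pj[OF p3(2)] emb_mult
          by (simp add: bump_apply field_simps)
        moreover have ?F
          using arg_cong[OF elem_11_inner_f[OF n rg 3], of "\<lambda>t. P a j * t"]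
          unfolding s Ki kEF elem_tilde lo Pa[OF p3(1)] Pj[OF p3(1)] Pa[OF p3(2)] Pj[OF p3(2)] emb_mult
          by (simp add: bump_apply field_simps)
        ultimately show ?thesis ..
      qed
    qed
    then show ?E ?F by blast+
  qed
qed

lemma B_commutes:
  assumes n: "n \<ge> 1" and C: "C \<in> carrier (UB n eps)" and v: "v \<in> W2 n eps"
  shows "pi2B n eps x_gen y_gen (copB_op n eps C) (S_11_tilde n eps zz v)
    = S_11_tilde n eps zz (pi2B n eps x_gen y_gen (copB n eps C) v)"
proof -
  interpret intertwiner n eps n "\<lambda>r. r" Suc "\<lambda>r. if r = 0 then x_gen else 1" "\<lambda>r. if r = 0 then y_gen else 1"
    "\<lambda>r. if r = 0 then inverse pp else if r = n then pp else 1" "rB n"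
    "genB n eps x_gen" "genB n eps y_gen" "DB n eps" "S_11_tilde n eps zz" elem_tilde
    by (rule B_intertwiner[OF n])
  show ?thesis unfolding pi2B_def copB_op_def copB_def
  proof (rule intertwining)
    show "DB n eps i j \<noteq> 0" for i j
    proof -
      have "finite (angB n i)" for i by (simp add: angB_def)
      then show ?thesis unfolding DB_def qi_tq by simp
    qed
    show "C \<in> carrier (Ualg n (DB n eps) (rB n))" using C by (simp add: UB_def)
    show "v \<in> kspan (W \<times> W)" using v by (simp add: W2_kspan)
    show "W \<times> W \<subseteq> W \<times> W" by auto
    fix s b assume s: "gidx s \<le> n" and "b \<in> W \<times> W"
    then obtain i j where b: "b = (i, j)" "i \<in> W" "j \<in> W" by blast
    have ij: "ket i \<in> kspan W" "ket j \<in> kspan W" using b by simp_all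
    have "lin (cop_act False (genB n eps x_gen) (genB n eps y_gen) s) (ket i \<otimes>\<^sub>v ket j) \<in> kspan (W \<times> W)"
      using s ij by (cases s) (auto simp del: lin_ket genB.simps simp: cop_act_tens
          intro!: span_add span_tens represents_span[OF X.represents] represents_span[OF Y.represents])
    then show "cop_act False (genB n eps x_gen) (genB n eps y_gen) s b \<in> kspan (W \<times> W)"
      unfolding b(1) by (simp add: tens_ket)
  qed
qed

end

theorem theorem5p1:
  fixes n :: nat and eps :: "nat \<Rightarrow> nat"
  assumes eps: "eps \<in> {1..n} \<rightarrow> {0, 1}"
  shows
    "(n \<ge> 2 \<longrightarrow>
       (\<forall>g\<in>carrier (UA n eps). \<forall>l m. \<forall>v\<in>W2_graded n eps l m.
          pi2A n eps x_gen y_gen (copA_op n eps g) (S_tr n eps l m (x_gen / y_gen) v)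
          = S_tr n eps l m (x_gen / y_gen) (pi2A n eps x_gen y_gen (copA n eps g) v)))
     \<and> (n \<ge> 1 \<longrightarrow>
       (\<forall>g\<in>carrier (UB n eps). \<forall>v\<in>W2 n eps.
          pi2B n eps x_gen y_gen (copB_op n eps g) (S_11_tilde n eps (x_gen / y_gen) v)
          = S_11_tilde n eps (x_gen / y_gen) (pi2B n eps x_gen y_gen (copB n eps g) v)))"
proof -
  interpret shape n eps by unfold_locales (use eps in auto)
  show ?thesis unfolding zz_def[symmetric] using A_commutes B_commutes by blast
qed

end
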